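(* Let $n\ge 2$, $G=SL(n,\mathbb{C})$, and let $P$ be a minimal parabolic subgroup of $G$, i.e. $P=P_{\alpha_i}$ for some $1\le i\le n-1$. Then there is no nonconstant morphism from $\mathbb{P}^4$ to $G/P$.
   Context: Varieties are over $\mathbb{C}$, and morphism means morphism of algebraic varieties. $B\subset G$ is the Borel subgroup of upper triangular matrices and $T$ the maximal torus of diagonal matrices; $\epsilon_i$ is the character of $T$ sending $\mathrm{diag}(t_1,\dots,t_n)$ to $t_i$; the simple roots are $\alpha_i=\epsilon_i-\epsilon_{i+1}$ for $1\le i\le n-1$; the Weyl group is $S_n$, with $s_{\alpha_i}$ the transposition of $i$ and $i+1$. The minimal parabolic subgroup associated with $\alpha_i$ is $P_{\alpha_i}=B\cup Bs_{\alpha_i}B$. Equivalently, $G/P_{\alpha_i}$ is the variety of partial flags in $\mathbb{C}^n$ consisting of nested subspaces of every dimension in $\{1,\dots,n-1\}\setminus\{i\}$. *)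

theory Defs
  imports
    "HOL-Analysis.Abstract_Topology_2"
    "HOL-Algebra.Left_Coset"
    "Jordan_Normal_Form.Determinant"
begin

section \<open>Polynomial functions\<close>

text \<open>Over the infinite field of complex numbers, polynomials may be identified with the functions
  they define. A monomial is given by its exponents \<open>m\<close>; only the values of \<open>m\<close> on \<open>I\<close> matter.\<close>

definition poly_funs :: "'i set \<Rightarrow> (('i \<Rightarrow> complex) \<Rightarrow> complex) set" where
  "poly_funs I = {p. \<exists>M c. finite M \<and> p = (\<lambda>x. \<Sum>m\<in>M. c m * (\<Prod>i\<in>I. x i ^ m i))}"

definition homog_poly_funs :: "'i set \<Rightarrow> nat \<Rightarrow> (('i \<Rightarrow> complex) \<Rightarrow> complex) set" where
  "homog_poly_funs I d =
     {p. \<exists>M c. finite M \<and> (\<forall>m\<in>M. (\<Sum>i\<in>I. m i) = d)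
             \<and> p = (\<lambda>x. \<Sum>m\<in>M. c m * (\<Prod>i\<in>I. x i ^ m i))}"

section \<open>Varieties as spaces with functions\<close>

text \<open>A variety is presented by its set of points with the Zariski topology, together with the
  regular complex-valued functions on each open set. HOL functions are total: membership in
  \<open>regular X U\<close> only constrains the values on \<open>U\<close>.\<close>

record 'a fspace =
  zariski :: "'a topology"
  regular :: "'a set \<Rightarrow> ('a \<Rightarrow> complex) set"

abbreviation points :: "('a, 'z) fspace_scheme \<Rightarrow> 'a set" where
  "points X \<equiv> topspace (zariski X)"

definition morphism :: "'a fspace \<Rightarrow> 'b fspace \<Rightarrow> ('a \<Rightarrow> 'b) \<Rightarrow> bool" where
  "morphism X Y \<phi> \<longleftrightarrow>
     continuous_map (zariski X) (zariski Y) \<phi> \<and>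
     (\<forall>V f. openin (zariski Y) V \<longrightarrow> f \<in> regular Y V \<longrightarrow>
        f \<circ> \<phi> \<in> regular X {x \<in> points X. \<phi> x \<in> V})"

text \<open>The quotient variety of \<open>X\<close> by the fibres of \<open>\<pi>\<close>: the quotient topology, with a function
  being regular iff its pullback along \<open>\<pi>\<close> is. For a closed subgroup \<open>H\<close> of a linear algebraic
  group \<open>G\<close> and \<open>\<pi> g = g H\<close> this is the structure of algebraic variety on \<open>G/H\<close>.\<close>

definition quotient_topology :: "'a topology \<Rightarrow> ('a \<Rightarrow> 'b) \<Rightarrow> 'b topology" where
  "quotient_topology T \<pi> =
     topology (\<lambda>V. V \<subseteq> \<pi> ` topspace T \<and> openin T {x \<in> topspace T. \<pi> x \<in> V})"

definition quotient_fspace :: "'a fspace \<Rightarrow> ('a \<Rightarrow> 'b) \<Rightarrow> 'b fspace" where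
  "quotient_fspace X \<pi> =
     \<lparr>zariski = quotient_topology (zariski X) \<pi>,
      regular = (\<lambda>V. {f. f \<circ> \<pi> \<in> regular X {x \<in> points X. \<pi> x \<in> V}})\<rparr>"

lemma openin_quotient_topology:
  "openin (quotient_topology T \<pi>) V \<longleftrightarrow>
     V \<subseteq> \<pi> ` topspace T \<and> openin T {x \<in> topspace T. \<pi> x \<in> V}"
proof -
  have "istopology (\<lambda>V. V \<subseteq> \<pi> ` topspace T \<and> openin T {x \<in> topspace T. \<pi> x \<in> V})"
    unfolding istopology_def
  proof (intro conjI allI impI)
    fix S V assume a: "S \<subseteq> \<pi> ` topspace T \<and> openin T {x \<in> topspace T. \<pi> x \<in> S}"
      and b: "V \<subseteq> \<pi> ` topspace T \<and> openin T {x \<in> topspace T. \<pi> x \<in> V}"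
    have "{x \<in> topspace T. \<pi> x \<in> S \<inter> V} =
        {x \<in> topspace T. \<pi> x \<in> S} \<inter> {x \<in> topspace T. \<pi> x \<in> V}" by auto
    with a b show "openin T {x \<in> topspace T. \<pi> x \<in> S \<inter> V}" by (simp add: openin_Int)
    from a show "S \<inter> V \<subseteq> \<pi> ` topspace T" by auto
  next
    fix \<K> assume a: "\<forall>K\<in>\<K>. K \<subseteq> \<pi> ` topspace T \<and> openin T {x \<in> topspace T. \<pi> x \<in> K}"
    have "{x \<in> topspace T. \<pi> x \<in> \<Union>\<K>} = (\<Union>K\<in>\<K>. {x \<in> topspace T. \<pi> x \<in> K})" by auto
    moreover have "openin T (\<Union>K\<in>\<K>. {x \<in> topspace T. \<pi> x \<in> K})"
      using a by (intro openin_Union) blast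
    ultimately show "openin T {x \<in> topspace T. \<pi> x \<in> \<Union>\<K>}" by (simp only:)
    from a show "\<Union>\<K> \<subseteq> \<pi> ` topspace T" by auto
  qed
  then show ?thesis
    by (simp add: quotient_topology_def topology_inverse')
qed

lemma topspace_quotient_topology [simp]:
  "topspace (quotient_topology T \<pi>) = \<pi> ` topspace T"
proof
  show "topspace (quotient_topology T \<pi>) \<subseteq> \<pi> ` topspace T"
    using openin_topspace[of "quotient_topology T \<pi>"]
    unfolding openin_quotient_topology by (rule conjunct1)
  have "{x \<in> topspace T. \<pi> x \<in> \<pi> ` topspace T} = topspace T" by auto
  then have "openin (quotient_topology T \<pi>) (\<pi> ` topspace T)"
    by (simp add: openin_quotient_topology)
  then show "\<pi> ` topspace T \<subseteq> topspace (quotient_topology T \<pi>)"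
    by (rule openin_subset)
qed

section \<open>Projective space\<close>

abbreviation (input) vcoord :: "complex vec \<Rightarrow> nat \<Rightarrow> complex" where
  "vcoord v \<equiv> (\<lambda>i. v $ i)"

text \<open>The points of \<open>\<P>\<^sup>m\<close> are the lines through the origin of \<open>\<complex>\<^sup>m\<^sup>+\<^sup>1\<close>.\<close>

definition proj_points :: "nat \<Rightarrow> complex vec set set" where
  "proj_points m = {{a \<cdot>\<^sub>v v | a. True} | v. v \<in> carrier_vec (Suc m) \<and> v \<noteq> 0\<^sub>v (Suc m)}"

text \<open>The non-vanishing loci of homogeneous polynomials form a base of the Zariski topology.\<close>

definition proj_zariski :: "nat \<Rightarrow> complex vec set topology" where
  "proj_zariski m = topology_generated_by
     {{L \<in> proj_points m. \<exists>v\<in>L. p (vcoord v) \<noteq> 0} | p d. p \<in> homog_poly_funs {..m} d}"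

text \<open>Regular functions are locally quotients of homogeneous polynomials of the same degree.\<close>

definition proj_space :: "nat \<Rightarrow> complex vec set fspace" where
  "proj_space m =
     \<lparr>zariski = proj_zariski m,
      regular = (\<lambda>U. {f. \<forall>L\<in>U. \<exists>W d. \<exists>p\<in>homog_poly_funs {..m} d. \<exists>q\<in>homog_poly_funs {..m} d.
         openin (proj_zariski m) W \<and> L \<in> W \<and> W \<subseteq> U \<and>
         (\<forall>L'\<in>W. \<forall>v\<in>L' - {0\<^sub>v (Suc m)}.
            q (vcoord v) \<noteq> 0 \<and> f L' = p (vcoord v) / q (vcoord v))})\<rparr>"

section \<open>The special linear group and its minimal parabolic subgroups\<close>

definition SL :: "nat \<Rightarrow> complex mat monoid" where
  "SL n = \<lparr>carrier = {A \<in> carrier_mat n n. det A = 1}, monoid.mult = (*), one = 1\<^sub>m n\<rparr>"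

abbreviation (input) mcoord :: "complex mat \<Rightarrow> nat \<times> nat \<Rightarrow> complex" where
  "mcoord A \<equiv> (\<lambda>ij. A $$ ij)"

text \<open>The structure of affine variety on \<open>SL n\<close>, a closed subset of the space of matrices: the
  non-vanishing loci of polynomials in the matrix entries form a base of the Zariski topology.\<close>

definition SL_zariski :: "nat \<Rightarrow> complex mat topology" where
  "SL_zariski n = topology_generated_by
     {{A \<in> carrier (SL n). p (mcoord A) \<noteq> 0} | p. p \<in> poly_funs ({..<n} \<times> {..<n})}"

definition SL_variety :: "nat \<Rightarrow> complex mat fspace" where
  "SL_variety n =
     \<lparr>zariski = SL_zariski n,
      regular = (\<lambda>U. {f. \<forall>A\<in>U. \<exists>W. \<exists>p\<in>poly_funs ({..<n} \<times> {..<n}). \<exists>q\<in>poly_funs ({..<n} \<times> {..<n}).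
         openin (SL_zariski n) W \<and> A \<in> W \<and> W \<subseteq> U \<and>
         (\<forall>A'\<in>W. q (mcoord A') \<noteq> 0 \<and> f A' = p (mcoord A') / q (mcoord A'))})\<rparr>"

definition borel_subgroup :: "nat \<Rightarrow> complex mat set" where
  "borel_subgroup n = {A \<in> carrier (SL n). upper_triangular A}"

text \<open>A representative in \<open>SL n\<close> of the simple reflection exchanging \<open>i\<close> and \<open>i + 1\<close>. Two
  representatives differ by a diagonal matrix, so the double coset below does not depend on the
  choice. Matrix indices start from 0, hence the shift by one.\<close>

definition simple_refl :: "nat \<Rightarrow> nat \<Rightarrow> complex mat" where
  "simple_refl n i = mat n n (\<lambda>(r, c).
     if r = i - 1 \<and> c = i then 1
     else if r = i \<and> c = i - 1 then - 1
     else if r = c \<and> r \<noteq> i - 1 \<and> r \<noteq> i then 1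
     else 0)"

definition min_parabolic :: "nat \<Rightarrow> nat \<Rightarrow> complex mat set" where
  "min_parabolic n i =
     borel_subgroup n \<union>
     ((borel_subgroup n #>\<^bsub>SL n\<^esub> simple_refl n i) <#>\<^bsub>SL n\<^esub> borel_subgroup n)"

definition SL_quotient :: "nat \<Rightarrow> complex mat set \<Rightarrow> complex mat set fspace" where
  "SL_quotient n P = quotient_fspace (SL_variety n) (\<lambda>g. g <#\<^bsub>SL n\<^esub> P)"

section \<open>Basic facts\<close>

lemma simple_refl_in_SL:
  assumes "1 \<le> i" "i < n"
  shows "simple_refl n i \<in> carrier (SL n)"
proof -
  have eq: "simple_refl n i = multrow i (- 1) (swaprows_mat n (i - 1) i)"
    proof (rule eq_matI)
    fix r c assume "r < dim_row (multrow i (- 1) (swaprows_mat n (i - 1) i) :: complex mat)"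
      "c < dim_col (multrow i (- 1) (swaprows_mat n (i - 1) i) :: complex mat)"
    then have "r < n" "c < n" by simp_all
    with assms show "simple_refl n i $$ (r, c) =
        multrow i (- 1) (swaprows_mat n (i - 1) i) $$ (r, c)"
      by (cases "r = i"; cases "r = i - 1"; cases "c = i"; cases "c = i - 1")
        (simp_all add: simple_refl_def)
  qed (simp_all add: simple_refl_def)
  have "det (simple_refl n i) = 1"
    unfolding eq using assms
    by (subst det_multrow[where n = n]) (auto simp: det_swaprows_mat)
  then show ?thesis by (simp add: SL_def simple_refl_def)
qed

lemma points_proj_space: "points (proj_space m) = proj_points m"
proof -
  have one: "(\<lambda>_. 1) \<in> homog_poly_funs {..m} 0"
    unfolding homog_poly_funs_def
    by (rule CollectI, rule exI[of _ "{\<lambda>_. 0}"], rule exI[of _ "\<lambda>_. 1"]) auto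
  have "{L \<in> proj_points m. \<exists>v\<in>L. (1::complex) \<noteq> 0} = proj_points m"
    by (auto simp: proj_points_def)
  with one have "proj_points m \<in>
      {{L \<in> proj_points m. \<exists>v\<in>L. p (vcoord v) \<noteq> 0} | p d. p \<in> homog_poly_funs {..m} d}"
    by (intro CollectI exI[of _ "\<lambda>_. 1"] exI[of _ 0]) simp
  then show ?thesis
    by (auto simp: proj_space_def proj_zariski_def)
qed

lemma points_SL_variety: "points (SL_variety n) = carrier (SL n)"
proof -
  have one: "(\<lambda>_. 1) \<in> poly_funs ({..<n} \<times> {..<n})"
    unfolding poly_funs_def
    by (rule CollectI, rule exI[of _ "{\<lambda>_. 0}"], rule exI[of _ "\<lambda>_. 1"]) auto
  then have "carrier (SL n) \<in>
      {{A \<in> carrier (SL n). p (mcoord A) \<noteq> 0} | p. p \<in> poly_funs ({..<n} \<times> {..<n})}"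
    by (intro CollectI exI[of _ "\<lambda>_. 1"]) simp
  then show ?thesis
    by (auto simp: SL_variety_def SL_zariski_def)
qed

lemma points_SL_quotient: "points (SL_quotient n P) = lcosets\<^bsub>SL n\<^esub> P"
proof -
  have "points (SL_quotient n P) = (\<lambda>g. g <#\<^bsub>SL n\<^esub> P) ` points (SL_variety n)"
    by (simp add: SL_quotient_def quotient_fspace_def)
  then show ?thesis by (auto simp: points_SL_variety LCOSETS_def)
qed

end

theory Submission
  imports
    Defs
    "HOL-Library.Function_Algebras"
    "HOL-Computational_Algebra.Computational_Algebra"
    "HOL-Computational_Algebra.Field_as_Ring"
begin

text \<open>
  A morphism from \<open>\<P>\<^sup>4\<close> to \<open>G/P\<close> is a family of flags \<open>V\<^sub>j(x) \<subseteq> \<complex>\<^sup>n\<close>, \<open>j \<noteq> i\<close>, with local frames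
  whose entries are forms. The subquotients are line bundles \<open>\<O>(a\<^sub>k)\<close>, except that the piece
  \<open>V\<^sub>i\<^sub>+\<^sub>1/V\<^sub>i\<^sub>-\<^sub>1\<close> of rank two need not split. Its Chern classes \<open>c\<^sub>3\<close> and \<open>c\<^sub>4\<close> vanish, and as the
  bundle \<open>\<O>\<^sup>n\<close> is trivial this says that the complete symmetric polynomials of degrees 3 and 4 of
  the \<open>a\<^sub>k\<close> are zero. The power sums \<open>s\<^sub>p\<close> of the \<open>a\<^sub>k\<close> then satisfy
  \<open>\<Sum>\<^sub>k a\<^sub>k\<^sup>2 ((a\<^sub>k + s\<^sub>1/2)\<^sup>2 + (s\<^sub>1\<^sup>2 + 2 s\<^sub>2)/4) = 0\<close>, so all \<open>a\<^sub>k\<close> are zero and the flag is constant.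

  Chern classes are replaced by Hilbert functions: the two relations come from the dimensions, in
  large degrees \<open>t\<close>, of the spaces of sections of the bundles, of their exterior squares and of
  tensor products of them. That sections lift along a surjection of bundles in large degrees
  follows from the Nullstellensatz and the finiteness of graded modules.
\<close>

section \<open>Forms in five variables\<close>

text \<open>The obstacle is the gap at \<open>i\<close>: the piece \<open>E\<close> of rank two has
  no known Hilbert function. It is eliminated in the group of classes of bundles. Let
  \<open>L\<close> be the sum of the classes of the lines of degrees \<open>deg k\<close>. The flag
  gives \<open>E = n - L\<close>. The exterior square of the trivial bundle is again trivial, and
  the flag filters it with class \<open>e_2 + L E + det E\<close>, where \<open>e_2\<close> is the
  second elementary symmetric expression in the lines and \<open>det E\<close> is a line of some
  degree \<open>c\<close>. Hence \<open>n (n - 1) / 2 = n L - h_2 + det E\<close>, with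
  \<open>h_2\<close> the complete symmetric expression of degree two: a relation among lines only.
  Its Hilbert functions yield the power sums of exponents 1, 3 and 4, that is,
  \<open>c = - s_1\<close> and the two vanishing relations. Exponent 4 is within reach because the
  Hilbert polynomial of projective four-space has degree 4. The relations force the degrees to
  vanish because these are real numbers: a sum of nonnegative terms is zero.\<close>

definition fscale :: "complex \<Rightarrow> ('a \<Rightarrow> complex) \<Rightarrow> 'a \<Rightarrow> complex" where
  "fscale c f = (\<lambda>x. c * f x)"

lemma fscale_apply [simp]: "fscale c f x = c * f x"
  by (simp add: fscale_def)

interpretation fv: vector_space "fscale :: complex \<Rightarrow> ('a \<Rightarrow> complex) \<Rightarrow> 'a \<Rightarrow> complex"
  by unfold_locales (auto simp: fun_eq_iff algebra_simps)

text \<open>A vector representing a point of projective four-space. Coordinates beyond the fifth are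
  left free, as no form sees them. On the punctured cone forms are honest functions, and a plain
  quantifier over \<open>pt\<close> ranges over all points.\<close>

typedef pt = "{x :: nat \<Rightarrow> complex. \<exists>k\<le>4. x k \<noteq> 0}"
  by (rule exI[of _ "\<lambda>_. 1"]) auto

definition co :: "nat \<Rightarrow> pt \<Rightarrow> complex" where
  "co k p = Rep_pt p k"

lemma co_nonzero: "\<exists>k\<le>4. co k p \<noteq> 0"
  using Rep_pt[of p] by (simp add: co_def)

definition rmon :: "(nat \<Rightarrow> nat) \<Rightarrow> (nat \<Rightarrow> complex) \<Rightarrow> complex" where
  "rmon m x = (\<Prod>k\<le>4. x k ^ m k)"

definition mon :: "(nat \<Rightarrow> nat) \<Rightarrow> pt \<Rightarrow> complex" where
  "mon m p = rmon m (Rep_pt p)"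

text \<open>Degrees are integers, with no monomials in negative degree, so that twists and quotients
  of forms need no case distinction. Exponents are zero beyond index 4 to make them unique.\<close>

definition expo :: "int \<Rightarrow> (nat \<Rightarrow> nat) set" where
  "expo t = {m. 0 \<le> t \<and> (\<forall>k>4. m k = 0) \<and> (\<Sum>k\<le>4. m k) = nat t}"

definition forms :: "int \<Rightarrow> (pt \<Rightarrow> complex) set" where
  "forms t = {f. \<exists>c. f = (\<lambda>p. \<Sum>m\<in>expo t. c m * mon m p)}"

lemma expo_neg: "t < 0 \<Longrightarrow> expo t = {}"
  by (simp add: expo_def)

lemma expo_0: "expo 0 = {\<lambda>_. 0}"
proof -
  have "m k = 0" if "\<forall>k>4. m k = 0" "(\<Sum>k\<le>4. m k) = 0" for m :: "nat \<Rightarrow> nat" and k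
    using that by (cases "k \<le> 4") auto
  then show ?thesis by (auto simp: expo_def fun_eq_iff)
qed

lemma bij_expo_lists:
  assumes "0 \<le> t"
  shows "bij_betw (\<lambda>m. map m [0..<5]) (expo t) {l. length l = 5 \<and> sum_list l = nat t}"
proof (rule bij_betw_byWitness[where f' = "\<lambda>l k. if k < 5 then l ! k else 0"])
  have atm: "{..4::nat} = {0..<5}" by auto
  show "\<forall>m\<in>expo t. (\<lambda>k. if k < 5 then map m [0..<5] ! k else 0) = m"
    by (auto simp: expo_def fun_eq_iff)
  show "\<forall>l\<in>{l. length l = 5 \<and> sum_list l = nat t}.
      map (\<lambda>k. if k < 5 then l ! k else 0) [0..<5] = l"
    by (auto intro!: nth_equalityI)
  show "(\<lambda>m. map m [0..<5]) ` expo t \<subseteq> {l. length l = 5 \<and> sum_list l = nat t}"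
    using assms by (auto simp: expo_def atm interv_sum_list_conv_sum_set_nat simp del: upt_rec_numeral)
  show "(\<lambda>l k. if k < 5 then l ! k else 0) ` {l. length l = 5 \<and> sum_list l = nat t} \<subseteq> expo t"
    using assms by (auto simp: expo_def atm sum_list_sum_nth intro!: sum.cong)
qed

lemma finite_expo: "finite (expo t)"
proof (cases "0 \<le> t")
  case True
  have "finite {l::nat list. length l = 5 \<and> sum_list l = nat t}"
  proof (rule finite_subset)
    show "{l::nat list. length l = 5 \<and> sum_list l = nat t} \<subseteq> {l. set l \<subseteq> {..nat t} \<and> length l = 5}"
      using member_le_sum_list by fastforce
  qed (simp add: finite_lists_length_eq)
  with bij_expo_lists[OF True] show ?thesis using bij_betw_finite by blast
qed (simp add: expo_neg)

lemma card_expo: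
  assumes "0 \<le> t" shows "card (expo t) = (nat t + 4) choose 4"
proof -
  have "card (expo t) = card {l::nat list. length l = 5 \<and> sum_list l = nat t}"
    using bij_betw_same_card[OF bij_expo_lists[OF assms]] .
  also have "\<dots> = (nat t + 5 - 1) choose nat t" by (rule card_length_sum_list)
  also have "\<dots> = (nat t + 4) choose 4"
    using binomial_symmetric[of 4 "nat t + 4"] by (simp add: add.commute)
  finally show ?thesis .
qed

text \<open>Induction on the number of variables: as a polynomial in the last variable the sum
  vanishes identically, so its coefficient at the power \<open>j = m K\<close> is zero, and this is
  a relation in the remaining variables.\<close>

lemma rmon_independent_aux:
  "finite E \<Longrightarrow> (\<And>m. m \<in> E \<Longrightarrow> \<forall>k\<ge>K. m k = 0) \<Longrightarrow>
    (\<And>x::nat \<Rightarrow> complex. (\<Sum>m\<in>E. c m * (\<Prod>k<K. x k ^ m k)) = 0) \<Longrightarrow> m \<in> E \<Longrightarrow> c m = 0"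
proof (induction K arbitrary: E c m)
  case 0
  have "E \<subseteq> {\<lambda>_. 0}" using 0(2) by fastforce
  then have "E = {m}" using 0(4) by auto
  with 0(3) show ?case by simp
next
  case (Suc K)
  define j where "j = m K"
  define E' where "E' = {m\<in>E. m K = j}"
  have inj: "inj_on (\<lambda>m. m(K := 0)) E'"
  proof (rule inj_onI)
    fix a b assume ab: "a \<in> E'" "b \<in> E'" "a(K := 0) = b(K := 0)"
    then have "a k = b k" for k
      by (cases "k = K") (auto simp: E'_def dest: fun_cong[of _ _ k])
    then show "a = b" by auto
  qed
  define c' where "c' = (\<lambda>m. c (m(K := j)))"
  have mE: "m \<in> E'" using Suc.prems by (simp add: E'_def j_def)
  have "c' (m(K := 0)) = 0"
  proof (rule Suc.IH[of "(\<lambda>m. m(K := 0)) ` E'" c' "m(K := 0)"])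
    show "finite ((\<lambda>m. m(K := 0)) ` E')" using Suc.prems by (simp add: E'_def)
    show "\<forall>k\<ge>K. a k = 0" if "a \<in> (\<lambda>m. m(K := 0)) ` E'" for a
      using that Suc.prems(2) by (auto simp: E'_def)
    show "m(K := 0) \<in> (\<lambda>m. m(K := 0)) ` E'" using mE by blast
    fix x :: "nat \<Rightarrow> complex"
    define P where "P = (\<Sum>m\<in>E. monom (c m * (\<Prod>k<K. x k ^ m k)) (m K))"
    have "poly P z = 0" for z
    proof -
      have "poly P z = (\<Sum>m\<in>E. c m * (\<Prod>k<K. x k ^ m k) * z ^ m K)"
        by (simp add: P_def poly_sum poly_monom)
      also have "\<dots> = (\<Sum>m\<in>E. c m * (\<Prod>k<Suc K. (x(K := z)) k ^ m k))"
        by (intro sum.cong) (auto simp: mult.assoc)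
      finally show ?thesis using Suc.prems(3)[of "x(K := z)"] by simp
    qed
    then have "P = 0" using poly_all_0_iff_0 by blast
    then have "0 = coeff P j" by simp
    also have "\<dots> = (\<Sum>m\<in>E'. c m * (\<Prod>k<K. x k ^ m k))"
      using Suc.prems(1) by (simp add: P_def coeff_sum E'_def sum.inter_filter)
    also have "\<dots> = (\<Sum>m\<in>(\<lambda>m. m(K := 0)) ` E'. c' m * (\<Prod>k<K. x k ^ m k))"
      by (subst sum.reindex[OF inj]) (auto simp: c'_def E'_def fun_upd_idem intro!: sum.cong prod.cong)
    finally show "(\<Sum>m\<in>(\<lambda>m. m(K := 0)) ` E'. c' m * (\<Prod>k<K. x k ^ m k)) = 0" by simp
  qed
  then show ?case by (simp add: c'_def j_def)
qed

lemma mon_independent: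
  assumes "\<And>p. (\<Sum>m\<in>expo t. c m * mon m p) = 0" and "m \<in> expo t"
  shows "c m = 0"
proof (rule rmon_independent_aux[where E = "expo t" and K = 5 and c = c and m = m])
  show "finite (expo t)" by (rule finite_expo)
  show "\<forall>k\<ge>5. m k = 0" if "m \<in> expo t" for m using that by (auto simp: expo_def)
  have eq: "(\<Prod>k<5. x k ^ m k) = rmon m x" for x and m :: "nat \<Rightarrow> nat"
    by (simp add: rmon_def lessThan_Suc_atMost[symmetric] numeral_eq_Suc)
  fix x :: "nat \<Rightarrow> complex"
  show "(\<Sum>m\<in>expo t. c m * (\<Prod>k<5. x k ^ m k)) = 0"
  proof (cases "\<exists>k\<le>4. x k \<noteq> 0")
    case True
    then show ?thesis using assms(1)[of "Abs_pt x"] by (simp add: eq mon_def Abs_pt_inverse)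
  next
    \<comment> \<open>The origin is not a \<open>pt\<close>, so the assumption is silent there: in
      degree zero all values agree with those elsewhere, and in any other degree the monomials
      vanish.\<close>
    case False
    show ?thesis
    proof (cases "t = 0")
      case True
      have "rmon m x = 1" "mon m p = 1" if "m \<in> expo t" for m p
        using that unfolding True expo_0 by (auto simp: rmon_def mon_def)
      then show ?thesis using assms(1) by (simp add: eq)
    next
      case 2: False
      have "rmon m x = 0" if m: "m \<in> expo t" for m
      proof -
        have "\<exists>k\<le>4. m k \<noteq> 0" using m 2 by (force simp: expo_def intro: ccontr)
        then show ?thesis using False by (auto simp: rmon_def)
      qed
      then show ?thesis by (simp add: eq)
    qed
  qed
qed (rule assms)

lemma fun_sum_apply: "(\<Sum>i\<in>A. f i) x = (\<Sum>i\<in>A. f i x)"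
  by (induction A rule: infinite_finite_induct) auto

lemma inj_on_mon: "inj_on mon (expo t)"
proof (rule inj_onI, rule ccontr)
  fix a b assume ab: "a \<in> expo t" "b \<in> expo t" "mon a = mon b" "a \<noteq> b"
  define c :: "(nat \<Rightarrow> nat) \<Rightarrow> complex" where "c = (\<lambda>m. if m = a then 1 else if m = b then -1 else 0)"
  have "(\<Sum>m\<in>expo t. c m * mon m p) = 0" for p
  proof -
    have "(\<Sum>m\<in>expo t. c m * mon m p) = (\<Sum>m\<in>{a,b}. c m * mon m p)"
      by (rule sum.mono_neutral_right) (auto simp: finite_expo ab c_def)
    then show ?thesis using ab by (simp add: c_def)
  qed
  from mon_independent[OF this ab(1)] show False by (simp add: c_def)
qed

lemma forms_eq_span: "forms t = fv.span (mon ` expo t)"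
proof -
  have "fv.span (mon ` expo t) = range (\<lambda>u. \<Sum>v\<in>mon ` expo t. fscale (u v) v)"
    using finite_expo by (intro fv.span_finite) auto
  also have "\<dots> = forms t"
  proof (intro subset_antisym subsetI)
    fix f assume "f \<in> range (\<lambda>u. \<Sum>v\<in>mon ` expo t. fscale (u v) v)"
    then obtain u where "f = (\<Sum>v\<in>mon ` expo t. fscale (u v) v)" by auto
    then have "f = (\<lambda>p. \<Sum>m\<in>expo t. (u (mon m)) * mon m p)"
      by (simp add: fun_eq_iff fun_sum_apply sum.reindex[OF inj_on_mon])
    then show "f \<in> forms t" by (auto simp: forms_def)
  next
    fix f assume "f \<in> forms t"
    then obtain c where f: "f = (\<lambda>p. \<Sum>m\<in>expo t. c m * mon m p)" by (auto simp: forms_def)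
    have "f = (\<Sum>v\<in>mon ` expo t. fscale (c (the_inv_into (expo t) mon v)) v)"
      by (simp add: f fun_eq_iff fun_sum_apply sum.reindex[OF inj_on_mon] the_inv_into_f_f[OF inj_on_mon])
    then show "f \<in> range (\<lambda>u. \<Sum>v\<in>mon ` expo t. fscale (u v) v)" by auto
  qed
  finally show ?thesis ..
qed

lemma subspace_forms: "fv.subspace (forms t)"
  by (simp add: forms_eq_span)

lemma independent_mon: "fv.independent (mon ` expo t)"
proof (rule fv.independent_if_scalars_zero)
  show "finite (mon ` expo t)" by (simp add: finite_expo)
  fix f :: "(pt \<Rightarrow> complex) \<Rightarrow> complex" and v assume z: "(\<Sum>v\<in>mon ` expo t. fscale (f v) v) = 0" and v: "v \<in> mon ` expo t"
  then obtain m where m: "m \<in> expo t" "v = mon m" by auto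
  have "(\<Sum>m\<in>expo t. f (mon m) * mon m p) = 0" for p
    using fun_cong[OF z, of p] by (simp add: fun_sum_apply sum.reindex[OF inj_on_mon])
  from mon_independent[where c = "\<lambda>m. f (mon m)", OF this m(1)] show "f v = 0" by (simp add: m)
qed

lemma forms_0 [simp]: "0 \<in> forms t"
  by (rule fv.subspace_0[OF subspace_forms])

lemma forms_add: "f \<in> forms t \<Longrightarrow> g \<in> forms t \<Longrightarrow> f + g \<in> forms t"
  by (rule fv.subspace_add[OF subspace_forms])

lemma forms_scale: "f \<in> forms t \<Longrightarrow> fscale c f \<in> forms t"
  by (rule fv.subspace_scale[OF subspace_forms])

lemma forms_diff: "f \<in> forms t \<Longrightarrow> g \<in> forms t \<Longrightarrow> f - g \<in> forms t"
  by (rule fv.subspace_diff[OF subspace_forms])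

lemma forms_sum: "(\<And>i. i \<in> I \<Longrightarrow> h i \<in> forms t) \<Longrightarrow> (\<Sum>i\<in>I. h i) \<in> forms t"
  by (rule fv.subspace_sum[OF subspace_forms])

lemma mon_in_forms: "m \<in> expo t \<Longrightarrow> mon m \<in> forms t"
  by (simp add: forms_eq_span fv.span_base)

lemma mon_mult: "mon m * mon m' = mon (\<lambda>k. m k + m' k)"
  by (simp add: fun_eq_iff mon_def rmon_def power_add prod.distrib)

lemma expo_add: "m \<in> expo s \<Longrightarrow> m' \<in> expo t \<Longrightarrow> (\<lambda>k. m k + m' k) \<in> expo (s + t)"
  by (auto simp: expo_def sum.distrib nat_add_distrib)

lemma forms_neg_degree: "t < 0 \<Longrightarrow> f \<in> forms t \<longleftrightarrow> f = 0"
  by (auto simp: forms_def expo_neg zero_fun_def)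

lemma forms_degree: "f \<in> forms t \<Longrightarrow> f p \<noteq> 0 \<Longrightarrow> 0 \<le> t"
  using forms_neg_degree[of t f] by (cases "t < 0") auto

text \<open>Linearity reduces products of forms to monomials, one factor at a time.\<close>

lemma forms_mult_closed:
  assumes "\<And>m. m \<in> expo s \<Longrightarrow> mon m * g \<in> forms t" and f: "f \<in> forms s"
  shows "f * g \<in> forms t"
  using f unfolding forms_eq_span[of s]
proof (induction rule: fv.span_induct_alt)
  case base show ?case unfolding mult_zero_left by (rule forms_0)
next
  case (step c x y)
  have eq: "(fscale c x + y) * g = fscale c (x * g) + y * g"
    by (simp add: fun_eq_iff algebra_simps)
  have "x * g \<in> forms t" using step(1) assms(1) by auto
  then show ?case unfolding eq by (intro forms_add forms_scale step)
qed

lemma forms_mult: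
  assumes f: "f \<in> forms s" and g: "g \<in> forms t" shows "f * g \<in> forms (s + t)"
proof (rule forms_mult_closed[OF _ f])
  fix m assume m: "m \<in> expo s"
  have "g * mon m \<in> forms (s + t)"
  proof (rule forms_mult_closed[OF _ g])
    fix m' assume "m' \<in> expo t"
    with m show "mon m' * mon m \<in> forms (s + t)"
      using expo_add[OF m] by (subst mult.commute, unfold mon_mult, intro mon_in_forms)
  qed
  then show "mon m * g \<in> forms (s + t)" by (subst mult.commute)
qed

lemma forms_const: "(\<lambda>_. c) \<in> forms 0"
proof -
  have "(\<lambda>_. 0) \<in> expo 0" by (simp add: expo_def)
  moreover have "(\<lambda>_. c) = fscale c (mon (\<lambda>_. 0))" by (simp add: fun_eq_iff mon_def rmon_def)
  ultimately show ?thesis by (simp add: forms_scale mon_in_forms)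
qed

lemma forms_1: "1 \<in> forms 0"
  unfolding one_fun_def by (rule forms_const)

lemma forms_0_const: assumes "f \<in> forms 0" shows "f p = f p'"
  using assms by (auto simp: forms_def expo_0 mon_def rmon_def)

lemma co_eq_mon: assumes "k \<le> 4" shows "co k = mon (\<lambda>i. if i = k then 1 else 0)"
proof -
  have "(\<Prod>i\<le>4. Rep_pt p i ^ (if i = k then 1 else 0)) = Rep_pt p k" for p
  proof -
    have "(\<Prod>i\<le>4. Rep_pt p i ^ (if i = k then 1 else 0)) = (\<Prod>i\<le>4. if i = k then Rep_pt p i else 1)"
      by (rule prod.cong) auto
    then show ?thesis using assms by (simp add: prod.delta)
  qed
  then show ?thesis by (simp add: fun_eq_iff co_def mon_def rmon_def)
qed

lemma unit_expo: "k \<le> 4 \<Longrightarrow> (\<lambda>i. if i = k then 1 else 0) \<in> expo 1"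
  by (auto simp: expo_def)

lemma co_in_forms: "k \<le> 4 \<Longrightarrow> co k \<in> forms 1"
  by (simp add: co_eq_mon mon_in_forms unit_expo)

lemma forms_power: "f \<in> forms t \<Longrightarrow> f ^ k \<in> forms (int k * t)"
proof (induction k)
  case 0 then show ?case using forms_1 by (simp only: power_0 of_nat_0 mult_zero_left)
next
  case (Suc k)
  have "int (Suc k) * t = t + int k * t" by (simp add: algebra_simps)
  then show ?case using forms_mult[OF Suc.prems Suc.IH[OF Suc.prems]] by (simp only: power_Suc)
qed

lemma forms_prod: "finite I \<Longrightarrow> (\<And>i. i \<in> I \<Longrightarrow> h i \<in> forms (d i)) \<Longrightarrow> (\<Prod>i\<in>I. h i) \<in> forms (\<Sum>i\<in>I. d i)"
  by (induction I rule: finite_induct) (simp_all add: forms_1 forms_mult)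

lemma forms_smult: "f \<in> forms t \<Longrightarrow> (\<lambda>p. c * f p) \<in> forms t"
  using forms_scale[of f t c] by (simp add: fscale_def)

text \<open>The line is described through \<open>Rep_pt\<close>, so the claim is silent about
  parameters where it passes through the origin.\<close>

lemma forms_line:
  assumes "f \<in> forms t"
  shows "\<exists>P. (\<forall>z p. Rep_pt p = (\<lambda>k. a k + z * b k) \<longrightarrow> f p = poly P z) \<and> (0 \<le> t \<longrightarrow> degree P \<le> nat t)"
proof -
  obtain c where f: "f = (\<lambda>p. \<Sum>m\<in>expo t. c m * mon m p)" using assms by (auto simp: forms_def)
  define P where "P = (\<Sum>m\<in>expo t. smult (c m) (\<Prod>k\<le>4. [:a k, b k:] ^ m k))"
  have "f p = poly P z" if "Rep_pt p = (\<lambda>k. a k + z * b k)" for z p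
    using that by (simp add: f P_def poly_sum poly_prod mon_def rmon_def poly_power mult.commute)
  moreover have "degree P \<le> nat t" if "0 \<le> t" unfolding P_def
  proof (rule degree_sum_le[OF finite_expo])
    fix m assume m: "m \<in> expo t"
    have "degree (smult (c m) (\<Prod>k\<le>4. [:a k, b k:] ^ m k)) \<le> degree (\<Prod>k\<le>4. [:a k, b k:] ^ m k)"
      by (rule degree_smult_le)
    also have "\<dots> \<le> (\<Sum>k\<le>4. degree ([:a k, b k:] ^ m k))"
      using degree_prod_sum_le[of "{..4}" "\<lambda>k. [:a k, b k:] ^ m k"] by (simp add: o_def)
    also have "\<dots> \<le> (\<Sum>k\<le>4. m k)"
    proof (rule sum_mono)
      fix k
      have "degree ([:a k, b k:] ^ m k) \<le> degree [:a k, b k:] * m k" by (rule degree_power_le)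
      also have "\<dots> \<le> 1 * m k" by (intro mult_right_mono) auto
      finally show "degree ([:a k, b k:] ^ m k) \<le> m k" by simp
    qed
    also have "\<dots> = nat t" using m by (auto simp: expo_def)
    finally show "degree (smult (c m) (\<Prod>k\<le>4. [:a k, b k:] ^ m k)) \<le> nat t" .
  qed
  ultimately show ?thesis by blast
qed

text \<open>On the line joining a point where \<open>f\<close> is nonzero to one where
  \<open>g\<close> is nonzero, both restrict to nonzero univariate polynomials, whose product is
  nonzero somewhere.\<close>

lemma forms_no_zero_divisors:
  assumes "f \<in> forms s" "g \<in> forms t" "f * g = 0"
  shows "f = 0 \<or> g = 0"
proof (rule ccontr)
  assume "\<not> (f = 0 \<or> g = 0)"
  then obtain p p' where p: "f p \<noteq> 0" "g p' \<noteq> 0" by (auto simp: fun_eq_iff)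
  define a b where "a = Rep_pt p" and "b = (\<lambda>k. Rep_pt p' k - Rep_pt p k)"
  obtain P where P: "\<And>z p. Rep_pt p = (\<lambda>k. a k + z * b k) \<Longrightarrow> f p = poly P z"
    using forms_line[OF assms(1), of a b] by auto
  obtain Q where Q: "\<And>z p. Rep_pt p = (\<lambda>k. a k + z * b k) \<Longrightarrow> g p = poly Q z"
    using forms_line[OF assms(2), of a b] by auto
  obtain k where k: "k \<le> 4" "a k \<noteq> 0" using Rep_pt[of p] by (auto simp: a_def)
  have "poly P 0 \<noteq> 0" using P[of p 0] p by (simp add: a_def)
  moreover have "poly Q 1 \<noteq> 0" using Q[of p' 1] p by (simp add: a_def b_def)
  \<comment> \<open>The factor \<open>[:a k, b k:]\<close> keeps coordinate \<open>k\<close>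
    nonzero, so the chosen point of the line is not the origin.\<close>
  ultimately have "P \<noteq> 0" "Q \<noteq> 0" "[:a k, b k:] \<noteq> 0" using k by auto
  then have "P * Q * [:a k, b k:] \<noteq> 0" by (simp only: mult_eq_0_iff simp_thms)
  then obtain z where z: "poly (P * Q * [:a k, b k:]) z \<noteq> 0" using poly_all_0_iff_0 by blast
  define r where "r = Abs_pt (\<lambda>k. a k + z * b k)"
  have "a k + z * b k \<noteq> 0" using z by (simp only: poly_mult mult_eq_0_iff) simp
  then have "Rep_pt r = (\<lambda>k. a k + z * b k)" unfolding r_def using k(1) by (intro Abs_pt_inverse) auto
  then have "f r = poly P z" "g r = poly Q z" using P Q by blast+
  moreover have "poly P z \<noteq> 0" "poly Q z \<noteq> 0" using z by (simp_all only: poly_mult mult_eq_0_iff) simp_all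
  ultimately have "(f * g) r \<noteq> 0" by simp
  then show False using assms(3) by simp
qed

lemma forms_mult_left_cancel:
  assumes "q \<in> forms s" "q \<noteq> 0" "f \<in> forms t" "g \<in> forms t" "q * f = q * g"
  shows "f = g"
  using forms_no_zero_divisors[OF assms(1) forms_diff[OF assms(3,4)]] assms(2,5)
  by (simp add: right_diff_distrib)

lemma homog_poly_funs_forms:
  assumes "P \<in> homog_poly_funs {..4} d" shows "(\<lambda>p. P (Rep_pt p)) \<in> forms (int d)"
proof -
  obtain M c where M: "finite M" "\<forall>m\<in>M. (\<Sum>i\<in>{..4}. m i) = d"
    "P = (\<lambda>x. \<Sum>m\<in>M. c m * (\<Prod>i\<in>{..4}. x i ^ m i))"
    using assms by (auto simp: homog_poly_funs_def)
  have "(\<lambda>p. P (Rep_pt p)) = (\<Sum>m\<in>M. fscale (c m) (mon (\<lambda>k. if k \<le> 4 then m k else 0)))"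
    by (simp add: M(3) fun_eq_iff fun_sum_apply mon_def rmon_def)
  also have "\<dots> \<in> forms (int d)"
    using M(2) by (intro forms_sum forms_scale mon_in_forms) (auto simp: expo_def)
  finally show ?thesis .
qed

section \<open>Prime factors of forms\<close>

lemma forms_cong_degree: "f \<in> forms s \<Longrightarrow> s = t \<Longrightarrow> f \<in> forms t"
  by simp

definition scale_pt :: "complex \<Rightarrow> pt \<Rightarrow> pt" where
  "scale_pt z p = Abs_pt (\<lambda>k. z * Rep_pt p k)"

lemma Rep_scale_pt: assumes "z \<noteq> 0" shows "Rep_pt (scale_pt z p) = (\<lambda>k. z * Rep_pt p k)"
  unfolding scale_pt_def using Rep_pt[of p] assms by (intro Abs_pt_inverse) auto

lemma forms_scale_pt:
  assumes "f \<in> forms t" "z \<noteq> 0" shows "f (scale_pt z p) = z ^ nat t * f p"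
proof -
  obtain c where f: "f = (\<lambda>p. \<Sum>m\<in>expo t. c m * mon m p)" using assms by (auto simp: forms_def)
  have "mon m (scale_pt z p) = z ^ nat t * mon m p" if m: "m \<in> expo t" for m
  proof -
    have "mon m (scale_pt z p) = (\<Prod>k\<le>4. z ^ m k) * mon m p"
      by (simp add: mon_def rmon_def Rep_scale_pt assms(2) power_mult_distrib prod.distrib)
    also have "(\<Prod>k\<le>4. z ^ m k) = z ^ nat t" using m by (simp add: power_sum[symmetric] expo_def)
    finally show ?thesis .
  qed
  then show ?thesis by (simp add: f sum_distrib_left mult.left_commute)
qed

text \<open>Scaling a point by 2 multiplies a value of degree \<open>t\<close> by
  \<open>2 ^ t\<close>; a nonzero value therefore determines the degree.\<close>

lemma forms_degree_unique:
  assumes "f \<in> forms s" "f \<in> forms t" "f \<noteq> 0" shows "s = t"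
proof -
  obtain p where p: "f p \<noteq> 0" using assms(3) by (auto simp: fun_eq_iff)
  have "0 \<le> s" "0 \<le> t" using assms forms_degree p by blast+
  moreover have "(2::complex) ^ nat s = 2 ^ nat t"
    using forms_scale_pt[OF assms(1), of 2 p] forms_scale_pt[OF assms(2), of 2 p] p by simp
  then have "(2::real) ^ nat s = 2 ^ nat t"
    by (metis norm_numeral norm_power)
  then have "nat s = nat t" by simp
  ultimately show ?thesis by simp
qed

text \<open>All polynomial functions, homogeneous or not. Factorization takes place in the full
  polynomial ring; factors of a form are found here first and then shown to be homogeneous.\<close>

definition pfun :: "(pt \<Rightarrow> complex) set" where
  "pfun = {f. \<exists>N h. (\<forall>d. h d \<in> forms (int d)) \<and> f = (\<Sum>d\<le>N. h d)}"

lemma forms_pfun: assumes "f \<in> forms t" shows "f \<in> pfun"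
proof (cases "0 \<le> t")
  case True
  define h where "h = (\<lambda>d. if d = nat t then f else 0)"
  have "\<forall>d. h d \<in> forms (int d)" using assms True by (auto simp: h_def)
  moreover have "f = (\<Sum>d\<le>nat t. h d)" by (simp add: h_def)
  ultimately show ?thesis unfolding pfun_def by blast
next
  case False
  then have "f = (\<Sum>d\<le>(0::nat). 0)" using assms forms_neg_degree by simp
  then show ?thesis unfolding pfun_def using forms_0 by (intro CollectI exI[of _ 0] exI[of _ "\<lambda>_. 0"]) blast
qed

lemma pfun_add: assumes "f \<in> pfun" "g \<in> pfun" shows "f + g \<in> pfun"
proof -
  obtain N h where h: "\<And>d. h d \<in> forms (int d)" "f = (\<Sum>d\<le>N. h d)" using assms(1) by (auto simp: pfun_def)
  obtain M k where k: "\<And>d. k d \<in> forms (int d)" "g = (\<Sum>d\<le>M. k d)" using assms(2) by (auto simp: pfun_def)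
  define h' where "h' = (\<lambda>d. if d \<le> N then h d else 0)"
  define k' where "k' = (\<lambda>d. if d \<le> M then k d else 0)"
  have "f = (\<Sum>d\<le>max N M. h' d)" unfolding h(2) h'_def
    by (rule sum.mono_neutral_cong_left) auto
  moreover have "g = (\<Sum>d\<le>max N M. k' d)" unfolding k(2) k'_def
    by (rule sum.mono_neutral_cong_left) auto
  ultimately have "f + g = (\<Sum>d\<le>max N M. h' d + k' d)" by (simp only: sum.distrib)
  moreover have "\<forall>d. h' d + k' d \<in> forms (int d)"
    using h k by (intro allI forms_add) (auto simp: h'_def k'_def)
  ultimately show ?thesis unfolding pfun_def
    by (intro CollectI exI[of _ "max N M"] exI[of _ "\<lambda>d. h' d + k' d"] conjI)
qed

lemma pfun_sum: "(\<And>i. i \<in> I \<Longrightarrow> h i \<in> pfun) \<Longrightarrow> (\<Sum>i\<in>I. h i) \<in> pfun"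
proof (induction I rule: infinite_finite_induct)
  case (insert x F)
  then have "h x + sum h F \<in> pfun" by (intro pfun_add) auto
  then show ?case using insert(1,2) by (simp only: sum.insert if_False simp_thms)
next
  case (infinite A)
  then show ?case unfolding sum.infinite[OF infinite(1)] by (intro forms_pfun forms_0)
next
  case empty
  then show ?case using forms_pfun[OF forms_0] by (simp only: sum.empty)
qed

lemma pfun_mult: assumes "f \<in> pfun" "g \<in> pfun" shows "f * g \<in> pfun"
proof -
  obtain N h where h: "\<And>d. h d \<in> forms (int d)" "f = (\<Sum>d\<le>N. h d)" using assms(1) by (auto simp: pfun_def)
  obtain M k where k: "\<And>d. k d \<in> forms (int d)" "g = (\<Sum>d\<le>M. k d)" using assms(2) by (auto simp: pfun_def)
  have "f * g = (\<Sum>d\<le>N. \<Sum>e\<le>M. h d * k e)" unfolding h k by (rule sum_product)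
  also have "\<dots> \<in> pfun"
    by (intro pfun_sum) (rule forms_pfun[OF forms_mult[OF h(1) k(1)]])
  finally show ?thesis .
qed

text \<open>Order at zero and degree are both additive, and they agree for the product; as the order
  never exceeds the degree, they agree for each factor.\<close>

lemma factor_of_monom:
  fixes G K :: "complex poly"
  assumes "G * K = monom c t" "c \<noteq> 0" "coeff G i \<noteq> 0" "coeff G j \<noteq> 0"
  shows "i = j"
proof -
  have nz: "G \<noteq> 0" "K \<noteq> 0" using assms by auto
  have "degree G + degree K = t"
    using degree_mult_eq[OF nz] assms(1,2) by (simp add: degree_monom_eq)
  moreover have "order 0 G + order 0 K = t"
    using order_mult[of G K 0] nz assms(1,2) by (simp add: order_0_monom)
  moreover have "order 0 G \<le> degree G" "order 0 K \<le> degree K"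
    using order_degree[OF nz(1)] order_degree[OF nz(2)] by auto
  ultimately have "order 0 G = degree G" by simp
  then have "monom 1 (degree G) dvd G" using nz by (simp add: monom_1_dvd_iff)
  then have "\<forall>k<degree G. coeff G k = 0" by (simp add: monom_1_dvd_iff')
  then have "k = degree G" if "coeff G k \<noteq> 0" for k
    using that le_degree[OF that] by (cases "k < degree G") auto
  then show ?thesis using assms(3,4) by blast
qed

text \<open>Along the ray through a point \<open>p\<close>, a factor of the form \<open>f\<close>
  becomes a factor of a monomial in the ray parameter, hence a monomial. So at most one homogeneous
  part of \<open>g\<close> is nonzero.\<close>

lemma pfun_factor_of_form:
  assumes g: "g \<in> pfun" and k: "k \<in> pfun" and f: "f \<in> forms t" "f \<noteq> 0" "g * k = f"
  shows "\<exists>e. g \<in> forms e"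
proof -
  obtain N h where h: "\<And>d. h d \<in> forms (int d)" "g = (\<Sum>d\<le>N. h d)" using g by (auto simp: pfun_def)
  obtain M l where l: "\<And>d. l d \<in> forms (int d)" "k = (\<Sum>d\<le>M. l d)" using k by (auto simp: pfun_def)
  have uniq: "i = j" if ij: "i \<le> N" "j \<le> N" "h i \<noteq> 0" "h j \<noteq> 0" for i j
  proof -
    have "h i * h j \<noteq> 0" using forms_no_zero_divisors[OF h(1) h(1)] ij by blast
    then have "h i * h j * f \<noteq> 0" using forms_no_zero_divisors[OF forms_mult[OF h(1) h(1)] f(1)] f(2) by blast
    then obtain p where p: "h i p \<noteq> 0" "h j p \<noteq> 0" "f p \<noteq> 0" by (auto simp: fun_eq_iff)
    define G where "G = (\<Sum>d\<le>N. monom (h d p) d)"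
    define K where "K = (\<Sum>d\<le>M. monom (l d p) d)"
    \<comment> \<open>\<open>scale_pt\<close> is under control only for nonzero \<open>z\<close>;
      the extra factor \<open>z\<close> removes the case \<open>z = 0\<close>.\<close>
    have "poly ([:0,1:] * (G * K - monom (f p) (nat t))) z = 0" for z
    proof (cases "z = 0")
      case False
      have "poly G z = g (scale_pt z p)" "poly K z = k (scale_pt z p)"
        by (simp_all add: G_def K_def poly_sum poly_monom h(2) l(2) fun_sum_apply
            forms_scale_pt[OF h(1) False] forms_scale_pt[OF l(1) False] mult.commute)
      moreover have "g (scale_pt z p) * k (scale_pt z p) = f (scale_pt z p)"
        using fun_cong[OF f(3)] by simp
      ultimately show ?thesis
        by (simp add: poly_monom forms_scale_pt[OF f(1) False] mult.commute)
    qed simp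
    then have "[:0,1:] * (G * K - monom (f p) (nat t)) = 0" using poly_all_0_iff_0 by blast
    then have GK: "G * K = monom (f p) (nat t)" by (simp only: mult_eq_0_iff) simp
    have "coeff G d = (if d \<le> N then h d p else 0)" for d
      by (simp add: G_def coeff_sum)
    then show "i = j" using factor_of_monom[OF GK p(3), of i j] p ij by simp
  qed
  show ?thesis
  proof (cases "\<exists>i\<le>N. h i \<noteq> 0")
    case True
    then obtain i where i: "i \<le> N" "h i \<noteq> 0" by blast
    have "g = (\<Sum>d\<in>{i}. h d)" unfolding h(2)
      by (rule sum.mono_neutral_right) (use i uniq in auto)
    then have "g = h i" by simp
    then show ?thesis using h(1) by blast
  next
    case False
    then have "g = 0" by (simp add: h(2))
    then show ?thesis using forms_0 by blast
  qed
qed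

section \<open>Unique factorization through iterated polynomial rings\<close>

inductive_set rpoly :: "((nat \<Rightarrow> complex) \<Rightarrow> complex) set" where
  const: "(\<lambda>_. c) \<in> rpoly"
| coord: "k \<le> 4 \<Longrightarrow> (\<lambda>x. x k) \<in> rpoly"
| add: "f \<in> rpoly \<Longrightarrow> g \<in> rpoly \<Longrightarrow> (\<lambda>x. f x + g x) \<in> rpoly"
| mult: "f \<in> rpoly \<Longrightarrow> g \<in> rpoly \<Longrightarrow> (\<lambda>x. f x * g x) \<in> rpoly"

lemma rpoly_pfun: "f \<in> rpoly \<Longrightarrow> (\<lambda>p. f (Rep_pt p)) \<in> pfun"
proof (induction rule: rpoly.induct)
  case (const c)
  then show ?case using forms_pfun[OF forms_const] .
next
  case (coord k)
  then show ?case using forms_pfun[OF co_in_forms[OF coord]] by (simp add: co_def[abs_def])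
next
  case (add f g)
  then show ?case using pfun_add[OF add.IH] by (simp add: plus_fun_def)
next
  case (mult f g)
  then show ?case using pfun_mult[OF mult.IH] by (simp add: times_fun_def)
qed

text \<open>Polynomials in \<open>k\<close> variables are iterated univariate ones, for which the library knows
  unique factorization; \<open>e\<close> evaluates them and \<open>C\<close> embeds the constants.\<close>

definition eval_level :: "nat \<Rightarrow> ('a::idom \<Rightarrow> (nat \<Rightarrow> complex) \<Rightarrow> complex) \<Rightarrow> (complex \<Rightarrow> 'a) \<Rightarrow> bool" where
  "eval_level k e C \<longleftrightarrow>
     (\<forall>a b x. e (a + b) x = e a x + e b x) \<and> (\<forall>a b x. e (a * b) x = e a x * e b x) \<and>
     (\<forall>z x. e (C z) x = z) \<and> (\<forall>Q. (\<forall>x. e Q x = 0) \<longrightarrow> Q = 0) \<and>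
     (\<forall>Q x j z. k \<le> j \<longrightarrow> e Q (x(j := z)) = e Q x) \<and>
     (\<forall>j<k. \<exists>Q. \<forall>x. e Q x = x j) \<and> (\<forall>Q. e Q \<in> rpoly)"

lemma eval_level_0: "eval_level 0 (\<lambda>c _. c) (\<lambda>c. c)"
  by (simp add: eval_level_def rpoly.const)

lemma eval_level_Suc:
  assumes L: "eval_level k e C" and k: "k \<le> 4"
  shows "eval_level (Suc k) (\<lambda>P x. e (poly P (C (x k))) x) (\<lambda>z. [:C z:])"
proof -
  have add: "\<And>a b x. e (a + b) x = e a x + e b x" and mult: "\<And>a b x. e (a * b) x = e a x * e b x"
    and C: "\<And>z x. e (C z) x = z" and inj: "\<And>Q. (\<And>x. e Q x = 0) \<Longrightarrow> Q = 0"
    and dep: "\<And>Q x j z. k \<le> j \<Longrightarrow> e Q (x(j := z)) = e Q x"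
    and var: "\<And>j. j < k \<Longrightarrow> \<exists>Q. \<forall>x. e Q x = x j" and range: "\<And>Q. e Q \<in> rpoly"
    using L by (auto simp: eval_level_def)
  have e0: "e 0 x = 0" for x using add[of 0 0 x] by simp
  have e1: "e 1 x = 1" for x using mult[of 1 "C 1" x] C[of 1 x] by simp
  have injC: "inj C" by (rule injI) (metis C)
  \<comment> \<open>Coefficients do not depend on coordinate \<open>k\<close>, so that coordinate
    may be varied alone: every constant \<open>C z\<close> is a root of \<open>P\<close>, and there
    are infinitely many.\<close>
  have P0: "P = 0" if P: "\<And>x. e (poly P (C (x k))) x = 0" for P
  proof (rule ccontr)
    assume "P \<noteq> 0"
    then have "finite {x. poly P x = 0}" by (rule poly_roots_finite)
    moreover have "range C \<subseteq> {x. poly P x = 0}"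
    proof clarify
      fix z
      have "e (poly P (C z)) x = 0" for x
        using P[of "x(k := z)"] dep[of k "poly P (C z)" x z] by simp
      then show "poly P (C z) = 0" by (rule inj)
    qed
    ultimately have "finite (range C)" by (rule finite_subset[rotated])
    then have "finite (UNIV :: complex set)" using injC by (rule finite_imageD)
    then show False using infinite_UNIV_char_0 by blast
  qed
  have vars: "\<exists>Q. \<forall>x. e (poly Q (C (x k))) x = x j" if j: "j < Suc k" for j
  proof (cases "j = k")
    case True
    show ?thesis by (rule exI[of _ "[:0, 1:]"]) (simp add: C True)
  next
    case False
    with j var obtain Q where "\<And>x. e Q x = x j" by (metis less_SucE)
    then show ?thesis by (intro exI[of _ "[:Q:]"]) simp
  qed
  have ranges: "(\<lambda>x. e (poly Q (C (x k))) x) \<in> rpoly" for Q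
  proof (induction Q)
    case 0
    then show ?case by (simp add: e0 rpoly.const)
  next
    case (pCons a P)
    have "(\<lambda>x. e a x + x k * e (poly P (C (x k))) x) \<in> rpoly"
      using range[of a] pCons k by (intro rpoly.add rpoly.mult rpoly.coord) auto
    then show ?case by (simp add: add mult C)
  qed
  show ?thesis unfolding eval_level_def
    using vars ranges P0 dep by (auto simp: add mult C)
qed

type_synonym poly5 = "complex poly poly poly poly poly"

lemma ex_eval_level_5: "\<exists>e C. eval_level 5 (e :: poly5 \<Rightarrow> _) C"
proof -
  note 1 = eval_level_Suc[OF eval_level_0, simplified]
  note 2 = eval_level_Suc[OF 1]
  note 3 = eval_level_Suc[OF 2]
  note 4 = eval_level_Suc[OF 3]
  note 5 = eval_level_Suc[OF 4]
  have "eval_level (Suc (Suc (Suc (Suc (Suc 0)))))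
     (\<lambda>(P::poly5) x. poly (poly (poly (poly (poly P [:[:[:[:x (Suc (Suc (Suc (Suc 0)))):]:]:]:])
       [:[:[:x (Suc (Suc (Suc 0))):]:]:]) [:[:x (Suc (Suc 0)):]:]) [:x (Suc 0):]) (x 0))
     (\<lambda>z. [:[:[:[:[:z:]:]:]:]:])"
    by (rule 5) auto
  then show ?thesis by (auto simp: numeral_eq_Suc)
qed

text \<open>Among the prime factors of the polynomial of \<open>f\<close> one vanishes at
  \<open>x0\<close>; as a factor of a form it is itself a form. The last property is its primality,
  phrased with quotients of the expected degree.\<close>

lemma prime_form_factor:
  assumes f: "f \<in> forms d" "f \<noteq> 0" and f0: "f x0 = 0"
  obtains e p k where "1 \<le> e" "p \<in> forms e" "p \<noteq> 0" "p x0 = 0" "k \<in> forms (d - e)" "f = p * k"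
    "\<And>a b g h k. g \<in> forms a \<Longrightarrow> h \<in> forms b \<Longrightarrow> k \<in> forms (a + b - e) \<Longrightarrow> g * h = p * k \<Longrightarrow>
       (\<exists>k'\<in>forms (a - e). g = p * k') \<or> (\<exists>k'\<in>forms (b - e). h = p * k')"
proof -
  obtain ev :: "poly5 \<Rightarrow> (nat \<Rightarrow> complex) \<Rightarrow> complex" and C where L: "eval_level 5 ev C"
    using ex_eval_level_5 by blast
  define E where "E Q = (\<lambda>p. ev Q (Rep_pt p))" for Q
  have Eadd: "E (a + b) = E a + E b" and Emult: "E (a * b) = E a * E b" for a b
    using L by (auto simp: eval_level_def E_def fun_eq_iff)
  have EC: "E (C z) = (\<lambda>_. z)" for z using L by (auto simp: eval_level_def E_def fun_eq_iff)
  have E0: "E 0 = 0" using Eadd[of 0 0] by simp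
  \<comment> \<open>Evaluation determines polynomials, so \<open>C 1\<close> is identified with 1 by
    its values.\<close>
  have C1: "C 1 = 1"
  proof -
    have "ev (C 1 + (- 1)) x = 0" for x
    proof -
      have "ev (C 1 * (C 1 + (-1))) x = ev (C 1) x * ev (C 1 + (-1)) x"
        using L by (simp add: eval_level_def)
      moreover have "ev (1 * C 1) x = ev 1 x * ev (C 1) x" using L unfolding eval_level_def by blast
      moreover have "ev (C 1) x = 1" using L by (simp add: eval_level_def)
      moreover have "ev (1 + (-1)) x = ev 1 x + ev (-1) x" "ev (0 + 0) x = ev 0 x + ev 0 x"
        "ev (C 1 + (-1)) x = ev (C 1) x + ev (-1) x"
        using L unfolding eval_level_def by blast+
      ultimately show ?thesis by (simp add: add.commute)
    qed
    then have "C 1 + (- 1) = 0" using L unfolding eval_level_def by blast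
    then show ?thesis by simp
  qed
  have E1: "E 1 = 1" using EC[of 1] by (simp add: C1 one_fun_def)
  obtain X0 where X0: "\<And>x. ev X0 x = x 0" using L unfolding eval_level_def by fastforce
  have Einj: "Q = 0" if "E Q = 0" for Q
  proof -
    \<comment> \<open>Multiplying by \<open>X0\<close> disposes of the vectors with
      \<open>x 0 = 0\<close>, among them the origin, which is not a \<open>pt\<close>.\<close>
    have "ev (X0 * Q) x = 0" for x
    proof (cases "x 0 = 0")
      case False
      then have "Rep_pt (Abs_pt x) = x" by (intro Abs_pt_inverse) auto
      then have "ev Q x = 0" using fun_cong[OF that, of "Abs_pt x"] by (simp add: E_def)
      then show ?thesis using L by (simp add: eval_level_def)
    qed (use L X0 in \<open>simp add: eval_level_def\<close>)
    then have "X0 * Q = 0" using L unfolding eval_level_def by blast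
    moreover have "X0 \<noteq> 0"
    proof
      assume "X0 = 0"
      then have "X0 + X0 = X0" by simp
      then have "ev X0 x + ev X0 x = ev X0 x" for x using L unfolding eval_level_def by metis
      from this[of "\<lambda>_. 1"] show False by (simp add: X0)
    qed
    ultimately show ?thesis by simp
  qed
  have Einj': "P = Q" if "E P = E Q" for P Q
  proof -
    have "E (P - Q) + E Q = E P" using Eadd[of "P - Q" Q] by simp
    then have "E (P - Q) = 0" using that by simp
    then show ?thesis using Einj by fastforce
  qed
  have Epfun: "E Q \<in> pfun" for Q
    using L rpoly_pfun[of "ev Q"] by (simp add: E_def eval_level_def)
  have sumE: "\<exists>Q. E Q = (\<Sum>i\<in>I. h i)" if "finite I" "\<And>i. i \<in> I \<Longrightarrow> \<exists>Q. E Q = h i"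
    for I :: "(nat \<Rightarrow> nat) set" and h
    using that by (induction I rule: finite_induct) (use E0 in \<open>auto, metis Eadd\<close>)
  have monE: "\<exists>Q. E Q = mon m" for m
  proof -
    have "\<exists>Q. \<forall>x. ev Q x = x j" if "j \<le> 4" for j using L that by (simp add: eval_level_def)
    then obtain V where V: "\<And>x j. j \<le> 4 \<Longrightarrow> ev (V j) x = x j" by metis
    have pw: "E (q ^ i) p = E q p ^ i" for q i p
      by (induction i) (simp_all add: E1 Emult)
    have pr: "finite J \<Longrightarrow> E (\<Prod>j\<in>J. q j) p = (\<Prod>j\<in>J. E (q j) p)" for J :: "nat set" and q p
      by (induction J rule: finite_induct) (simp_all add: E1 Emult)
    have EV: "E (V j) p = Rep_pt p j" if "j \<le> 4" for j p using V[OF that] by (simp add: E_def)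
    have "E (\<Prod>j\<le>4. V j ^ m j) p = mon m p" for p
      by (simp add: pr pw mon_def rmon_def EV)
    then show ?thesis by blast
  qed
  have Esurj: "\<exists>Q. E Q = g" if gt: "g \<in> forms t" for g t
  proof -
    obtain c where "g = (\<lambda>p. \<Sum>m\<in>expo t. c m * mon m p)" using gt by (auto simp: forms_def)
    then have g: "g = (\<Sum>m\<in>expo t. (\<lambda>_. c m) * mon m)" by (simp add: fun_eq_iff fun_sum_apply)
    have "\<exists>Q. E Q = (\<lambda>_. c m) * mon m" for m using monE[of m] EC Emult by metis
    then show ?thesis unfolding g by (intro sumE finite_expo)
  qed
  \<comment> \<open>A quotient of forms in the polynomial ring is a form of the difference of the
    degrees. The zero quotient is treated apart, as its degree is not determined.\<close>
  have quot: "k \<in> forms (a - e)" if "p \<in> forms e" "p \<noteq> 0" "k \<in> pfun" "p * k = g" "g \<in> forms a" for p e k g a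
  proof (cases "g = 0")
    case True
    have "k = 0"
    proof -
      obtain Q where "E Q = p" using Esurj[OF \<open>p \<in> forms e\<close>] by blast
      from that(3) obtain N h where h: "\<And>d. h d \<in> forms (int d)" "k = (\<Sum>d\<le>N. h d)"
        by (auto simp: pfun_def)
      have "\<forall>d. \<exists>Q. E Q = h d" using Esurj[OF h(1)] by blast
      then obtain H where H: "\<And>d. E (H d) = h d" by metis
      have "finite I \<Longrightarrow> E (\<Sum>d\<in>I. H d) = (\<Sum>d\<in>I. h d)" for I
        by (induction I rule: finite_induct) (auto simp: E0 Eadd H)
      then have "E (\<Sum>d\<le>N. H d) = k" by (simp add: h)
      then have "E (Q * (\<Sum>d\<le>N. H d)) = 0" using Emult \<open>E Q = p\<close> that(4) True by simp
      then have "Q * (\<Sum>d\<le>N. H d) = 0" by (rule Einj)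
      then have "(\<Sum>d\<le>N. H d) = 0" using \<open>E Q = p\<close> that(2) E0 by auto
      then show ?thesis using \<open>E (\<Sum>d\<le>N. H d) = k\<close> E0 by simp
    qed
    then show ?thesis by simp
  next
    case False
    then have k0: "k \<noteq> 0" using that(4) by auto
    have "k * p = g" using that(4) by (simp add: mult.commute)
    from pfun_factor_of_form[OF that(3) forms_pfun[OF that(1)] that(5) False this]
    obtain s where s: "k \<in> forms s" by blast
    have "e + s = a" using forms_degree_unique[OF forms_mult[OF that(1) s]] that False by simp
    then show ?thesis using s by (auto intro: forms_cong_degree)
  qed
  obtain F where F: "E F = f" using Esurj[OF f(1)] by blast
  have F0: "F \<noteq> 0" using F f(2) E0 by auto
  have prodE: "E (prod_mset A) x0 = 0 \<Longrightarrow> \<exists>p\<in>#A. E p x0 = 0" for A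
    by (induction A) (auto simp: E1 Emult)
  have "F dvd prod_mset (prime_factorization F)"
    using prod_mset_prime_factorization_weak[OF F0] by (rule associatedD2)
  then obtain R where "prod_mset (prime_factorization F) = F * R" by (auto elim: dvdE)
  then have "E (prod_mset (prime_factorization F)) x0 = 0" using F f0 by (simp add: Emult)
  then obtain P where P: "P \<in># prime_factorization F" "E P x0 = 0" using prodE by auto
  have prime: "prime_elem P" and "P dvd F"
    using in_prime_factors_imp_prime[OF P(1)] in_prime_factors_imp_dvd[OF P(1)] by (auto simp: prime_def)
  then obtain K where K: "F = P * K" by (auto elim: dvdE)
  have fPK: "E P * E K = f" using F K Emult by simp
  obtain e where e: "E P \<in> forms e"
    using pfun_factor_of_form[OF Epfun Epfun f fPK] by blast
  have Pnz: "E P \<noteq> 0" using prime Einj[of P] by (auto simp: prime_elem_def)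
  have e1: "1 \<le> e"
  proof (rule ccontr)
    assume "\<not> 1 \<le> e"
    then have "e < 0 \<or> e = 0" by auto
    then have "E P = 0"
    proof
      assume "e = 0"
      then show ?thesis using forms_0_const[of "E P" _ x0] e P(2) by (simp add: fun_eq_iff)
    qed (use e forms_neg_degree in blast)
    then show False using Pnz by simp
  qed
  show thesis
  proof (rule that[OF e1 e Pnz P(2)])
    show "E K \<in> forms (d - e)" by (rule quot[OF e Pnz Epfun fPK f(1)])
    show "f = E P * E K" using fPK by simp
    fix a b g h k assume g: "g \<in> forms a" and h: "h \<in> forms b" and k: "k \<in> forms (a + b - e)"
      and eq: "g * h = E P * k"
    obtain G H K' where GHK: "E G = g" "E H = h" "E K' = k" using Esurj g h k by metis
    then have "E (G * H) = E (P * K')" using eq Emult by simp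
    then have "P dvd G * H" using Einj' by (metis dvd_triv_left)
    then have "P dvd G \<or> P dvd H" using prime prime_elem_dvd_mult_iff by blast
    then show "(\<exists>k'\<in>forms (a - e). g = E P * k') \<or> (\<exists>k'\<in>forms (b - e). h = E P * k')"
    proof
      assume "P dvd G"
      then obtain R where "G = P * R" by (auto elim: dvdE)
      then have R: "E P * E R = g" using GHK Emult by simp
      from quot[OF e Pnz Epfun R g] R show ?thesis by blast
    next
      assume "P dvd H"
      then obtain R where "H = P * R" by (auto elim: dvdE)
      then have R: "E P * E R = h" using GHK Emult by simp
      from quot[OF e Pnz Epfun R h] R show ?thesis by blast
    qed
  qed
qed

text \<open>Near each point the family is generated by one form \<open>g\<close>, up to a
  denominator \<open>q\<close>; this is how a line bundle on projective space is recognized as a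
  twist. Take a common factor \<open>D\<close> of largest degree, which is bounded by the degree of
  \<open>f0\<close>. If the cofactor of \<open>g\<close> vanished at \<open>x\<close>, it would have
  a prime factor \<open>p\<close> vanishing there. Then \<open>p\<close> divides \<open>q\<close>
  times every cofactor but does not divide \<open>q\<close>, so \<open>D * p\<close> would be a
  larger common factor.\<close>

lemma ex_common_factor:
  assumes I: "\<And>t f. f \<in> I t \<Longrightarrow> f \<in> forms t" and f0: "f0 \<in> I t0" "f0 \<noteq> 0"
    and loc: "\<And>x. \<exists>s q b g. q \<in> forms s \<and> q x \<noteq> 0 \<and> g \<in> I b \<and>
      (\<forall>t. \<forall>f\<in>I t. \<exists>k\<in>forms (s + t - b). q * f = g * k)"
  obtains \<delta> D where "D \<in> forms \<delta>" "D \<noteq> 0"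
    "\<And>t f. f \<in> I t \<Longrightarrow> \<exists>k\<in>forms (t - \<delta>). f = D * k"
    "\<And>x. \<exists>t f k. f \<in> I t \<and> k \<in> forms (t - \<delta>) \<and> f = D * k \<and> k x \<noteq> 0"
proof -
  define CF where "CF \<delta> D \<longleftrightarrow> D \<in> forms \<delta> \<and> D \<noteq> 0 \<and> (\<forall>t. \<forall>f\<in>I t. \<exists>k\<in>forms (t - \<delta>). f = D * k)"
    for \<delta> D
  have CF1: "CF 0 1"
    unfolding CF_def using I forms_1 by (auto simp: fun_eq_iff intro!: bexI[of _ "_ :: pt \<Rightarrow> complex"])
  have bound: "\<delta> \<le> t0" if "CF \<delta> D" for \<delta> D
  proof -
    have "\<exists>k\<in>forms (t0 - \<delta>). f0 = D * k" using that f0(1) by (simp add: CF_def)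
    then obtain k where k: "k \<in> forms (t0 - \<delta>)" "f0 = D * k" by blast
    then have "k \<noteq> 0" using f0(2) by auto
    then show ?thesis using k(1) forms_neg_degree[of "t0 - \<delta>" k] by auto
  qed
  have "\<exists>n D. CF (int n) D \<and> (\<forall>m D'. CF (int m) D' \<longrightarrow> m \<le> n)"
  proof -
    have 1: "\<exists>D. CF (int 0) D" using CF1 by auto
    have 2: "\<forall>y. (\<exists>D. CF (int y) D) \<longrightarrow> y < Suc (nat t0)" using bound by fastforce
    from ex_has_greatest_nat[of "\<lambda>n. \<exists>D. CF (int n) D" 0 id "Suc (nat t0)"] 1 2
    show ?thesis by auto
  qed
  then obtain n D where D: "CF (int n) D" and max: "\<And>m D'. CF (int m) D' \<Longrightarrow> m \<le> n" by blast
  have Df: "D \<in> forms (int n)" "D \<noteq> 0" and Dd: "\<And>t f. f \<in> I t \<Longrightarrow> \<exists>k\<in>forms (t - int n). f = D * k"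
    using D by (auto simp: CF_def)
  show thesis
  proof (rule that[OF Df Dd])
    fix x
    obtain s q b g where q: "q \<in> forms s" "q x \<noteq> 0" "g \<in> I b"
      and gd: "\<And>t f. f \<in> I t \<Longrightarrow> \<exists>k\<in>forms (s + t - b). q * f = g * k" using loc[of x] by blast
    obtain g' where g': "g' \<in> forms (b - int n)" "g = D * g'" using Dd q(3) by blast
    have q0: "q \<noteq> 0" using q(2) by auto
    have "g' x \<noteq> 0"
    proof
      assume gx: "g' x = 0"
      have "g \<noteq> 0"
      proof
        assume "g = 0"
        then have "q * f0 = 0" using gd[OF f0(1)] by auto
        then show False using forms_no_zero_divisors[OF q(1) I[OF f0(1)]] q0 f0(2) by blast
      qed
      then have "g' \<noteq> 0" using g' by auto
      then obtain e p k0 where p: "1 \<le> e" "p \<in> forms e" "p \<noteq> 0" "p x = 0" "k0 \<in> forms (b - int n - e)"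
          "g' = p * k0"
        and pr: "\<And>a b g h k. g \<in> forms a \<Longrightarrow> h \<in> forms b \<Longrightarrow> k \<in> forms (a + b - e) \<Longrightarrow> g * h = p * k \<Longrightarrow>
           (\<exists>k'\<in>forms (a - e). g = p * k') \<or> (\<exists>k'\<in>forms (b - e). h = p * k')"
        using prime_form_factor[OF g'(1) _ gx] by metis
      have "CF (int (n + nat e)) (D * p)"
        unfolding CF_def
      proof (intro conjI allI ballI)
        have "D * p \<in> forms (int n + e)" by (rule forms_mult[OF Df(1) p(2)])
        then show "D * p \<in> forms (int (n + nat e))" using p(1) by (auto intro: forms_cong_degree)
        show "D * p \<noteq> 0" using forms_no_zero_divisors[OF Df(1) p(2)] Df(2) p(3) by blast
        fix t f assume f: "f \<in> I t"
        obtain k where k: "k \<in> forms (s + t - b)" "q * f = g * k" using gd[OF f] by blast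
        obtain f' where f': "f' \<in> forms (t - int n)" "f = D * f'" using Dd[OF f] by blast
        have "D * (q * f') = D * (p * (k0 * k))"
          using k(2) unfolding f'(2) g'(2) p(6) by (simp only: mult_ac)
        have eq: "q * f' = p * (k0 * k)"
        proof (rule forms_mult_left_cancel[OF Df _ _ \<open>D * (q * f') = D * (p * (k0 * k))\<close>])
          show "q * f' \<in> forms (s + (t - int n))" by (rule forms_mult[OF q(1) f'(1)])
          have "p * (k0 * k) \<in> forms (e + (b - int n - e + (s + t - b)))"
            by (intro forms_mult p k)
          then show "p * (k0 * k) \<in> forms (s + (t - int n))" by (auto elim: forms_cong_degree)
        qed
        have k0k: "k0 * k \<in> forms (s + (t - int n) - e)"
          by (rule forms_cong_degree[OF forms_mult[OF p(5) k(1)]]) simp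
        have "\<not> (\<exists>k'\<in>forms (s - e). q = p * k')" using q(2) p(4) by auto
        then obtain h where h: "h \<in> forms (t - int n - e)" "f' = p * h"
          using pr[OF q(1) f'(1) k0k eq] by blast
        have "f = D * p * h" unfolding f'(2) h(2) by (simp only: mult.assoc)
        moreover have "h \<in> forms (t - int (n + nat e))"
          using h(1) p(1) by (auto elim: forms_cong_degree)
        ultimately show "\<exists>k\<in>forms (t - int (n + nat e)). f = D * p * k" by blast
      qed
      from max[OF this] p(1) show False by simp
    qed
    then show "\<exists>t f k. f \<in> I t \<and> k \<in> forms (t - int n) \<and> f = D * k \<and> k x \<noteq> 0"
      using q(3) g' by blast
  qed
qed

section \<open>The projective Nullstellensatz\<close>

text \<open>A homogeneous ideal, given by its homogeneous elements tagged with their degrees; the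
  tag matters because the zero function is a form of every degree.\<close>

definition gideal :: "(int \<times> (pt \<Rightarrow> complex)) set \<Rightarrow> bool" where
  "gideal J \<longleftrightarrow> (\<forall>t f. (t, f) \<in> J \<longrightarrow> f \<in> forms t) \<and> (\<forall>t. (t, 0) \<in> J) \<and>
     (\<forall>t f g. (t, f) \<in> J \<longrightarrow> (t, g) \<in> J \<longrightarrow> (t, f + g) \<in> J) \<and>
     (\<forall>t f s h. (t, f) \<in> J \<longrightarrow> h \<in> forms s \<longrightarrow> (t + s, f * h) \<in> J)"

lemma gidealD:
  assumes "gideal J"
  shows "(t, f) \<in> J \<Longrightarrow> f \<in> forms t" "(t, 0) \<in> J"
    "(t, f) \<in> J \<Longrightarrow> (t, g) \<in> J \<Longrightarrow> (t, f + g) \<in> J"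
    "(t, f) \<in> J \<Longrightarrow> h \<in> forms s \<Longrightarrow> (t + s, f * h) \<in> J"
  using assms unfolding gideal_def by blast+

lemma gideal_scale:
  assumes "gideal J" "(t, f) \<in> J" shows "(t, (\<lambda>_. c) * f) \<in> J"
  using gidealD(4)[OF assms forms_const[of c]] by (simp add: mult.commute)

lemma gideal_diff:
  assumes "gideal J" "(t, f) \<in> J" "(t, g) \<in> J" shows "(t, f - g) \<in> J"
proof -
  have "(t, f + (\<lambda>_. -1) * g) \<in> J" by (intro gidealD(3)[OF assms(1)] gideal_scale assms)
  moreover have "f + (\<lambda>_. -1) * g = f - g" by (simp add: fun_eq_iff)
  ultimately show ?thesis by simp
qed

lemma gideal_sum:
  assumes "gideal J" "\<And>i. i \<in> I \<Longrightarrow> (t, h i) \<in> J" shows "(t, \<Sum>i\<in>I. h i) \<in> J"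
  using assms(2)
proof (induction I rule: infinite_finite_induct)
  case (infinite A)
  then show ?case unfolding sum.infinite[OF infinite(1)] by (intro gidealD(2)[OF assms(1)])
next
  case empty
  then show ?case unfolding sum.empty by (intro gidealD(2)[OF assms(1)])
next
  case (insert x F)
  then show ?case unfolding sum.insert[OF insert(1,2)] by (intro gidealD(3)[OF assms(1)]) auto
qed

lemma gideal_mult2:
  assumes "gideal J" "(t, f) \<in> J" "h \<in> forms s" "u = s + t" shows "(u, h * f) \<in> J"
  using gidealD(4)[OF assms(1-3)] assms(4) by (simp add: mult.commute add.commute)

text \<open>Stated for families rather than sets, so that two equal members already count as a
  dependence.\<close>

lemma dependent_family:
  assumes fin: "finite A" "card (expo t) < card A" and r: "\<And>c. c \<in> A \<Longrightarrow> r c \<in> forms t"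
  shows "\<exists>l. (\<exists>c\<in>A. l c \<noteq> (0::complex)) \<and> (\<Sum>c\<in>A. (\<lambda>_. l c) * r c) = 0"
proof (cases "inj_on r A")
  case True
  have "r ` A \<subseteq> fv.span (mon ` expo t)" using r forms_eq_span by auto
  moreover have "card (r ` A) > card (mon ` expo t)"
    using fin by (simp add: card_image True inj_on_mon)
  ultimately have "fv.dependent (r ` A)"
    using fv.independent_span_bound[of "mon ` expo t" "r ` A"] finite_expo by fastforce
  then obtain u where u: "\<exists>v\<in>r ` A. u v \<noteq> 0" "(\<Sum>v\<in>r ` A. fscale (u v) v) = 0"
    using fv.dependent_finite[of "r ` A"] fin by auto
  have "(\<Sum>c\<in>A. (\<lambda>_. u (r c)) * r c) = (\<Sum>v\<in>r ` A. fscale (u v) v)"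
    by (simp add: sum.reindex[OF True] fun_eq_iff fun_sum_apply)
  with u show ?thesis by (intro exI[of _ "\<lambda>c. u (r c)"]) auto
next
  case False
  then obtain a b where ab: "a \<in> A" "b \<in> A" "a \<noteq> b" "r a = r b" by (auto simp: inj_on_def)
  define l :: "'a \<Rightarrow> complex" where "l = (\<lambda>c. if c = a then 1 else if c = b then -1 else 0)"
  have "(\<Sum>c\<in>A. (\<lambda>_. l c) * r c) = (\<Sum>c\<in>{a,b}. (\<lambda>_. l c) * r c)"
    by (rule sum.mono_neutral_right) (use fin ab in \<open>auto simp: l_def fun_eq_iff\<close>)
  also have "\<dots> = 0" using ab by (simp add: l_def fun_eq_iff)
  finally show ?thesis using ab by (intro exI[of _ l]) (auto simp: l_def)
qed

lemma forms_eq_off_coord: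
  assumes "f \<in> forms t" "g \<in> forms t" "i \<le> 4" "\<And>p. co i p \<noteq> 0 \<Longrightarrow> f p = g p"
  shows "f = g"
proof (rule forms_mult_left_cancel[OF co_in_forms[OF assms(3)] _ assms(1,2)])
  show "co i * f = co i * g" using assms(4) by (auto simp: fun_eq_iff)
  have "Rep_pt (Abs_pt (\<lambda>_. 1)) = (\<lambda>_. 1)" by (intro Abs_pt_inverse) auto
  then have "co i (Abs_pt (\<lambda>_. 1)) = 1" by (simp add: co_def)
  then show "co i \<noteq> 0" by auto
qed

definition homogenize :: "nat \<Rightarrow> nat \<Rightarrow> nat \<Rightarrow> complex poly \<Rightarrow> pt \<Rightarrow> complex" where
  "homogenize i j N A = (\<Sum>d\<le>N. (\<lambda>_. coeff A d) * (co j ^ d * co i ^ (N - d)))"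

lemma fun_power_apply: "(f ^ k) x = f x ^ k" for f :: "'a \<Rightarrow> complex"
  by (induction k) simp_all

lemma fun_prod_apply: "(\<Prod>i\<in>A. f i) x = (\<Prod>i\<in>A. f i x)" for f :: "'b \<Rightarrow> 'a \<Rightarrow> complex"
  by (induction A rule: infinite_finite_induct) auto

lemma homogenize_forms: "i \<le> 4 \<Longrightarrow> j \<le> 4 \<Longrightarrow> homogenize i j N A \<in> forms (int N)"
  unfolding homogenize_def
proof (rule forms_sum)
  fix d assume "i \<le> 4" "j \<le> 4" "d \<in> {..N}"
  then have "(\<lambda>_. coeff A d) * (co j ^ d * co i ^ (N - d)) \<in> forms (0 + (int d * 1 + int (N - d) * 1))"
    by (intro forms_mult forms_const forms_power co_in_forms)
  then show "(\<lambda>_. coeff A d) * (co j ^ d * co i ^ (N - d)) \<in> forms (int N)"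
    using \<open>d \<in> {..N}\<close> by (auto elim: forms_cong_degree)
qed

lemma homogenize_apply:
  assumes "degree A \<le> N" "co i p \<noteq> 0"
  shows "homogenize i j N A p = co i p ^ N * poly A (co j p / co i p)"
proof -
  have "poly A (co j p / co i p) = (\<Sum>d\<le>N. coeff A d * (co j p / co i p) ^ d)"
    unfolding poly_altdef using assms(1) by (intro sum.mono_neutral_left) (auto simp: coeff_eq_0)
  then have "co i p ^ N * poly A (co j p / co i p) = (\<Sum>d\<le>N. coeff A d * (co j p ^ d * co i p ^ (N - d)))"
    using assms(2) by (auto simp: sum_distrib_left power_diff field_simps intro!: sum.cong)
  then show ?thesis by (simp add: homogenize_def fun_sum_apply fun_power_apply)
qed

lemma linear_form: "i \<le> 4 \<Longrightarrow> j \<le> 4 \<Longrightarrow> co j - (\<lambda>_. c) * co i \<in> forms 1"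
proof -
  assume ij: "i \<le> 4" "j \<le> 4"
  have "(\<lambda>_. c) * co i \<in> forms (0 + 1)" by (intro forms_mult forms_const co_in_forms ij)
  then show ?thesis by (intro forms_diff co_in_forms ij) simp
qed

text \<open>In a prime ideal avoiding the powers of \<open>co i\<close> that is maximal with this property, the residue
  field of the localization is \<open>\<complex>\<close>: otherwise the uncountably many inverses of
  \<open>co j / co i - c\<close> would lie in countably many finite-dimensional spaces.\<close>

lemma maximal_ideal_linear:
  assumes P: "gideal P" and i: "i \<le> 4" and j: "j \<le> 4"
    and pow: "\<And>k. (int k, co i ^ k) \<notin> P"
    and mx: "\<And>e h. h \<in> forms e \<Longrightarrow> (e, h) \<notin> P \<Longrightarrow> \<exists>k. \<exists>r\<in>forms (int k - e). (int k, co i ^ k - h * r) \<in> P"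
    and prime: "\<And>s t f g. f \<in> forms s \<Longrightarrow> g \<in> forms t \<Longrightarrow> (s + t, f * g) \<in> P \<Longrightarrow> (s, f) \<in> P \<or> (t, g) \<in> P"
  shows "\<exists>c. (1, co j - (\<lambda>_. c) * co i) \<in> P"
proof (rule ccontr)
  assume none: "\<nexists>c. (1, co j - (\<lambda>_. c) * co i) \<in> P"
  define lin where "lin c = co j - (\<lambda>_. c) * co i" for c :: complex
  have lin1: "lin c \<in> forms 1" for c unfolding lin_def by (rule linear_form[OF i j])
  have linP: "(1, lin c) \<notin> P" for c using none by (simp add: lin_def)
  have "\<exists>k. \<exists>r\<in>forms (int k - 1). (int k, co i ^ k - lin c * r) \<in> P" for c
    by (rule mx[OF lin1 linP])
  then obtain K R where R: "\<And>c. R c \<in> forms (int (K c) - 1)"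
    and KR: "\<And>c. (int (K c), co i ^ K c - lin c * R c) \<in> P" by metis
  \<comment> \<open>Uncountably many reals are sorted by countably many exponents, so infinitely
    many share one exponent \<open>k\<close>.\<close>
  have "\<exists>k. infinite {c::real. K (of_real c) = k}"
  proof (rule ccontr)
    assume "\<not> ?thesis"
    then have "countable (\<Union>k. {c::real. K (of_real c) = k})"
      by (intro countable_UN) (auto intro: countable_finite)
    moreover have "(\<Union>k. {c::real. K (of_real c) = k}) = UNIV" by auto
    ultimately show False using uncountable_UNIV_real by simp
  qed
  then obtain k where k: "infinite {c::real. K (of_real c) = k}" by blast
  \<comment> \<open>One more point than the dimension of the space of forms containing all
    \<open>R c\<close>, which forces a linear relation \<open>l\<close> among them.\<close>
  obtain C' where C': "C' \<subseteq> {c::real. K (of_real c) = k}" "finite C'" "card C' = Suc (card (expo (int k - 1)))"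
    using infinite_arbitrarily_large[OF k] by blast
  define A :: "complex set" where "A = of_real ` C'"
  have A: "finite A" "card A = Suc (card (expo (int k - 1)))" "\<And>c. c \<in> A \<Longrightarrow> K c = k"
    using C' by (auto simp: A_def card_image inj_on_def)
  obtain l where l: "\<exists>c\<in>A. l c \<noteq> (0::complex)" "(\<Sum>c\<in>A. (\<lambda>_. l c) * R c) = 0"
    using dependent_family[OF A(1), of "int k - 1" R] A R by (metis lessI)
  define N where "N = card A - 1"
  have NA: "card A = Suc N" using A(2) by (simp add: N_def)
  define Pr where "Pr c = (\<Prod>c'\<in>A - {c}. lin c')" for c
  have card1: "card (A - {c}) = N" if "c \<in> A" for c using that NA A(1) by simp
  have Pr: "Pr c \<in> forms (int N)" if c: "c \<in> A" for c
  proof -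
    have "Pr c \<in> forms (\<Sum>c'\<in>A - {c}. 1)" unfolding Pr_def by (rule forms_prod) (use A lin1 in auto)
    then show ?thesis by (simp add: card1[OF c])
  qed
  define all where "all = (\<Prod>c'\<in>A. lin c')"
  have all: "all = lin c * Pr c" if "c \<in> A" for c
    unfolding all_def Pr_def using that A(1) by (rule prod.remove[rotated])
  \<comment> \<open>The numerator of the sum of \<open>l c / lin c\<close> over the common
    denominator \<open>all\<close>. Modulo \<open>P\<close> the form \<open>R c\<close> plays the
    part of \<open>co i ^ k / lin c\<close>, so the relation among the \<open>R c\<close> puts
    \<open>co i ^ k * Psi\<close> into \<open>P\<close>.\<close>
  define Psi where "Psi = (\<Sum>c\<in>A. (\<lambda>_. l c) * Pr c)"
  have "(int k + int N, \<Sum>c\<in>A. (\<lambda>_. l c) * ((co i ^ k - lin c * R c) * Pr c)) \<in> P"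
  proof (rule gideal_sum[OF P])
    fix c assume c: "c \<in> A"
    show "(int k + int N, (\<lambda>_. l c) * ((co i ^ k - lin c * R c) * Pr c)) \<in> P"
      by (intro gideal_scale gidealD(4)[OF P] P Pr c) (use KR[of c] A(3)[OF c] in simp)
  qed
  moreover have "(\<Sum>c\<in>A. (\<lambda>_. l c) * ((co i ^ k - lin c * R c) * Pr c)) = co i ^ k * Psi"
  proof -
    have "(\<lambda>_. l c) * ((co i ^ k - lin c * R c) * Pr c) = co i ^ k * ((\<lambda>_. l c) * Pr c) - all * ((\<lambda>_. l c) * R c)"
      if "c \<in> A" for c unfolding all[OF that] by (simp add: algebra_simps)
    then have "(\<Sum>c\<in>A. (\<lambda>_. l c) * ((co i ^ k - lin c * R c) * Pr c)) =
      (\<Sum>c\<in>A. co i ^ k * ((\<lambda>_. l c) * Pr c) - all * ((\<lambda>_. l c) * R c))" by (rule sum.cong[OF refl])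
    also have "\<dots> = co i ^ k * Psi - all * (\<Sum>c\<in>A. (\<lambda>_. l c) * R c)"
      by (simp only: sum_subtractf sum_distrib_left Psi_def)
    also have "\<dots> = co i ^ k * Psi" unfolding l(2) by simp
    finally show ?thesis .
  qed
  ultimately have 1: "(int k + int N, co i ^ k * Psi) \<in> P" by simp
  have Psi: "Psi \<in> forms (int N)"
    unfolding Psi_def
  proof (rule forms_sum)
    fix c assume "c \<in> A"
    then have "(\<lambda>_. l c) * Pr c \<in> forms (0 + int N)" by (intro forms_mult forms_const Pr)
    then show "(\<lambda>_. l c) * Pr c \<in> forms (int N)" by simp
  qed
  have "co i ^ k \<in> forms (int k)" using forms_power[OF co_in_forms[OF i], of k] by simp
  from prime[OF this Psi 1] pow have PsiP: "(int N, Psi) \<in> P" by blast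
  \<comment> \<open>\<open>Psi\<close> dehomogenized. At a point \<open>c0\<close> with
    \<open>l c0\<close> nonzero only one summand survives, hence \<open>Q\<close> is not
    zero.\<close>
  define Q where "Q = (\<Sum>c\<in>A. smult (l c) (\<Prod>c'\<in>A - {c}. [:-c', 1:]))"
  have degQ: "degree Q \<le> N" unfolding Q_def
  proof (rule degree_sum_le[OF A(1)])
    fix c assume c: "c \<in> A"
    have "degree (smult (l c) (\<Prod>c'\<in>A - {c}. [:-c', 1:])) \<le> degree (\<Prod>c'\<in>A - {c}. [:-c', 1:])"
      by (rule degree_smult_le)
    also have "\<dots> \<le> (\<Sum>c'\<in>A - {c}. degree [:-c', 1:])"
      using degree_prod_sum_le[of "A - {c}" "\<lambda>c'. [:-c', 1:]"] A(1) by (simp add: o_def)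
    also have "\<dots> = N" by (simp add: card1[OF c])
    finally show "degree (smult (l c) (\<Prod>c'\<in>A - {c}. [:-c', 1:])) \<le> N" .
  qed
  have Q0: "Q \<noteq> 0"
  proof -
    obtain c0 where c0: "c0 \<in> A" "l c0 \<noteq> 0" using l by blast
    have "poly Q c0 = (\<Sum>c\<in>A. l c * (\<Prod>c'\<in>A - {c}. c0 - c'))"
      by (simp add: Q_def poly_sum poly_prod)
    also have "\<dots> = (\<Sum>c\<in>{c0}. l c * (\<Prod>c'\<in>A - {c}. c0 - c'))"
      by (rule sum.mono_neutral_right) (use A(1) c0 in auto)
    finally have "poly Q c0 \<noteq> 0" using A(1) c0 by auto
    then show ?thesis by auto
  qed
  have "homogenize i j N Q = Psi"
  proof (rule forms_eq_off_coord[OF homogenize_forms[OF i j] Psi i])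
    fix p assume p: "co i p \<noteq> 0"
    have "co i p ^ N * (l c * (\<Prod>c'\<in>A - {c}. co j p / co i p - c')) = l c * (\<Prod>c'\<in>A - {c}. co j p - c' * co i p)"
      if c: "c \<in> A" for c
    proof -
      have "co i p ^ N * (\<Prod>c'\<in>A - {c}. co j p / co i p - c') = (\<Prod>c'\<in>A - {c}. co i p * (co j p / co i p - c'))"
        by (simp only: prod.distrib prod_constant card1[OF c])
      also have "\<dots> = (\<Prod>c'\<in>A - {c}. co j p - c' * co i p)"
        by (rule prod.cong) (use p in \<open>auto simp: field_simps\<close>)
      finally show ?thesis by (simp add: mult.left_commute)
    qed
    note eq = this
    have "homogenize i j N Q p = (\<Sum>c\<in>A. co i p ^ N * (l c * (\<Prod>c'\<in>A - {c}. co j p / co i p - c')))"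
      unfolding homogenize_apply[OF degQ p] by (simp add: Q_def poly_sum poly_prod sum_distrib_left)
    also have "\<dots> = (\<Sum>c\<in>A. l c * (\<Prod>c'\<in>A - {c}. co j p - c' * co i p))"
      by (rule sum.cong[OF refl eq])
    also have "\<dots> = Psi p" by (simp add: Psi_def fun_sum_apply Pr_def fun_prod_apply lin_def)
    finally show "homogenize i j N Q p = Psi p" .
  qed
  then have QP: "(int N, homogenize i j N Q) \<in> P" using PsiP by simp
  \<comment> \<open>Over the complex numbers the homogenized \<open>Q\<close> is, up to a nonzero
    constant, a product of linear forms \<open>lin z\<close> and a power of \<open>co i\<close>.
    None of these factors lies in the prime ideal \<open>P\<close>.\<close>
  have "\<not> (int N, homogenize i j N Q) \<in> P"
    using Q0 degQ
  proof (induction N arbitrary: Q)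
    case 0
    have "homogenize i j 0 Q = (\<lambda>_. coeff Q 0)" by (simp add: homogenize_def fun_eq_iff)
    moreover have "coeff Q 0 \<noteq> 0" using 0 leading_coeff_0_iff[of Q] by simp
    ultimately show ?case
    proof (intro notI)
      assume a: "(int 0, homogenize i j 0 Q) \<in> P" "homogenize i j 0 Q = (\<lambda>_. coeff Q 0)" "coeff Q 0 \<noteq> 0"
      have "(int 0, (\<lambda>_. inverse (coeff Q 0)) * homogenize i j 0 Q) \<in> P" by (rule gideal_scale[OF P a(1)])
      moreover have "(\<lambda>_. inverse (coeff Q 0)) * homogenize i j 0 Q = co i ^ 0"
        using a by (simp add: fun_eq_iff)
      ultimately show False using pow[of 0] by simp
    qed
  next
    case (Suc N)
    show ?case
    proof (cases "degree Q \<le> N")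
      case True
      have "homogenize i j (Suc N) Q = co i * homogenize i j N Q"
      proof (rule forms_eq_off_coord[OF homogenize_forms[OF i j] _ i])
        show "co i * homogenize i j N Q \<in> forms (int (Suc N))"
          using forms_mult[OF co_in_forms[OF i] homogenize_forms[OF i j]] by simp
        fix p assume "co i p \<noteq> 0"
        then show "homogenize i j (Suc N) Q p = (co i * homogenize i j N Q) p"
          using True Suc.prems by (simp add: homogenize_apply)
      qed
      moreover have "1 + int N = int (Suc N)" "(1, co i) \<notin> P" using pow[of 1] by simp_all
      ultimately show ?thesis
        using prime[OF co_in_forms[OF i] homogenize_forms[OF i j], of N Q] Suc.IH[OF Suc.prems(1) True]
        by metis
    next
      case False
      then have "degree Q \<noteq> 0" by simp
      then have "\<exists>z. poly Q z = 0"
        using fundamental_theorem_of_algebra[of Q] by (simp add: constant_degree)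
      then obtain z where "poly Q z = 0" by blast
      then obtain B where B: "Q = [:- z, 1:] * B" by (auto simp: poly_eq_0_iff_dvd elim: dvdE)
      have B0: "B \<noteq> 0" using B Suc.prems by auto
      have "degree Q = 1 + degree B"
        unfolding B using B0 by (subst degree_mult_eq) auto
      then have dB: "degree B \<le> N" using Suc.prems by simp
      have "homogenize i j (Suc N) Q = lin z * homogenize i j N B"
      proof (rule forms_eq_off_coord[OF homogenize_forms[OF i j] _ i])
        show "lin z * homogenize i j N B \<in> forms (int (Suc N))"
          using forms_mult[OF lin1 homogenize_forms[OF i j]] by simp
        fix p assume "co i p \<noteq> 0"
        then show "homogenize i j (Suc N) Q p = (lin z * homogenize i j N B) p"
          using dB Suc.prems by (simp add: homogenize_apply B lin_def field_simps)
      qed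
      moreover have "1 + int N = int (Suc N)" by simp
      moreover have "(1 + int N, lin z * homogenize i j N B) \<in> P \<Longrightarrow>
          (1, lin z) \<in> P \<or> (int N, homogenize i j N B) \<in> P"
        by (rule prime[OF lin1 homogenize_forms[OF i j]])
      ultimately show ?thesis
        using Suc.IH[OF B0 dB] linP[of z]
        by metis
    qed
  qed
  with QP show False by blast
qed

text \<open>Otherwise a homogeneous ideal containing \<open>J\<close> and maximal among those
  without powers of \<open>co i\<close> is prime, and it contains the linear forms cutting out one
  point \<open>x\<close>. Modulo it every form equals its value at \<open>x\<close> times a power of
  \<open>co i\<close>, so no member of \<open>J\<close> can be nonzero at \<open>x\<close>.\<close>

lemma power_coord_in_gideal:
  assumes J: "gideal J" and i: "i \<le> 4" and nz: "\<And>x. \<exists>t f. (t, f) \<in> J \<and> f x \<noteq> 0"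
  shows "\<exists>k. (int k, co i ^ k) \<in> J"
proof (rule ccontr)
  assume none: "\<nexists>k. (int k, co i ^ k) \<in> J"
  define \<A> where "\<A> = {P. gideal P \<and> J \<subseteq> P \<and> (\<forall>k. (int k, co i ^ k) \<notin> P)}"
  have "\<exists>M\<in>\<A>. \<forall>X\<in>\<A>. M \<subseteq> X \<longrightarrow> X = M"
  proof (rule subset_Zorn_nonempty)
    show "\<A> \<noteq> {}" using J none by (auto simp: \<A>_def)
    fix \<C> assume C: "\<C> \<noteq> {}" "subset.chain \<A> \<C>"
    then have CA: "\<C> \<subseteq> \<A>" and tot: "\<And>X Y. X \<in> \<C> \<Longrightarrow> Y \<in> \<C> \<Longrightarrow> X \<subseteq> Y \<or> Y \<subseteq> X"
      by (auto simp: subset_chain_def)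
    have G: "gideal X" if "X \<in> \<C>" for X using that CA by (auto simp: \<A>_def)
    have "gideal (\<Union>\<C>)" unfolding gideal_def
    proof (intro conjI allI impI)
      show "f \<in> forms t" if "(t, f) \<in> \<Union>\<C>" for t f using that gidealD(1)[OF G] by blast
      show "(t, 0) \<in> \<Union>\<C>" for t using C(1) gidealD(2)[OF G] by blast
      show "(t + s, f * h) \<in> \<Union>\<C>" if "(t, f) \<in> \<Union>\<C>" "h \<in> forms s" for t f s h
        using that gidealD(4)[OF G] by blast
      show "(t, f + g) \<in> \<Union>\<C>" if fg: "(t, f) \<in> \<Union>\<C>" "(t, g) \<in> \<Union>\<C>" for t f g
      proof -
        obtain X Y where XY: "X \<in> \<C>" "Y \<in> \<C>" "(t, f) \<in> X" "(t, g) \<in> Y" using fg by blast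
        with tot[of X Y] consider "(t, g) \<in> X" | "(t, f) \<in> Y" by blast
        then show ?thesis
        proof cases
          case 1 then show ?thesis using gidealD(3)[OF G] XY by blast
        next
          case 2 then show ?thesis using gidealD(3)[OF G] XY by blast
        qed
      qed
    qed
    then show "\<Union>\<C> \<in> \<A>" using CA C(1) by (auto simp: \<A>_def)
  qed
  then obtain P where "P \<in> \<A>" and max: "\<And>X. X \<in> \<A> \<Longrightarrow> P \<subseteq> X \<Longrightarrow> X = P" by blast
  then have P: "gideal P" and JP: "J \<subseteq> P" and pow: "\<And>k. (int k, co i ^ k) \<notin> P" by (auto simp: \<A>_def)
  have mx: "\<exists>k. \<exists>r\<in>forms (int k - e). (int k, co i ^ k - h * r) \<in> P"
    if h: "h \<in> forms e" "(e, h) \<notin> P" for e h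
  proof -
    \<comment> \<open>The homogeneous ideal generated by \<open>P\<close> and
      \<open>h\<close>.\<close>
    define X where "X = {(t, f). \<exists>r\<in>forms (t - e). (t, f - h * r) \<in> P}"
    have "gideal X" unfolding gideal_def X_def
    proof (intro conjI allI impI; clarsimp)
      fix t f r assume "r \<in> forms (t - e)" "(t, f - h * r) \<in> P"
      then have "(f - h * r) + h * r \<in> forms t"
        using forms_mult[OF h(1), of r "t - e"] gidealD(1)[OF P] by (intro forms_add) auto
      then show "f \<in> forms t" by simp
    next
      fix t show "\<exists>r\<in>forms (t - e). (t, - (h * r)) \<in> P"
        by (rule bexI[OF _ forms_0]) (use gidealD(2)[OF P] in simp)
    next
      fix t f g r r' assume a: "r \<in> forms (t - e)" "(t, f - h * r) \<in> P" "r' \<in> forms (t - e)" "(t, g - h * r') \<in> P"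
      have "(t, (f - h * r) + (g - h * r')) \<in> P" by (rule gidealD(3)[OF P a(2,4)])
      then have "(t, f + g - h * (r + r')) \<in> P" by (simp add: algebra_simps)
      then show "\<exists>r\<in>forms (t - e). (t, f + g - h * r) \<in> P" using forms_add[OF a(1,3)] by blast
    next
      fix t f s g r assume a: "g \<in> forms s" "r \<in> forms (t - e)" "(t, f - h * r) \<in> P"
      have "(t + s, (f - h * r) * g) \<in> P" by (rule gidealD(4)[OF P a(3,1)])
      then have "(t + s, f * g - h * (r * g)) \<in> P" by (simp add: algebra_simps)
      moreover have "r * g \<in> forms (t + s - e)" using forms_mult[OF a(2,1)] by (simp add: algebra_simps)
      ultimately show "\<exists>r\<in>forms (t + s - e). (t + s, f * g - h * r) \<in> P" by blast
    qed
    moreover have "P \<subseteq> X"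
    proof (clarsimp simp: X_def)
      fix t f assume "(t, f) \<in> P"
      then show "\<exists>r\<in>forms (t - e). (t, f - h * r) \<in> P"
        by (intro bexI[OF _ forms_0]) simp
    qed
    moreover have "(e, h) \<in> X"
      unfolding X_def using gidealD(2)[OF P] forms_1 by (auto intro!: bexI[of _ 1])
    ultimately have "X \<notin> \<A>" using max h(2) by blast
    then obtain k where "(int k, co i ^ k) \<in> X"
      using \<open>gideal X\<close> \<open>P \<subseteq> X\<close> JP by (auto simp: \<A>_def)
    then show ?thesis by (auto simp: X_def)
  qed
  have prime: "(s, f) \<in> P \<or> (t, g) \<in> P" if fg: "f \<in> forms s" "g \<in> forms t" "(s + t, f * g) \<in> P" for s t f g
  proof (rule ccontr)
    assume "\<not> ((s, f) \<in> P \<or> (t, g) \<in> P)"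
    then obtain k r l r' where k: "r \<in> forms (int k - s)" "(int k, co i ^ k - f * r) \<in> P"
      and l: "r' \<in> forms (int l - t)" "(int l, co i ^ l - g * r') \<in> P" using mx fg by meson
    have ck: "co i ^ k \<in> forms (int k)" using forms_power[OF co_in_forms[OF i], of k] by simp
    have "(int l + int k, (co i ^ l - g * r') * co i ^ k) \<in> P"
      by (rule gidealD(4)[OF P l(2) ck])
    moreover have "(int k + (t + (int l - t)), (co i ^ k - f * r) * (g * r')) \<in> P"
      by (intro gidealD(4)[OF P k(2)] forms_mult fg l)
    moreover have "(s + t + (int k - s + (int l - t)), (f * g) * (r * r')) \<in> P"
      by (intro gidealD(4)[OF P fg(3)] forms_mult k l)
    ultimately have "(int (k + l), (co i ^ l - g * r') * co i ^ k + (co i ^ k - f * r) * (g * r') + (f * g) * (r * r')) \<in> P"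
      by (intro gidealD(3)[OF P]) (simp_all add: algebra_simps)
    moreover have "(co i ^ l - g * r') * co i ^ k + (co i ^ k - f * r) * (g * r') + (f * g) * (r * r') = co i ^ (k + l)"
      by (simp add: algebra_simps power_add)
    ultimately show False using pow by metis
  qed
  have "\<forall>j. \<exists>c. j \<le> 4 \<longrightarrow> (1, co j - (\<lambda>_. c) * co i) \<in> P"
    using maximal_ideal_linear[OF P i _ pow mx prime] by blast
  then obtain c0 where c0: "\<And>j. j \<le> 4 \<Longrightarrow> (1, co j - (\<lambda>_. c0 j) * co i) \<in> P" by metis
  \<comment> \<open>The common zero of these linear forms, normalized to have coordinate
    \<open>i\<close> equal to 1.\<close>
  define c where "c = c0(i := 1)"
  have c: "(1, co j - (\<lambda>_. c j) * co i) \<in> P" if "j \<le> 4" for j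
  proof (cases "j = i")
    case True
    have "co j - (\<lambda>_. c j) * co i = 0" by (simp add: True c_def fun_eq_iff)
    then show ?thesis using gidealD(2)[OF P] by simp
  qed (use c0[OF that] in \<open>simp add: c_def\<close>)
  define x where "x = Abs_pt c"
  have x: "Rep_pt x = c" unfolding x_def using i by (intro Abs_pt_inverse) (auto simp: c_def)
  \<comment> \<open>Congruence of \<open>f\<close> modulo \<open>P\<close> to its value at
    \<open>x\<close> times \<open>co i ^ d\<close>. It is compatible with products, so for monomials
    it need only be checked on coordinates.\<close>
  define good where "good d f \<longleftrightarrow> f \<in> forms (int d) \<and> (int d, f - (\<lambda>_. f x) * co i ^ d) \<in> P" for d f
  have cd: "co i ^ d \<in> forms (int d)" for d using forms_power[OF co_in_forms[OF i], of d] by simp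
  have gmult: "good (d + e) (f * g)" if fg: "good d f" "good e g" for d e f g
  proof -
    have "(int d + int e, (f - (\<lambda>_. f x) * co i ^ d) * g) \<in> P"
      using fg by (intro gidealD(4)[OF P]) (auto simp: good_def)
    moreover have "(int d + int e, ((\<lambda>_. f x) * co i ^ d) * (g - (\<lambda>_. g x) * co i ^ e)) \<in> P"
    proof (rule gideal_mult2[OF P])
      show "(int e, g - (\<lambda>_. g x) * co i ^ e) \<in> P" using fg by (simp add: good_def)
      show "(\<lambda>_. f x) * co i ^ d \<in> forms (0 + int d)" by (intro forms_mult forms_const cd)
    qed simp
    ultimately have "(int d + int e, (f - (\<lambda>_. f x) * co i ^ d) * g + ((\<lambda>_. f x) * co i ^ d) * (g - (\<lambda>_. g x) * co i ^ e)) \<in> P"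
      by (rule gidealD(3)[OF P])
    moreover have "(f - (\<lambda>_. f x) * co i ^ d) * g + ((\<lambda>_. f x) * co i ^ d) * (g - (\<lambda>_. g x) * co i ^ e)
       = f * g - (\<lambda>_. (f * g) x) * co i ^ (d + e)"
      by (simp add: fun_eq_iff fun_power_apply algebra_simps power_add)
    moreover have "f * g \<in> forms (int d + int e)" using fg by (intro forms_mult) (auto simp: good_def)
    ultimately show ?thesis by (simp add: good_def)
  qed
  have g1: "good 0 1" using gidealD(2)[OF P] forms_1 by (simp add: good_def one_fun_def[symmetric])
  have gco: "good 1 (co j)" if "j \<le> 4" for j
    using c[OF that] co_in_forms[OF that] by (simp add: good_def co_def[of j x] x)
  have gpow: "good e (co j ^ e)" if "j \<le> 4" for j e
  proof (induction e)
    case 0 then show ?case using g1 by (simp only: power_0)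
  next
    case (Suc e)
    from gmult[OF gco[OF that] this] show ?case by (simp only: power_Suc plus_1_eq_Suc)
  qed
  have gprod: "finite I \<Longrightarrow> I \<subseteq> {..4} \<Longrightarrow> good (\<Sum>j\<in>I. m j) (\<Prod>j\<in>I. co j ^ m j)" for m I
  proof (induction I rule: finite_induct)
    case empty then show ?case using g1 by (simp only: sum.empty prod.empty)
  next
    case (insert j I)
    have "good (m j + (\<Sum>j\<in>I. m j)) (co j ^ m j * (\<Prod>j\<in>I. co j ^ m j))"
      using insert by (intro gmult gpow) auto
    then show ?case by (simp only: sum.insert[OF insert(1,2)] prod.insert[OF insert(1,2)])
  qed
  have gmon: "(t, mon m - (\<lambda>_. mon m x) * co i ^ nat t) \<in> P" if m: "m \<in> expo t" for m t
  proof -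
    have "mon m = (\<Prod>j\<le>4. co j ^ m j)"
      by (simp add: fun_eq_iff fun_prod_apply fun_power_apply mon_def rmon_def co_def)
    then have "good (nat t) (mon m)" using gprod[of "{..4}" m] m by (simp add: expo_def)
    then show ?thesis using m by (simp add: good_def expo_def)
  qed
  have gform: "(t, f - (\<lambda>_. f x) * co i ^ nat t) \<in> P" if f: "f \<in> forms t" for f t
  proof -
    obtain a where a: "f = (\<lambda>p. \<Sum>m\<in>expo t. a m * mon m p)" using f by (auto simp: forms_def)
    have "(t, \<Sum>m\<in>expo t. (\<lambda>_. a m) * (mon m - (\<lambda>_. mon m x) * co i ^ nat t)) \<in> P"
      by (intro gideal_sum[OF P] gideal_scale[OF P] gmon)
    moreover have "(\<Sum>m\<in>expo t. (\<lambda>_. a m) * (mon m - (\<lambda>_. mon m x) * co i ^ nat t)) = f - (\<lambda>_. f x) * co i ^ nat t"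
      by (simp add: a fun_eq_iff fun_sum_apply algebra_simps sum_subtractf sum_distrib_left sum_distrib_right)
    ultimately show ?thesis by simp
  qed
  obtain t f where f: "(t, f) \<in> J" "f x \<noteq> 0" using nz by blast
  have ft: "f \<in> forms t" using gidealD(1)[OF J f(1)] .
  then have t0: "0 \<le> t" using forms_degree f(2) by blast
  have "(t, f - (f - (\<lambda>_. f x) * co i ^ nat t)) \<in> P"
    using f(1) JP by (intro gideal_diff[OF P] gform[OF ft]) blast
  then have "(t, (\<lambda>_. inverse (f x)) * (f - (f - (\<lambda>_. f x) * co i ^ nat t))) \<in> P" by (rule gideal_scale[OF P])
  moreover have "(\<lambda>_. inverse (f x)) * (f - (f - (\<lambda>_. f x) * co i ^ nat t)) = co i ^ nat t"
    using f(2) by (simp add: fun_eq_iff)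
  ultimately show False using pow[of "nat t"] t0 by simp
qed

text \<open>By pigeonhole, every monomial whose degree is the sum of the \<open>K i\<close> is
  divisible by one of the powers \<open>co i ^ K i\<close>.\<close>

theorem projective_nullstellensatz:
  assumes J: "gideal J" and nz: "\<And>x. \<exists>t f. (t, f) \<in> J \<and> f x \<noteq> 0"
  shows "\<exists>N\<ge>0. \<forall>f\<in>forms N. (N, f) \<in> J"
proof -
  have "\<forall>i. \<exists>k. i \<le> 4 \<longrightarrow> (int k, co i ^ k) \<in> J" using power_coord_in_gideal[OF J _ nz] by blast
  then obtain K where K: "\<And>i. i \<le> 4 \<Longrightarrow> (int (K i), co i ^ K i) \<in> J" by metis
  define N where "N = (\<Sum>i\<le>4. K i)"
  have mon: "(int N, mon m) \<in> J" if m: "m \<in> expo (int N)" for m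
  proof -
    have "\<exists>i\<le>4. K i \<le> m i"
    proof (rule ccontr)
      assume "\<not> ?thesis"
      then have "m i < K i" if "i \<le> 4" for i using that by force
      then have "(\<Sum>i\<le>4. m i) < (\<Sum>i\<le>4. K i)" by (intro sum_strict_mono) auto
      then show False using m by (simp add: expo_def N_def del: of_nat_sum)
    qed
    then obtain i where i: "i \<le> 4" "K i \<le> m i" by blast
    define m' where "m' = m(i := m i - K i)"
    have "(\<Sum>k\<le>4. m k) = (\<Sum>k\<le>4. m' k + (if k = i then K i else 0))"
      using i by (intro sum.cong) (auto simp: m'_def)
    also have "\<dots> = (\<Sum>k\<le>4. m' k) + K i" using i by (simp add: sum.distrib)
    finally have "N = (\<Sum>k\<le>4. m' k) + K i" using m by (simp add: expo_def)
    then have m': "m' \<in> expo (int N - int (K i))" using m i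
      by (simp add: expo_def del: of_nat_sum) (simp add: m'_def)
    have "mon m = co i ^ K i * mon m'"
    proof
      fix p
      have "mon m p = (\<Prod>k\<le>4. Rep_pt p k ^ m' k * (if k = i then Rep_pt p i ^ K i else 1))"
        unfolding mon_def rmon_def using i by (intro prod.cong) (auto simp: m'_def power_add[symmetric])
      also have "\<dots> = mon m' p * co i p ^ K i"
        using i by (simp add: prod.distrib mon_def rmon_def co_def)
      finally show "mon m p = (co i ^ K i * mon m') p" by (simp add: fun_power_apply)
    qed
    then show ?thesis using gidealD(4)[OF J K[OF i(1)] mon_in_forms[OF m']] by simp
  qed
  have "(int N, f) \<in> J" if f: "f \<in> forms (int N)" for f
  proof -
    obtain a where a: "f = (\<lambda>p. \<Sum>m\<in>expo (int N). a m * mon m p)" using f by (auto simp: forms_def)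
    have "(int N, \<Sum>m\<in>expo (int N). (\<lambda>_. a m) * mon m) \<in> J"
      by (intro gideal_sum[OF J] gideal_scale[OF J] mon)
    moreover have "(\<Sum>m\<in>expo (int N). (\<lambda>_. a m) * mon m) = f" by (simp add: a fun_eq_iff fun_sum_apply)
    ultimately show ?thesis by simp
  qed
  then show ?thesis by (intro exI[of _ "int N"]) auto
qed

section \<open>Graded modules\<close>

definition sscale :: "complex \<Rightarrow> ('r \<Rightarrow> pt \<Rightarrow> complex) \<Rightarrow> 'r \<Rightarrow> pt \<Rightarrow> complex" where
  "sscale c f = (\<lambda>r p. c * f r p)"

lemma sscale_apply [simp]: "sscale c f r p = c * f r p"
  by (simp add: sscale_def)

interpretation sv: vector_space "sscale :: complex \<Rightarrow> ('r \<Rightarrow> pt \<Rightarrow> complex) \<Rightarrow> 'r \<Rightarrow> pt \<Rightarrow> complex"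
  by unfold_locales (auto simp: fun_eq_iff algebra_simps)

text \<open>Rank and nullity on a finite-dimensional subspace \<open>V\<close> of an
  infinite-dimensional function space.\<close>

lemma sv_dim_split:
  fixes T :: "('r \<Rightarrow> pt \<Rightarrow> complex) \<Rightarrow> ('s \<Rightarrow> pt \<Rightarrow> complex)"
  assumes V: "sv.subspace V" "V \<subseteq> sv.span S" "finite S"
    and add: "\<And>f g. T (f + g) = T f + T g" and scale: "\<And>c f. T (sscale c f) = sscale c (T f)"
  shows "sv.dim V = sv.dim {f\<in>V. T f = 0} + sv.dim (T ` V)"
proof -
  have T0: "T 0 = 0" using scale[of 0 0] by simp
  have Tsum: "T (\<Sum>b\<in>A. sscale (u b) b) = (\<Sum>b\<in>A. sscale (u b) (T b))" for A u
  proof (induction A rule: infinite_finite_induct)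
    case (insert x F)
    then show ?case by (simp only: sum.insert[OF insert(1,2)] add scale)
  qed (simp_all only: sum.infinite sum.empty T0 not_False_eq_True)
  define Ker where "Ker = {f\<in>V. T f = 0}"
  obtain K where K: "K \<subseteq> Ker" "sv.independent K" "Ker \<subseteq> sv.span K" "card K = sv.dim Ker"
    using sv.basis_exists[of Ker] by blast
  have "K \<subseteq> V" using K(1) by (auto simp: Ker_def)
  then obtain B where B: "K \<subseteq> B" "B \<subseteq> V" "sv.independent B" "V \<subseteq> sv.span B"
    using sv.maximal_independent_subset_extend[OF _ K(2), of V] by blast
  have finB: "finite B" using sv.independent_span_bound[OF V(3) B(3)] B(2) V(2) by blast
  have finK: "finite K" using finB B(1) finite_subset by blast
  have dimV: "card B = sv.dim V" by (rule sv.basis_card_eq_dim[OF B(2,4,3)])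
  have VB: "v \<in> V" if "v = (\<Sum>b\<in>A. sscale (u b) b)" "A \<subseteq> B" for v A u
    unfolding that(1) using that(2) B(2) by (intro sv.subspace_sum[OF V(1)] sv.subspace_scale[OF V(1)]) auto
  have indep: "u b = 0" if u: "T (\<Sum>b\<in>B - K. sscale (u b) b) = 0" "b \<in> B - K" for u b
  proof -
    have "(\<Sum>b\<in>B - K. sscale (u b) b) \<in> Ker" using u(1) VB[OF refl, of "B - K" u] by (auto simp: Ker_def)
    then have "(\<Sum>b\<in>B - K. sscale (u b) b) \<in> sv.span K" using K(3) by blast
    then obtain c where c: "(\<Sum>b\<in>B - K. sscale (u b) b) = (\<Sum>b\<in>K. sscale (c b) b)"
      unfolding sv.span_finite[OF finK] by blast
    define d where "d b = (if b \<in> K then - c b else u b)" for b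
    have "(\<Sum>b\<in>B. sscale (d b) b) = (\<Sum>b\<in>B - K. sscale (d b) b) + (\<Sum>b\<in>K. sscale (d b) b)"
      by (rule sum.subset_diff[OF B(1) finB])
    also have "(\<Sum>b\<in>B - K. sscale (d b) b) = (\<Sum>b\<in>B - K. sscale (u b) b)"
      by (rule sum.cong) (auto simp: d_def)
    also have "(\<Sum>b\<in>K. sscale (d b) b) = - (\<Sum>b\<in>K. sscale (c b) b)"
      unfolding sum_negf[symmetric] by (rule sum.cong) (auto simp: d_def fun_eq_iff)
    finally have "(\<Sum>b\<in>B. sscale (d b) b) = 0" by (simp only: c add.right_inverse)
    from sv.independentD[OF B(3) finB subset_refl this, of b] u(2) show ?thesis by (simp add: d_def)
  qed
  have inj: "inj_on T (B - K)"
  proof (rule inj_onI, rule ccontr)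
    fix a b assume ab: "a \<in> B - K" "b \<in> B - K" "T a = T b" "a \<noteq> b"
    define u where "u x = (if x = a then 1 else if x = b then -1 else 0 :: complex)" for x
    have "(\<Sum>x\<in>B - K. sscale (u x) x) = (\<Sum>x\<in>{a, b}. sscale (u x) x)"
      by (rule sum.mono_neutral_right) (use finB ab in \<open>auto simp: u_def fun_eq_iff\<close>)
    also have "\<dots> = sscale 1 a + sscale (-1) b" using ab by (simp add: u_def)
    finally have "T (\<Sum>x\<in>B - K. sscale (u x) x) = sscale 1 (T a) + sscale (-1) (T b)"
      by (simp only: add scale)
    also have "\<dots> = 0" using ab by (simp add: fun_eq_iff)
    finally have "u a = 0" using indep ab by blast
    then show False by (simp add: u_def)
  qed
  have ind: "sv.independent (T ` (B - K))"
  proof (rule sv.independent_if_scalars_zero)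
    show "finite (T ` (B - K))" using finB by simp
    fix f :: "('s \<Rightarrow> pt \<Rightarrow> complex) \<Rightarrow> complex" and x
    assume z: "(\<Sum>x\<in>T ` (B - K). sscale (f x) x) = 0" and x: "x \<in> T ` (B - K)"
    then have "T (\<Sum>b\<in>B - K. sscale (f (T b)) b) = 0"
      unfolding Tsum by (simp only: sum.reindex[OF inj] o_def)
    with x indep[of "\<lambda>b. f (T b)"] show "f x = 0" by auto
  qed
  have "T ` V \<subseteq> sv.span (T ` (B - K))"
  proof clarify
    fix v assume "v \<in> V"
    then obtain c where c: "v = (\<Sum>b\<in>B. sscale (c b) b)" using B(4) unfolding sv.span_finite[OF finB] by blast
    have "T v = (\<Sum>b\<in>B. sscale (c b) (T b))" unfolding c Tsum ..
    also have "\<dots> = (\<Sum>b\<in>B - K. sscale (c b) (T b))"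
      by (rule sum.mono_neutral_right) (use finB K(1) in \<open>auto simp: Ker_def\<close>)
    also have "\<dots> \<in> sv.span (T ` (B - K))"
      by (intro sv.span_sum sv.span_scale sv.span_base) auto
    finally show "T v \<in> sv.span (T ` (B - K))" .
  qed
  moreover have "T ` (B - K) \<subseteq> T ` V" using B(2) by blast
  ultimately have "card (T ` (B - K)) = sv.dim (T ` V)"
    using ind by (intro sv.basis_card_eq_dim)
  then have "sv.dim (T ` V) = card B - card K"
    by (simp add: card_image[OF inj] card_Diff_subset[OF finK B(1)])
  moreover have "card K \<le> card B" by (rule card_mono[OF finB B(1)])
  ultimately show ?thesis using dimV K(4) by (simp add: Ker_def)
qed

definition smul :: "(pt \<Rightarrow> complex) \<Rightarrow> ('r \<Rightarrow> pt \<Rightarrow> complex) \<Rightarrow> 'r \<Rightarrow> pt \<Rightarrow> complex" where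
  "smul h f = (\<lambda>r p. h p * f r p)"

lemma smul_apply [simp]: "smul h f r p = h p * f r p"
  by (simp add: smul_def)

definition free :: "'r set \<Rightarrow> int \<Rightarrow> ('r \<Rightarrow> pt \<Rightarrow> complex) set" where
  "free R t = {f. (\<forall>r. f r \<in> forms t) \<and> (\<forall>r. r \<notin> R \<longrightarrow> f r = 0)}"

definition gmod :: "'r set \<Rightarrow> (int \<Rightarrow> ('r \<Rightarrow> pt \<Rightarrow> complex) set) \<Rightarrow> bool" where
  "gmod R G \<longleftrightarrow> finite R \<and> (\<forall>t. sv.subspace (G t)) \<and> (\<forall>t. G t \<subseteq> free R t) \<and>
     (\<forall>t s f h. f \<in> G t \<longrightarrow> h \<in> forms s \<longrightarrow> smul h f \<in> G (t + s))"

lemma smul_forms: "f r \<in> forms t \<Longrightarrow> h \<in> forms s \<Longrightarrow> smul h f r \<in> forms (t + s)"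
proof -
  assume "f r \<in> forms t" "h \<in> forms s"
  then have "f r * h \<in> forms (t + s)" by (rule forms_mult)
  moreover have "f r * h = smul h f r" by (simp add: fun_eq_iff)
  ultimately show ?thesis by simp
qed

lemma subspace_free: "sv.subspace (free R t)"
proof (rule sv.subspaceI)
  show "0 \<in> free R t" by (simp add: free_def)
next
  fix f g assume "f \<in> free R t" "g \<in> free R t"
  then show "f + g \<in> free R t" unfolding free_def by (auto intro: forms_add)
next
  fix c f assume "f \<in> free R t"
  moreover have "sscale c f r = fscale c (f r)" for r by (simp add: fun_eq_iff)
  ultimately show "sscale c f \<in> free R t" unfolding free_def by (auto intro: forms_scale)
qed

lemma gmod_free: "finite R \<Longrightarrow> gmod R (free R)"
  unfolding gmod_def using subspace_free
  by (auto simp: free_def smul_forms)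

definition single :: "'r \<Rightarrow> (pt \<Rightarrow> complex) \<Rightarrow> 'r \<Rightarrow> pt \<Rightarrow> complex" where
  "single r f = (\<lambda>r'. if r' = r then f else 0)"

lemma free_basis:
  assumes "finite R"
  shows "free R t = sv.span ((\<lambda>(r, m). single r (mon m)) ` (R \<times> expo t))"
    and "sv.dim (free R t) = card R * card (expo t)"
proof -
  let ?B = "(\<lambda>(r, m). single r (mon m)) ` (R \<times> expo t)"
  have inj: "inj_on (\<lambda>(r, m). single r (mon m)) (R \<times> expo t)"
  proof (rule inj_onI, clarify)
    fix r m r' m' assume a: "m \<in> expo t" "m' \<in> expo t" "single r (mon m) = single r' (mon m')"
    have "mon m \<noteq> 0" using independent_mon[of t] sv.dependent_zero a(1)
      by (metis fv.dependent_zero image_eqI)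
    then have "r = r'" using fun_cong[OF a(3), of r] by (auto simp: single_def split: if_splits)
    moreover have "mon m = mon m'" using fun_cong[OF a(3), of r] \<open>r = r'\<close> by (simp add: single_def)
    ultimately show "r = r' \<and> m = m'" using inj_onD[OF inj_on_mon] a by blast
  qed
  have fin: "finite ?B" using assms finite_expo by blast
  have sub: "?B \<subseteq> free R t" by (auto simp: free_def single_def mon_in_forms)
  have span: "free R t \<subseteq> sv.span ?B"
  proof
    fix f assume f: "f \<in> free R t"
    then have "\<exists>c. f r = (\<lambda>p. \<Sum>m\<in>expo t. c m * mon m p)" for r by (auto simp: free_def forms_def)
    then obtain c where c: "\<And>r. f r = (\<lambda>p. \<Sum>m\<in>expo t. c r m * mon m p)" by metis
    have "f = (\<Sum>r\<in>R. \<Sum>m\<in>expo t. sscale (c r m) (single r (mon m)))"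
    proof (intro ext)
      fix r p
      have "(\<Sum>r'\<in>R. \<Sum>m\<in>expo t. sscale (c r' m) (single r' (mon m))) r p =
        (\<Sum>r'\<in>R. if r' = r then \<Sum>m\<in>expo t. c r' m * mon m p else 0)"
        unfolding fun_sum_apply by (intro sum.cong) (auto simp: single_def)
      also have "\<dots> = (if r \<in> R then f r p else 0)" using assms by (simp add: c)
      also have "\<dots> = f r p" using f by (auto simp: free_def)
      finally show "f r p = (\<Sum>r'\<in>R. \<Sum>m\<in>expo t. sscale (c r' m) (single r' (mon m))) r p" ..
    qed
    also have "\<dots> \<in> sv.span ?B" by (intro sv.span_sum sv.span_scale sv.span_base) auto
    finally show "f \<in> sv.span ?B" .
  qed
  have ind: "sv.independent ?B"
  proof (rule sv.independent_if_scalars_zero[OF fin])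
    fix f :: "('a \<Rightarrow> pt \<Rightarrow> complex) \<Rightarrow> complex" and x
    assume z: "(\<Sum>x\<in>?B. sscale (f x) x) = 0" and x: "x \<in> ?B"
    then obtain r m where rm: "r \<in> R" "m \<in> expo t" "x = single r (mon m)" by auto
    have "(\<Sum>m\<in>expo t. f (single r (mon m)) * mon m p) = 0" for p
    proof -
      have "0 = (\<Sum>x\<in>?B. sscale (f x) x) r p" by (simp add: z)
      also have "\<dots> = (\<Sum>r'\<in>R. \<Sum>m\<in>expo t. f (single r' (mon m)) * single r' (mon m) r p)"
      proof -
        have "(\<Sum>x\<in>?B. sscale (f x) x) r p = (\<Sum>x\<in>?B. f x * x r p)" by (simp add: fun_sum_apply)
        also have "\<dots> = (\<Sum>(r', m)\<in>R \<times> expo t. f (single r' (mon m)) * single r' (mon m) r p)"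
          unfolding sum.reindex[OF inj] by (simp add: o_def case_prod_unfold)
        finally show ?thesis by (simp only: sum.cartesian_product)
      qed
      also have "\<dots> = (\<Sum>r'\<in>R. if r' = r then \<Sum>m\<in>expo t. f (single r' (mon m)) * mon m p else 0)"
        by (intro sum.cong) (auto simp: single_def)
      finally show ?thesis using rm assms by simp
    qed
    from mon_independent[where c = "\<lambda>m. f (single r (mon m))", OF this rm(2)] show "f x = 0" by (simp add: rm)
  qed
  show "free R t = sv.span ?B"
    using span sv.span_minimal[OF sub subspace_free] by blast
  show "sv.dim (free R t) = card R * card (expo t)"
    using sv.basis_card_eq_dim[OF sub span ind] by (simp add: card_image[OF inj] card_cartesian_product)
qed

lemma gmodD:
  assumes "gmod R G"
  shows "finite R" "sv.subspace (G t)" "f \<in> G t \<Longrightarrow> f r \<in> forms t" "f \<in> G t \<Longrightarrow> r \<notin> R \<Longrightarrow> f r = 0"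
    "f \<in> G t \<Longrightarrow> h \<in> forms s \<Longrightarrow> smul h f \<in> G (t + s)" "G t \<subseteq> free R t"
    "\<exists>S. finite S \<and> G t \<subseteq> sv.span S"
proof -
  show "\<exists>S. finite S \<and> G t \<subseteq> sv.span S"
  proof (intro exI conjI)
    have R: "finite R" "G t \<subseteq> free R t" using assms by (simp_all add: gmod_def)
    show "finite ((\<lambda>(r, m). single r (mon m)) ` (R \<times> expo t))" using R(1) finite_expo by blast
    show "G t \<subseteq> sv.span ((\<lambda>(r, m). single r (mon m)) ` (R \<times> expo t))"
      using R(2) unfolding free_basis(1)[OF R(1)] .
  qed
next
  assume f: "f \<in> G t"
  then have "f \<in> free R t" using assms unfolding gmod_def by blast
  then show "f r \<in> forms t" "r \<notin> R \<Longrightarrow> f r = 0" by (simp_all add: free_def)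
qed (use assms in \<open>simp_all add: gmod_def\<close>)

section \<open>Finite generation of graded modules in large degrees\<close>

lemma nat_seq_mono_subseq:
  fixes g :: "nat \<Rightarrow> nat"
  shows "\<exists>\<sigma> :: nat \<Rightarrow> nat. strict_mono \<sigma> \<and> mono (g \<circ> \<sigma>)"
proof -
  obtain f where f: "strict_mono f" "monoseq (\<lambda>n. g (f n))" using seq_monosub[of g] by auto
  show ?thesis
  proof (cases "\<forall>m n. m \<le> n \<longrightarrow> g (f m) \<le> g (f n)")
    case True
    then show ?thesis using f(1) by (intro exI[of _ f]) (simp add: mono_def)
  next
    case False
    then have dec: "\<And>m n. m \<le> n \<Longrightarrow> g (f n) \<le> g (f m)" using f(2) by (auto simp: monoseq_def)
    obtain n0 where n0: "\<And>n. g (f n0) \<le> g (f n)" using ex_has_least_nat[of "\<lambda>_. True" 0 "\<lambda>n. g (f n)"] by auto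
    have "g (f (n0 + n)) = g (f n0)" for n using dec[of n0 "n0 + n"] n0[of "n0 + n"] by simp
    then show ?thesis using f(1)
      by (intro exI[of _ "\<lambda>n. f (n0 + n)"]) (auto simp: strict_mono_def mono_def)
  qed
qed

text \<open>Subsequences are refined one coordinate at a time until all \<open>K\<close> coordinates
  are monotone.\<close>

lemma dickson:
  fixes s :: "nat \<Rightarrow> nat \<Rightarrow> nat"
  shows "\<exists>i j. i < j \<and> (\<forall>k<K. s i k \<le> s j k)"
proof -
  have "\<exists>\<sigma> :: nat \<Rightarrow> nat. strict_mono \<sigma> \<and> (\<forall>k<K. mono (\<lambda>n. s (\<sigma> n) k))"
  proof (induction K)
    case 0
    show ?case by (intro exI[of _ "\<lambda>n. n"]) (simp add: strict_mono_def)
  next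
    case (Suc K)
    then obtain \<sigma> :: "nat \<Rightarrow> nat" where s: "strict_mono \<sigma>" "\<forall>k<K. mono (\<lambda>n. s (\<sigma> n) k)" by blast
    obtain \<tau> :: "nat \<Rightarrow> nat" where t: "strict_mono \<tau>" "mono ((\<lambda>n. s (\<sigma> n) K) \<circ> \<tau>)"
      using nat_seq_mono_subseq[of "\<lambda>n. s (\<sigma> n) K"] by blast
    have "mono (\<lambda>n. s (\<sigma> (\<tau> n)) k)" if "k < Suc K" for k
    proof (cases "k = K")
      case False
      then have "mono (\<lambda>n. s (\<sigma> n) k)" using s that by simp
      then show ?thesis using t(1) by (auto simp: mono_def strict_mono_less_eq)
    qed (use t in \<open>simp add: o_def\<close>)
    moreover have "strict_mono (\<lambda>n. \<sigma> (\<tau> n))" using s t by (simp add: strict_mono_def)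
    ultimately show ?case by blast
  qed
  then obtain \<sigma> :: "nat \<Rightarrow> nat" where "strict_mono \<sigma>" "\<forall>k<K. mono (\<lambda>n. s (\<sigma> n) k)" by blast
  then show ?thesis
    by (intro exI[of _ "\<sigma> 0"] exI[of _ "\<sigma> 1"]) (auto simp: strict_mono_def mono_def)
qed

text \<open>Coefficients are set to zero outside \<open>expo t\<close>, which makes them unique and
  keeps shifts of exponents free of side conditions.\<close>

definition cf :: "int \<Rightarrow> (pt \<Rightarrow> complex) \<Rightarrow> (nat \<Rightarrow> nat) \<Rightarrow> complex" where
  "cf t f = (SOME c. f = (\<lambda>p. \<Sum>m\<in>expo t. c m * mon m p) \<and> (\<forall>m. m \<notin> expo t \<longrightarrow> c m = 0))"

lemma cf:
  assumes "f \<in> forms t"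
  shows "f = (\<lambda>p. \<Sum>m\<in>expo t. cf t f m * mon m p)" "m \<notin> expo t \<Longrightarrow> cf t f m = 0"
proof -
  obtain c where c: "f = (\<lambda>p. \<Sum>m\<in>expo t. c m * mon m p)" using assms by (auto simp: forms_def)
  have "f = (\<lambda>p. \<Sum>m\<in>expo t. (if m \<in> expo t then c m else 0) * mon m p) \<and>
      (\<forall>m. m \<notin> expo t \<longrightarrow> (if m \<in> expo t then c m else 0) = 0)"
    unfolding c by (auto simp: fun_eq_iff intro!: sum.cong)
  from someI[where P = "\<lambda>c. f = (\<lambda>p. \<Sum>m\<in>expo t. c m * mon m p) \<and> (\<forall>m. m \<notin> expo t \<longrightarrow> c m = 0)", OF this]
  show "f = (\<lambda>p. \<Sum>m\<in>expo t. cf t f m * mon m p)" "m \<notin> expo t \<Longrightarrow> cf t f m = 0"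
    unfolding cf_def by blast+
qed

lemma cf_unique:
  assumes "f = (\<lambda>p. \<Sum>m\<in>expo t. c m * mon m p)" "\<And>m. m \<notin> expo t \<Longrightarrow> c m = 0"
  shows "cf t f = c"
proof
  fix m
  have f: "f \<in> forms t" using assms(1) by (auto simp: forms_def)
  show "cf t f m = c m"
  proof (cases "m \<in> expo t")
    case True
    have "(\<Sum>m\<in>expo t. (cf t f m - c m) * mon m p) = 0" for p
    proof -
      have "(\<Sum>m\<in>expo t. (cf t f m - c m) * mon m p) = (\<Sum>m\<in>expo t. cf t f m * mon m p) - (\<Sum>m\<in>expo t. c m * mon m p)"
        by (simp add: left_diff_distrib sum_subtractf)
      also have "\<dots> = f p - f p" using fun_cong[OF cf(1)[OF f], of p] fun_cong[OF assms(1), of p] by simp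
      finally show ?thesis by simp
    qed
    from mon_independent[where c = "\<lambda>m. cf t f m - c m", OF this True] show ?thesis by simp
  qed (use cf(2)[OF f] assms(2) in simp)
qed

lemma cf_diff_scale:
  assumes "f \<in> forms t" "g \<in> forms t"
  shows "cf t (\<lambda>p. f p - a * g p) m = cf t f m - a * cf t g m"
proof -
  have "cf t (\<lambda>p. f p - a * g p) = (\<lambda>m. cf t f m - a * cf t g m)"
  proof (rule cf_unique)
    show "(\<lambda>p. f p - a * g p) = (\<lambda>p. \<Sum>m\<in>expo t. (cf t f m - a * cf t g m) * mon m p)"
      by (subst cf(1)[OF assms(1)], subst cf(1)[OF assms(2)])
        (simp add: fun_eq_iff left_diff_distrib sum_subtractf sum_distrib_left mult.assoc)
  qed (use cf(2) assms in simp)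
  then show ?thesis by simp
qed

lemma cf_mon_mult:
  assumes f: "f \<in> forms s" and b: "b \<in> expo d"
  shows "cf (s + d) (\<lambda>p. mon b p * f p) m =
    (if (\<forall>k. b k \<le> m k) then cf s f (\<lambda>k. m k - b k) else 0)"
proof -
  let ?c = "\<lambda>m. if (\<forall>k. b k \<le> m k) then cf s f (\<lambda>k. m k - b k) else 0"
  let ?sh = "\<lambda>m k. m k + b k"
  have inj: "inj_on ?sh (expo s)" by (auto simp: inj_on_def fun_eq_iff)
  have sub: "?sh ` expo s \<subseteq> expo (s + d)" using expo_add b by blast
  have "cf (s + d) (\<lambda>p. mon b p * f p) = ?c"
  proof (rule cf_unique)
    show "(\<lambda>p. mon b p * f p) = (\<lambda>p. \<Sum>m\<in>expo (s + d). ?c m * mon m p)"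
    proof
      fix p
      have z: "?c m = 0" if "m \<in> expo (s + d) - ?sh ` expo s" for m
      proof (cases "\<forall>k. b k \<le> m k")
        case True
        have "(\<lambda>k. m k - b k) \<notin> expo s"
        proof
          assume "(\<lambda>k. m k - b k) \<in> expo s"
          then have "?sh (\<lambda>k. m k - b k) \<in> ?sh ` expo s" by (rule image_eqI[OF refl])
          moreover have "?sh (\<lambda>k. m k - b k) = m" using True by (auto simp: fun_eq_iff)
          ultimately show False using that by simp
        qed
        then show ?thesis using cf(2)[OF f] by simp
      qed auto
      have "(\<Sum>m\<in>expo (s + d). ?c m * mon m p) = (\<Sum>m\<in>?sh ` expo s. ?c m * mon m p)"
        using sub z by (intro sum.mono_neutral_right finite_expo) auto
      also have "\<dots> = (\<Sum>m\<in>expo s. ?c (?sh m) * mon (?sh m) p)" by (simp only: sum.reindex[OF inj] o_def)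
      also have "\<dots> = (\<Sum>m\<in>expo s. mon b p * (cf s f m * mon m p))"
      proof (rule sum.cong[OF refl])
        fix m
        have "mon (?sh m) p = mon m p * mon b p" using fun_cong[OF mon_mult[of m b], of p] by simp
        then show "?c (?sh m) * mon (?sh m) p = mon b p * (cf s f m * mon m p)" by simp
      qed
      also have "\<dots> = mon b p * f p" using fun_cong[OF cf(1)[OF f], of p] by (simp only: sum_distrib_left)
      finally show "mon b p * f p = (\<Sum>m\<in>expo (s + d). ?c m * mon m p)" ..
    qed
    fix m assume m: "m \<notin> expo (s + d)"
    show "?c m = 0"
    proof (cases "\<forall>k. b k \<le> m k")
      case True
      have "(\<lambda>k. m k - b k) \<notin> expo s"
      proof
        assume "(\<lambda>k. m k - b k) \<in> expo s"
        then have "?sh (\<lambda>k. m k - b k) \<in> expo (s + d)" using expo_add b by blast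
        moreover have "?sh (\<lambda>k. m k - b k) = m" using True by (auto simp: fun_eq_iff)
        ultimately show False using m by simp
      qed
      then show ?thesis using cf(2)[OF f] by simp
    qed auto
  qed
  then show ?thesis by simp
qed

text \<open>Integer polynomials with the order at infinity serve as weights: they turn the
  lexicographic order on monomials into a linear order compatible with addition.\<close>

definition weight :: "(nat \<Rightarrow> nat) \<Rightarrow> nat \<Rightarrow> int poly" where
  "weight m r = (\<Sum>k\<le>4. monom (int (m k)) k) + monom (int r) 5"

lemma coeff_weight: "coeff (weight m r) k = (if k \<le> 4 then int (m k) else if k = 5 then int r else 0)"
  by (auto simp: weight_def coeff_sum)

lemma weight_inj: "weight m r = weight m' r' \<Longrightarrow> (\<forall>k\<le>4. m k = m' k) \<and> r = r'"
proof (intro conjI allI impI)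
  assume w: "weight m r = weight m' r'"
  show "m k = m' k" if "k \<le> 4" for k
    using arg_cong[OF w, of "\<lambda>p. coeff p k"] that by (simp add: coeff_weight)
  show "r = r'" using arg_cong[OF w, of "\<lambda>p. coeff p 5"] by (simp add: coeff_weight)
qed

lemma weight_add: "weight (\<lambda>k. m k + b k) r = weight m r + weight b 0"
  by (intro poly_eqI) (simp add: coeff_weight)

text \<open>A Groebner basis argument. If it failed in infinitely many degrees, choose in each of
  these an element outside the generated part with least leading term. By Dickson, one of the
  leading terms divides a later one in the same component; subtracting a multiple of the earlier
  element, which lies in the generated part, lowers the leading term of the later one, against
  minimality.\<close>

lemma gmod_generated:
  assumes G: "gmod R G"
  shows "\<exists>t0\<ge>0. \<forall>t\<ge>t0. G (t + 1) \<subseteq> sv.span {smul (co k) f |k f. k \<le> 4 \<and> f \<in> G t}"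
proof (rule ccontr)
  define M where "M t = sv.span {smul (co k) f |k f. k \<le> 4 \<and> f \<in> G t}" for t
  define S where "S = {n. \<not> G (int n + 1) \<subseteq> M (int n)}"
  assume neg: "\<not> ?thesis"
  have "\<exists>n\<ge>k. n \<in> S" for k
  proof -
    obtain t where "t \<ge> int k" "\<not> G (t + 1) \<subseteq> M t" using neg unfolding M_def by (meson of_nat_0_le_iff)
    then show ?thesis by (intro exI[of _ "nat t"]) (auto simp: S_def)
  qed
  then have inf: "infinite S" by (auto simp: infinite_nat_iff_unbounded_le)
  have finR: "finite R" by (rule gmodD(1)[OF G])
  obtain \<rho> :: "_ \<Rightarrow> nat" where \<rho>: "inj_on \<rho> R" "\<rho> ` R \<subseteq> {..card R}"
  proof -
    obtain \<rho> where "bij_betw \<rho> R {0..<card R}" using ex_bij_betw_finite_nat[OF finR] by blast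
    then show ?thesis by (intro that[of \<rho>]) (auto simp: bij_betw_def)
  qed
  define Supp where "Supp n f = {(m, r). r \<in> R \<and> m \<in> expo (int n + 1) \<and> cf (int n + 1) (f r) m \<noteq> 0}" for n f
  define w where "w = (\<lambda>(m, r). weight m (\<rho> r))"
  define lead where "lead n f = Max (w ` Supp n f)" for n f
  have finE: "finite (expo (int n + 1) \<times> R)" for n using finR finite_expo by blast
  have finS: "finite (Supp n f)" for n f
    by (rule finite_subset[OF _ finE[of n]]) (auto simp: Supp_def)
  have w_inj: "x = y" if "w x = w y" "x \<in> expo t \<times> R" "y \<in> expo s \<times> R" for x y t s
  proof -
    obtain m r m' r' where xy: "x = (m, r)" "y = (m', r')" by (metis surj_pair)
    then have mr: "\<forall>k\<le>4. m k = m' k" "\<rho> r = \<rho> r'" using weight_inj that(1) by (auto simp: w_def)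
    have "m k = m' k" for k
      using mr(1) that(2,3) xy by (cases "k \<le> 4") (auto simp: expo_def not_le)
    then show ?thesis using mr(2) \<rho>(1) that(2,3) xy by (auto simp: inj_on_def)
  qed
  have Supp_ne: "Supp n f \<noteq> {}" if f: "f \<in> G (int n + 1)" "f \<noteq> 0" for n f
  proof
    assume e: "Supp n f = {}"
    have "f r = 0" for r
    proof (cases "r \<in> R")
      case True
      have "f r = (\<lambda>p. \<Sum>m\<in>expo (int n + 1). cf (int n + 1) (f r) m * mon m p)"
        by (rule cf(1)[OF gmodD(3)[OF G f(1)]])
      also have "\<dots> = (\<lambda>p. 0)" using e True by (auto simp: Supp_def fun_eq_iff intro!: sum.neutral)
      finally show ?thesis by (simp add: fun_eq_iff)
    qed (use gmodD(4)[OF G f(1)] in blast)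
    then show False using f(2) by (auto simp: fun_eq_iff)
  qed
  have M0: "0 \<in> M t" for t by (simp add: M_def sv.span_zero)
  have "\<exists>f. f \<in> G (int n + 1) - M (int n) \<and> (\<forall>g\<in>G (int n + 1) - M (int n). lead n f \<le> lead n g)"
    if n: "n \<in> S" for n
  proof -
    let ?Z = "G (int n + 1) - M (int n)"
    have "lead n f \<in> w ` (expo (int n + 1) \<times> R)" if "f \<in> ?Z" for f
    proof -
      have "f \<noteq> 0" using that M0 by auto
      then have "w ` Supp n f \<noteq> {}" using Supp_ne that by blast
      then have "lead n f \<in> w ` Supp n f" unfolding lead_def by (intro Max_in) (use finS in auto)
      then show ?thesis by (auto simp: Supp_def)
    qed
    then have "lead n ` ?Z \<subseteq> w ` (expo (int n + 1) \<times> R)" by blast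
    then have fin: "finite (lead n ` ?Z)" by (rule finite_subset) (use finE in blast)
    have ne: "lead n ` ?Z \<noteq> {}" using n by (auto simp: S_def)
    from Min_in[OF fin ne] obtain f where f: "f \<in> ?Z" "lead n f = Min (lead n ` ?Z)" by auto
    then show ?thesis using Min_le[OF fin] by (intro exI[of _ f]) auto
  qed
  then obtain F where F: "\<And>n. n \<in> S \<Longrightarrow> F n \<in> G (int n + 1) - M (int n)"
    and Fmin: "\<And>n g. n \<in> S \<Longrightarrow> g \<in> G (int n + 1) - M (int n) \<Longrightarrow> lead n (F n) \<le> lead n g"
    by metis
  have "\<exists>x. x \<in> Supp n (F n) \<and> w x = lead n (F n)" if "n \<in> S" for n
  proof -
    have "F n \<noteq> 0" using F[OF that] M0 by auto
    then have "w ` Supp n (F n) \<noteq> {}" using Supp_ne F[OF that] by blast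
    then have "lead n (F n) \<in> w ` Supp n (F n)" unfolding lead_def by (intro Max_in) (use finS in auto)
    then show ?thesis by (metis imageE)
  qed
  then obtain x where x: "\<And>n. n \<in> S \<Longrightarrow> x n \<in> Supp n (F n) \<and> w (x n) = lead n (F n)" by metis
  define b where "b = enumerate S"
  have b: "b i \<in> S" "i < j \<Longrightarrow> b i < b j" for i j
    using inf enumerate_in_set enumerate_mono by (auto simp: b_def)
  \<comment> \<open>Seven coordinates: five exponents, then the number of the component and its
    complement. Comparing the last two forces both leading terms into the same component.\<close>
  define s where "s i k = (if k \<le> 4 then fst (x (b i)) k else if k = 5 then \<rho> (snd (x (b i)))
      else card R - \<rho> (snd (x (b i))))" for i k
  obtain i j where ij: "i < j" "\<And>k. k < 7 \<Longrightarrow> s i k \<le> s j k" using dickson[of 7 s] by blast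
  define p q where "p = b i" and "q = b j"
  have pq: "p \<in> S" "q \<in> S" "p < q" using b ij by (auto simp: p_def q_def)
  obtain m r m' r' where xp: "x p = (m, r)" and xq: "x q = (m', r')" by (metis surj_pair)
  have mr: "r \<in> R" "m \<in> expo (int p + 1)" "cf (int p + 1) (F p r) m \<noteq> 0"
    "r' \<in> R" "m' \<in> expo (int q + 1)" "cf (int q + 1) (F q r') m' \<noteq> 0"
    using x[OF pq(1)] x[OF pq(2)] xp xq by (auto simp: Supp_def)
  have "\<rho> r \<le> card R" "\<rho> r' \<le> card R" using \<rho>(2) mr by auto
  moreover have "\<rho> r \<le> \<rho> r'" using ij(2)[of 5] xp xq by (simp add: s_def p_def q_def)
  moreover have "card R - \<rho> r \<le> card R - \<rho> r'" using ij(2)[of 6] xp xq by (simp add: s_def p_def q_def)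
  ultimately have "\<rho> r = \<rho> r'" by linarith
  then have rr: "r' = r" using \<rho>(1) mr by (auto simp: inj_on_def)
  have mle: "m k \<le> m' k" for k
  proof (cases "k \<le> 4")
    case True
    then show ?thesis using ij(2)[of k] xp xq by (simp add: s_def p_def q_def)
  next
    case False
    then show ?thesis using mr by (auto simp: expo_def)
  qed
  define d where "d = (\<lambda>k. m' k - m k)"
  have dsum: "(\<Sum>k\<le>4. d k) = q - p"
  proof -
    have "(\<Sum>k\<le>4. d k) = (\<Sum>k\<le>4. m' k) - (\<Sum>k\<le>4. m k)"
      unfolding d_def using mle by (intro sum_subtractf_nat) auto
    then show ?thesis using mr by (simp add: expo_def nat_add_distrib)
  qed
  have d: "d \<in> expo (int q - int p)" using dsum mr pq by (auto simp: expo_def d_def)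
  have m'eq: "m' = (\<lambda>k. m k + d k)" using mle by (auto simp: d_def fun_eq_iff)
  \<comment> \<open>Chosen to cancel the leading term of \<open>F q\<close>.\<close>
  define c where "c = cf (int q + 1) (F q r) m' / cf (int p + 1) (F p r) m"
  define h where "h = smul (mon d) (F p)"
  have FG: "F p \<in> G (int p + 1)" "F q \<in> G (int q + 1)" using F pq by auto
  \<comment> \<open>As \<open>q\<close> exceeds \<open>p\<close>, the exponent \<open>d\<close> is
    positive somewhere, and one coordinate can be split off.\<close>
  have hM: "h \<in> M (int q)"
  proof -
    have "\<exists>k\<le>4. d k \<noteq> 0" using dsum pq by (auto intro: ccontr)
    then obtain k where k: "k \<le> 4" "d k \<noteq> 0" by blast
    define d' where "d' = d(k := d k - 1)"
    have "(\<Sum>l\<le>4. d l) = (\<Sum>l\<le>4. d' l + (if l = k then 1 else 0))"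
      using k by (intro sum.cong) (auto simp: d'_def)
    also have "\<dots> = (\<Sum>l\<le>4. d' l) + 1" using k by (simp add: sum.distrib)
    finally have "(\<Sum>l\<le>4. d' l) + 1 = q - p" using dsum by simp
    moreover have "\<forall>l>4. d' l = 0" using d k by (auto simp: d'_def expo_def)
    ultimately have d': "d' \<in> expo (int q - int p - 1)" using pq(3) by (auto simp: expo_def)
    have "smul (mon d') (F p) \<in> G (int p + 1 + (int q - int p - 1))"
      by (rule gmodD(5)[OF G FG(1) mon_in_forms[OF d']])
    then have "smul (mon d') (F p) \<in> G (int q)" by simp
    moreover have "h = smul (co k) (smul (mon d') (F p))"
    proof -
      have "d = (\<lambda>l. (if l = k then 1 else 0) + d' l)" using k by (auto simp: d'_def fun_eq_iff)
      then have "mon d = co k * mon d'" by (simp only: co_eq_mon[OF k(1)] mon_mult)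
      then show ?thesis by (simp add: h_def fun_eq_iff)
    qed
    ultimately show ?thesis unfolding M_def using k(1) by (intro sv.span_base) blast
  qed
  have hG: "h \<in> G (int q + 1)"
    using gmodD(5)[OF G FG(1) mon_in_forms[OF d]] by (simp add: h_def add.commute)
  define g where "g = F q - sscale c h"
  have gG: "g \<in> G (int q + 1)" unfolding g_def
    by (intro sv.subspace_diff sv.subspace_scale gmodD(2)[OF G] FG hG)
  have gM: "g \<notin> M (int q)"
  proof
    assume "g \<in> M (int q)"
    then have "g + sscale c h \<in> M (int q)"
      using hM unfolding M_def by (intro sv.span_add sv.span_scale)
    then show False using F[OF pq(2)] by (simp add: g_def)
  qed
  have g0: "g \<noteq> 0" using gM M0 by auto
  have cfg: "cf (int q + 1) (g r1) m1 = cf (int q + 1) (F q r1) m1 -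
      c * (if \<forall>k. d k \<le> m1 k then cf (int p + 1) (F p r1) (\<lambda>k. m1 k - d k) else 0)" for r1 m1
  proof -
    have "cf (int p + 1 + (int q - int p)) (\<lambda>y. mon d y * F p r1 y) m1 =
        (if \<forall>k. d k \<le> m1 k then cf (int p + 1) (F p r1) (\<lambda>k. m1 k - d k) else 0)"
      by (rule cf_mon_mult[OF gmodD(3)[OF G FG(1)] d])
    moreover have "(\<lambda>y. mon d y * F p r1 y) = h r1" by (simp add: h_def fun_eq_iff)
    moreover have "int p + 1 + (int q - int p) = int q + 1" by simp
    ultimately have 1: "cf (int q + 1) (h r1) m1 = (if \<forall>k. d k \<le> m1 k then cf (int p + 1) (F p r1) (\<lambda>k. m1 k - d k) else 0)"
      by (simp only:)
    have "g r1 = (\<lambda>y. F q r1 y - c * h r1 y)" by (simp add: g_def fun_eq_iff)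
    then show ?thesis unfolding 1[symmetric]
      using cf_diff_scale[OF gmodD(3)[OF G FG(2)] gmodD(3)[OF G hG], of r1 c r1 m1] by simp
  qed
  have leadq: "lead q (F q) = weight m' (\<rho> r)" using x[OF pq(2)] xq rr by (simp add: w_def)
  have leadp: "lead p (F p) = weight m (\<rho> r)" using x[OF pq(1)] xp by (simp add: w_def)
  have "w y < lead q (F q)" if y: "y \<in> Supp q g" for y
  proof -
    obtain m1 r1 where y1: "y = (m1, r1)" by fastforce
    have r1: "r1 \<in> R" "m1 \<in> expo (int q + 1)" "cf (int q + 1) (g r1) m1 \<noteq> 0"
      using y by (auto simp: Supp_def y1)
    have "w y \<le> lead q (F q)"
    proof (cases "cf (int q + 1) (F q r1) m1 = 0")
      case False
      then have "y \<in> Supp q (F q)" using r1 by (simp add: Supp_def y1)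
      then show ?thesis unfolding lead_def using finS by (intro Max_ge) auto
    next
      case True
      then have dle: "\<forall>k. d k \<le> m1 k" and "cf (int p + 1) (F p r1) (\<lambda>k. m1 k - d k) \<noteq> 0"
        using r1(3) cfg[of r1 m1] by (auto split: if_splits)
      then have "(\<lambda>k. m1 k - d k, r1) \<in> Supp p (F p)"
        using r1(1) cf(2)[OF gmodD(3)[OF G FG(1)]] by (auto simp: Supp_def)
      then have "w (\<lambda>k. m1 k - d k, r1) \<le> lead p (F p)"
        unfolding lead_def using finS by (intro Max_ge) auto
      then have "weight (\<lambda>k. m1 k - d k) (\<rho> r1) + weight d 0 \<le> weight m (\<rho> r) + weight d 0"
        by (simp add: leadp w_def)
      moreover have "weight (\<lambda>k. m1 k - d k) (\<rho> r1) + weight d 0 = weight m1 (\<rho> r1)"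
        using weight_add[of "\<lambda>k. m1 k - d k" d "\<rho> r1"] dle by simp
      moreover have "weight m (\<rho> r) + weight d 0 = weight m' (\<rho> r)"
        unfolding m'eq weight_add ..
      ultimately show ?thesis by (simp add: leadq w_def y1)
    qed
    moreover have "w y \<noteq> lead q (F q)"
    proof
      assume "w y = lead q (F q)"
      then have "w y = w (m', r)" by (simp add: leadq w_def)
      then have "y = (m', r)" using w_inj[of y "(m', r)"] r1 mr rr by (simp add: y1)
      then have "cf (int q + 1) (g r) m' \<noteq> 0" using r1 y1 by simp
      moreover have "\<forall>k. d k \<le> m' k" "(\<lambda>k. m' k - d k) = m" by (auto simp: m'eq)
      ultimately show False using cfg[of r m'] mr(3) by (simp add: c_def)
    qed
    ultimately show ?thesis by simp
  qed
  moreover have "w ` Supp q g \<noteq> {}" using Supp_ne[OF gG g0] by blast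
  ultimately have "lead q g < lead q (F q)" unfolding lead_def[of q g] using finS by (subst Max_less_iff) auto
  moreover have "lead q (F q) \<le> lead q g" using Fmin[OF pq(2)] gG gM by blast
  ultimately show False by simp
qed

text \<open>The multipliers carrying \<open>G\<close> into \<open>G'\<close> form a homogeneous
  ideal without common zeros, so they include all forms of some degree \<open>N\<close>. In large
  degrees \<open>G\<close> is spanned by products of such forms with members of \<open>G\<close>
  whose degree is lower by \<open>N\<close>.\<close>

lemma gmod_local_global:
  assumes G: "gmod R G" and G': "gmod R G'" and sub: "\<And>t. G' t \<subseteq> G t"
    and loc: "\<And>x. \<exists>d q. q \<in> forms d \<and> q x \<noteq> 0 \<and> (\<forall>t. \<forall>f\<in>G t. smul q f \<in> G' (t + d))"
  shows "\<exists>t0. \<forall>t\<ge>t0. G' t = G t"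
proof -
  define J where "J = {(d, q). q \<in> forms d \<and> (\<forall>t. \<forall>f\<in>G t. smul q f \<in> G' (t + d))}"
  have "gideal J" unfolding gideal_def
  proof (intro conjI allI impI)
    show "q \<in> forms d" if "(d, q) \<in> J" for d q using that by (simp add: J_def)
    show "(d, 0) \<in> J" for d
    proof -
      have "smul 0 f = 0" for f :: "'a \<Rightarrow> pt \<Rightarrow> complex" by (simp add: fun_eq_iff)
      then show ?thesis using sv.subspace_0[OF gmodD(2)[OF G']] by (simp add: J_def)
    qed
    show "(d, q + q') \<in> J" if "(d, q) \<in> J" "(d, q') \<in> J" for d q q'
    proof -
      have "smul (q + q') f = smul q f + smul q' f" for f :: "'a \<Rightarrow> pt \<Rightarrow> complex"
        by (simp add: fun_eq_iff algebra_simps)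
      then show ?thesis using that sv.subspace_add[OF gmodD(2)[OF G']]
        unfolding J_def by (auto intro: forms_add)
    qed
    show "(d + s, q * h) \<in> J" if q: "(d, q) \<in> J" and h: "h \<in> forms s" for d q s h
    proof -
      have "smul (q * h) f \<in> G' (t + (d + s))" if f: "f \<in> G t" for f t
      proof -
        have "smul h (smul q f) \<in> G' (t + d + s)"
          using gmodD(5)[OF G' _ h] q f by (auto simp: J_def)
        moreover have "smul h (smul q f) = smul (q * h) f" by (simp add: fun_eq_iff)
        ultimately show ?thesis by (simp add: add.assoc)
      qed
      then show ?thesis using q forms_mult[OF _ h] by (auto simp: J_def)
    qed
  qed
  moreover have "\<exists>t f. (t, f) \<in> J \<and> f x \<noteq> 0" for x using loc[of x] by (auto simp: J_def)
  ultimately obtain N where N: "N \<ge> 0" "\<And>q. q \<in> forms N \<Longrightarrow> (N, q) \<in> J"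
    using projective_nullstellensatz by blast
  obtain t0 where t0: "\<And>t. t \<ge> t0 \<Longrightarrow> G (t + 1) \<subseteq> sv.span {smul (co k) f |k f. k \<le> 4 \<and> f \<in> G t}"
    using gmod_generated[OF G] by blast
  have gen: "G (t + int n) \<subseteq> sv.span {smul h f |h f. h \<in> forms (int n) \<and> f \<in> G t}" if t: "t \<ge> t0" for t n
  proof (induction n)
    case 0
    show ?case
    proof
      fix f assume "f \<in> G (t + int 0)"
      then have "f = smul 1 f" "f \<in> G t" by (simp_all add: fun_eq_iff)
      then show "f \<in> sv.span {smul h f |h f. h \<in> forms (int 0) \<and> f \<in> G t}"
        using forms_1 by (intro sv.span_base) auto
    qed
  next
    case (Suc n)
    let ?S = "{smul h f |h f. h \<in> forms (int (Suc n)) \<and> f \<in> G t}"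
    have "smul (co k) f \<in> sv.span ?S" if k: "k \<le> 4" and f: "f \<in> G (t + int n)" for k f
    proof -
      have "f \<in> sv.span {smul h f |h f. h \<in> forms (int n) \<and> f \<in> G t}" using Suc f by blast
      then show ?thesis
      proof (induction rule: sv.span_induct_alt)
        case base
        have "smul (co k) 0 = 0" by (simp add: fun_eq_iff)
        then show ?case using sv.span_zero by metis
      next
        case (step c x y)
        then obtain h f' where h: "h \<in> forms (int n)" "f' \<in> G t" "x = smul h f'" by blast
        have "co k * h \<in> forms (int (Suc n))" using forms_mult[OF co_in_forms[OF k] h(1)] by simp
        then have "smul (co k * h) f' \<in> sv.span ?S" using h(2) by (intro sv.span_base) blast
        then have "sscale c (smul (co k * h) f') + smul (co k) y \<in> sv.span ?S"
          by (intro sv.span_add sv.span_scale step)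
        moreover have "sscale c (smul (co k * h) f') + smul (co k) y = smul (co k) (sscale c x + y)"
          by (simp add: h fun_eq_iff algebra_simps)
        ultimately show ?case by (simp only:)
      qed
    qed
    then have "{smul (co k) f |k f. k \<le> 4 \<and> f \<in> G (t + int n)} \<subseteq> sv.span ?S" by blast
    then have "sv.span {smul (co k) f |k f. k \<le> 4 \<and> f \<in> G (t + int n)} \<subseteq> sv.span ?S"
      by (intro sv.span_minimal sv.subspace_span)
    moreover have "G (t + int n + 1) \<subseteq> sv.span {smul (co k) f |k f. k \<le> 4 \<and> f \<in> G (t + int n)}"
      using t0[of "t + int n"] t by simp
    moreover have "t + int (Suc n) = t + int n + 1" by simp
    ultimately show ?case by (simp only: subset_trans)
  qed
  have "G' t = G t" if t: "t \<ge> t0 + N" for t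
  proof (rule subset_antisym[OF sub])
    have "G (t - N + int (nat N)) \<subseteq> sv.span {smul h f |h f. h \<in> forms (int (nat N)) \<and> f \<in> G (t - N)}"
      using t by (intro gen) simp
    also have "\<dots> \<subseteq> G' t"
    proof (intro sv.span_minimal gmodD(2)[OF G'])
      show "{smul h f |h f. h \<in> forms (int (nat N)) \<and> f \<in> G (t - N)} \<subseteq> G' t"
        using N by (force simp: J_def)
    qed
    finally show "G t \<subseteq> G' t" using N(1) by simp
  qed
  then show ?thesis by blast
qed

section \<open>Sections of families of subspaces\<close>

text \<open>For a subbundle with fibres \<open>U x\<close> of the trivial bundle with basis
  \<open>R\<close>, these are the global sections of its twist by \<open>t\<close>.\<close>

definition Gam :: "'r set \<Rightarrow> (pt \<Rightarrow> ('r \<Rightarrow> complex) set) \<Rightarrow> int \<Rightarrow> ('r \<Rightarrow> pt \<Rightarrow> complex) set" where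
  "Gam R U t = {f \<in> free R t. \<forall>x. (\<lambda>r. f r x) \<in> U x}"

lemma GamD: "f \<in> Gam R U t \<Longrightarrow> f r \<in> forms t" "f \<in> Gam R U t \<Longrightarrow> r \<notin> R \<Longrightarrow> f r = 0"
  "f \<in> Gam R U t \<Longrightarrow> (\<lambda>r. f r x) \<in> U x"
  by (auto simp: Gam_def free_def)

lemma GamI: "(\<And>r. f r \<in> forms t) \<Longrightarrow> (\<And>r. r \<notin> R \<Longrightarrow> f r = 0) \<Longrightarrow> (\<And>x. (\<lambda>r. f r x) \<in> U x) \<Longrightarrow> f \<in> Gam R U t"
  by (auto simp: Gam_def free_def)

lemma gmod_Gam:
  assumes R: "finite R" and U: "\<And>x. fv.subspace (U x)"
  shows "gmod R (Gam R U)"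
  unfolding gmod_def
proof (intro conjI allI impI R)
  show "Gam R U t \<subseteq> free R t" for t by (auto simp: Gam_def)
  show "sv.subspace (Gam R U t)" for t
  proof (rule sv.subspaceI)
    show "0 \<in> Gam R U t"
      using sv.subspace_0[OF subspace_free] fv.subspace_0[OF U] by (simp add: Gam_def zero_fun_def)
  next
    fix f g assume fg: "f \<in> Gam R U t" "g \<in> Gam R U t"
    have "(\<lambda>r. (f + g) r x) = (\<lambda>r. f r x) + (\<lambda>r. g r x)" for x by (simp add: fun_eq_iff)
    then have "(\<lambda>r. (f + g) r x) \<in> U x" for x
      using fg fv.subspace_add[OF U] by (simp only: Gam_def mem_Collect_eq)
    then show "f + g \<in> Gam R U t"
      using fg sv.subspace_add[OF subspace_free] unfolding Gam_def by blast
  next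
    fix c f assume f: "f \<in> Gam R U t"
    have "(\<lambda>r. sscale c f r x) = fscale c (\<lambda>r. f r x)" for x by (simp add: fun_eq_iff)
    then have "(\<lambda>r. sscale c f r x) \<in> U x" for x
      using f fv.subspace_scale[OF U] by (simp only: Gam_def mem_Collect_eq)
    then show "sscale c f \<in> Gam R U t"
      using f sv.subspace_scale[OF subspace_free] unfolding Gam_def by blast
  qed
  fix t s f h assume f: "f \<in> Gam R U t" and h: "h \<in> forms s"
  have "(\<lambda>r. smul h f r x) = fscale (h x) (\<lambda>r. f r x)" for x by (simp add: fun_eq_iff)
  then have "(\<lambda>r. smul h f r x) \<in> U x" for x
    using f fv.subspace_scale[OF U] by (simp only: Gam_def mem_Collect_eq)
  then show "smul h f \<in> Gam R U (t + s)"
    using smul_forms[OF GamD(1)[OF f] h] GamD(2)[OF f] by (intro GamI) (auto simp: fun_eq_iff)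
qed

text \<open>This stands in for the vanishing of first cohomology in large degrees: if sections lift
  near each point at the cost of a denominator \<open>q\<close>, they lift globally in large
  degrees, and dimensions add as in an exact sequence. The integer \<open>a\<close> is the twist of
  the target.\<close>

lemma gmod_exact:
  fixes T :: "('r \<Rightarrow> pt \<Rightarrow> complex) \<Rightarrow> ('s \<Rightarrow> pt \<Rightarrow> complex)"
  assumes G: "gmod R G" and H: "gmod R' H"
    and add: "\<And>f g. T (f + g) = T f + T g" and smul: "\<And>h f. T (smul h f) = smul h (T f)"
    and map: "\<And>t f. f \<in> G t \<Longrightarrow> T f \<in> H (t + a)"
    and loc: "\<And>x. \<exists>d q. q \<in> forms d \<and> q x \<noteq> 0 \<and> (\<forall>t. \<forall>g\<in>H t. \<exists>f\<in>G (t + d - a). T f = smul q g)"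
  shows "\<exists>t0. \<forall>t\<ge>t0. T ` G t = H (t + a) \<and>
    sv.dim (G t) = sv.dim {f \<in> G t. T f = 0} + sv.dim (H (t + a))"
proof -
  have scale: "T (sscale c f) = sscale c (T f)" for c f
  proof -
    have "sscale c f = smul (\<lambda>_. c) f" "sscale c (T f) = smul (\<lambda>_. c) (T f)" by (simp_all add: fun_eq_iff)
    then show ?thesis by (simp only: smul)
  qed
  define G' where "G' t = T ` G (t - a)" for t
  have "gmod R' G'"
    unfolding gmod_def
  proof (intro conjI allI impI)
    show "finite R'" by (rule gmodD(1)[OF H])
    show "sv.subspace (G' t)" for t
    proof (rule sv.subspaceI)
      have "T 0 = 0" using scale[of 0 0] by simp
      then show "0 \<in> G' t" unfolding G'_def using sv.subspace_0[OF gmodD(2)[OF G]] by (metis imageI)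
    next
      fix x y assume "x \<in> G' t" "y \<in> G' t"
      then show "x + y \<in> G' t" unfolding G'_def
        using sv.subspace_add[OF gmodD(2)[OF G]] by (auto simp: add[symmetric])
    next
      fix c x assume "x \<in> G' t"
      then show "sscale c x \<in> G' t" unfolding G'_def
        using sv.subspace_scale[OF gmodD(2)[OF G]] by (auto simp: scale[symmetric])
    qed
    show "G' t \<subseteq> free R' t" for t
      using map[of _ "t - a"] gmodD(6)[OF H, of t] by (force simp: G'_def)
    show "smul h f \<in> G' (t + s)" if "f \<in> G' t" "h \<in> forms s" for t s f h
    proof -
      obtain f' where f': "f' \<in> G (t - a)" "f = T f'" using \<open>f \<in> G' t\<close> by (auto simp: G'_def)
      have "smul h f' \<in> G (t - a + s)" by (rule gmodD(5)[OF G f'(1) \<open>h \<in> forms s\<close>])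
      moreover have "t - a + s = t + s - a" by simp
      ultimately have "smul h f' \<in> G (t + s - a)" by (simp only:)
      then show ?thesis unfolding G'_def f'(2) smul[symmetric] by (rule imageI)
    qed
  qed
  moreover have "G' t \<subseteq> H t" for t using map[of _ "t - a"] by (auto simp: G'_def)
  moreover have "\<exists>d q. q \<in> forms d \<and> q x \<noteq> 0 \<and> (\<forall>t. \<forall>f\<in>H t. smul q f \<in> G' (t + d))" for x
  proof -
    obtain d q where q: "q \<in> forms d" "q x \<noteq> 0" and l: "\<And>t g. g \<in> H t \<Longrightarrow> \<exists>f\<in>G (t + d - a). T f = smul q g"
      using loc[of x] by blast
    have "smul q g \<in> G' (t + d)" if "g \<in> H t" for t g
      using l[OF that] unfolding G'_def by (metis imageI)
    then show ?thesis using q by blast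
  qed
  ultimately obtain t0 where t0: "\<And>t. t \<ge> t0 \<Longrightarrow> G' t = H t"
    using gmod_local_global[OF H, of G'] by blast
  have "T ` G t = H (t + a) \<and> sv.dim (G t) = sv.dim {f \<in> G t. T f = 0} + sv.dim (H (t + a))"
    if "t \<ge> t0 - a" for t
  proof -
    have im: "T ` G t = H (t + a)" using t0[of "t + a"] that by (simp add: G'_def)
    obtain S where "finite S" "G t \<subseteq> sv.span S" using gmodD(7)[OF G] by blast
    from sv_dim_split[OF gmodD(2)[OF G] this(2,1) add scale] show ?thesis by (simp add: im)
  qed
  then show ?thesis by blast
qed

definition pair_with :: "'r set \<Rightarrow> ('r \<Rightarrow> pt \<Rightarrow> complex) \<Rightarrow> ('r \<Rightarrow> pt \<Rightarrow> complex) \<Rightarrow> pt \<Rightarrow> complex" where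
  "pair_with R l f = (\<lambda>x. \<Sum>r\<in>R. l r x * f r x)"

lemma pair_with_forms:
  assumes "\<And>r. l r \<in> forms e" "\<And>r. f r \<in> forms t" shows "pair_with R l f \<in> forms (t + e)"
proof -
  have "pair_with R l f = (\<Sum>r\<in>R. f r * l r)" by (simp add: pair_with_def fun_eq_iff fun_sum_apply mult.commute)
  also have "\<dots> \<in> forms (t + e)" by (intro forms_sum forms_mult assms)
  finally show ?thesis .
qed

lemma forms_eq_generic:
  assumes "f \<in> forms t" "g \<in> forms t" "q \<in> forms d" "q \<noteq> 0" "\<And>x. q x \<noteq> 0 \<Longrightarrow> f x = g x"
  shows "f = g"
proof (rule forms_mult_left_cancel[OF assms(3,4,1,2)])
  show "q * f = q * g" using assms(5) by (auto simp: fun_eq_iff)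
qed

text \<open>A quotient of rank one of a family of subspaces is a line bundle on projective space, hence
  some \<open>\<O>(a)\<close>: one local functional, divided by the common factor of its values, works everywhere.\<close>

lemma line_quotient:
  assumes U: "\<And>x. fv.subspace (U x)"
    and loc: "\<And>x1. \<exists>e l d q. (\<forall>r. l r \<in> forms e) \<and> q \<in> forms d \<and> q x1 \<noteq> 0 \<and>
       (\<forall>x. q x \<noteq> 0 \<longrightarrow> (\<forall>u\<in>U x. u \<in> U' x \<longleftrightarrow> (\<Sum>r\<in>R. l r x * u r) = 0))"
    and gen: "\<And>x1. \<exists>t. \<exists>f\<in>Gam R U t. (\<lambda>r. f r x1) \<notin> U' x1"
  shows "\<exists>a y. (\<forall>x. \<forall>u\<in>U x. u \<in> U' x \<longleftrightarrow> (\<Sum>r\<in>R. y r x * u r) = 0) \<and>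
     (\<forall>t. \<forall>f\<in>Gam R U t. pair_with R y f \<in> forms (t + a))"
proof -
  define x0 :: pt where "x0 = undefined"
  obtain e0 l0 d0 q0 where l0: "\<And>r. l0 r \<in> forms e0" and q0: "q0 \<in> forms d0" "q0 x0 \<noteq> 0"
    and U'0: "\<And>x u. q0 x \<noteq> 0 \<Longrightarrow> u \<in> U x \<Longrightarrow> u \<in> U' x \<longleftrightarrow> (\<Sum>r\<in>R. l0 r x * u r) = 0"
    using loc[of x0] by blast
  define L0 where "L0 = pair_with R l0"
  have L0: "L0 f \<in> forms (t + e0)" if "f \<in> Gam R U t" for f t
    unfolding L0_def by (intro pair_with_forms l0 GamD(1)[OF that])
  obtain t0 f0 where f0: "f0 \<in> Gam R U t0" "(\<lambda>r. f0 r x0) \<notin> U' x0" using gen by blast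
  have f0nz: "L0 f0 \<noteq> 0"
    using U'0[OF q0(2) GamD(3)[OF f0(1)]] f0(2) by (auto simp: L0_def pair_with_def fun_eq_iff)
  \<comment> \<open>Two functionals with the same kernel are proportional. This cross relation holds
    where both local descriptions are valid, hence everywhere.\<close>
  have key: "pair_with R l1 f1 * L0 f = pair_with R l1 f * L0 f1"
    if l1: "\<And>r. l1 r \<in> forms e1" and q1: "q1 \<in> forms d1" "q1 x1 \<noteq> 0"
      and U'1: "\<forall>x u. q1 x \<noteq> 0 \<longrightarrow> u \<in> U x \<longrightarrow> u \<in> U' x \<longleftrightarrow> (\<Sum>r\<in>R. l1 r x * u r) = 0"
      and f1: "f1 \<in> Gam R U t1" and f: "f \<in> Gam R U t"
    for l1 e1 q1 d1 x1 f1 t1 f t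
  proof (rule forms_eq_generic)
    have "pair_with R l1 f1 * L0 f \<in> forms ((t1 + e1) + (t + e0))"
      by (intro forms_mult pair_with_forms l1 GamD(1)[OF f1] L0[OF f])
    then show "pair_with R l1 f1 * L0 f \<in> forms (t1 + e1 + t + e0)" by (simp only: add.assoc)
    have "pair_with R l1 f * L0 f1 \<in> forms ((t + e1) + (t1 + e0))"
      by (intro forms_mult pair_with_forms l1 GamD(1)[OF f] L0[OF f1])
    moreover have "(t + e1) + (t1 + e0) = t1 + e1 + t + e0" by simp
    ultimately show "pair_with R l1 f * L0 f1 \<in> forms (t1 + e1 + t + e0)" by (simp only:)
    show "q0 * q1 \<in> forms (d0 + d1)" by (rule forms_mult[OF q0(1) q1(1)])
    show "q0 * q1 \<noteq> 0" using forms_no_zero_divisors[OF q0(1) q1(1)] q0(2) q1(2) by auto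
    fix x assume "(q0 * q1) x \<noteq> 0"
    then have q: "q0 x \<noteq> 0" "q1 x \<noteq> 0" by auto
    \<comment> \<open>\<open>l1\<close> kills \<open>u\<close> by construction, so \<open>u\<close>
      lies in \<open>U' x\<close> and \<open>l0\<close> kills it as well.\<close>
    define u where "u = fscale (pair_with R l1 f1 x) (\<lambda>r. f r x) - fscale (pair_with R l1 f x) (\<lambda>r. f1 r x)"
    have uU: "u \<in> U x" unfolding u_def
      by (intro fv.subspace_diff fv.subspace_scale U GamD(3)[OF f] GamD(3)[OF f1])
    have ev: "(\<Sum>r\<in>R. l r x * u r) = pair_with R l1 f1 x * pair_with R l f x - pair_with R l1 f x * pair_with R l f1 x" for l
      by (simp add: u_def pair_with_def right_diff_distrib sum_subtractf sum_distrib_left mult.left_commute)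
    have "(\<Sum>r\<in>R. l1 r x * u r) = 0" by (simp add: ev)
    then have "u \<in> U' x" using U'1 q(2) uU by blast
    then have "(\<Sum>r\<in>R. l0 r x * u r) = 0" using U'0[OF q(1) uU] by simp
    then show "(pair_with R l1 f1 * L0 f) x = (pair_with R l1 f * L0 f1) x" by (simp add: ev L0_def)
  qed
  \<comment> \<open>The values of one local functional on sections, indexed by their own degree. By
    \<open>key\<close> this family is locally principal.\<close>
  define I where "I s = L0 ` Gam R U (s - e0)" for s
  have loc1: "\<exists>e1 l1 q1 d1 t1 f1. (\<forall>r. l1 r \<in> forms e1) \<and> q1 \<in> forms d1 \<and> q1 x1 \<noteq> 0 \<and>
     (\<forall>x u. q1 x \<noteq> 0 \<longrightarrow> u \<in> U x \<longrightarrow> u \<in> U' x \<longleftrightarrow> (\<Sum>r\<in>R. l1 r x * u r) = 0) \<and>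
     f1 \<in> Gam R U t1 \<and> pair_with R l1 f1 x1 \<noteq> 0" for x1
  proof -
    obtain e1 l1 d1 q1 where l1: "\<forall>r. l1 r \<in> forms e1" and q1: "q1 \<in> forms d1" "q1 x1 \<noteq> 0"
      and U'1: "\<forall>x u. q1 x \<noteq> 0 \<longrightarrow> u \<in> U x \<longrightarrow> u \<in> U' x \<longleftrightarrow> (\<Sum>r\<in>R. l1 r x * u r) = 0"
      using loc[of x1] by blast
    obtain t1 f1 where f1: "f1 \<in> Gam R U t1" "(\<lambda>r. f1 r x1) \<notin> U' x1" using gen by blast
    have "pair_with R l1 f1 x1 \<noteq> 0"
      using U'1 q1(2) GamD(3)[OF f1(1)] f1(2) by (auto simp: pair_with_def)
    with l1 q1 U'1 f1(1) show ?thesis by blast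
  qed
  have loc2: "\<exists>s q b g. q \<in> forms s \<and> q x1 \<noteq> 0 \<and> g \<in> I b \<and>
      (\<forall>t. \<forall>f\<in>I t. \<exists>k\<in>forms (s + t - b). q * f = g * k)" for x1
  proof -
    obtain e1 l1 q1 d1 t1 f1 where l1: "\<And>r. l1 r \<in> forms e1" and q1: "q1 \<in> forms d1" "q1 x1 \<noteq> 0"
      and U'1: "\<forall>x u. q1 x \<noteq> 0 \<longrightarrow> u \<in> U x \<longrightarrow> u \<in> U' x \<longleftrightarrow> (\<Sum>r\<in>R. l1 r x * u r) = 0"
      and f1: "f1 \<in> Gam R U t1" "pair_with R l1 f1 x1 \<noteq> 0" using loc1[of x1] by blast
    show ?thesis
    proof (intro exI conjI allI ballI)
      show "pair_with R l1 f1 \<in> forms (t1 + e1)" by (intro pair_with_forms l1 GamD(1)[OF f1(1)])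
      show "pair_with R l1 f1 x1 \<noteq> 0" by (rule f1(2))
      show "L0 f1 \<in> I (t1 + e0)" using f1(1) by (auto simp: I_def)
      fix t F assume "F \<in> I t"
      then obtain f where f: "f \<in> Gam R U (t - e0)" "F = L0 f" by (auto simp: I_def)
      have "pair_with R l1 f \<in> forms (t - e0 + e1)" by (intro pair_with_forms l1 GamD(1)[OF f(1)])
      moreover have "t - e0 + e1 = t1 + e1 + t - (t1 + e0)" by simp
      ultimately have "pair_with R l1 f \<in> forms (t1 + e1 + t - (t1 + e0))" by (simp only:)
      moreover have "pair_with R l1 f1 * F = L0 f1 * pair_with R l1 f"
        using key[OF l1 q1 U'1 f1(1) f(1)] f(2) by (metis mult.commute)
      ultimately show "\<exists>k\<in>forms (t1 + e1 + t - (t1 + e0)). pair_with R l1 f1 * F = L0 f1 * k" by blast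
    qed
  qed
  have IF: "F \<in> forms s" if "F \<in> I s" for s F
    using that L0[of _ "s - e0"] by (auto simp: I_def)
  have I0: "L0 f0 \<in> I (t0 + e0)" using f0(1) by (auto simp: I_def)
  obtain \<delta> D where D: "D \<in> forms \<delta>" "D \<noteq> 0"
    "\<And>t f. f \<in> I t \<Longrightarrow> \<exists>k\<in>forms (t - \<delta>). f = D * k"
    "\<And>x. \<exists>t f k. f \<in> I t \<and> k \<in> forms (t - \<delta>) \<and> f = D * k \<and> k x \<noteq> 0"
  proof (rule ex_common_factor[of I "L0 f0" "t0 + e0"])
    show "f \<in> forms t" if "f \<in> I t" for f t by (rule IF[OF that])
    show "\<exists>s q b g. q \<in> forms s \<and> q x \<noteq> 0 \<and> g \<in> I b \<and>
      (\<forall>t. \<forall>f\<in>I t. \<exists>k\<in>forms (s + t - b). q * f = g * k)" for x by (rule loc2)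
  qed (use I0 f0nz that in blast)+
  define a where "a = e0 - \<delta>"
  have "\<exists>k\<in>forms (t + a). L0 f = D * k" if "f \<in> Gam R U t" for f t
  proof -
    have "L0 f \<in> I (t + e0)" using that by (auto simp: I_def)
    from D(3)[OF this] show ?thesis by (simp add: a_def algebra_simps)
  qed
  \<comment> \<open>A section may count in several degrees only if its value under \<open>L0\<close>
    is zero; the quotient by \<open>D\<close> can therefore be chosen independently of the
    degree.\<close>
  then have "\<forall>f. \<exists>k. (\<forall>t. f \<in> Gam R U t \<longrightarrow> k \<in> forms (t + a)) \<and> ((\<exists>t. f \<in> Gam R U t) \<longrightarrow> L0 f = D * k)"
  proof (intro allI)
    fix f
    assume h: "\<And>f t. f \<in> Gam R U t \<Longrightarrow> \<exists>k\<in>forms (t + a). L0 f = D * k"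
    show "\<exists>k. (\<forall>t. f \<in> Gam R U t \<longrightarrow> k \<in> forms (t + a)) \<and> ((\<exists>t. f \<in> Gam R U t) \<longrightarrow> L0 f = D * k)"
    proof (cases "\<exists>t. f \<in> Gam R U t")
      case True
      then obtain s where s: "f \<in> Gam R U s" by blast
      obtain k where k: "k \<in> forms (s + a)" "L0 f = D * k" using h[OF s] by blast
      have "k \<in> forms (t + a)" if t: "f \<in> Gam R U t" for t
      proof -
        obtain k' where k': "k' \<in> forms (t + a)" "L0 f = D * k'" using h[OF t] by blast
        show ?thesis
        proof (cases "k' = 0")
          case True
          then have "D * k = 0" using k k' by simp
          then have "k = 0" using forms_no_zero_divisors[OF D(1) k(1)] D(2) by blast
          then show ?thesis by simp
        next
          case False
          then have "L0 f \<noteq> 0" using forms_no_zero_divisors[OF D(1) k'(1)] D(2) k'(2) by auto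
          then have "t + e0 = s + e0" by (intro forms_degree_unique[OF L0[OF t] L0[OF s]])
          then show ?thesis using k(1) by simp
        qed
      qed
      then show ?thesis using k(2) by blast
    qed blast
  qed
  then obtain \<psi> where \<psi>: "\<And>f t. f \<in> Gam R U t \<Longrightarrow> \<psi> f \<in> forms (t + a)"
    "\<And>f t. f \<in> Gam R U t \<Longrightarrow> L0 f = D * \<psi> f" by metis
  have "\<exists>y. (\<forall>u\<in>U x1. u \<in> U' x1 \<longleftrightarrow> (\<Sum>r\<in>R. y r * u r) = 0) \<and>
     (\<forall>t. \<forall>f\<in>Gam R U t. (\<Sum>r\<in>R. y r * f r x1) = \<psi> f x1)" for x1
  proof -
    obtain e1 l1 q1 d1 t1 f1 where l1: "\<And>r. l1 r \<in> forms e1" and q1: "q1 \<in> forms d1" "q1 x1 \<noteq> 0"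
      and U'1: "\<forall>x u. q1 x \<noteq> 0 \<longrightarrow> u \<in> U x \<longrightarrow> u \<in> U' x \<longleftrightarrow> (\<Sum>r\<in>R. l1 r x * u r) = 0"
      and f1: "f1 \<in> Gam R U t1" "pair_with R l1 f1 x1 \<noteq> 0" using loc1[of x1] by blast
    \<comment> \<open>The factor by which the local functional at \<open>x1\<close> has to be
      rescaled. It is nonzero because the values divided by \<open>D\<close> have no common
      zero.\<close>
    define \<kappa> where "\<kappa> = \<psi> f1 x1 / pair_with R l1 f1 x1"
    have val: "\<psi> f x1 = \<kappa> * pair_with R l1 f x1" if f: "f \<in> Gam R U t" for f t
    proof -
      have "D * (pair_with R l1 f1 * \<psi> f) = D * (pair_with R l1 f * \<psi> f1)"
        using key[OF l1 q1 U'1 f1(1) f] unfolding \<psi>(2)[OF f] \<psi>(2)[OF f1(1)] by (simp only: mult_ac)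
      then have "pair_with R l1 f1 * \<psi> f = pair_with R l1 f * \<psi> f1"
      proof (rule forms_mult_left_cancel[OF D(1,2), rotated -1])
        show "pair_with R l1 f1 * \<psi> f \<in> forms ((t1 + e1) + (t + a))"
          by (intro forms_mult pair_with_forms l1 GamD(1)[OF f1(1)] \<psi>(1)[OF f])
        have "pair_with R l1 f * \<psi> f1 \<in> forms ((t + e1) + (t1 + a))"
          by (intro forms_mult pair_with_forms l1 GamD(1)[OF f] \<psi>(1)[OF f1(1)])
        moreover have "(t + e1) + (t1 + a) = (t1 + e1) + (t + a)" by simp
        ultimately show "pair_with R l1 f * \<psi> f1 \<in> forms ((t1 + e1) + (t + a))" by (simp only:)
      qed
      from fun_cong[OF this, of x1] show ?thesis using f1(2) by (simp add: \<kappa>_def field_simps)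
    qed
    have "\<kappa> \<noteq> 0"
    proof -
      obtain t F k where F: "F \<in> I t" "k \<in> forms (t - \<delta>)" "F = D * k" "k x1 \<noteq> 0" using D(4) by blast
      obtain f where f: "f \<in> Gam R U (t - e0)" "F = L0 f" using F(1) by (auto simp: I_def)
      have "D * k = D * \<psi> f" using \<psi>(2)[OF f(1)] F(3) f(2) by simp
      then have "k = \<psi> f"
      proof (rule forms_mult_left_cancel[OF D(1,2) F(2), rotated])
        show "\<psi> f \<in> forms (t - \<delta>)" using \<psi>(1)[OF f(1)] by (simp add: a_def)
      qed
      then show ?thesis using val[OF f(1)] F(4) by auto
    qed
    show ?thesis
    proof (intro exI[of _ "\<lambda>r. \<kappa> * l1 r x1"] conjI ballI allI)
      fix u assume "u \<in> U x1"
      then have "u \<in> U' x1 \<longleftrightarrow> (\<Sum>r\<in>R. l1 r x1 * u r) = 0" using U'1 q1(2) by blast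
      then show "u \<in> U' x1 \<longleftrightarrow> (\<Sum>r\<in>R. \<kappa> * l1 r x1 * u r) = 0"
        using \<open>\<kappa> \<noteq> 0\<close> by (simp add: mult.assoc sum_distrib_left[symmetric])
    next
      fix t f assume f: "f \<in> Gam R U t"
      show "(\<Sum>r\<in>R. \<kappa> * l1 r x1 * f r x1) = \<psi> f x1"
        unfolding val[OF f] pair_with_def by (simp add: mult.assoc sum_distrib_left)
    qed
  qed
  then obtain y where y: "\<And>x1 u. u \<in> U x1 \<Longrightarrow> u \<in> U' x1 \<longleftrightarrow> (\<Sum>r\<in>R. y x1 r * u r) = 0"
     "\<And>x1 t f. f \<in> Gam R U t \<Longrightarrow> (\<Sum>r\<in>R. y x1 r * f r x1) = \<psi> f x1" by metis
  have "pair_with R (\<lambda>r x. y x r) f \<in> forms (t + a)" if "f \<in> Gam R U t" for t f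
  proof -
    have "pair_with R (\<lambda>r x. y x r) f = \<psi> f" using y(2)[OF that] by (simp add: pair_with_def fun_eq_iff)
    then show ?thesis using \<psi>(1)[OF that] by simp
  qed
  then show ?thesis using y(1) by (intro exI[of _ a] exI[of _ "\<lambda>r x. y x r"]) auto
qed

section \<open>Hilbert functions of a framed flag\<close>

text \<open>The columns of \<open>W\<close> form a frame of a flag with a gap at \<open>i\<close> wherever \<open>q\<close> does not vanish,
  and \<open>Y\<close> is \<open>q\<close> times the inverse of \<open>W\<close>.\<close>

definition is_frame :: "nat \<Rightarrow> nat \<Rightarrow> (nat \<Rightarrow> pt \<Rightarrow> (nat \<Rightarrow> complex) set) \<Rightarrow> int \<Rightarrow> int \<Rightarrow>
    (nat \<Rightarrow> nat \<Rightarrow> pt \<Rightarrow> complex) \<Rightarrow> (nat \<Rightarrow> nat \<Rightarrow> pt \<Rightarrow> complex) \<Rightarrow> (pt \<Rightarrow> complex) \<Rightarrow> bool" where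
  "is_frame n i V e e' W Y q \<longleftrightarrow>
     (\<forall>r c. W r c \<in> forms e) \<and> (\<forall>r c. Y r c \<in> forms e') \<and> q \<in> forms (e + e') \<and>
     (\<forall>r c. n \<le> r \<longrightarrow> W r c = 0) \<and>
     (\<forall>x. \<forall>r<n. \<forall>c<n. (\<Sum>k<n. W r k x * Y k c x) = (if r = c then q x else 0)) \<and>
     (\<forall>x. \<forall>r<n. \<forall>c<n. (\<Sum>k<n. Y r k x * W k c x) = (if r = c then q x else 0)) \<and>
     (\<forall>x. q x \<noteq> 0 \<longrightarrow> (\<forall>j\<le>n. j \<noteq> i \<longrightarrow>
        V j x = {v. (\<forall>r\<ge>n. v r = 0) \<and> (\<forall>r. j \<le> r \<longrightarrow> r < n \<longrightarrow> (\<Sum>s<n. Y r s x * v s) = 0)}))"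

text \<open>All that the argument up to the constancy of the flag uses of a morphism to
  \<open>G/P\<close>: a family of subspaces that has a polynomial frame near each point.\<close>

locale framed_flag =
  fixes n i :: nat and V :: "nat \<Rightarrow> pt \<Rightarrow> (nat \<Rightarrow> complex) set"
  assumes i: "1 \<le> i" "i < n"
    and frame: "\<And>x. \<exists>e e' W Y q. is_frame n i V e e' W Y q \<and> q x \<noteq> 0"
begin

lemma frameD:
  assumes "is_frame n i V e e' W Y q"
  shows "W r c \<in> forms e" "Y r c \<in> forms e'" "q \<in> forms (e + e')" "n \<le> r \<Longrightarrow> W r c = 0"
    "r < n \<Longrightarrow> c < n \<Longrightarrow> (\<Sum>k<n. W r k x * Y k c x) = (if r = c then q x else 0)"
    "r < n \<Longrightarrow> c < n \<Longrightarrow> (\<Sum>k<n. Y r k x * W k c x) = (if r = c then q x else 0)"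
    "q x \<noteq> 0 \<Longrightarrow> j \<le> n \<Longrightarrow> j \<noteq> i \<Longrightarrow>
      v \<in> V j x \<longleftrightarrow> (\<forall>r\<ge>n. v r = 0) \<and> (\<forall>r. j \<le> r \<longrightarrow> r < n \<longrightarrow> (\<Sum>s<n. Y r s x * v s) = 0)"
  using assms unfolding is_frame_def by auto

lemma V_iff: "j \<le> n \<Longrightarrow> j \<noteq> i \<Longrightarrow> \<exists>Y. \<forall>v. v \<in> V j x \<longleftrightarrow>
    (\<forall>r\<ge>n. v r = 0) \<and> (\<forall>r. j \<le> r \<longrightarrow> r < n \<longrightarrow> (\<Sum>s<n. Y r s * v s) = 0)"
proof -
  assume j: "j \<le> n" "j \<noteq> i"
  obtain e e' W Y q where F: "is_frame n i V e e' W Y q" "q x \<noteq> 0" using frame by blast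
  show ?thesis by (rule exI[of _ "\<lambda>r s. Y r s x"]) (simp add: frameD(7)[OF F j])
qed

lemma V_subspace: assumes j: "j \<le> n" "j \<noteq> i" shows "fv.subspace (V j x)"
proof -
  obtain Y where Y: "\<And>v. v \<in> V j x \<longleftrightarrow>
    (\<forall>r\<ge>n. v r = 0) \<and> (\<forall>r. j \<le> r \<longrightarrow> r < n \<longrightarrow> (\<Sum>s<n. Y r s * v s) = 0)" using V_iff[OF j, of x] by blast
  have "(\<Sum>s<n. Y r s * (c * v s)) = c * (\<Sum>s<n. Y r s * v s)" for r c v
    by (simp add: sum_distrib_left mult.left_commute)
  then show ?thesis by (intro fv.subspaceI) (auto simp: Y algebra_simps sum.distrib)
qed

lemma V_supp: "j \<le> n \<Longrightarrow> j \<noteq> i \<Longrightarrow> v \<in> V j x \<Longrightarrow> n \<le> r \<Longrightarrow> v r = 0"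
  using V_iff[of j x] by blast

lemma V_mono: assumes "j \<le> k" "k \<le> n" "j \<noteq> i" "k \<noteq> i" "v \<in> V j x" shows "v \<in> V k x"
proof -
  obtain e e' W Y q where F: "is_frame n i V e e' W Y q" "q x \<noteq> 0" using frame by blast
  show ?thesis using assms by (simp add: frameD(7)[OF F])
qed

lemma V_n: "v \<in> V n x \<longleftrightarrow> (\<forall>r\<ge>n. v r = 0)"
  using V_iff[of n x] i by auto

lemma frame_expand:
  assumes F: "is_frame n i V e e' W Y q" and v: "\<forall>r\<ge>n. v r = 0"
  shows "(\<Sum>c<n. W r c x * (\<Sum>s<n. Y c s x * v s)) = q x * v r"
proof (cases "r < n")
  case True
  have "(\<Sum>c<n. W r c x * (\<Sum>s<n. Y c s x * v s)) = (\<Sum>s<n. (\<Sum>c<n. W r c x * Y c s x) * v s)"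
    unfolding sum_distrib_left sum_distrib_right by (subst sum.swap) (simp add: mult.assoc)
  also have "\<dots> = (\<Sum>s<n. (if r = s then q x else 0) * v s)"
    using True by (intro sum.cong) (auto simp: frameD(5)[OF F])
  also have "\<dots> = q x * v r" using True by (simp add: if_distrib[of "\<lambda>z. z * _"] cong: if_cong)
  finally show ?thesis .
qed (use v frameD(4)[OF F] in simp)

lemma V_0: assumes "v \<in> V 0 x" shows "v = 0"
proof -
  obtain e e' W Y q where F: "is_frame n i V e e' W Y q" "q x \<noteq> 0" using frame by blast
  have v: "\<forall>r\<ge>n. v r = 0" "\<And>r. r < n \<Longrightarrow> (\<Sum>s<n. Y r s x * v s) = 0"
    using assms frameD(7)[OF F, of 0] i by auto
  have "q x * v r = 0" for r using frame_expand[OF F(1) v(1), of r x] v(2) by simp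
  then show ?thesis using F(2) by (auto simp: fun_eq_iff)
qed

lemma frame_col:
  assumes F: "is_frame n i V e e' W Y q" and j: "j \<le> n" "j \<noteq> i" "c < j" and x: "q x \<noteq> 0"
  shows "(\<lambda>r. W r c x) \<in> V j x"
  using frameD(6)[OF F, of _ c x] frameD(4)[OF F] j by (auto simp: frameD(7)[OF F x j(1,2)])

text \<open>The factor \<open>q\<close> makes the column vanish where the frame degenerates, so that
  it lies in \<open>V j\<close> at every point.\<close>

lemma frame_col_section:
  assumes F: "is_frame n i V e e' W Y q" and j: "j \<le> n" "j \<noteq> i" "c < j"
  shows "(\<lambda>r. W r c * q) \<in> Gam {..<n} (V j) (e + (e + e'))"
proof (rule GamI)
  show "W r c * q \<in> forms (e + (e + e'))" for r by (intro forms_mult frameD[OF F])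
  show "W r c * q = 0" if "r \<notin> {..<n}" for r
  proof -
    have "W r c = 0" using that frameD(4)[OF F] by simp
    then show ?thesis by (simp only: mult_zero_left)
  qed
  show "(\<lambda>r. (W r c * q) x) \<in> V j x" for x
  proof (cases "q x = 0")
    case True
    then show ?thesis using fv.subspace_0[OF V_subspace[OF j(1,2)], of x] by (simp add: zero_fun_def)
  next
    case False
    from fv.subspace_scale[OF V_subspace[OF j(1,2)] frame_col[OF F j False], of "q x"]
    show ?thesis by (simp add: fscale_def mult.commute)
  qed
qed

lemma frame_col_pair:
  assumes F: "is_frame n i V e e' W Y q" and "k < n" "c < n"
  shows "(\<Sum>r<n. Y k r x * (W r c * q) x) = (if k = c then q x * q x else 0)"
proof -
  have "(\<Sum>r<n. Y k r x * (W r c * q) x) = (\<Sum>r<n. Y k r x * W r c x) * q x"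
    by (simp add: sum_distrib_right mult.assoc)
  then show ?thesis using frameD(6)[OF F assms(2,3)] by simp
qed

text \<open>The indices \<open>k\<close> for which \<open>V (k + 1) / V k\<close> is a line of the
  flag: the gap \<open>i\<close> is neither \<open>k\<close> nor \<open>k + 1\<close>.\<close>

definition cols :: "nat set" where "cols = {..<n} - {i - 1, i}"

lemma cols: "k \<in> cols \<Longrightarrow> k < n \<and> k \<noteq> i \<and> k + 1 \<noteq> i \<and> k + 1 \<le> n"
  by (auto simp: cols_def)

section \<open>Line quotients of the flag and their Hilbert functions\<close>

lemma line_functional:
  assumes k: "k \<in> cols"
  shows "\<exists>a y. (\<forall>x. \<forall>u\<in>V (k + 1) x. u \<in> V k x \<longleftrightarrow> (\<Sum>r<n. y r x * u r) = 0) \<and>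
     (\<forall>t. \<forall>f\<in>Gam {..<n} (V (k + 1)) t. pair_with {..<n} y f \<in> forms (t + a))"
proof (rule line_quotient)
  note kc = cols[OF k]
  show "fv.subspace (V (k + 1) x)" for x using kc by (intro V_subspace) auto
  fix x
  obtain e e' W Y q where F: "is_frame n i V e e' W Y q" "q x \<noteq> 0" using frame by blast
  have "u \<in> V k z \<longleftrightarrow> (\<Sum>r<n. Y k r z * u r) = 0" if "q z \<noteq> 0" "u \<in> V (k + 1) z" for z u
  proof -
    have u: "\<forall>r\<ge>n. u r = 0" "\<forall>r. k + 1 \<le> r \<longrightarrow> r < n \<longrightarrow> (\<Sum>s<n. Y r s z * u s) = 0"
      using frameD(7)[OF F(1) that(1), of "k + 1" u] that(2) kc by simp_all
    have "(\<forall>r. k \<le> r \<longrightarrow> r < n \<longrightarrow> (\<Sum>s<n. Y r s z * u s) = 0) \<longleftrightarrow> (\<Sum>s<n. Y k s z * u s) = 0"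
    proof
      assume k0: "(\<Sum>s<n. Y k s z * u s) = 0"
      show "\<forall>r. k \<le> r \<longrightarrow> r < n \<longrightarrow> (\<Sum>s<n. Y r s z * u s) = 0"
      proof (intro allI impI)
        fix r assume "k \<le> r" "r < n"
        then show "(\<Sum>s<n. Y r s z * u s) = 0" using k0 u(2) by (cases "r = k") auto
      qed
    qed (use kc in blast)
    then show ?thesis using frameD(7)[OF F(1) that(1), of k u] u(1) kc by simp
  qed
  then show "\<exists>e l d q. (\<forall>r. l r \<in> forms e) \<and> q \<in> forms d \<and> q x \<noteq> 0 \<and>
      (\<forall>x. q x \<noteq> 0 \<longrightarrow> (\<forall>u\<in>V (k + 1) x. (u \<in> V k x) = ((\<Sum>r<n. l r x * u r) = 0)))"
    using frameD(2)[OF F(1), of k] frameD(3)[OF F(1)] F(2)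
    by (intro exI[of _ e'] exI[of _ "Y k"] exI[of _ "e + e'"] exI[of _ q]) auto
  have "(\<lambda>r. (W r k * q) x) \<notin> V k x"
    using frame_col_pair[OF F(1), of k k x] kc F(2) frameD(7)[OF F, of k "\<lambda>r. (W r k * q) x"] by auto
  moreover have "(\<lambda>r. W r k * q) \<in> Gam {..<n} (V (k + 1)) (e + (e + e'))"
    using kc by (intro frame_col_section[OF F(1)]) auto
  ultimately show "\<exists>t. \<exists>f\<in>Gam {..<n} (V (k + 1)) t. (\<lambda>r. f r x) \<notin> V k x"
    by (intro exI bexI)
qed

text \<open>The functional \<open>psi k\<close> identifies \<open>V (k + 1) / V k\<close> with the
  line bundle of degree \<open>deg k\<close>. It is chosen pointwise: only its values on sections,
  and not its entries, are known to be forms.\<close>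

definition lf :: "nat \<Rightarrow> int \<times> (nat \<Rightarrow> pt \<Rightarrow> complex)" where
  "lf k = (SOME (a, y). (\<forall>x. \<forall>u\<in>V (k + 1) x. u \<in> V k x \<longleftrightarrow> (\<Sum>r<n. y r x * u r) = 0) \<and>
     (\<forall>t. \<forall>f\<in>Gam {..<n} (V (k + 1)) t. pair_with {..<n} y f \<in> forms (t + a)))"

definition deg :: "nat \<Rightarrow> int" where "deg k = fst (lf k)"

definition psi :: "nat \<Rightarrow> nat \<Rightarrow> pt \<Rightarrow> complex" where "psi k = snd (lf k)"

lemma psi:
  assumes k: "k \<in> cols"
  shows "u \<in> V (k + 1) x \<Longrightarrow> u \<in> V k x \<longleftrightarrow> (\<Sum>r<n. psi k r x * u r) = 0"
    and "f \<in> Gam {..<n} (V (k + 1)) t \<Longrightarrow> pair_with {..<n} (psi k) f \<in> forms (t + deg k)"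
proof -
  let ?P = "\<lambda>(a, y). (\<forall>x. \<forall>u\<in>V (k + 1) x. u \<in> V k x \<longleftrightarrow> (\<Sum>r<n. y r x * u r) = 0) \<and>
     (\<forall>t. \<forall>f\<in>Gam {..<n} (V (k + 1)) t. pair_with {..<n} y f \<in> forms (t + a))"
  have "\<exists>z. ?P z" using line_functional[OF k] by auto
  then have "?P (lf k)" unfolding lf_def by (rule someI_ex)
  then have P: "?P (deg k, psi k)" by (simp add: deg_def psi_def case_prod_unfold)
  show "u \<in> V (k + 1) x \<Longrightarrow> u \<in> V k x \<longleftrightarrow> (\<Sum>r<n. psi k r x * u r) = 0" using P by simp
  show "f \<in> Gam {..<n} (V (k + 1)) t \<Longrightarrow> pair_with {..<n} (psi k) f \<in> forms (t + deg k)" using P by simp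
qed

lemma psi_nonzero_section:
  assumes k: "k \<in> cols"
  obtains t f where "f \<in> Gam {..<n} (V (k + 1)) t" "pair_with {..<n} (psi k) f x \<noteq> 0"
proof -
  note kc = cols[OF k]
  obtain e e' W Y q where F: "is_frame n i V e e' W Y q" "q x \<noteq> 0" using frame by blast
  have f: "(\<lambda>r. W r k * q) \<in> Gam {..<n} (V (k + 1)) (e + (e + e'))"
    using kc by (intro frame_col_section[OF F(1)]) auto
  have "(\<lambda>r. (W r k * q) x) \<notin> V k x"
    using frame_col_pair[OF F(1), of k k x] kc F(2) frameD(7)[OF F, of k "\<lambda>r. (W r k * q) x"] by auto
  then have "pair_with {..<n} (psi k) (\<lambda>r. W r k * q) x \<noteq> 0"
    using psi(1)[OF k GamD(3)[OF f, of x]] by (simp add: pair_with_def)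
  then show thesis by (rule that[OF f])
qed

definition hV :: "nat \<Rightarrow> int \<Rightarrow> nat" where "hV j t = sv.dim (Gam {..<n} (V j) t)"

definition H :: "int \<Rightarrow> nat" where "H t = card (expo t)"

lemma gmod_V: "j \<le> n \<Longrightarrow> j \<noteq> i \<Longrightarrow> gmod {..<n} (Gam {..<n} (V j))"
  by (intro gmod_Gam V_subspace) auto

lemma pair_with_add: "pair_with R l (f + g) = pair_with R l f + pair_with R l g"
  by (simp add: pair_with_def fun_eq_iff distrib_left sum.distrib)

lemma pair_with_smul: "pair_with R l (smul h f) = h * pair_with R l f"
  by (simp add: pair_with_def fun_eq_iff sum_distrib_left mult.left_commute)

text \<open>The exact sequence of \<open>V k\<close>, \<open>V (k + 1)\<close> and the line bundle
  of degree \<open>deg k\<close>, the last as a free module on the one-element type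
  \<open>unit\<close>. Surjectivity is recorded as well, to lift powers of coordinates when the flag
  is shown to be constant.\<close>

lemma hV_step:
  assumes k: "k \<in> cols"
  shows "\<exists>t0. \<forall>t\<ge>t0. (\<forall>g\<in>forms (t + deg k). \<exists>f\<in>Gam {..<n} (V (k + 1)) t. pair_with {..<n} (psi k) f = g) \<and>
    hV (k + 1) t = hV k t + H (t + deg k)"
proof -
  note kc = cols[OF k]
  let ?T = "\<lambda>f (_::unit). pair_with {..<n} (psi k) f"
  have fin: "finite (UNIV :: unit set)" by simp
  have "\<exists>t0. \<forall>t\<ge>t0. ?T ` Gam {..<n} (V (k + 1)) t = free UNIV (t + deg k) \<and>
    sv.dim (Gam {..<n} (V (k + 1)) t) = sv.dim {f \<in> Gam {..<n} (V (k + 1)) t. ?T f = 0} + sv.dim (free (UNIV :: unit set) (t + deg k))"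
  proof (rule gmod_exact[OF gmod_V gmod_free[OF fin]])
    show "k + 1 \<le> n" "k + 1 \<noteq> i" using kc by auto
    show "?T (f + g) = ?T f + ?T g" for f g by (simp add: pair_with_add fun_eq_iff)
    show "?T (smul h f) = smul h (?T f)" for h f by (simp add: pair_with_smul fun_eq_iff)
    show "?T f \<in> free UNIV (t + deg k)" if "f \<in> Gam {..<n} (V (k + 1)) t" for t f
      using psi(2)[OF k that] by (simp add: free_def)
    fix x
    obtain s f where f: "f \<in> Gam {..<n} (V (k + 1)) s" "pair_with {..<n} (psi k) f x \<noteq> 0"
      using psi_nonzero_section[OF k] .
    show "\<exists>d q. q \<in> forms d \<and> q x \<noteq> 0 \<and>
        (\<forall>t. \<forall>g\<in>free (UNIV :: unit set) t. \<exists>f\<in>Gam {..<n} (V (k + 1)) (t + d - deg k). ?T f = smul q g)"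
    proof (intro exI conjI allI ballI)
      show "pair_with {..<n} (psi k) f \<in> forms (s + deg k)" by (rule psi(2)[OF k f(1)])
      show "pair_with {..<n} (psi k) f x \<noteq> 0" by (rule f(2))
      fix t and g :: "unit \<Rightarrow> pt \<Rightarrow> complex" assume "g \<in> free UNIV t"
      then have "g () \<in> forms t" by (simp add: free_def)
      then have "smul (g ()) f \<in> Gam {..<n} (V (k + 1)) (s + t)"
        using kc by (intro gmodD(5)[OF gmod_V f(1)]) auto
      moreover have "?T (smul (g ()) f) = smul (pair_with {..<n} (psi k) f) g"
        by (simp add: pair_with_smul fun_eq_iff mult.commute)
      moreover have "s + t = t + (s + deg k) - deg k" by simp
      ultimately show "\<exists>f'\<in>Gam {..<n} (V (k + 1)) (t + (s + deg k) - deg k). ?T f' = smul (pair_with {..<n} (psi k) f) g"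
        by metis
    qed
  qed
  then obtain t0 where t0: "\<And>t. t \<ge> t0 \<Longrightarrow> ?T ` Gam {..<n} (V (k + 1)) t = free UNIV (t + deg k)"
    "\<And>t. t \<ge> t0 \<Longrightarrow> sv.dim (Gam {..<n} (V (k + 1)) t) = sv.dim {f \<in> Gam {..<n} (V (k + 1)) t. ?T f = 0} + sv.dim (free (UNIV :: unit set) (t + deg k))"
    by blast
  have ker: "{f \<in> Gam {..<n} (V (k + 1)) t. ?T f = 0} = Gam {..<n} (V k) t" for t
  proof (intro subset_antisym subsetI)
    fix f assume "f \<in> {f \<in> Gam {..<n} (V (k + 1)) t. ?T f = 0}"
    then have f: "f \<in> Gam {..<n} (V (k + 1)) t" "?T f = 0" by auto
    have "(\<lambda>r. f r x) \<in> V k x" for x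
      using psi(1)[OF k GamD(3)[OF f(1), of x]] fun_cong[OF fun_cong[OF f(2), of "()"], of x] by (simp add: pair_with_def)
    then show "f \<in> Gam {..<n} (V k) t" using f(1) by (simp add: Gam_def)
  next
    fix f assume f: "f \<in> Gam {..<n} (V k) t"
    have u: "(\<lambda>r. f r x) \<in> V (k + 1) x" for x using kc by (intro V_mono[OF _ _ _ _ GamD(3)[OF f]]) auto
    then have "pair_with {..<n} (psi k) f x = 0" for x
      using psi(1)[OF k u] GamD(3)[OF f] by (simp add: pair_with_def)
    then show "f \<in> {f \<in> Gam {..<n} (V (k + 1)) t. ?T f = 0}" using f u by (simp add: Gam_def fun_eq_iff)
  qed
  have "\<exists>f\<in>Gam {..<n} (V (k + 1)) t. pair_with {..<n} (psi k) f = g" if "t \<ge> t0" "g \<in> forms (t + deg k)" for t g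
  proof -
    have "(\<lambda>_::unit. g) \<in> ?T ` Gam {..<n} (V (k + 1)) t" unfolding t0(1)[OF that(1)] using that(2) by (simp add: free_def)
    then obtain f where "f \<in> Gam {..<n} (V (k + 1)) t" "(\<lambda>_::unit. g) = ?T f" by blast
    then show ?thesis by (intro bexI[of _ f]) (auto dest: fun_cong)
  qed
  moreover have "hV (k + 1) t = hV k t + H (t + deg k)" if "t \<ge> t0" for t
    unfolding hV_def H_def t0(2)[OF that] ker by (simp add: free_basis(2))
  ultimately show ?thesis by blast
qed

section \<open>Tensor products and exterior squares of the steps of the flag\<close>

definition Tens :: "nat \<Rightarrow> nat \<Rightarrow> pt \<Rightarrow> (nat \<times> nat \<Rightarrow> complex) set" where
  "Tens j k x = {F. (\<forall>r. (\<lambda>s. F (r, s)) \<in> V k x) \<and> (\<forall>s. (\<lambda>r. F (r, s)) \<in> V j x)}"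

definition Alt :: "nat \<Rightarrow> pt \<Rightarrow> (nat \<times> nat \<Rightarrow> complex) set" where
  "Alt j x = {F. (\<forall>r. (\<lambda>s. F (r, s)) \<in> V j x) \<and> (\<forall>r s. F (r, s) = - F (s, r))}"

text \<open>The product of \<open>V (i + 1)\<close> and \<open>V (i - 1)\<close> inside the exterior
  square of \<open>V (i + 1)\<close>. Tensors are matrices whose first index belongs to the left
  factor, and skew matrices stand for bivectors. The quotient of the exterior square by
  \<open>Wedge\<close> is the determinant of the piece of rank two.\<close>

definition Wedge :: "pt \<Rightarrow> (nat \<times> nat \<Rightarrow> complex) set" where
  "Wedge x = {F. \<exists>G\<in>Tens (i + 1) (i - 1) x. \<forall>r s. F (r, s) = G (r, s) - G (s, r)}"

definition sq :: "(nat \<times> nat) set" where "sq = {..<n} \<times> {..<n}"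

lemma finite_sq: "finite sq"
  by (simp add: sq_def)

lemma subspace_vimage_row: "fv.subspace S \<Longrightarrow> fv.subspace {F. (\<lambda>s. F (g s)) \<in> S}"
  unfolding fv.subspace_def by (auto simp: zero_fun_def plus_fun_def fscale_def)

lemma Tens_subspace:
  assumes "j \<le> n" "j \<noteq> i" "k \<le> n" "k \<noteq> i" shows "fv.subspace (Tens j k x)"
proof -
  have "Tens j k x = (\<Inter>r. {F. (\<lambda>s. F (r, s)) \<in> V k x}) \<inter> (\<Inter>s. {F. (\<lambda>r. F (r, s)) \<in> V j x})"
    by (auto simp: Tens_def)
  also have "fv.subspace \<dots>"
    using V_subspace assms by (intro fv.subspace_inter fv.subspace_Int subspace_vimage_row)
  finally show ?thesis .
qed

lemma Alt_subspace:
  assumes "j \<le> n" "j \<noteq> i" shows "fv.subspace (Alt j x)"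
proof -
  have "fv.subspace {F :: nat \<times> nat \<Rightarrow> complex. \<forall>r s. F (r, s) = - F (s, r)}" (is "fv.subspace ?A")
  proof (rule fv.subspaceI)
    show "0 \<in> ?A" by simp
  next
    fix F G assume "F \<in> ?A" "G \<in> ?A"
    then have F: "\<And>r s. F (r, s) = - F (s, r)" and G: "\<And>r s. G (r, s) = - G (s, r)" by blast+
    show "F + G \<in> ?A"
    proof (intro CollectI allI)
      fix r s show "(F + G) (r, s) = - (F + G) (s, r)" using F[of r s] G[of r s] by simp
    qed
  next
    fix c F assume "F \<in> ?A"
    then have F: "\<And>r s. F (r, s) = - F (s, r)" by blast
    show "fscale c F \<in> ?A"
    proof (intro CollectI allI)
      fix r s show "fscale c F (r, s) = - fscale c F (s, r)" using F[of r s] by simp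
    qed
  qed
  moreover have "Alt j x = (\<Inter>r. {F. (\<lambda>s. F (r, s)) \<in> V j x}) \<inter> {F. \<forall>r s. F (r, s) = - F (s, r)}"
    by (auto simp: Alt_def)
  ultimately show ?thesis
    using V_subspace assms by (simp only:) (intro fv.subspace_inter fv.subspace_Int subspace_vimage_row)
qed

lemma AltD: "F \<in> Alt j x \<Longrightarrow> F (r, s) = - F (s, r)" "F \<in> Alt j x \<Longrightarrow> (\<lambda>s. F (r, s)) \<in> V j x"
  unfolding Alt_def by blast+

lemma Alt_change: "F \<in> Alt j x \<Longrightarrow> (\<And>r. (\<lambda>s. F (r, s)) \<in> V m x) \<Longrightarrow> F \<in> Alt m x"
  unfolding Alt_def by blast

lemma Alt_col:
  assumes "j \<le> n" "j \<noteq> i" "F \<in> Alt j x" shows "(\<lambda>r. F (r, s)) \<in> V j x"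
proof -
  have "(\<lambda>r. F (r, s)) = - (\<lambda>r. F (s, r))" using AltD(1)[OF assms(3), of _ s] by (simp add: fun_eq_iff)
  then show ?thesis using fv.subspace_neg[OF V_subspace[OF assms(1,2)] AltD(2)[OF assms(3), of s]] by simp
qed

lemma Wedge_subspace: "fv.subspace (Wedge x)"
proof -
  have S: "fv.subspace (Tens (i + 1) (i - 1) x)" using i by (intro Tens_subspace) auto
  show ?thesis
  proof (rule fv.subspaceI)
    show "0 \<in> Wedge x" unfolding Wedge_def using fv.subspace_0[OF S] by (intro CollectI bexI[of _ 0]) auto
  next
    fix F F' assume "F \<in> Wedge x" "F' \<in> Wedge x"
    then obtain G G' where "G \<in> Tens (i + 1) (i - 1) x" "\<forall>r s. F (r, s) = G (r, s) - G (s, r)"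
      "G' \<in> Tens (i + 1) (i - 1) x" "\<forall>r s. F' (r, s) = G' (r, s) - G' (s, r)" unfolding Wedge_def by blast
    then show "F + F' \<in> Wedge x" unfolding Wedge_def using fv.subspace_add[OF S]
      by (intro CollectI bexI[of _ "G + G'"]) auto
  next
    fix c F assume "F \<in> Wedge x"
    then obtain G where "G \<in> Tens (i + 1) (i - 1) x" "\<forall>r s. F (r, s) = G (r, s) - G (s, r)"
      unfolding Wedge_def by blast
    then show "fscale c F \<in> Wedge x" unfolding Wedge_def using fv.subspace_scale[OF S]
      by (intro CollectI bexI[of _ "fscale c G"]) (auto simp: right_diff_distrib)
  qed
qed

lemma Wedge_Alt: assumes "F \<in> Wedge x" shows "F \<in> Alt (i + 1) x"
proof -
  obtain G where G: "G \<in> Tens (i + 1) (i - 1) x" "\<And>r s. F (r, s) = G (r, s) - G (s, r)"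
    using assms unfolding Wedge_def by blast
  have S: "fv.subspace (V (i + 1) x)" using i by (intro V_subspace) auto
  have "(\<lambda>s. F (r, s)) \<in> V (i + 1) x" for r
  proof -
    have "(\<lambda>s. G (r, s)) \<in> V (i + 1) x" using G(1) i by (intro V_mono[of "i - 1" "i + 1"]) (auto simp: Tens_def)
    moreover have "(\<lambda>s. G (s, r)) \<in> V (i + 1) x" using G(1) by (simp add: Tens_def)
    moreover have "(\<lambda>s. F (r, s)) = (\<lambda>s. G (r, s)) - (\<lambda>s. G (s, r))" by (simp add: G fun_eq_iff)
    ultimately show ?thesis using fv.subspace_diff[OF S] by simp
  qed
  then show ?thesis unfolding Alt_def by (simp add: G)
qed

lemma gmod_Tens: "j \<le> n \<Longrightarrow> j \<noteq> i \<Longrightarrow> k \<le> n \<Longrightarrow> k \<noteq> i \<Longrightarrow> gmod sq (Gam sq (Tens j k))"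
  by (intro gmod_Gam Tens_subspace finite_sq)

lemma gmod_Alt: "j \<le> n \<Longrightarrow> j \<noteq> i \<Longrightarrow> gmod sq (Gam sq (Alt j))"
  by (intro gmod_Gam Alt_subspace finite_sq)

lemma gmod_Wedge: "gmod sq (Gam sq Wedge)"
  by (intro gmod_Gam Wedge_subspace finite_sq)

lemma Gam_row:
  assumes F: "F \<in> Gam sq U t" and U: "\<And>x F r. F \<in> U x \<Longrightarrow> (\<lambda>s. F (r, s)) \<in> V k x"
  shows "(\<lambda>s. F (r, s)) \<in> Gam {..<n} (V k) t"
  using GamD[OF F] U[OF GamD(3)[OF F]] by (intro GamI) (auto simp: sq_def)

definition contract :: "nat \<Rightarrow> (nat \<times> nat \<Rightarrow> pt \<Rightarrow> complex) \<Rightarrow> nat \<Rightarrow> pt \<Rightarrow> complex" where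
  "contract k F = (\<lambda>r. pair_with {..<n} (psi k) (\<lambda>s. F (r, s)))"

lemma contract_apply: "contract k F r x = (\<Sum>s<n. psi k s x * F (r, s) x)"
  by (simp add: contract_def pair_with_def)

lemma contract_add: "contract k (F + G) = contract k F + contract k G"
  by (simp add: fun_eq_iff contract_apply distrib_left sum.distrib)

lemma contract_smul: "contract k (smul h F) = smul h (contract k F)"
  by (simp add: fun_eq_iff contract_apply sum_distrib_left mult.left_commute)

lemma contract_zero_iff:
  assumes k: "k \<in> cols" and row: "\<And>r. (\<lambda>s. F (r, s) x) \<in> V (k + 1) x"
  shows "(\<forall>r. contract k F r x = 0) \<longleftrightarrow> (\<forall>r. (\<lambda>s. F (r, s) x) \<in> V k x)"
  unfolding contract_apply using psi(1)[OF k row] by simp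

lemma contract_span:
  assumes S: "fv.subspace (V j x)" and col: "\<And>s. (\<lambda>r. F (r, s) x) \<in> V j x"
  shows "(\<lambda>r. contract k F r x) \<in> V j x"
proof -
  have "(\<lambda>r. contract k F r x) = (\<Sum>s<n. fscale (psi k s x) (\<lambda>r. F (r, s) x))"
    by (simp add: fun_eq_iff contract_apply fun_sum_apply)
  then show ?thesis using S col by (simp only: fv.subspace_sum fv.subspace_scale)
qed

lemma contract_forms:
  assumes k: "k \<in> cols" and F: "F \<in> Gam sq U t" and U: "\<And>x F r. F \<in> U x \<Longrightarrow> (\<lambda>s. F (r, s)) \<in> V (k + 1) x"
  shows "contract k F r \<in> forms (t + deg k)" "r \<notin> {..<n} \<Longrightarrow> contract k F r = 0"
proof -
  show "contract k F r \<in> forms (t + deg k)"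
    unfolding contract_def by (rule psi(2)[OF k Gam_row[OF F U]])
  show "contract k F r = 0" if "r \<notin> {..<n}"
    using that GamD(2)[OF F] by (simp add: fun_eq_iff contract_apply sq_def)
qed

lemma outer_forms:
  assumes f: "f \<in> Gam {..<n} U s" and g: "g \<in> Gam {..<n} U' t"
  shows "f r * g r' \<in> forms (t + s)" "(r, r') \<notin> sq \<Longrightarrow> f r * g r' = 0"
proof -
  show "f r * g r' \<in> forms (t + s)"
    using forms_mult[OF GamD(1)[OF f, of r] GamD(1)[OF g, of r']] by (simp only: add.commute)
  assume "(r, r') \<notin> sq"
  then have "f r = 0 \<or> g r' = 0" using GamD(2)[OF f] GamD(2)[OF g] by (auto simp: sq_def)
  then show "f r * g r' = 0" by (metis mult_zero_left mult_zero_right)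
qed

text \<open>The exact sequence of \<open>hV_step\<close> tensored with \<open>V j\<close>;
  \<open>contract k\<close> is \<open>psi k\<close> on the second factor.\<close>

lemma Tens_step:
  assumes k: "k \<in> cols" and j: "j \<le> n" "j \<noteq> i"
  shows "\<exists>t0. \<forall>t\<ge>t0. sv.dim (Gam sq (Tens j (k + 1)) t) = sv.dim (Gam sq (Tens j k) t) + hV j (t + deg k)"
proof -
  note kc = cols[OF k]
  have row: "F \<in> Tens j m x \<Longrightarrow> (\<lambda>s. F (r, s)) \<in> V m x" for F m x r by (simp add: Tens_def)
  have col: "F \<in> Tens j m x \<Longrightarrow> (\<lambda>r. F (r, s)) \<in> V j x" for F m x s by (simp add: Tens_def)
  have "\<exists>t0. \<forall>t\<ge>t0. contract k ` Gam sq (Tens j (k + 1)) t = Gam {..<n} (V j) (t + deg k) \<and>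
    sv.dim (Gam sq (Tens j (k + 1)) t) = sv.dim {F \<in> Gam sq (Tens j (k + 1)) t. contract k F = 0} + sv.dim (Gam {..<n} (V j) (t + deg k))"
  proof (rule gmod_exact[OF gmod_Tens gmod_V[OF j] contract_add contract_smul])
    show "j \<le> n" "j \<noteq> i" "k + 1 \<le> n" "k + 1 \<noteq> i" using kc j by auto
    show "contract k F \<in> Gam {..<n} (V j) (t + deg k)" if F: "F \<in> Gam sq (Tens j (k + 1)) t" for t F
    proof (rule GamI)
      show "contract k F r \<in> forms (t + deg k)" "r \<notin> {..<n} \<Longrightarrow> contract k F r = 0" for r
        using contract_forms[OF k F row] by blast+
      show "(\<lambda>r. contract k F r x) \<in> V j x" for x
        by (rule contract_span[OF V_subspace[OF j] col[OF GamD(3)[OF F]]])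
    qed
    fix x
    obtain s f where f: "f \<in> Gam {..<n} (V (k + 1)) s" "pair_with {..<n} (psi k) f x \<noteq> 0"
      using psi_nonzero_section[OF k] .
    show "\<exists>d q. q \<in> forms d \<and> q x \<noteq> 0 \<and>
        (\<forall>t. \<forall>g\<in>Gam {..<n} (V j) t. \<exists>F\<in>Gam sq (Tens j (k + 1)) (t + d - deg k). contract k F = smul q g)"
    proof (intro exI conjI allI ballI)
      show "pair_with {..<n} (psi k) f \<in> forms (s + deg k)" by (rule psi(2)[OF k f(1)])
      show "pair_with {..<n} (psi k) f x \<noteq> 0" by (rule f(2))
      fix t g assume g: "g \<in> Gam {..<n} (V j) t"
      define F where "F = (\<lambda>(r, s). g r * f s)"
      have "F \<in> Gam sq (Tens j (k + 1)) (t + s)"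
      proof (rule GamI)
        show "F rs \<in> forms (t + s)" "rs \<notin> sq \<Longrightarrow> F rs = 0" for rs
          using outer_forms[OF g f(1), of "fst rs" "snd rs"] by (auto simp: F_def case_prod_unfold add.commute)
        fix x
        have "(\<lambda>s. F (r, s) x) = fscale (g r x) (\<lambda>s. f s x)" "(\<lambda>r. F (r, s) x) = fscale (f s x) (\<lambda>r. g r x)" for r s
          by (simp_all add: F_def fun_eq_iff mult.commute)
        then show "(\<lambda>rs. F rs x) \<in> Tens j (k + 1) x"
          unfolding Tens_def using GamD(3)[OF f(1)] GamD(3)[OF g] kc j
          by (simp add: fv.subspace_scale[OF V_subspace])
      qed
      moreover have "contract k F = smul (pair_with {..<n} (psi k) f) g"
      proof (intro ext)
        fix r x
        have "contract k F r x = g r x * (\<Sum>s<n. psi k s x * f s x)"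
          by (simp add: contract_apply F_def sum_distrib_left mult.left_commute)
        then show "contract k F r x = smul (pair_with {..<n} (psi k) f) g r x"
          by (simp add: pair_with_def mult.commute)
      qed
      moreover have "t + s = t + (s + deg k) - deg k" by simp
      ultimately show "\<exists>F\<in>Gam sq (Tens j (k + 1)) (t + (s + deg k) - deg k). contract k F = smul (pair_with {..<n} (psi k) f) g"
        by metis
    qed
  qed
  moreover have ker: "{F \<in> Gam sq (Tens j (k + 1)) t. contract k F = 0} = Gam sq (Tens j k) t" for t
  proof (intro subset_antisym subsetI)
    fix F assume "F \<in> {F \<in> Gam sq (Tens j (k + 1)) t. contract k F = 0}"
    then have F: "F \<in> Gam sq (Tens j (k + 1)) t" "contract k F = 0" by auto
    have "(\<lambda>rs. F rs x) \<in> Tens j k x" for x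
      using contract_zero_iff[where F = F and x = x, OF k row[OF GamD(3)[OF F(1)]]] F(2) GamD(3)[OF F(1), of x] by (simp add: Tens_def)
    then show "F \<in> Gam sq (Tens j k) t" using F(1) by (simp add: Gam_def)
  next
    fix F assume F: "F \<in> Gam sq (Tens j k) t"
    have T: "(\<lambda>rs. F rs x) \<in> Tens j (k + 1) x" for x
      using GamD(3)[OF F, of x] kc V_mono[of k "k + 1" _ x] by (simp add: Tens_def)
    have "\<forall>r. contract k F r x = 0" for x
      using contract_zero_iff[where F = F and x = x, OF k row[OF T]] row[OF GamD(3)[OF F]] by blast
    then show "F \<in> {F \<in> Gam sq (Tens j (k + 1)) t. contract k F = 0}"
      using F T by (simp add: Gam_def fun_eq_iff)
  qed
  ultimately show ?thesis unfolding hV_def by auto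
qed

text \<open>The exact sequence whose kernel is the exterior square of \<open>V k\<close> and whose
  quotient is \<open>V k\<close> twisted by the line \<open>V (k + 1) / V k\<close>.\<close>

lemma Alt_step:
  assumes k: "k \<in> cols"
  shows "\<exists>t0. \<forall>t\<ge>t0. sv.dim (Gam sq (Alt (k + 1)) t) = sv.dim (Gam sq (Alt k) t) + hV k (t + deg k)"
proof -
  note kc = cols[OF k]
  have kn: "k \<le> n" "k \<noteq> i" "k + 1 \<le> n" "k + 1 \<noteq> i" using kc by auto
  have "\<exists>t0. \<forall>t\<ge>t0. contract k ` Gam sq (Alt (k + 1)) t = Gam {..<n} (V k) (t + deg k) \<and>
    sv.dim (Gam sq (Alt (k + 1)) t) = sv.dim {F \<in> Gam sq (Alt (k + 1)) t. contract k F = 0} + sv.dim (Gam {..<n} (V k) (t + deg k))"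
  proof (rule gmod_exact[OF gmod_Alt[OF kn(3,4)] gmod_V[OF kn(1,2)] contract_add contract_smul])
    show "contract k F \<in> Gam {..<n} (V k) (t + deg k)" if F: "F \<in> Gam sq (Alt (k + 1)) t" for t F
    proof (rule GamI)
      show "contract k F r \<in> forms (t + deg k)" "r \<notin> {..<n} \<Longrightarrow> contract k F r = 0" for r
        using contract_forms[OF k F AltD(2)] by blast+
      show "(\<lambda>r. contract k F r x) \<in> V k x" for x
      proof -
        have 1: "(\<lambda>r. contract k F r x) \<in> V (k + 1) x"
          by (rule contract_span[OF V_subspace[OF kn(3,4)] Alt_col[OF kn(3,4) GamD(3)[OF F]]])
        \<comment> \<open>Applying \<open>psi k\<close> to both factors of a skew tensor gives zero,
          which puts the contraction into \<open>V k\<close>.\<close>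
        let ?S = "\<Sum>r<n. psi k r x * contract k F r x"
        have S: "?S = (\<Sum>r<n. \<Sum>s<n. psi k r x * psi k s x * F (r, s) x)"
          by (simp add: contract_apply sum_distrib_left mult.assoc)
        also have "\<dots> = (\<Sum>s<n. \<Sum>r<n. psi k r x * psi k s x * F (r, s) x)" by (rule sum.swap)
        also have "\<dots> = (\<Sum>s<n. \<Sum>r<n. - (psi k s x * psi k r x * F (s, r) x))"
        proof (intro sum.cong refl)
          fix r s
          show "psi k r x * psi k s x * F (r, s) x = - (psi k s x * psi k r x * F (s, r) x)"
            using AltD(1)[OF GamD(3)[OF F, of x], of r s] by (simp add: mult.commute)
        qed
        also have "\<dots> = - ?S" unfolding S by (simp add: sum_negf)
        finally have "?S = 0" by simp
        then show ?thesis using psi(1)[OF k 1] by simp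
      qed
    qed
    fix x
    obtain s f where f: "f \<in> Gam {..<n} (V (k + 1)) s" "pair_with {..<n} (psi k) f x \<noteq> 0"
      using psi_nonzero_section[OF k] .
    show "\<exists>d q. q \<in> forms d \<and> q x \<noteq> 0 \<and>
        (\<forall>t. \<forall>g\<in>Gam {..<n} (V k) t. \<exists>F\<in>Gam sq (Alt (k + 1)) (t + d - deg k). contract k F = smul q g)"
    proof (intro exI conjI allI ballI)
      show "pair_with {..<n} (psi k) f \<in> forms (s + deg k)" by (rule psi(2)[OF k f(1)])
      show "pair_with {..<n} (psi k) f x \<noteq> 0" by (rule f(2))
      fix t g assume g: "g \<in> Gam {..<n} (V k) t"
      \<comment> \<open>The bivector of \<open>g\<close> and \<open>f\<close>. Since
        \<open>psi k\<close> kills \<open>g\<close>, contraction returns \<open>g\<close> times the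
        value of \<open>psi k\<close> on \<open>f\<close>, which is nonzero at
        \<open>x\<close>.\<close>
      define F where "F = (\<lambda>(r, s). g r * f s - f r * g s)"
      have gV: "(\<lambda>r. g r x) \<in> V (k + 1) x" for x using kn by (intro V_mono[OF _ _ _ _ GamD(3)[OF g]]) auto
      have pg: "(\<Sum>r<n. psi k r x * g r x) = 0" for x
        using psi(1)[OF k gV] GamD(3)[OF g] by simp
      have "F \<in> Gam sq (Alt (k + 1)) (t + s)"
      proof (rule GamI)
        show "F rs \<in> forms (t + s)" for rs
          using outer_forms(1)[OF g f(1), of "fst rs" "snd rs"] outer_forms(1)[OF f(1) g, of "fst rs" "snd rs"]
          unfolding F_def case_prod_unfold by (intro forms_diff) (simp_all only: add.commute)
        show "F rs = 0" if "rs \<notin> sq" for rs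
        proof -
          have "g (fst rs) * f (snd rs) = 0" "f (fst rs) * g (snd rs) = 0"
            using outer_forms(2)[OF g f(1), of "fst rs" "snd rs"] outer_forms(2)[OF f(1) g, of "fst rs" "snd rs"] that
            unfolding prod.collapse by blast+
          then show ?thesis unfolding F_def case_prod_unfold by (simp only: diff_self)
        qed
        fix x
        have "(\<lambda>s. F (r, s) x) = fscale (g r x) (\<lambda>s. f s x) - fscale (f r x) (\<lambda>s. g s x)" for r
          by (simp add: F_def fun_eq_iff)
        moreover have "fscale (g r x) (\<lambda>s. f s x) - fscale (f r x) (\<lambda>s. g s x) \<in> V (k + 1) x" for r
          by (intro fv.subspace_diff fv.subspace_scale V_subspace[OF kn(3,4)] GamD(3)[OF f(1)] gV)
        ultimately show "(\<lambda>rs. F rs x) \<in> Alt (k + 1) x"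
          unfolding Alt_def by (simp add: F_def)
      qed
      moreover have "contract k F = smul (pair_with {..<n} (psi k) f) g"
      proof (intro ext)
        fix r x
        have "contract k F r x = g r x * (\<Sum>s<n. psi k s x * f s x) - f r x * (\<Sum>s<n. psi k s x * g s x)"
          by (simp add: contract_apply F_def right_diff_distrib sum_subtractf sum_distrib_left mult.left_commute)
        then have "contract k F r x = g r x * (\<Sum>s<n. psi k s x * f s x)"
          by (simp only: pg mult_zero_right diff_0_right)
        then show "contract k F r x = smul (pair_with {..<n} (psi k) f) g r x"
          by (simp add: pair_with_def mult.commute)
      qed
      moreover have "t + s = t + (s + deg k) - deg k" by simp
      ultimately show "\<exists>F\<in>Gam sq (Alt (k + 1)) (t + (s + deg k) - deg k). contract k F = smul (pair_with {..<n} (psi k) f) g"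
        by metis
    qed
  qed
  moreover have ker: "{F \<in> Gam sq (Alt (k + 1)) t. contract k F = 0} = Gam sq (Alt k) t" for t
  proof (intro subset_antisym subsetI)
    fix F assume "F \<in> {F \<in> Gam sq (Alt (k + 1)) t. contract k F = 0}"
    then have F: "F \<in> Gam sq (Alt (k + 1)) t" "contract k F = 0" by auto
    have "(\<lambda>rs. F rs x) \<in> Alt k x" for x
    proof (rule Alt_change[OF GamD(3)[OF F(1)]])
      show "(\<lambda>s. F (r, s) x) \<in> V k x" for r
        using contract_zero_iff[where F = F and x = x, OF k AltD(2)[OF GamD(3)[OF F(1)]]] F(2) by simp
    qed
    then show "F \<in> Gam sq (Alt k) t" using F(1) by (simp add: Gam_def)
  next
    fix F assume F: "F \<in> Gam sq (Alt k) t"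
    have T: "(\<lambda>rs. F rs x) \<in> Alt (k + 1) x" for x
      by (rule Alt_change[OF GamD(3)[OF F]], rule V_mono[OF _ kn(3,2,4) AltD(2)[OF GamD(3)[OF F]]]) simp
    have "\<forall>r. contract k F r x = 0" for x
      using contract_zero_iff[where F = F and x = x, OF k AltD(2)[OF T]] AltD(2)[OF GamD(3)[OF F]] by blast
    then show "F \<in> {F \<in> Gam sq (Alt (k + 1)) t. contract k F = 0}"
      using F T by (simp add: Gam_def fun_eq_iff)
  qed
  ultimately show ?thesis unfolding hV_def by auto
qed

end

section \<open>The piece of rank two, seen through its determinant\<close>

context framed_flag
begin

text \<open>As \<open>Y\<close> is \<open>q\<close> times the inverse frame, these are
  \<open>q^2\<close> times the coordinates of the tensor in the frame.\<close>

definition coord2 :: "(nat \<Rightarrow> nat \<Rightarrow> pt \<Rightarrow> complex) \<Rightarrow> (nat \<times> nat \<Rightarrow> pt \<Rightarrow> complex) \<Rightarrow> nat \<Rightarrow> nat \<Rightarrow> pt \<Rightarrow> complex" where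
  "coord2 Y F c d = (\<Sum>a<n. \<Sum>b<n. Y c a * F (a, b) * Y d b)"

definition low :: "(nat \<Rightarrow> nat \<Rightarrow> pt \<Rightarrow> complex) \<Rightarrow> (nat \<Rightarrow> nat \<Rightarrow> pt \<Rightarrow> complex) \<Rightarrow>
    (nat \<times> nat \<Rightarrow> pt \<Rightarrow> complex) \<Rightarrow> nat \<times> nat \<Rightarrow> pt \<Rightarrow> complex" where
  "low W Y F = (\<lambda>(r, s). \<Sum>c<n. \<Sum>d<n. if d < c then W r c * W s d * coord2 Y F c d else 0)"

lemma coord2_apply: "coord2 Y F c d x = (\<Sum>a<n. Y c a x * (\<Sum>b<n. Y d b x * F (a, b) x))"
  by (simp add: coord2_def fun_sum_apply sum_distrib_left mult_ac)

lemma low_apply: "low W Y F (r, s) x = (\<Sum>c<n. \<Sum>d<n. if d < c then W r c x * W s d x * coord2 Y F c d x else 0)"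
  unfolding low_def by (simp add: fun_sum_apply if_distrib[of "\<lambda>f. f x"] cong: if_cong)

lemma coord2_skew:
  assumes "\<And>a b. F (a, b) x = - F (b, a) x"
  shows "coord2 Y F c d x = - coord2 Y F d c x"
proof -
  have "coord2 Y F c d x = (\<Sum>a<n. \<Sum>b<n. Y c a x * Y d b x * F (a, b) x)"
    by (simp add: coord2_apply sum_distrib_left mult_ac)
  also have "\<dots> = (\<Sum>b<n. \<Sum>a<n. Y c a x * Y d b x * F (a, b) x)" by (rule sum.swap)
  also have "\<dots> = (\<Sum>b<n. \<Sum>a<n. - (Y d b x * Y c a x * F (b, a) x))"
  proof (intro sum.cong refl)
    fix a b show "Y c a x * Y d b x * F (a, b) x = - (Y d b x * Y c a x * F (b, a) x)"
      using assms[of a b] by (simp add: mult.commute)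
  qed
  also have "\<dots> = - coord2 Y F d c x"
    by (simp add: coord2_apply sum_negf sum_distrib_left mult_ac)
  finally show ?thesis .
qed

text \<open>Expanding in the frame costs one factor \<open>q\<close> per index. Skewness kills the
  diagonal coordinates and makes the upper half of the expansion the negative transpose of the lower
  half \<open>low\<close>.\<close>

lemma low_diff:
  assumes F: "is_frame n i V e e' W Y q" and skew: "\<And>a b. F (a, b) x = - F (b, a) x"
    and supp: "\<And>a b. n \<le> a \<Longrightarrow> F (a, b) x = 0"
  shows "q x * q x * F (r, s) x = low W Y F (r, s) x - low W Y F (s, r) x"
proof -
  have supp': "F (a, b) x = 0" if "n \<le> b" for a b using skew[of a b] supp[OF that] by simp
  define A where "A c d = W r c x * W s d x * coord2 Y F c d x" for c d
  have "(\<Sum>c<n. \<Sum>d<n. A c d) = (\<Sum>c<n. W r c x * (\<Sum>d<n. W s d x * (\<Sum>a<n. Y c a x * (\<Sum>b<n. Y d b x * F (a, b) x))))"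
    by (simp add: A_def coord2_apply sum_distrib_left mult.assoc)
  also have "\<dots> = (\<Sum>c<n. W r c x * (\<Sum>a<n. Y c a x * (\<Sum>d<n. W s d x * (\<Sum>b<n. Y d b x * F (a, b) x))))"
  proof (rule sum.cong[OF refl], rule arg_cong[where f = "\<lambda>z. _ * z"])
    fix c
    define Z where "Z a d = (\<Sum>b<n. Y d b x * F (a, b) x)" for a d
    have "(\<Sum>d<n. W s d x * (\<Sum>a<n. Y c a x * Z a d)) = (\<Sum>d<n. \<Sum>a<n. Y c a x * (W s d x * Z a d))"
      by (simp add: sum_distrib_left mult.left_commute)
    also have "\<dots> = (\<Sum>a<n. \<Sum>d<n. Y c a x * (W s d x * Z a d))"
      by (rule sum.swap)
    finally show "(\<Sum>d<n. W s d x * (\<Sum>a<n. Y c a x * (\<Sum>b<n. Y d b x * F (a, b) x))) =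
      (\<Sum>a<n. Y c a x * (\<Sum>d<n. W s d x * (\<Sum>b<n. Y d b x * F (a, b) x)))"
      by (simp only: sum_distrib_left[symmetric] Z_def)
  qed
  also have "\<dots> = (\<Sum>c<n. W r c x * (\<Sum>a<n. Y c a x * (q x * F (a, s) x)))"
  proof -
    have "(\<Sum>d<n. W s d x * (\<Sum>b<n. Y d b x * F (a, b) x)) = q x * F (a, s) x" for a
      by (rule frame_expand[OF F]) (use supp' in simp)
    then show ?thesis by (simp only:)
  qed
  also have "\<dots> = q x * (q x * F (r, s) x)"
    by (rule frame_expand[OF F, of "\<lambda>a. q x * F (a, s) x"]) (use supp in simp)
  finally have 1: "(\<Sum>c<n. \<Sum>d<n. A c d) = q x * q x * F (r, s) x" by (simp only: mult.assoc)
  have C0: "coord2 Y F c c x = 0" for c using coord2_skew[where F = F and x = x, OF skew, of Y c c] by simp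
  have "(\<Sum>c<n. \<Sum>d<n. A c d) = (\<Sum>c<n. \<Sum>d<n. (if d < c then A c d else 0) + (if c < d then A c d else 0))"
  proof (intro sum.cong refl)
    fix c d show "A c d = (if d < c then A c d else 0) + (if c < d then A c d else 0)"
      by (cases c d rule: linorder_cases) (auto simp: A_def C0)
  qed
  also have "\<dots> = low W Y F (r, s) x + (\<Sum>c<n. \<Sum>d<n. if c < d then A c d else 0)"
    by (simp add: sum.distrib low_apply A_def cong: if_cong)
  also have "(\<Sum>c<n. \<Sum>d<n. if c < d then A c d else 0) = (\<Sum>d<n. \<Sum>c<n. if c < d then A c d else 0)"
    by (rule sum.swap)
  also have "\<dots> = (\<Sum>d<n. \<Sum>c<n. - (if c < d then W s d x * W r c x * coord2 Y F d c x else 0))"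
  proof (intro sum.cong refl)
    fix c d
    show "(if c < d then A c d else 0) = - (if c < d then W s d x * W r c x * coord2 Y F d c x else 0)"
      using coord2_skew[where F = F and x = x, OF skew, of Y c d] by (simp add: A_def)
  qed
  also have "\<dots> = - low W Y F (s, r) x" by (simp only: low_apply sum_negf)
  finally show ?thesis using 1 by simp
qed

text \<open>For a bivector of \<open>V (i + 1)\<close> the coordinates beyond \<open>i\<close>
  vanish. If the coordinate at \<open>(i - 1, i)\<close> vanishes too, each remaining term with
  \<open>d < c\<close> has \<open>c\<close> at most \<open>i\<close> and \<open>d\<close> below
  \<open>i - 1\<close>, so its factors lie in \<open>V (i + 1)\<close> and
  \<open>V (i - 1)\<close>.\<close>

lemma low_Tens:
  assumes F: "is_frame n i V e e' W Y q" and x: "q x \<noteq> 0" and A: "(\<lambda>rs. F rs x) \<in> Alt (i + 1) x"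
    and c0: "coord2 Y F (i - 1) i x = 0"
  shows "(\<lambda>rs. low W Y F rs x) \<in> Tens (i + 1) (i - 1) x"
proof -
  have skew: "F (a, b) x = - F (b, a) x" for a b using AltD(1)[OF A] by blast
  have C1: "coord2 Y F c d x = 0" if "i < d" "d < n" for c d
  proof -
    have "(\<Sum>b<n. Y d b x * F (a, b) x) = 0" for a
      using AltD(2)[OF A, of a] that i frameD(7)[OF F x, of "i + 1" "\<lambda>b. F (a, b) x"] by simp
    then show ?thesis by (simp add: coord2_apply)
  qed
  have C2: "coord2 Y F c d x = 0" if "i < c" "c < n" for c d
    using coord2_skew[where F = F and x = x, OF skew, of Y c d] C1[OF that, of d] by simp
  have C3: "coord2 Y F i (i - 1) x = 0" using coord2_skew[where F = F and x = x, OF skew, of Y i "i - 1"] c0 by simp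
  have C: "c \<le> i \<and> d < i - 1" if "c < n" "d < c" "coord2 Y F c d x \<noteq> 0" for c d
  proof -
    have "c \<le> i" using C2[of c d] that by force
    moreover have "\<not> (c = i \<and> d = i - 1)" using C3 that(3) by auto
    ultimately show ?thesis using that(2) by auto
  qed
  have Si: "fv.subspace (V (i + 1) x)" "fv.subspace (V (i - 1) x)" using i by (intro V_subspace; simp)+
  have "(\<lambda>s. low W Y F (r, s) x) \<in> V (i - 1) x" for r
  proof -
    have eq: "(\<lambda>s. low W Y F (r, s) x) = (\<Sum>c<n. \<Sum>d<n. fscale (if d < c then W r c x * coord2 Y F c d x else 0) (\<lambda>s. W s d x))"
      by (auto simp: fun_eq_iff low_apply fun_sum_apply intro!: sum.cong)
    have "fscale (if d < c then W r c x * coord2 Y F c d x else 0) (\<lambda>s. W s d x) \<in> V (i - 1) x" if "c < n" for c d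
    proof (cases "d < c \<and> coord2 Y F c d x \<noteq> 0")
      case True
      then have "(\<lambda>s. W s d x) \<in> V (i - 1) x" using C[OF that] i by (intro frame_col[OF F _ _ _ x]) auto
      then show ?thesis by (rule fv.subspace_scale[OF Si(2)])
    next
      case False
      then have "fscale (if d < c then W r c x * coord2 Y F c d x else 0) (\<lambda>s. W s d x) = 0" by (auto simp: fun_eq_iff)
      then show ?thesis using fv.subspace_0[OF Si(2)] by (simp only:)
    qed
    then show ?thesis unfolding eq by (intro fv.subspace_sum[OF Si(2)]) auto
  qed
  moreover have "(\<lambda>r. low W Y F (r, s) x) \<in> V (i + 1) x" for s
  proof -
    have eq: "(\<lambda>r. low W Y F (r, s) x) = (\<Sum>c<n. \<Sum>d<n. fscale (if d < c then W s d x * coord2 Y F c d x else 0) (\<lambda>r. W r c x))"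
      by (auto simp: fun_eq_iff low_apply fun_sum_apply intro!: sum.cong)
    have "fscale (if d < c then W s d x * coord2 Y F c d x else 0) (\<lambda>r. W r c x) \<in> V (i + 1) x" if "c < n" for c d
    proof (cases "d < c \<and> coord2 Y F c d x \<noteq> 0")
      case True
      then have "(\<lambda>r. W r c x) \<in> V (i + 1) x" using C[OF that, of d] i by (intro frame_col[OF F _ _ _ x]) auto
      then show ?thesis by (rule fv.subspace_scale[OF Si(1)])
    next
      case False
      then have "fscale (if d < c then W s d x * coord2 Y F c d x else 0) (\<lambda>r. W r c x) = 0" by (auto simp: fun_eq_iff)
      then show ?thesis using fv.subspace_0[OF Si(1)] by (simp only:)
    qed
    then show ?thesis unfolding eq by (intro fv.subspace_sum[OF Si(1)]) auto
  qed
  ultimately show ?thesis by (simp add: Tens_def)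
qed

lemma Alt_supp: "j \<le> n \<Longrightarrow> j \<noteq> i \<Longrightarrow> F \<in> Alt j x \<Longrightarrow> n \<le> a \<Longrightarrow> F (a, b) = 0"
  using V_supp[OF _ _ Alt_col[of j F x b], of a] by simp

text \<open>Columns \<open>i - 1\<close> and \<open>i\<close> span the piece of rank two, and the
  coordinate of their bivector is the only obstruction to a lift by \<open>low\<close>. So
  \<open>Wedge\<close> is cut out by a single equation.\<close>

lemma Wedge_iff:
  assumes F: "is_frame n i V e e' W Y q" and x: "q x \<noteq> 0" and A: "(\<lambda>rs. F rs x) \<in> Alt (i + 1) x"
  shows "(\<lambda>rs. F rs x) \<in> Wedge x \<longleftrightarrow> coord2 Y F (i - 1) i x = 0"
proof
  assume "(\<lambda>rs. F rs x) \<in> Wedge x"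
  then obtain G where G: "G \<in> Tens (i + 1) (i - 1) x" "\<And>r s. F (r, s) x = G (r, s) - G (s, r)"
    unfolding Wedge_def by blast
  have row: "(\<Sum>s<n. Y c s x * G (r, s)) = 0" if "i - 1 \<le> c" "c < n" for r c
    using G(1) frameD(7)[OF F x, of "i - 1" "\<lambda>s. G (r, s)"] that i by (simp add: Tens_def)
  have "coord2 Y F (i - 1) i x = (\<Sum>a<n. Y (i - 1) a x * (\<Sum>b<n. Y i b x * G (a, b))) -
      (\<Sum>a<n. \<Sum>b<n. Y i b x * (Y (i - 1) a x * G (b, a)))"
    by (simp add: coord2_apply G(2) right_diff_distrib sum_subtractf sum_distrib_left mult.left_commute)
  also have "(\<Sum>a<n. \<Sum>b<n. Y i b x * (Y (i - 1) a x * G (b, a))) = (\<Sum>b<n. \<Sum>a<n. Y i b x * (Y (i - 1) a x * G (b, a)))"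
    by (rule sum.swap)
  finally show "coord2 Y F (i - 1) i x = 0"
    using row[of i] row[of "i - 1"] i by (simp add: sum_distrib_left[symmetric])
next
  assume c0: "coord2 Y F (i - 1) i x = 0"
  have S: "fv.subspace (Tens (i + 1) (i - 1) x)" using i by (intro Tens_subspace) auto
  have ii: "i + 1 \<le> n" "i + 1 \<noteq> i" using i by auto
  have eq: "q x * q x * F (r, s) x = low W Y F (r, s) x - low W Y F (s, r) x" for r s
  proof (rule low_diff[OF F])
    show "F (a, b) x = - F (b, a) x" for a b using AltD(1)[OF A] by blast
    show "F (a, b) x = 0" if "n \<le> a" for a b using Alt_supp[OF ii A that] .
  qed
  have "F (r, s) x = inverse (q x * q x) * low W Y F (r, s) x - inverse (q x * q x) * low W Y F (s, r) x" for r s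
    unfolding right_diff_distrib[symmetric] eq[symmetric] using x by (simp add: field_simps)
  then show "(\<lambda>rs. F rs x) \<in> Wedge x"
    unfolding Wedge_def using fv.subspace_scale[OF S low_Tens[OF F x A c0], of "inverse (q x * q x)"]
    by (intro CollectI bexI) (auto simp: fscale_def)
qed

lemma pair_with_sq: "(\<Sum>rs\<in>sq. (Y c (fst rs) * Y d (snd rs)) x * F rs x) = coord2 Y F c d x"
proof -
  have "(\<Sum>rs\<in>sq. h rs) = (\<Sum>a<n. \<Sum>b<n. h (a, b))" for h :: "nat \<times> nat \<Rightarrow> complex"
    by (simp add: sq_def sum.cartesian_product)
  then show ?thesis by (simp add: coord2_apply sum_distrib_left mult_ac)
qed

lemma wedge_functional:
  "\<exists>a y. (\<forall>x. \<forall>u\<in>Alt (i + 1) x. u \<in> Wedge x \<longleftrightarrow> (\<Sum>rs\<in>sq. y rs x * u rs) = 0) \<and>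
     (\<forall>t. \<forall>f\<in>Gam sq (Alt (i + 1)) t. pair_with sq y f \<in> forms (t + a))"
  "\<exists>t. \<exists>f\<in>Gam sq (Alt (i + 1)) t. (\<lambda>rs. f rs x) \<notin> Wedge x"
proof -
  have ii: "i + 1 \<le> n" "i + 1 \<noteq> i" using i by auto
  have gen: "\<exists>t. \<exists>f\<in>Gam sq (Alt (i + 1)) t. (\<lambda>rs. f rs x) \<notin> Wedge x" for x
  proof -
    obtain e e' W Y q where F: "is_frame n i V e e' W Y q" "q x \<noteq> 0" using frame by blast
    define f1 f2 where "f1 = (\<lambda>r. W r (i - 1) * q)" and "f2 = (\<lambda>r. W r i * q)"
    have f1: "f1 \<in> Gam {..<n} (V (i + 1)) (e + (e + e'))" and f2: "f2 \<in> Gam {..<n} (V (i + 1)) (e + (e + e'))"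
      unfolding f1_def f2_def using i by (intro frame_col_section[OF F(1) ii]; simp)+
    \<comment> \<open>The bivector of the columns \<open>i - 1\<close> and \<open>i\<close>, which
      generates the quotient by \<open>Wedge\<close> at \<open>x\<close>.\<close>
    define f where "f = (\<lambda>(r, s). f1 r * f2 s - f2 r * f1 s)"
    have fG: "f \<in> Gam sq (Alt (i + 1)) ((e + (e + e')) + (e + (e + e')))"
    proof (rule GamI)
      show "f rs \<in> forms ((e + (e + e')) + (e + (e + e')))" for rs
        unfolding f_def case_prod_unfold by (intro forms_diff outer_forms(1)[OF f1 f2] outer_forms(1)[OF f2 f1])
      show "f rs = 0" if "rs \<notin> sq" for rs
      proof -
        have "f1 (fst rs) * f2 (snd rs) = 0" "f2 (fst rs) * f1 (snd rs) = 0"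
          using outer_forms(2)[OF f1 f2, of "fst rs" "snd rs"] outer_forms(2)[OF f2 f1, of "fst rs" "snd rs"] that
          unfolding prod.collapse by blast+
        then show ?thesis unfolding f_def case_prod_unfold by (simp only: diff_self)
      qed
      fix y
      have "(\<lambda>s. f (r, s) y) = fscale (f1 r y) (\<lambda>s. f2 s y) - fscale (f2 r y) (\<lambda>s. f1 s y)" for r
        by (simp add: f_def fun_eq_iff)
      moreover have "fscale (f1 r y) (\<lambda>s. f2 s y) - fscale (f2 r y) (\<lambda>s. f1 s y) \<in> V (i + 1) y" for r
        by (intro fv.subspace_diff fv.subspace_scale V_subspace[OF ii] GamD(3)[OF f1] GamD(3)[OF f2])
      ultimately show "(\<lambda>rs. f rs y) \<in> Alt (i + 1) y" unfolding Alt_def by (simp add: f_def)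
    qed
    have p: "(\<Sum>b<n. Y c b x * f1 b x) = (if c = i - 1 then q x * q x else 0)"
      "(\<Sum>b<n. Y c b x * f2 b x) = (if c = i then q x * q x else 0)" if "c < n" for c
      unfolding f1_def f2_def using frame_col_pair[OF F(1) that] i by auto
    have "coord2 Y f (i - 1) i x = (\<Sum>a<n. Y (i - 1) a x * (f1 a x * (\<Sum>b<n. Y i b x * f2 b x) - f2 a x * (\<Sum>b<n. Y i b x * f1 b x)))"
      by (simp add: coord2_apply f_def right_diff_distrib sum_subtractf sum_distrib_left mult.left_commute)
    also have "\<dots> = (\<Sum>a<n. Y (i - 1) a x * f1 a x) * (q x * q x)"
      using p[of i] i by (simp add: sum_distrib_right mult.assoc)
    also have "\<dots> = (q x * q x) * (q x * q x)" using p[of "i - 1"] i by simp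
    finally have "coord2 Y f (i - 1) i x \<noteq> 0" using F(2) by simp
    then have "(\<lambda>rs. f rs x) \<notin> Wedge x" using Wedge_iff[where F = f and x = x, OF F GamD(3)[OF fG]] by simp
    then show ?thesis using fG by (intro exI bexI)
  qed
  show "\<exists>t. \<exists>f\<in>Gam sq (Alt (i + 1)) t. (\<lambda>rs. f rs x) \<notin> Wedge x" by (rule gen)
  show "\<exists>a y. (\<forall>x. \<forall>u\<in>Alt (i + 1) x. u \<in> Wedge x \<longleftrightarrow> (\<Sum>rs\<in>sq. y rs x * u rs) = 0) \<and>
     (\<forall>t. \<forall>f\<in>Gam sq (Alt (i + 1)) t. pair_with sq y f \<in> forms (t + a))"
  proof (rule line_quotient[OF Alt_subspace[OF ii] _ gen])
    fix x
    obtain e e' W Y q where F: "is_frame n i V e e' W Y q" "q x \<noteq> 0" using frame by blast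
    define l where "l = (\<lambda>rs. Y (i - 1) (fst rs) * Y i (snd rs))"
    have "u \<in> Wedge z \<longleftrightarrow> (\<Sum>rs\<in>sq. l rs z * u rs) = 0" if "q z \<noteq> 0" "u \<in> Alt (i + 1) z" for z u
      using Wedge_iff[OF F(1) that(1), of "\<lambda>rs _. u rs"] that(2) pair_with_sq[of Y "i - 1" i z "\<lambda>rs _. u rs"]
      by (simp add: l_def)
    moreover have "l rs \<in> forms (e' + e')" for rs unfolding l_def by (intro forms_mult frameD(2)[OF F(1)])
    ultimately show "\<exists>e l d q. (\<forall>rs. l rs \<in> forms e) \<and> q \<in> forms d \<and> q x \<noteq> 0 \<and>
       (\<forall>x. q x \<noteq> 0 \<longrightarrow> (\<forall>u\<in>Alt (i + 1) x. (u \<in> Wedge x) = ((\<Sum>rs\<in>sq. l rs x * u rs) = 0)))"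
      using frameD(3)[OF F(1)] F(2)
      by (intro exI[of _ "e' + e'"] exI[of _ l] exI[of _ "e + e'"] exI[of _ q]) auto
  qed
qed

text \<open>Here \<open>c\<close> is the degree of the determinant of the piece of rank two.\<close>

lemma Wedge_step:
  "\<exists>c t0. \<forall>t\<ge>t0. sv.dim (Gam sq (Alt (i + 1)) t) = sv.dim (Gam sq Wedge t) + H (t + c)"
proof -
  have ii: "i + 1 \<le> n" "i + 1 \<noteq> i" using i by auto
  obtain a y where y1: "\<And>x u. u \<in> Alt (i + 1) x \<Longrightarrow> u \<in> Wedge x \<longleftrightarrow> (\<Sum>rs\<in>sq. y rs x * u rs) = 0"
    and y2: "\<And>t f. f \<in> Gam sq (Alt (i + 1)) t \<Longrightarrow> pair_with sq y f \<in> forms (t + a)"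
    using wedge_functional(1) by blast
  let ?T = "\<lambda>f (_::unit). pair_with sq y f"
  have fin: "finite (UNIV :: unit set)" by simp
  have "\<exists>t0. \<forall>t\<ge>t0. ?T ` Gam sq (Alt (i + 1)) t = free UNIV (t + a) \<and>
    sv.dim (Gam sq (Alt (i + 1)) t) = sv.dim {f \<in> Gam sq (Alt (i + 1)) t. ?T f = 0} + sv.dim (free (UNIV :: unit set) (t + a))"
  proof (rule gmod_exact[OF gmod_Alt[OF ii] gmod_free[OF fin]])
    show "?T (f + g) = ?T f + ?T g" for f g by (simp add: pair_with_add fun_eq_iff)
    show "?T (smul h f) = smul h (?T f)" for h f by (simp add: pair_with_smul fun_eq_iff)
    show "?T f \<in> free UNIV (t + a)" if "f \<in> Gam sq (Alt (i + 1)) t" for t f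
      using y2[OF that] by (simp add: free_def)
    fix x
    obtain s f where f: "f \<in> Gam sq (Alt (i + 1)) s" "(\<lambda>rs. f rs x) \<notin> Wedge x" using wedge_functional(2) by blast
    show "\<exists>d q. q \<in> forms d \<and> q x \<noteq> 0 \<and>
        (\<forall>t. \<forall>g\<in>free (UNIV :: unit set) t. \<exists>f\<in>Gam sq (Alt (i + 1)) (t + d - a). ?T f = smul q g)"
    proof (intro exI conjI allI ballI)
      show "pair_with sq y f \<in> forms (s + a)" by (rule y2[OF f(1)])
      show "pair_with sq y f x \<noteq> 0" using y1[OF GamD(3)[OF f(1)]] f(2) by (simp add: pair_with_def)
      fix t and g :: "unit \<Rightarrow> pt \<Rightarrow> complex" assume "g \<in> free UNIV t"
      then have "g () \<in> forms t" by (simp add: free_def)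
      then have "smul (g ()) f \<in> Gam sq (Alt (i + 1)) (s + t)"
        by (intro gmodD(5)[OF gmod_Alt[OF ii] f(1)])
      moreover have "?T (smul (g ()) f) = smul (pair_with sq y f) g"
        by (simp add: pair_with_smul fun_eq_iff mult.commute)
      moreover have "s + t = t + (s + a) - a" by simp
      ultimately show "\<exists>f'\<in>Gam sq (Alt (i + 1)) (t + (s + a) - a). ?T f' = smul (pair_with sq y f) g"
        by metis
    qed
  qed
  moreover have ker: "{f \<in> Gam sq (Alt (i + 1)) t. ?T f = 0} = Gam sq Wedge t" for t
  proof (intro subset_antisym subsetI)
    fix f assume "f \<in> {f \<in> Gam sq (Alt (i + 1)) t. ?T f = 0}"
    then have f: "f \<in> Gam sq (Alt (i + 1)) t" "?T f = 0" by auto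
    have "(\<lambda>r. f r x) \<in> Wedge x" for x
      using y1[OF GamD(3)[OF f(1)]] fun_cong[OF fun_cong[OF f(2), of "()"], of x] by (simp add: pair_with_def)
    then show "f \<in> Gam sq Wedge t" using f(1) by (simp add: Gam_def)
  next
    fix f assume f: "f \<in> Gam sq Wedge t"
    have u: "(\<lambda>r. f r x) \<in> Alt (i + 1) x" for x by (rule Wedge_Alt[OF GamD(3)[OF f]])
    then have "pair_with sq y f x = 0" for x
      using y1[OF u] GamD(3)[OF f] by (simp add: pair_with_def)
    then show "f \<in> {f \<in> Gam sq (Alt (i + 1)) t. ?T f = 0}" using f u by (simp add: Gam_def fun_eq_iff)
  qed
  ultimately obtain t0 where "\<And>t. t \<ge> t0 \<Longrightarrow> sv.dim (Gam sq (Alt (i + 1)) t) = sv.dim (Gam sq Wedge t) + H (t + a)"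
    by (auto simp: free_basis(2)[OF fin] H_def)
  then show ?thesis by blast
qed

definition skew :: "(nat \<times> nat \<Rightarrow> pt \<Rightarrow> complex) \<Rightarrow> nat \<times> nat \<Rightarrow> pt \<Rightarrow> complex" where
  "skew G = (\<lambda>(r, s). G (r, s) - G (s, r))"

lemma skew_add: "skew (F + G) = skew F + skew G"
  by (simp add: skew_def fun_eq_iff)

lemma skew_smul: "skew (smul h F) = smul h (skew F)"
  by (simp add: skew_def fun_eq_iff right_diff_distrib)

lemma skew_forms:
  assumes "F \<in> Gam sq U t" shows "skew F rs \<in> forms t" "rs \<notin> sq \<Longrightarrow> skew F rs = 0"
proof -
  show "skew F rs \<in> forms t" unfolding skew_def case_prod_unfold by (intro forms_diff GamD(1)[OF assms])
  assume "rs \<notin> sq"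
  then have "(fst rs, snd rs) \<notin> sq" "(snd rs, fst rs) \<notin> sq" by (auto simp: sq_def mem_Times_iff)
  then have "F (fst rs, snd rs) = 0" "F (snd rs, fst rs) = 0" using GamD(2)[OF assms] by blast+
  then show "skew F rs = 0" unfolding skew_def case_prod_unfold by (simp only: diff_self)
qed

lemma low_forms:
  assumes fr: "is_frame n i V e e' W Y q" and F: "F \<in> Gam sq U t"
  shows "low W Y F rs \<in> forms (t + (e + e') + (e + e'))" "rs \<notin> sq \<Longrightarrow> low W Y F rs = 0"
proof -
  have "Y c a * F (a, b) * Y d b \<in> forms (e' + t + e')" for a b c d
    by (intro forms_mult frameD(2)[OF fr] GamD(1)[OF F])
  then have c2: "coord2 Y F c d \<in> forms (e' + t + e')" for c d
    unfolding coord2_def by (intro forms_sum)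
  have "W r c * W s d * coord2 Y F c d \<in> forms (e + e + (e' + t + e'))" for r s c d
    by (intro forms_mult frameD(1)[OF fr] c2)
  then have "(if d < c then W r c * W s d * coord2 Y F c d else 0) \<in> forms (e + e + (e' + t + e'))" for r s c d
    by (cases "d < c") (simp_all only: if_True if_False forms_0)
  then have "low W Y F rs \<in> forms (e + e + (e' + t + e'))"
    unfolding low_def case_prod_unfold by (intro forms_sum)
  then show "low W Y F rs \<in> forms (t + (e + e') + (e + e'))" by (rule forms_cong_degree) simp
  assume "rs \<notin> sq"
  moreover obtain r s where rs: "rs = (r, s)" by fastforce
  ultimately have "n \<le> r \<or> n \<le> s" by (auto simp: sq_def)
  then have "(\<forall>c. W r c = 0) \<or> (\<forall>c. W s c = 0)" using frameD(4)[OF fr] by blast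
  then have "low W Y F rs x = 0" for x unfolding rs low_apply by (intro sum.neutral ballI) auto
  then show "low W Y F rs = 0" by (simp add: fun_eq_iff)
qed

text \<open>\<open>Wedge\<close> is counted as the image of skewing. A tensor in
  \<open>Tens (i + 1) (i - 1)\<close> with zero skewing is symmetric, so its rows and its columns
  lie in \<open>V (i - 1)\<close>. The kernel is therefore that of skewing on
  \<open>Tens (i - 1) (i - 1)\<close>, whose image in large degrees is the exterior square of
  \<open>V (i - 1)\<close>.\<close>

lemma Wedge_count:
  "\<exists>t0. \<forall>t\<ge>t0. sv.dim (Gam sq (Tens (i + 1) (i - 1)) t) + sv.dim (Gam sq (Alt (i - 1)) t) =
     sv.dim (Gam sq Wedge t) + sv.dim (Gam sq (Tens (i - 1) (i - 1)) t)"
proof -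
  have ii: "i + 1 \<le> n" "i + 1 \<noteq> i" "i - 1 \<le> n" "i - 1 \<noteq> i" using i by auto
  have 1: "\<exists>t0. \<forall>t\<ge>t0. skew ` Gam sq (Tens (i + 1) (i - 1)) t = Gam sq Wedge (t + 0) \<and>
    sv.dim (Gam sq (Tens (i + 1) (i - 1)) t) = sv.dim {F \<in> Gam sq (Tens (i + 1) (i - 1)) t. skew F = 0} + sv.dim (Gam sq Wedge (t + 0))"
  proof (rule gmod_exact[OF gmod_Tens[OF ii] gmod_Wedge skew_add skew_smul])
    show "skew F \<in> Gam sq Wedge (t + 0)" if F: "F \<in> Gam sq (Tens (i + 1) (i - 1)) t" for F t
    proof (rule GamI)
      show "skew F rs \<in> forms (t + 0)" for rs using skew_forms(1)[OF F] by simp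
      show "skew F rs = 0" if "rs \<notin> sq" for rs using skew_forms(2)[OF F that] .
      show "(\<lambda>rs. skew F rs x) \<in> Wedge x" for x
        unfolding Wedge_def using GamD(3)[OF F, of x] by (intro CollectI bexI) (auto simp: skew_def)
    qed
    fix x
    obtain e e' W Y q where fr: "is_frame n i V e e' W Y q" "q x \<noteq> 0" using frame by blast
    show "\<exists>d q. q \<in> forms d \<and> q x \<noteq> 0 \<and> (\<forall>t. \<forall>g\<in>Gam sq Wedge t. \<exists>F\<in>Gam sq (Tens (i + 1) (i - 1)) (t + d - 0). skew F = smul q g)"
    proof (intro exI conjI allI ballI)
      \<comment> \<open>Two factors \<open>q\<close> come from \<open>low_diff\<close>; the third
        makes the lift vanish where the frame degenerates, so that it lies in the tensor product
        everywhere.\<close>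
      show "q * q * q \<in> forms ((e + e') + (e + e') + (e + e'))" by (intro forms_mult frameD(3)[OF fr(1)])
      show "(q * q * q) x \<noteq> 0" using fr(2) by simp
      fix t g assume g: "g \<in> Gam sq Wedge t"
      have A: "(\<lambda>rs. g rs y) \<in> Alt (i + 1) y" for y by (rule Wedge_Alt[OF GamD(3)[OF g]])
      define F where "F = smul q (low W Y g)"
      have "F \<in> Gam sq (Tens (i + 1) (i - 1)) (t + ((e + e') + (e + e') + (e + e')) - 0)"
      proof (rule GamI)
        have "smul q (low W Y g) rs \<in> forms (t + (e + e') + (e + e') + (e + e'))" for rs
          by (rule smul_forms[where f = "low W Y g", OF low_forms(1)[OF fr(1) g] frameD(3)[OF fr(1)]])
        then show "F rs \<in> forms (t + ((e + e') + (e + e') + (e + e')) - 0)" for rs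
          unfolding F_def by (rule forms_cong_degree) simp
        show "F rs = 0" if "rs \<notin> sq" for rs
          using low_forms(2)[OF fr(1) g that] by (simp add: F_def fun_eq_iff)
        show "(\<lambda>rs. F rs y) \<in> Tens (i + 1) (i - 1) y" for y
        proof (cases "q y = 0")
          case True
          then have "(\<lambda>rs. F rs y) = 0" by (simp add: F_def fun_eq_iff)
          then show ?thesis using fv.subspace_0[OF Tens_subspace[OF ii]] by (simp only:)
        next
          case False
          have "coord2 Y g (i - 1) i y = 0" using Wedge_iff[where F = g and x = y, OF fr(1) False A] GamD(3)[OF g] by simp
          from fv.subspace_scale[OF Tens_subspace[OF ii] low_Tens[where F = g and x = y, OF fr(1) False A this], of "q y"]
          show ?thesis by (simp add: F_def fscale_def)
        qed
      qed
      moreover have "skew F = smul (q * q * q) g"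
      proof (intro ext)
        fix rs :: "nat \<times> nat" and y
        obtain r s where rs: "rs = (r, s)" by fastforce
        have "q y * q y * g (r, s) y = low W Y g (r, s) y - low W Y g (s, r) y"
        proof (rule low_diff[OF fr(1)])
          show "g (a, b) y = - g (b, a) y" for a b using AltD(1)[OF A] by blast
          show "g (a, b) y = 0" if "n \<le> a" for a b using Alt_supp[OF ii(1,2) A that] .
        qed
        then have "q y * (q y * q y * g (r, s) y) = q y * low W Y g (r, s) y - q y * low W Y g (s, r) y"
          by (simp only: right_diff_distrib)
        then show "skew F rs y = smul (q * q * q) g rs y" by (simp add: skew_def F_def rs mult.assoc)
      qed
      ultimately show "\<exists>F\<in>Gam sq (Tens (i + 1) (i - 1)) (t + ((e + e') + (e + e') + (e + e')) - 0). skew F = smul (q * q * q) g"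
        by blast
    qed
  qed
  have 2: "\<exists>t0. \<forall>t\<ge>t0. skew ` Gam sq (Tens (i - 1) (i - 1)) t = Gam sq (Alt (i - 1)) (t + 0) \<and>
    sv.dim (Gam sq (Tens (i - 1) (i - 1)) t) = sv.dim {F \<in> Gam sq (Tens (i - 1) (i - 1)) t. skew F = 0} + sv.dim (Gam sq (Alt (i - 1)) (t + 0))"
  proof (rule gmod_exact[OF gmod_Tens[OF ii(3,4,3,4)] gmod_Alt[OF ii(3,4)] skew_add skew_smul])
    show "skew F \<in> Gam sq (Alt (i - 1)) (t + 0)" if F: "F \<in> Gam sq (Tens (i - 1) (i - 1)) t" for F t
    proof (rule GamI)
      show "skew F rs \<in> forms (t + 0)" for rs using skew_forms(1)[OF F] by simp
      show "skew F rs = 0" if "rs \<notin> sq" for rs using skew_forms(2)[OF F that] .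
      fix x
      have "(\<lambda>s. skew F (r, s) x) = (\<lambda>s. F (r, s) x) - (\<lambda>s. F (s, r) x)" for r by (simp add: skew_def fun_eq_iff)
      then have "(\<lambda>s. skew F (r, s) x) \<in> V (i - 1) x" for r
        using GamD(3)[OF F, of x] fv.subspace_diff[OF V_subspace[OF ii(3,4)]] by (simp add: Tens_def)
      then show "(\<lambda>rs. skew F rs x) \<in> Alt (i - 1) x" unfolding Alt_def by (simp add: skew_def)
    qed
    fix x
    show "\<exists>d q. q \<in> forms d \<and> q x \<noteq> 0 \<and> (\<forall>t. \<forall>g\<in>Gam sq (Alt (i - 1)) t. \<exists>F\<in>Gam sq (Tens (i - 1) (i - 1)) (t + d - 0). skew F = smul q g)"
    proof (intro exI conjI allI ballI)
      \<comment> \<open>A skew tensor is its own lift up to the factor 2.\<close>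
      show "(\<lambda>_. 2) \<in> forms 0" by (rule forms_const)
      show "(2::complex) \<noteq> 0" by simp
      fix t g assume g: "g \<in> Gam sq (Alt (i - 1)) t"
      have "g \<in> Gam sq (Tens (i - 1) (i - 1)) (t + 0 - 0)"
      proof (rule GamI)
        show "(\<lambda>rs. g rs x) \<in> Tens (i - 1) (i - 1) x" for x
          using AltD(2)[OF GamD(3)[OF g]] Alt_col[OF ii(3,4) GamD(3)[OF g]] by (simp add: Tens_def)
      qed (use GamD(1,2)[OF g] in simp_all)
      moreover have "skew g = smul (\<lambda>_. 2) g"
      proof (intro ext)
        fix rs :: "nat \<times> nat" and x
        obtain r s where rs: "rs = (r, s)" by fastforce
        show "skew g rs x = smul (\<lambda>_. 2) g rs x"
          using AltD(1)[OF GamD(3)[OF g, of x], of s r] by (simp add: skew_def rs)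
      qed
      ultimately show "\<exists>F\<in>Gam sq (Tens (i - 1) (i - 1)) (t + 0 - 0). skew F = smul (\<lambda>_. 2) g" by blast
    qed
  qed
  have ker: "{F \<in> Gam sq (Tens (i + 1) (i - 1)) t. skew F = 0} = {F \<in> Gam sq (Tens (i - 1) (i - 1)) t. skew F = 0}" for t
  proof -
    have "(\<lambda>rs. F rs x) \<in> Tens (i + 1) (i - 1) x \<longleftrightarrow> (\<lambda>rs. F rs x) \<in> Tens (i - 1) (i - 1) x" if sk: "skew F = 0" for F x
    proof -
      have "F (r, s) x = F (s, r) x" for r s using fun_cong[OF fun_cong[OF sk, of "(r, s)"], of x] by (simp add: skew_def)
      then have "(\<lambda>r. F (r, s) x) = (\<lambda>r. F (s, r) x)" for s by (simp add: fun_eq_iff)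
      then show ?thesis
        using V_mono[of "i - 1" "i + 1"] ii unfolding Tens_def by auto
    qed
    then show ?thesis unfolding Gam_def by blast
  qed
  obtain t1 where t1: "\<And>t. t \<ge> t1 \<Longrightarrow> sv.dim (Gam sq (Tens (i + 1) (i - 1)) t) =
     sv.dim {F \<in> Gam sq (Tens (i + 1) (i - 1)) t. skew F = 0} + sv.dim (Gam sq Wedge t)" using 1 by auto
  obtain t2 where t2: "\<And>t. t \<ge> t2 \<Longrightarrow> sv.dim (Gam sq (Tens (i - 1) (i - 1)) t) =
     sv.dim {F \<in> Gam sq (Tens (i - 1) (i - 1)) t. skew F = 0} + sv.dim (Gam sq (Alt (i - 1)) t)" using 2 by auto
  show ?thesis
  proof (intro exI allI impI)
    fix t assume "max t1 t2 \<le> t"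
    then show "sv.dim (Gam sq (Tens (i + 1) (i - 1)) t) + sv.dim (Gam sq (Alt (i - 1)) t) =
     sv.dim (Gam sq Wedge t) + sv.dim (Gam sq (Tens (i - 1) (i - 1)) t)"
      using t1[of t] t2[of t] ker[of t] by simp
  qed
qed

text \<open>A skew matrix is determined by its entries above the diagonal, and for the trivial
  bundle these are arbitrary forms.\<close>

lemma Alt_n: "\<exists>N. \<forall>t. sv.dim (Gam sq (Alt n) t) = N * H t"
proof (intro exI allI)
  fix t
  have nn: "n \<le> n" "n \<noteq> i" using i by auto
  define R where "R = {(r, s). r < s \<and> s < n}"
  have finR: "finite R" by (rule finite_subset[of _ "{..<n} \<times> {..<n}"]) (auto simp: R_def)
  define T where "T F = (\<lambda>(r::nat, s). if r < s then F (r, s) else 0)" for F :: "nat \<times> nat \<Rightarrow> pt \<Rightarrow> complex"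
  obtain S where S: "finite S" "Gam sq (Alt n) t \<subseteq> sv.span S" using gmodD(7)[OF gmod_Alt[OF nn]] by blast
  have "sv.dim (Gam sq (Alt n) t) = sv.dim {F \<in> Gam sq (Alt n) t. T F = 0} + sv.dim (T ` Gam sq (Alt n) t)"
    by (rule sv_dim_split[OF gmodD(2)[OF gmod_Alt[OF nn]] S(2,1)]) (auto simp: T_def fun_eq_iff)
  moreover have "{F \<in> Gam sq (Alt n) t. T F = 0} = {0}"
  proof (intro subset_antisym subsetI)
    fix F assume "F \<in> {F \<in> Gam sq (Alt n) t. T F = 0}"
    then have F: "F \<in> Gam sq (Alt n) t" "T F = 0" by auto
    have lt: "F (r, s) x = 0" if "r < s" for r s x
      using fun_cong[OF fun_cong[OF F(2), of "(r, s)"], of x] that by (simp add: T_def)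
    have "F (r, s) x = 0" for r s x
      using lt[of r s x] lt[of s r x] AltD(1)[OF GamD(3)[OF F(1), of x], of r s]
      by (cases r s rule: linorder_cases) auto
    then show "F \<in> {0}" by (auto simp: fun_eq_iff)
  next
    fix F :: "nat \<times> nat \<Rightarrow> pt \<Rightarrow> complex" assume "F \<in> {0}"
    then have F0: "F = 0" by simp
    have "T 0 = 0" by (simp add: T_def fun_eq_iff)
    then show "F \<in> {F \<in> Gam sq (Alt n) t. T F = 0}"
      unfolding F0 using sv.subspace_0[OF gmodD(2)[OF gmod_Alt[OF nn]], of t] by (intro CollectI conjI)
  qed
  moreover have "T ` Gam sq (Alt n) t = free R t"
  proof (intro subset_antisym subsetI)
    fix G assume "G \<in> T ` Gam sq (Alt n) t"
    then obtain F where F: "F \<in> Gam sq (Alt n) t" "G = T F" by auto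
    show "G \<in> free R t" unfolding free_def F(2)
      using GamD(1,2)[OF F(1)] by (auto simp: T_def R_def sq_def)
  next
    fix G assume G: "G \<in> free R t"
    then have Gf: "G rs \<in> forms t" for rs unfolding free_def by blast
    define F where "F = (\<lambda>(r, s). G (r, s) - G (s, r))"
    have F: "F \<in> Gam sq (Alt n) t"
    proof (rule GamI)
      show "F rs \<in> forms t" for rs unfolding F_def case_prod_unfold by (intro forms_diff Gf)
      show "F rs = 0" if "rs \<notin> sq" for rs
      proof -
        have "(fst rs, snd rs) \<notin> R" "(snd rs, fst rs) \<notin> R" using that by (auto simp: R_def sq_def mem_Times_iff)
        then have "G (fst rs, snd rs) = 0" "G (snd rs, fst rs) = 0" using G unfolding free_def by blast+
        then show ?thesis unfolding F_def case_prod_unfold by (simp only: diff_self)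
      qed
      fix x
      have "F (r, s) x = 0" if "n \<le> s" for r s
      proof -
        have "(r, s) \<notin> R" "(s, r) \<notin> R" using that by (auto simp: R_def)
        then have "G (r, s) = 0" "G (s, r) = 0" using G unfolding free_def by blast+
        then show ?thesis by (simp add: F_def)
      qed
      then show "(\<lambda>rs. F rs x) \<in> Alt n x" unfolding Alt_def by (simp add: V_n) (simp add: F_def)
    qed
    have "T F = G"
    proof (intro ext)
      fix rs :: "nat \<times> nat" and x
      obtain r s where rs: "rs = (r, s)" by fastforce
      have "\<not> r < s \<Longrightarrow> G (r, s) = 0" "r < s \<Longrightarrow> G (s, r) = 0" using G by (auto simp: free_def R_def)
      then show "T F rs x = G rs x" by (auto simp: T_def F_def rs)
    qed
    then show "G \<in> T ` Gam sq (Alt n) t" using F by blast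
  qed
  moreover have "sv.dim {0 :: nat \<times> nat \<Rightarrow> pt \<Rightarrow> complex} = 0"
    using sv.dim_le_card[of "{0}" "{}"] by simp
  ultimately show "sv.dim (Gam sq (Alt n) t) = card R * H t"
    by (simp add: free_basis(2)[OF finR] H_def)
qed

end

section \<open>The numerical contradiction\<close>

text \<open>The pattern of \<open>2 h_2 = p_1^2 + p_2\<close>, which turns the complete symmetric
  expression into power sums.\<close>

lemma triangular_sum:
  fixes g :: "'a::linorder \<Rightarrow> 'a \<Rightarrow> real"
  assumes "finite S" "\<And>k l. g k l = g l k"
  shows "2 * (\<Sum>k\<in>S. \<Sum>l\<in>{l\<in>S. k \<le> l}. g k l) = (\<Sum>k\<in>S. \<Sum>l\<in>S. g k l) + (\<Sum>k\<in>S. g k k)"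
proof -
  define T where "T = (\<Sum>k\<in>S. \<Sum>l\<in>S. if k \<le> l then g k l else 0)"
  have T1: "T = (\<Sum>k\<in>S. \<Sum>l\<in>{l\<in>S. k \<le> l}. g k l)"
    unfolding T_def using assms(1) by (simp add: sum.inter_filter)
  have "T = (\<Sum>l\<in>S. \<Sum>k\<in>S. if k \<le> l then g k l else 0)" unfolding T_def by (rule sum.swap)
  also have "\<dots> = (\<Sum>k\<in>S. \<Sum>l\<in>S. if l \<le> k then g k l else 0)"
    by (intro sum.cong refl if_cong assms(2))
  finally have "T + T = (\<Sum>k\<in>S. \<Sum>l\<in>S. (if k \<le> l then g k l else 0) + (if l \<le> k then g k l else 0))"
    unfolding T_def by (simp add: sum.distrib)
  also have "\<dots> = (\<Sum>k\<in>S. \<Sum>l\<in>S. g k l + (if k = l then g k k else 0))"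
    by (intro sum.cong refl) auto
  also have "\<dots> = (\<Sum>k\<in>S. \<Sum>l\<in>S. g k l) + (\<Sum>k\<in>S. g k k)"
    using assms(1) by (simp add: sum.distrib)
  finally show ?thesis by (simp add: T1)
qed

text \<open>The binomial coefficient of \<open>z + 4\<close> over 4 as a polynomial, which is the
  Hilbert polynomial of projective four-space.\<close>

definition hilb :: "real \<Rightarrow> real" where
  "hilb z = (z + 1) * (z + 2) * (z + 3) * (z + 4) / 24"

lemma card_expo_hilb: assumes "0 \<le> t" shows "real (card (expo t)) = hilb (of_int t)"
proof -
  define m where "m = nat t"
  have t: "of_int t = real m" using assms by (simp add: m_def)
  define b2 b3 b4 where "b2 = (m + 2 choose 2)" and "b3 = (m + 3 choose 3)" and "b4 = (m + 4 choose 4)"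
  have S: "Suc (m + 3) = m + 4" "Suc (m + 2) = m + 3" "Suc (m + 1) = m + 2" "Suc 3 = 4" "Suc 2 = 3" "Suc 1 = 2"
    by simp_all
  have b: "4 * b4 = (m + 4) * b3" "3 * b3 = (m + 3) * b2" "2 * b2 = (m + 2) * (m + 1)"
    using Suc_times_binomial[of 3 "m + 3"] Suc_times_binomial[of 2 "m + 2"] Suc_times_binomial[of 1 "m + 1"]
    unfolding S b2_def b3_def b4_def by simp_all
  have "24 * b4 = 6 * (4 * b4)" by simp
  also have "\<dots> = 2 * (m + 4) * (3 * b3)" unfolding b(1) by simp
  also have "\<dots> = (m + 4) * (m + 3) * (2 * b2)" unfolding b(2) by (simp only: mult_ac)
  also have "\<dots> = (m + 1) * (m + 2) * (m + 3) * (m + 4)" unfolding b(3) by (simp only: mult_ac)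
  finally have "24 * (m + 4 choose 4) = (m + 1) * (m + 2) * (m + 3) * (m + 4)" unfolding b4_def .
  then have "real (24 * (m + 4 choose 4)) = real ((m + 1) * (m + 2) * (m + 3) * (m + 4))" by (simp only:)
  then have "24 * real (m + 4 choose 4) = (real m + 1) * (real m + 2) * (real m + 3) * (real m + 4)"
    by (simp only: of_nat_mult of_nat_add of_nat_1 of_nat_numeral)
  then have "real (m + 4 choose 4) = hilb (real m)" unfolding hilb_def by linarith
  then show ?thesis using card_expo[OF assms] by (simp only: t m_def[symmetric])
qed

text \<open>\<open>\<Phi>\<close> collects the differences of both sides of an identity between Hilbert polynomials. Translates
  of the Hilbert polynomial span the polynomials of degree at most 4, so power sums may be read off;
  they satisfy the relations of the Chern roots of a bundle of rank 2 that vanish in degrees 3 and 4.\<close>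

lemma degrees_vanish:
  fixes a :: "'k \<Rightarrow> int" and c :: int and N :: real and K :: "'k set"
  assumes K: "finite K"
    and ev: "\<forall>\<^sub>F t in at_top. N * hilb (of_int t) = 2 * (real (card K) + 2) * (\<Sum>k\<in>K. hilb (of_int (t + a k)))
       + 2 * hilb (of_int (t + c)) - (\<Sum>k\<in>K. \<Sum>l\<in>K. hilb (of_int (t + a k + a l))) - (\<Sum>k\<in>K. hilb (of_int (t + a k + a k)))"
    and k: "k \<in> K"
  shows "a k = 0"
proof -
  define x where "x k = real_of_int (a k)" for k
  define C where "C = real_of_int c"
  define n' where "n' = real (card K)"
  define \<Phi> where "\<Phi> f = N * f 0 - 2 * (n' + 2) * (\<Sum>k\<in>K. f (x k)) - 2 * f C
     + (\<Sum>k\<in>K. \<Sum>l\<in>K. f (x k + x l)) + (\<Sum>k\<in>K. f (2 * x k))" for f :: "real \<Rightarrow> real"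
  have lin: "\<Phi> (\<lambda>z. \<alpha> * f z + g z) = \<alpha> * \<Phi> f + \<Phi> g" for \<alpha> f g
    by (simp add: \<Phi>_def sum.distrib sum_distrib_left[symmetric] algebra_simps)
  define P :: "real poly" where "P = smult (1/24) ([:1,1:] * [:2,1:] * [:3,1:] * [:4,1:])"
  have P: "poly P z = hilb z" for z by (simp add: P_def hilb_def algebra_simps)
  \<comment> \<open>The assumption holds for infinitely many integers, so it is an identity of
    polynomials; this permits the negative shifts below.\<close>
  have zero: "\<Phi> (\<lambda>w. hilb (z + w)) = 0" for z
  proof -
    define sh where "sh b = pcompose P [:b, 1:]" for b
    have sh: "poly (sh b) z = hilb (z + b)" for b z by (simp add: sh_def poly_pcompose P add.commute)
    define Q where "Q = smult N (sh 0) - smult (2 * (n' + 2)) (\<Sum>k\<in>K. sh (x k)) - smult 2 (sh C)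
      + (\<Sum>k\<in>K. \<Sum>l\<in>K. sh (x k + x l)) + (\<Sum>k\<in>K. sh (2 * x k))"
    have Q: "poly Q z = \<Phi> (\<lambda>w. hilb (z + w))" for z
      by (simp add: Q_def \<Phi>_def poly_sum sh)
    obtain t0 where t0: "\<And>t. t \<ge> t0 \<Longrightarrow> N * hilb (of_int t) = 2 * (real (card K) + 2) * (\<Sum>k\<in>K. hilb (of_int (t + a k)))
       + 2 * hilb (of_int (t + c)) - (\<Sum>k\<in>K. \<Sum>l\<in>K. hilb (of_int (t + a k + a l))) - (\<Sum>k\<in>K. hilb (of_int (t + a k + a k)))"
      using ev unfolding eventually_at_top_linorder by blast
    have root: "poly Q (of_int t) = 0" if "t \<ge> t0" for t
      using t0[OF that] by (simp add: Q \<Phi>_def n'_def x_def C_def add.assoc)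
    have "poly Q (real_of_int (t0 + int m)) = 0" for m by (rule root) simp
    then have "range (\<lambda>m. real_of_int (t0 + int m)) \<subseteq> {z. poly Q z = 0}" by blast
    moreover have "infinite (range (\<lambda>m. real_of_int (t0 + int m)))"
      by (rule range_inj_infinite) (simp add: inj_def)
    ultimately have "infinite {z. poly Q z = 0}" using finite_subset by blast
    then have "Q = 0" using poly_roots_finite by blast
    then show ?thesis using Q[of z] by simp
  qed
  have comb: "\<Phi> (\<lambda>w. b1 * hilb (-1 + w) + (b2 * hilb (-2 + w) + (b3 * hilb (-3 + w) + (b4 * hilb (-4 + w) + 0 * hilb (0 + w))))) = 0"
    for b1 b2 b3 b4
    by (simp only: lin zero) (use zero lin[of 0 "\<lambda>w. hilb (0 + w)" "\<lambda>_. 0"] in \<open>simp add: \<Phi>_def\<close>)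
  \<comment> \<open>The four shifts of \<open>hilb\<close> are the binomial coefficients of
    \<open>w + 3\<close>, \<open>w + 2\<close>, \<open>w + 1\<close> and \<open>w\<close> over 4,
    and their third difference is \<open>w\<close>.\<close>
  have "(\<lambda>w. 1 * hilb (-1 + w) + (-3 * hilb (-2 + w) + (3 * hilb (-3 + w) + (-1 * hilb (-4 + w) + 0 * hilb (0 + w))))) = (\<lambda>w. w)"
    by (auto simp: fun_eq_iff hilb_def field_simps)
  with comb[of 1 "-3" 3 "-1"] have f1: "\<Phi> (\<lambda>w. w) = 0" by simp
  \<comment> \<open>The coefficients are the differences of the Eulerian numbers 1, 4, 1 in
    Worpitzky's identity for the cube.\<close>
  have "(\<lambda>w. 1 * hilb (-1 + w) + (3 * hilb (-2 + w) + (-3 * hilb (-3 + w) + (-1 * hilb (-4 + w) + 0 * hilb (0 + w))))) = (\<lambda>w. w^3)"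
    by (auto simp: fun_eq_iff hilb_def field_simps power3_eq_cube)
  with comb[of 1 3 "-3" "-1"] have f3: "\<Phi> (\<lambda>w. w^3) = 0" by simp
  \<comment> \<open>Worpitzky's identity for the fourth power, with the Eulerian numbers 1, 11, 11,
    1.\<close>
  have "(\<lambda>w. 1 * hilb (-1 + w) + (11 * hilb (-2 + w) + (11 * hilb (-3 + w) + (1 * hilb (-4 + w) + 0 * hilb (0 + w))))) = (\<lambda>w. w^4)"
    by (auto simp: fun_eq_iff hilb_def field_simps power4_eq_xxxx)
  with comb[of 1 11 11 1] have f4: "\<Phi> (\<lambda>w. w^4) = 0" by simp
  define s1 s2 s3 s4 where "s1 = (\<Sum>k\<in>K. x k)" and "s2 = (\<Sum>k\<in>K. x k ^ 2)"
    and "s3 = (\<Sum>k\<in>K. x k ^ 3)" and "s4 = (\<Sum>k\<in>K. x k ^ 4)"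
  have "(\<Sum>k\<in>K. \<Sum>l\<in>K. x k + x l) = 2 * n' * s1"
    by (simp add: sum.distrib s1_def n'_def sum_distrib_left[symmetric])
  moreover have "(\<Sum>k\<in>K. 2 * x k) = 2 * s1" by (simp add: s1_def sum_distrib_left)
  \<comment> \<open>The first Chern class of the piece of rank two, since that of the trivial bundle
    is zero.\<close>
  ultimately have C: "C = - s1"
    using f1 unfolding \<Phi>_def s1_def[symmetric] by (simp add: algebra_simps)
  have "(\<Sum>l\<in>K. (x k + x l) ^ 3) = n' * x k ^ 3 + 3 * x k ^ 2 * s1 + 3 * x k * s2 + s3" for k
  proof -
    have "(x k + x l) ^ 3 = x k ^ 3 + 3 * x k ^ 2 * x l + 3 * x k * x l ^ 2 + x l ^ 3" for l
      by (simp add: power3_eq_cube power2_eq_square algebra_simps)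
    then show ?thesis by (simp add: sum.distrib s1_def s2_def s3_def n'_def sum_distrib_left)
  qed
  then have "(\<Sum>k\<in>K. \<Sum>l\<in>K. (x k + x l) ^ 3) = n' * s3 + 3 * s2 * s1 + 3 * s1 * s2 + n' * s3"
    by (simp add: sum.distrib s1_def s2_def s3_def n'_def sum_distrib_left[symmetric] sum_distrib_right[symmetric])
  moreover have "(\<Sum>k\<in>K. (2 * x k) ^ 3) = 8 * s3"
    by (simp add: power_mult_distrib s3_def sum_distrib_left)
  \<comment> \<open>Six times the complete symmetric polynomial of degree 3 in the degrees.\<close>
  ultimately have e3: "s1 ^ 3 + 3 * s1 * s2 + 2 * s3 = 0"
    using f3 by (simp add: \<Phi>_def s3_def[symmetric] C algebra_simps)
  have "(\<Sum>l\<in>K. (x k + x l) ^ 4) = n' * x k ^ 4 + 4 * x k ^ 3 * s1 + 6 * x k ^ 2 * s2 + 4 * x k * s3 + s4" for k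
  proof -
    have "(x k + x l) ^ 4 = x k ^ 4 + 4 * x k ^ 3 * x l + 6 * x k ^ 2 * x l ^ 2 + 4 * x k * x l ^ 3 + x l ^ 4" for l
      by (simp add: power4_eq_xxxx power3_eq_cube power2_eq_square algebra_simps)
    then show ?thesis by (simp add: sum.distrib s1_def s2_def s3_def s4_def n'_def sum_distrib_left)
  qed
  then have "(\<Sum>k\<in>K. \<Sum>l\<in>K. (x k + x l) ^ 4) = n' * s4 + 4 * s3 * s1 + 6 * s2 * s2 + 4 * s1 * s3 + n' * s4"
    by (simp add: sum.distrib s1_def s2_def s3_def s4_def n'_def sum_distrib_left[symmetric] sum_distrib_right[symmetric])
  moreover have "(\<Sum>k\<in>K. (2 * x k) ^ 4) = 16 * s4"
    by (simp add: power_mult_distrib s4_def sum_distrib_left)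
  \<comment> \<open>Twenty-four times the complete symmetric polynomial of degree 4, minus
    \<open>12 * s1\<close> times the one of degree 3.\<close>
  ultimately have e4: "- (s1 ^ 4) + 4 * s1 * s3 + 3 * s2 ^ 2 + 6 * s4 = 0"
    using f4 unfolding \<Phi>_def s4_def[symmetric] C power2_eq_square
    by (simp add: algebra_simps power_minus_even)
  have s2: "0 \<le> s2" unfolding s2_def by (simp add: sum_nonneg)
  \<comment> \<open>The scaling by 4 avoids fractions. Each term is nonnegative because
    \<open>s2\<close> is a sum of squares of reals.\<close>
  define F where "F k = x k ^ 2 * ((2 * x k + s1) ^ 2 + s1 ^ 2 + 2 * s2)" for k
  have F0: "0 \<le> F k" for k unfolding F_def using s2 by (intro mult_nonneg_nonneg) auto
  have "F k = 4 * x k ^ 4 + 4 * s1 * x k ^ 3 + (2 * s1 ^ 2 + 2 * s2) * x k ^ 2" for k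
    unfolding F_def power4_eq_xxxx power3_eq_cube power2_eq_square by (simp add: algebra_simps)
  then have "(\<Sum>k\<in>K. F k) = 4 * s4 + 4 * s1 * s3 + (2 * s1 ^ 2 + 2 * s2) * s2"
    by (simp add: sum.distrib s2_def s3_def s4_def sum_distrib_left)
  moreover have "3 * (4 * s4 + 4 * s1 * s3 + (2 * s1 ^ 2 + 2 * s2) * s2) =
      2 * (- (s1 ^ 4) + 4 * s1 * s3 + 3 * s2 ^ 2 + 6 * s4) + 2 * s1 * (s1 ^ 3 + 3 * s1 * s2 + 2 * s3)"
    unfolding power4_eq_xxxx power3_eq_cube power2_eq_square by (simp add: algebra_simps)
  ultimately have "(\<Sum>k\<in>K. F k) = 0" using e3 e4 by simp
  then have "F k = 0" using sum_nonneg_eq_0_iff[OF K, of F] F0 k by blast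
  then have "x k = 0 \<or> (2 * x k + s1) ^ 2 + s1 ^ 2 + 2 * s2 = 0" by (simp add: F_def)
  then have "x k = 0"
  proof
    assume "(2 * x k + s1) ^ 2 + s1 ^ 2 + 2 * s2 = 0"
    moreover have "0 \<le> (2 * x k + s1) ^ 2" "0 \<le> s1 ^ 2" by simp_all
    ultimately have "s2 = 0" using s2 by linarith
    then have "x k ^ 2 = 0" unfolding s2_def using sum_nonneg_eq_0_iff[OF K, of "\<lambda>k. x k ^ 2"] k by simp
    then show ?thesis by simp
  qed
  then show ?thesis by (simp add: x_def)
qed

section \<open>Assembling the dimension counts\<close>

lemma eventually_shift: "eventually P (at_top :: int filter) \<Longrightarrow> eventually (\<lambda>t. P (t + a)) at_top"
proof -
  assume "eventually P (at_top :: int filter)"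
  then obtain N where "\<And>t. t \<ge> N \<Longrightarrow> P t" unfolding eventually_at_top_linorder by blast
  then show ?thesis unfolding eventually_at_top_linorder by (intro exI[of _ "N - a"]) auto
qed

lemma eventually_telescope:
  fixes D h :: "nat \<Rightarrow> int \<Rightarrow> nat"
  assumes "a \<le> b" "\<And>k. a \<le> k \<Longrightarrow> k < b \<Longrightarrow> \<exists>t0. \<forall>t\<ge>t0. D (k + 1) t = D k t + h k t"
  shows "\<forall>\<^sub>F t in at_top. D b t = D a t + (\<Sum>k\<in>{a..<b}. h k t)"
  using assms
proof (induction b rule: dec_induct)
  case (step m)
  have "\<forall>\<^sub>F t in at_top. D m t = D a t + (\<Sum>k\<in>{a..<m}. h k t)" using step by simp
  moreover have "\<forall>\<^sub>F t in at_top. D (m + 1) t = D m t + h m t"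
    using step.prems[of m] step.hyps unfolding eventually_at_top_linorder by simp
  ultimately show ?case
    by eventually_elim (use step.hyps in simp)
qed simp

context framed_flag
begin

lemma hV_low: assumes "k \<le> i - 1"
  shows "\<forall>\<^sub>F t in at_top. hV k t = (\<Sum>l\<in>{0..<k}. H (t + deg l))"
proof -
  have "Gam {..<n} (V 0) t = {0}" for t
  proof (intro subset_antisym subsetI)
    fix f assume f: "f \<in> Gam {..<n} (V 0) t"
    have "(\<lambda>r. f r x) = 0" for x by (rule V_0[OF GamD(3)[OF f]])
    then show "f \<in> {0}" by (auto simp: fun_eq_iff)
  qed (use sv.subspace_0[OF gmodD(2)[OF gmod_V[of 0]]] i in auto)
  then have "hV 0 t = 0" for t
    using sv.dim_le_card[of "{0 :: nat \<Rightarrow> pt \<Rightarrow> complex}" "{}"] by (simp add: hV_def)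
  moreover have "\<forall>\<^sub>F t in at_top. hV k t = hV 0 t + (\<Sum>l\<in>{0..<k}. H (t + deg l))"
  proof (rule eventually_telescope)
    fix l assume "l < k"
    then have "l \<in> cols" using assms i by (auto simp: cols_def)
    from hV_step[OF this] show "\<exists>t0. \<forall>t\<ge>t0. hV (l + 1) t = hV l t + H (t + deg l)" by blast
  qed simp
  ultimately show ?thesis by simp
qed

text \<open>Above the gap dimensions are counted downwards from the trivial bundle:
  \<open>V (i + 1)\<close> is not built from lines of known degree from below.\<close>

lemma hV_high: assumes "i + 1 \<le> j" "j \<le> n"
  shows "\<forall>\<^sub>F t in at_top. n * H t = hV j t + (\<Sum>l\<in>{j..<n}. H (t + deg l))"
proof -
  have "Gam {..<n} (V n) t = free {..<n} t" for t
    by (auto simp: Gam_def free_def V_n)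
  then have "hV n t = n * H t" for t by (simp add: hV_def H_def free_basis(2))
  moreover have "\<forall>\<^sub>F t in at_top. hV n t = hV j t + (\<Sum>l\<in>{j..<n}. H (t + deg l))"
  proof (rule eventually_telescope[OF assms(2)])
    fix l assume "j \<le> l" "l < n"
    then have "l \<in> cols" using assms i by (auto simp: cols_def)
    from hV_step[OF this] show "\<exists>t0. \<forall>t\<ge>t0. hV (l + 1) t = hV l t + H (t + deg l)" by blast
  qed
  ultimately show ?thesis by simp
qed

lemma zero_family_dim:
  fixes U :: "pt \<Rightarrow> (nat \<times> nat \<Rightarrow> complex) set"
  assumes "\<And>x F. F \<in> U x \<Longrightarrow> \<forall>r. (\<lambda>s. F (r, s)) \<in> V 0 x"
  shows "sv.dim (Gam sq U t) = 0"
proof -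
  have "Gam sq U t \<subseteq> {0}"
  proof
    fix F assume F: "F \<in> Gam sq U t"
    have "(\<lambda>s. F (r, s) x) = 0" for r x using assms[OF GamD(3)[OF F]] V_0 by blast
    then have "F (r, s) x = 0" for r s x by (metis zero_fun_apply)
    then show "F \<in> {0}" by (auto simp: fun_eq_iff)
  qed
  then show ?thesis
    using sv.dim_le_card[of "Gam sq U t" "{}"] by simp
qed

text \<open>\<open>E1\<close> and \<open>E2\<close> descend from the trivial exterior square to
  \<open>Wedge\<close>, splitting off the determinant; \<open>E3\<close> to \<open>E5\<close> count
  \<open>Wedge\<close> from below. Eliminating its dimension leaves Hilbert functions of lines:
  \<open>N * h t = n * A cols + h (t + c)\<close> minus the sum of \<open>g k l\<close> over pairs
  with \<open>k \<le> l\<close>.\<close>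

lemma deg_zero: assumes "k \<in> cols" shows "deg k = 0"
proof -
  define Lo Up where "Lo = {0..<i - 1}" and "Up = {i + 1..<n}"
  have LU: "cols = Lo \<union> Up" "Lo \<inter> Up = {}" "finite Lo" "finite Up"
    using i by (auto simp: cols_def Lo_def Up_def)
  have sub: "k \<in> cols" if "k \<in> Lo \<or> k \<in> Up" for k using that LU by auto
  have cardc: "real (card cols) + 2 = real n"
    using i by (simp add: LU card_Un_disjoint Lo_def Up_def)
  define h where "h t = real (H t)" for t
  obtain N where N: "\<And>t. sv.dim (Gam sq (Alt n) t) = N * H t" using Alt_n by blast
  obtain c where "\<exists>t0. \<forall>t\<ge>t0. sv.dim (Gam sq (Alt (i + 1)) t) = sv.dim (Gam sq Wedge t) + H (t + c)"
    using Wedge_step by blast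
  then have E2: "\<forall>\<^sub>F t in at_top. sv.dim (Gam sq (Alt (i + 1)) t) = sv.dim (Gam sq Wedge t) + H (t + c)"
    by (simp add: eventually_at_top_linorder)
  have E1: "\<forall>\<^sub>F t in at_top. sv.dim (Gam sq (Alt n) t) = sv.dim (Gam sq (Alt (i + 1)) t) + (\<Sum>k\<in>Up. hV k (t + deg k))"
    unfolding Up_def
  proof (rule eventually_telescope)
    fix k assume "i + 1 \<le> k" "k < n"
    then have "k \<in> cols" using sub by (simp add: Up_def)
    from Alt_step[OF this] show "\<exists>t0. \<forall>t\<ge>t0. sv.dim (Gam sq (Alt (k + 1)) t) = sv.dim (Gam sq (Alt k) t) + hV k (t + deg k)" .
  qed (use i in simp)
  have E3: "\<forall>\<^sub>F t in at_top. sv.dim (Gam sq (Tens (i + 1) (i - 1)) t) + sv.dim (Gam sq (Alt (i - 1)) t) =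
     sv.dim (Gam sq Wedge t) + sv.dim (Gam sq (Tens (i - 1) (i - 1)) t)"
    using Wedge_count by (simp add: eventually_at_top_linorder)
  have E4: "\<forall>\<^sub>F t in at_top. sv.dim (Gam sq (Alt (i - 1)) t) = sv.dim (Gam sq (Alt 0) t) + (\<Sum>k\<in>Lo. hV k (t + deg k))"
    unfolding Lo_def
  proof (rule eventually_telescope)
    fix k assume "k < i - 1"
    then have "k \<in> cols" using sub by (simp add: Lo_def)
    from Alt_step[OF this] show "\<exists>t0. \<forall>t\<ge>t0. sv.dim (Gam sq (Alt (k + 1)) t) = sv.dim (Gam sq (Alt k) t) + hV k (t + deg k)" .
  qed simp
  have E5: "\<forall>\<^sub>F t in at_top. sv.dim (Gam sq (Tens j (i - 1)) t) = sv.dim (Gam sq (Tens j 0) t) + (\<Sum>k\<in>Lo. hV j (t + deg k))"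
    if "j \<le> n" "j \<noteq> i" for j
    unfolding Lo_def
  proof (rule eventually_telescope)
    fix k assume "k < i - 1"
    then have "k \<in> cols" using sub by (simp add: Lo_def)
    from Tens_step[OF this that]
    show "\<exists>t0. \<forall>t\<ge>t0. sv.dim (Gam sq (Tens j (k + 1)) t) = sv.dim (Gam sq (Tens j k) t) + hV j (t + deg k)" .
  qed simp
  have z0: "sv.dim (Gam sq (Alt 0) t) = 0" "sv.dim (Gam sq (Tens j 0) t) = 0" for j t
  proof -
    show "sv.dim (Gam sq (Alt 0) t) = 0" by (rule zero_family_dim) (use AltD(2) in blast)
    show "sv.dim (Gam sq (Tens j 0) t) = 0" by (rule zero_family_dim) (simp add: Tens_def)
  qed
  have ii: "i + 1 \<le> n" "i + 1 \<noteq> i" "i - 1 \<le> n" "i - 1 \<noteq> i" using i by auto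
  have F1: "\<forall>\<^sub>F t in at_top. \<forall>k\<in>Lo. real (hV k (t + deg k)) = (\<Sum>l\<in>{0..<k}. h (t + deg k + deg l))"
  proof (rule eventually_ball_finite[OF LU(3)], rule ballI)
    fix k assume "k \<in> Lo"
    then have "k \<le> i - 1" by (simp add: Lo_def)
    from eventually_shift[OF hV_low[OF this], of "deg k"]
    show "\<forall>\<^sub>F t in at_top. real (hV k (t + deg k)) = (\<Sum>l\<in>{0..<k}. h (t + deg k + deg l))"
      by eventually_elim (simp add: h_def)
  qed
  have F2: "\<forall>\<^sub>F t in at_top. \<forall>k\<in>Lo. real (hV (i - 1) (t + deg k)) = (\<Sum>l\<in>Lo. h (t + deg k + deg l))"
  proof (rule eventually_ball_finite[OF LU(3)], rule ballI)
    fix k assume "k \<in> Lo"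
    from eventually_shift[OF hV_low[OF order_refl], of "deg k"]
    show "\<forall>\<^sub>F t in at_top. real (hV (i - 1) (t + deg k)) = (\<Sum>l\<in>Lo. h (t + deg k + deg l))"
      by eventually_elim (simp add: h_def Lo_def)
  qed
  have F3: "\<forall>\<^sub>F t in at_top. \<forall>k\<in>Lo. real (hV (i + 1) (t + deg k)) = n * h (t + deg k) - (\<Sum>l\<in>Up. h (t + deg k + deg l))"
  proof (rule eventually_ball_finite[OF LU(3)], rule ballI)
    fix k assume "k \<in> Lo"
    from eventually_shift[OF hV_high[OF order_refl ii(1)], of "deg k"]
    show "\<forall>\<^sub>F t in at_top. real (hV (i + 1) (t + deg k)) = n * h (t + deg k) - (\<Sum>l\<in>Up. h (t + deg k + deg l))"
      by eventually_elim (auto simp: h_def Up_def of_nat_mult[symmetric] simp del: of_nat_mult)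
  qed
  have F4: "\<forall>\<^sub>F t in at_top. \<forall>k\<in>Up. real (hV k (t + deg k)) = n * h (t + deg k) - (\<Sum>l\<in>{k..<n}. h (t + deg k + deg l))"
  proof (rule eventually_ball_finite[OF LU(4)], rule ballI)
    fix k assume "k \<in> Up"
    then have "i + 1 \<le> k" "k \<le> n" by (auto simp: Up_def)
    from eventually_shift[OF hV_high[OF this], of "deg k"]
    show "\<forall>\<^sub>F t in at_top. real (hV k (t + deg k)) = n * h (t + deg k) - (\<Sum>l\<in>{k..<n}. h (t + deg k + deg l))"
      by eventually_elim (auto simp: h_def of_nat_mult[symmetric] simp del: of_nat_mult)
  qed
  \<comment> \<open>Once \<open>t\<close> reaches \<open>2 * B\<close>, every shifted degree in
    sight is nonnegative, and there \<open>H\<close> agrees with \<open>hilb\<close>.\<close>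
  define B where "B = Max (insert \<bar>c\<bar> ((\<lambda>k. \<bar>deg k\<bar>) ` cols))"
  have fincols: "finite cols" by (simp add: LU)
  have B: "\<bar>c\<bar> \<le> B" "k \<in> cols \<Longrightarrow> \<bar>deg k\<bar> \<le> B" for k
    unfolding B_def using fincols by (auto intro!: Max_ge)
  have "\<forall>\<^sub>F t in at_top. 2 * N * hilb (of_int t) = 2 * (real (card cols) + 2) * (\<Sum>k\<in>cols. hilb (of_int (t + deg k)))
       + 2 * hilb (of_int (t + c)) - (\<Sum>k\<in>cols. \<Sum>l\<in>cols. hilb (of_int (t + deg k + deg l))) - (\<Sum>k\<in>cols. hilb (of_int (t + deg k + deg k)))"
    using E1 E2 E3 E4 E5[OF ii(1,2)] E5[OF ii(3,4)] F1 F2 F3 F4 eventually_ge_at_top[of "2 * B"]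
  proof eventually_elim
    case (elim t)
    define g where "g k l = h (t + deg k + deg l)" for k l
    have sym: "g k l = g l k" for k l by (simp add: g_def algebra_simps)
    define A where "A S = (\<Sum>k\<in>S. h (t + deg k))" for S
    have "N * h t = h (t + c) + real (sv.dim (Gam sq Wedge t)) + (\<Sum>k\<in>Up. real (hV k (t + deg k)))"
      using elim(1,2) N[of t] by (simp add: h_def of_nat_mult[symmetric] del: of_nat_mult)
    moreover have "real (sv.dim (Gam sq Wedge t)) = (\<Sum>k\<in>Lo. real (hV (i + 1) (t + deg k))) + (\<Sum>k\<in>Lo. real (hV k (t + deg k)))
        - (\<Sum>k\<in>Lo. real (hV (i - 1) (t + deg k)))"
    proof -
      have "real (\<Sum>k\<in>Lo. hV (i + 1) (t + deg k)) + real (\<Sum>k\<in>Lo. hV k (t + deg k)) =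
          real (sv.dim (Gam sq Wedge t)) + real (\<Sum>k\<in>Lo. hV (i - 1) (t + deg k))"
        using elim(3-6) z0 by (simp only: of_nat_add[symmetric])
      then show ?thesis by simp
    qed
    moreover have "(\<Sum>k\<in>Up. real (hV k (t + deg k))) = n * A Up - (\<Sum>k\<in>Up. \<Sum>l\<in>{l\<in>Up. k \<le> l}. g k l)"
    proof -
      have "{l \<in> Up. k \<le> l} = {k..<n}" if "k \<in> Up" for k using that by (auto simp: Up_def)
      then show ?thesis using elim(10) by (simp add: A_def g_def sum_subtractf sum_distrib_left)
    qed
    moreover have "(\<Sum>k\<in>Lo. real (hV (i + 1) (t + deg k))) = n * A Lo - (\<Sum>k\<in>Lo. \<Sum>l\<in>Up. g k l)"
      using elim(9) by (simp add: A_def g_def sum_subtractf sum_distrib_left)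
    moreover have "(\<Sum>k\<in>Lo. real (hV (i - 1) (t + deg k))) - (\<Sum>k\<in>Lo. real (hV k (t + deg k))) = (\<Sum>k\<in>Lo. \<Sum>l\<in>{l\<in>Lo. k \<le> l}. g k l)"
    proof -
      have "(\<Sum>l\<in>Lo. g k l) - (\<Sum>l\<in>{0..<k}. g k l) = (\<Sum>l\<in>{l\<in>Lo. k \<le> l}. g k l)" if "k \<in> Lo" for k
      proof -
        have "Lo = {0..<k} \<union> {l \<in> Lo. k \<le> l}" "{0..<k} \<inter> {l \<in> Lo. k \<le> l} = {}"
          using that by (auto simp: Lo_def)
        then have "(\<Sum>l\<in>Lo. g k l) = (\<Sum>l\<in>{0..<k}. g k l) + (\<Sum>l\<in>{l \<in> Lo. k \<le> l}. g k l)"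
          using sum.union_disjoint[of "{0..<k}" "{l \<in> Lo. k \<le> l}" "g k"] LU(3) by simp
        then show ?thesis by simp
      qed
      then show ?thesis using elim(7,8) by (simp add: g_def sum_subtractf[symmetric])
    qed
    moreover have "(\<Sum>k\<in>Up. \<Sum>l\<in>Lo. g k l) = (\<Sum>k\<in>Lo. \<Sum>l\<in>Up. g k l)"
      by (subst sum.swap) (simp add: sym)
    moreover have "(\<Sum>k\<in>cols. \<Sum>l\<in>cols. g k l) = (\<Sum>k\<in>Lo. \<Sum>l\<in>Lo. g k l) + (\<Sum>k\<in>Lo. \<Sum>l\<in>Up. g k l)
        + (\<Sum>k\<in>Up. \<Sum>l\<in>Lo. g k l) + (\<Sum>k\<in>Up. \<Sum>l\<in>Up. g k l)"
      unfolding LU(1) using LU(2-4) by (simp add: sum.union_disjoint sum.distrib)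
    moreover have "(\<Sum>k\<in>cols. g k k) = (\<Sum>k\<in>Lo. g k k) + (\<Sum>k\<in>Up. g k k)" "A cols = A Lo + A Up"
      unfolding LU(1) A_def using LU(2-4) by (simp_all add: sum.union_disjoint)
    moreover note triangular_sum[OF LU(3), of g, OF sym] triangular_sum[OF LU(4), of g, OF sym]
    ultimately have main: "2 * (N * h t) = 2 * (n * A cols) + 2 * h (t + c) - (\<Sum>k\<in>cols. \<Sum>l\<in>cols. g k l) - (\<Sum>k\<in>cols. g k k)"
      by (simp add: algebra_simps)
    have hh: "h s = hilb (of_int s)" if "0 \<le> s" for s using card_expo_hilb[OF that] by (simp add: h_def H_def)
    have B0: "0 \<le> B" using B(1) by linarith
    have "h t = hilb (of_int t)" "h (t + c) = hilb (of_int (t + c))"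
      using elim(11) B(1) B0 by (intro hh; linarith)+
    moreover have "g k l = hilb (of_int (t + deg k + deg l))" if "k \<in> cols" "l \<in> cols" for k l
      unfolding g_def using elim(11) B(2)[OF that(1)] B(2)[OF that(2)] by (intro hh) linarith
    moreover have "h (t + deg k) = hilb (of_int (t + deg k))" if "k \<in> cols" for k
      using elim(11) B(2)[OF that] B0 by (intro hh) linarith
    ultimately show ?case using main unfolding cardc A_def by (simp add: mult.assoc)
  qed
  from degrees_vanish[OF fincols this assms] show ?thesis .
qed

section \<open>Flags of degree zero are constant\<close>

text \<open>Downward from the full space. A vector of the constant space \<open>V (k + 1)\<close> is
  a constant section of degree 0, and its value under \<open>psi k\<close> is a form of degree
  \<open>deg k = 0\<close>, hence constant: it vanishes at all points or at none.\<close>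

lemma V_high_const: assumes "i + 1 \<le> j" "j \<le> n" shows "V j x = V j x'"
  using assms(2,1)
proof (induction j arbitrary: x x' rule: inc_induct)
  case base
  show ?case by (auto simp: V_n)
next
  case (step k)
  then have k: "k \<in> cols" by (auto simp: cols_def)
  have const: "V (k + 1) y = V (k + 1) y'" for y y' using step.IH[of y y'] step.prems by simp
  have "u \<in> V k y'" if u: "u \<in> V k y" for u y y'
  proof -
    have u1: "u \<in> V (k + 1) z" for z
      using V_mono[OF _ _ _ _ u, of "k + 1"] cols[OF k] const[of y z] by auto
    have "(\<lambda>r _. u r) \<in> Gam {..<n} (V (k + 1)) 0"
      using u1 V_supp[OF _ _ u1] cols[OF k] by (intro GamI forms_const) (auto simp: fun_eq_iff)
    from forms_0_const[OF psi(2)[OF k this, unfolded deg_zero[OF k] add_0_right], of y y']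
    have "(\<Sum>r<n. psi k r y * u r) = (\<Sum>r<n. psi k r y' * u r)" by (simp add: pair_with_def)
    then show ?thesis using u psi(1)[OF k u1] by simp
  qed
  then show ?case by blast
qed

text \<open>Every monomial of \<open>A * co l ^ M\<close> is divisible by \<open>co k ^ M\<close>,
  and since \<open>k\<close> differs from \<open>l\<close> so is every monomial of \<open>A\<close>.
  In degree \<open>M\<close> only \<open>co k ^ M\<close> itself is left.\<close>

lemma form_power_quotient:
  assumes A: "A \<in> forms (int M)" and B: "B \<in> forms (int M)" and kl: "k \<le> 4" "l \<le> 4" "k \<noteq> l"
    and eq: "A * co l ^ M = B * co k ^ M"
  shows "\<exists>c. A = (\<lambda>p. c * co k p ^ M)"
proof -
  define e where "e k = (\<lambda>j::nat. if j = k then M else 0)" for k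
  have e: "e k \<in> expo (int M)" if "k \<le> 4" for k
    using that by (auto simp: expo_def e_def)
  have mon_e: "mon (e k) p = co k p ^ M" if "k \<le> 4" for k p
  proof -
    have "mon (e k) p = (\<Prod>j\<le>4. if j = k then co k p ^ M else 1)"
      unfolding mon_def rmon_def by (rule prod.cong) (auto simp: e_def co_def)
    then show ?thesis using that by simp
  qed
  have eq': "(\<lambda>p. mon (e l) p * A p) = (\<lambda>p. mon (e k) p * B p)"
    using eq by (simp add: fun_eq_iff mon_e kl fun_power_apply mult.commute)
  have "m = e k" if m: "cf (int M) A m \<noteq> 0" for m
  proof -
    define m' where "m' = (\<lambda>j. m j + e l j)"
    have "cf (int M + int M) (\<lambda>p. mon (e l) p * A p) m' = cf (int M) A m"
      unfolding cf_mon_mult[OF A e[OF kl(2)]] by (simp add: m'_def)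
    then have "cf (int M + int M) (\<lambda>p. mon (e k) p * B p) m' \<noteq> 0" using m eq' by simp
    then have "e k k \<le> m' k" unfolding cf_mon_mult[OF B e[OF kl(1)]] by (auto split: if_splits)
    then have Mk: "M \<le> m k" using kl by (simp add: e_def m'_def)
    have mE: "m \<in> expo (int M)" using m cf(2)[OF A] by blast
    then have sum: "(\<Sum>j\<le>4. m j) = M" by (simp add: expo_def)
    have "m k + (\<Sum>j\<in>{..4} - {k}. m j) = M" using sum sum.remove[of "{..4::nat}" k m] kl by simp
    then have "m k = M" "(\<Sum>j\<in>{..4} - {k}. m j) = 0" using Mk by linarith+
    moreover from this have "m j = 0" if "j \<le> 4" "j \<noteq> k" for j
      using sum_eq_0_iff[of "{..4} - {k}" m] that by blast
    ultimately have "m j = e k j" for j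
      using mE by (cases "j \<le> 4") (auto simp: e_def expo_def)
    then show ?thesis by auto
  qed
  then have z: "cf (int M) A m = 0" if "m \<noteq> e k" for m using that by blast
  have "A p = cf (int M) A (e k) * co k p ^ M" for p
  proof -
    have "A p = (\<Sum>m\<in>expo (int M). cf (int M) A m * mon m p)" using fun_cong[OF cf(1)[OF A], of p] .
    also have "\<dots> = (\<Sum>m\<in>{e k}. cf (int M) A m * mon m p)"
      by (rule sum.mono_neutral_right) (use finite_expo e kl z in auto)
    finally show ?thesis by (simp add: mon_e kl)
  qed
  then show ?thesis by blast
qed

text \<open>Upward from zero. Once \<open>V k\<close> is constant, \<open>V (k + 1) / V k\<close> is
  a trivial line bundle inside a constant quotient space. Its section mapping to 1 under
  \<open>psi k\<close> has coordinates of degree zero there, so it is constant modulo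
  \<open>V k\<close>.\<close>

lemma V_low_const: assumes "j \<le> i - 1" shows "V j x = V j x'"
  using assms
proof (induction j arbitrary: x x')
  case 0
  have "V 0 z = {0}" for z
    using V_0 fv.subspace_0[OF V_subspace[of 0 z]] i by auto
  then show ?case by simp
next
  case (Suc k)
  then have k: "k \<in> cols" using i by (auto simp: cols_def)
  note kc = cols[OF k]
  have const: "V k y = V k y'" for y y' using Suc.IH Suc.prems by simp
  obtain t0 where t0: "\<And>t g. t \<ge> t0 \<Longrightarrow> g \<in> forms (t + deg k) \<Longrightarrow> \<exists>f\<in>Gam {..<n} (V (k + 1)) t. pair_with {..<n} (psi k) f = g"
    using hV_step[OF k] by blast
  \<comment> \<open>Lifting is known only in large degrees, so the products of the section mapping
    to 1 with \<open>co l ^ M\<close> are lifted; \<open>f l / co l ^ M\<close> represents that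
    section where \<open>co l\<close> is nonzero.\<close>
  define M where "M = nat t0"
  have "\<exists>f\<in>Gam {..<n} (V (k + 1)) (int M). pair_with {..<n} (psi k) f = co l ^ M" if "l \<le> 4" for l
    using forms_power[OF co_in_forms[OF that], of M] by (intro t0) (simp_all add: M_def deg_zero[OF k])
  then have "\<exists>f. l \<le> 4 \<longrightarrow> f \<in> Gam {..<n} (V (k + 1)) (int M) \<and> pair_with {..<n} (psi k) f = co l ^ M" for l by blast
  then obtain f where f: "\<And>l. l \<le> 4 \<Longrightarrow> f l \<in> Gam {..<n} (V (k + 1)) (int M)"
    and pf: "\<And>l. l \<le> 4 \<Longrightarrow> pair_with {..<n} (psi k) (f l) = co l ^ M" by metis
  define p1 where "p1 = Abs_pt (\<lambda>_. 1)"
  have p1: "co l p1 = 1" for l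
  proof -
    have "Rep_pt p1 = (\<lambda>_. 1)" unfolding p1_def by (intro Abs_pt_inverse) auto
    then show ?thesis by (simp add: co_def)
  qed
  obtain Y where Y: "\<And>v. v \<in> V k x \<longleftrightarrow>
    (\<forall>r\<ge>n. v r = 0) \<and> (\<forall>r. k \<le> r \<longrightarrow> r < n \<longrightarrow> (\<Sum>s<n. Y r s * v s) = 0)" using V_iff[of k x] kc by auto
  \<comment> \<open>The equations \<open>Y\<close> of the constant space \<open>V k\<close>, applied
    to the lift: its coordinates modulo \<open>V k\<close>.\<close>
  define \<phi> where "\<phi> r l = (\<lambda>p. \<Sum>s<n. Y r s * f l s p)" for r l
  have \<phi>: "\<phi> r l \<in> forms (int M)" if "l \<le> 4" for r l
  proof -
    have "\<phi> r l = (\<Sum>s<n. fscale (Y r s) (f l s))" by (simp add: \<phi>_def fun_eq_iff fun_sum_apply)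
    then show ?thesis using GamD(1)[OF f[OF that]] by (simp only: forms_sum forms_scale)
  qed
  have cross: "\<phi> r l * co m ^ M = \<phi> r m * co l ^ M" if lm: "l \<le> 4" "m \<le> 4" and r: "k \<le> r" "r < n" for r l m
  proof
    fix p
    define u where "u = fscale (co m p ^ M) (\<lambda>s. f l s p) - fscale (co l p ^ M) (\<lambda>s. f m s p)"
    have S: "fv.subspace (V (k + 1) p)" using kc by (intro V_subspace) auto
    have u1: "u \<in> V (k + 1) p" unfolding u_def
      by (intro fv.subspace_diff fv.subspace_scale S GamD(3)[OF f[OF lm(1)]] GamD(3)[OF f[OF lm(2)]])
    have "(\<Sum>s<n. psi k s p * u s) = co m p ^ M * (\<Sum>s<n. psi k s p * f l s p) - co l p ^ M * (\<Sum>s<n. psi k s p * f m s p)"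
      by (simp add: u_def right_diff_distrib sum_subtractf sum_distrib_left mult.left_commute)
    also have "\<dots> = 0"
      using fun_cong[OF pf[OF lm(1)], of p] fun_cong[OF pf[OF lm(2)], of p] by (simp add: pair_with_def fun_power_apply)
    finally have "u \<in> V k x" using psi(1)[OF k u1] const[of p x] by simp
    then have "(\<Sum>s<n. Y r s * u s) = 0" using Y r by blast
    then show "(\<phi> r l * co m ^ M) p = (\<phi> r m * co l ^ M) p"
      by (simp add: u_def \<phi>_def fun_power_apply right_diff_distrib sum_subtractf sum_distrib_left sum_distrib_right mult_ac)
  qed
  have val: "\<phi> r l p = \<phi> r l p1 * co l p ^ M" if l: "l \<le> 4" and r: "k \<le> r" "r < n" for r l p
  proof -
    define m where "m = (if l = 0 then 1 else 0 :: nat)"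
    have m: "m \<le> 4" "l \<noteq> m" by (auto simp: m_def)
    obtain c where "\<phi> r l = (\<lambda>p. c * co l p ^ M)"
      using form_power_quotient[OF \<phi>[OF l] \<phi>[OF m(1)] l m cross[OF l m(1) r]] by blast
    then show ?thesis by (simp add: p1)
  qed
  have same: "\<phi> r l p1 = \<phi> r m p1" if "l \<le> 4" "m \<le> 4" "k \<le> r" "r < n" for r l m
    using fun_cong[OF cross[OF that], of p1] by (simp add: p1 fun_power_apply)
  have "v \<in> V (k + 1) y'" if v: "v \<in> V (k + 1) y" for v y y'
  proof -
    obtain l m where l: "l \<le> 4" "co l y \<noteq> 0" and m: "m \<le> 4" "co m y' \<noteq> 0" using co_nonzero by metis
    define u where "u = (\<lambda>s. f l s y / co l y ^ M)"
    define u' where "u' = (\<lambda>s. f m s y' / co m y' ^ M)"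
    have S: "fv.subspace (V (k + 1) z)" for z using kc by (intro V_subspace) auto
    have u1: "u \<in> V (k + 1) y" "u' \<in> V (k + 1) y'"
      using fv.subspace_scale[OF S GamD(3)[OF f[OF l(1)], of y], of "inverse (co l y ^ M)"]
        fv.subspace_scale[OF S GamD(3)[OF f[OF m(1)], of y'], of "inverse (co m y' ^ M)"]
      by (simp_all add: u_def u'_def fscale_def field_simps)
    have pu: "(\<Sum>s<n. psi k s y * u s) = 1"
      using fun_cong[OF pf[OF l(1)], of y] l(2)
      by (simp add: u_def pair_with_def fun_power_apply sum_divide_distrib[symmetric])
    have "u - u' \<in> V k x" unfolding Y
    proof (intro conjI allI impI)
      show "(u - u') r = 0" if "n \<le> r" for r
        using V_supp[OF _ _ u1(1) that] V_supp[OF _ _ u1(2) that] kc by simp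
      fix r assume r: "k \<le> r" "r < n"
      have "(\<Sum>s<n. Y r s * (u - u') s) = \<phi> r l y / co l y ^ M - \<phi> r m y' / co m y' ^ M"
        by (simp add: u_def u'_def \<phi>_def right_diff_distrib sum_subtractf sum_divide_distrib)
      also have "\<dots> = 0"
        using val[OF l(1) r, of y] val[OF m(1) r, of y'] same[OF l(1) m(1) r] l(2) m(2) by simp
      finally show "(\<Sum>s<n. Y r s * (u - u') s) = 0" .
    qed
    then have d: "u - u' \<in> V k y'" using const by blast
    \<comment> \<open>\<open>v\<close> is a multiple of \<open>u\<close> plus an element of
      \<open>V k\<close>, and \<open>u\<close> may be exchanged for \<open>u'\<close>, which lies in
      the space at \<open>y'\<close>.\<close>
    define \<alpha> where "\<alpha> = (\<Sum>s<n. psi k s y * v s)"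
    have "v - fscale \<alpha> u \<in> V (k + 1) y" by (intro fv.subspace_diff fv.subspace_scale S v u1)
    moreover have "(\<Sum>s<n. psi k s y * (v - fscale \<alpha> u) s) = 0"
    proof -
      have "(\<Sum>s<n. psi k s y * (v - fscale \<alpha> u) s) = (\<Sum>s<n. psi k s y * v s) - \<alpha> * (\<Sum>s<n. psi k s y * u s)"
        by (simp add: right_diff_distrib sum_subtractf sum_distrib_left mult.left_commute)
      then show ?thesis by (simp add: pu \<alpha>_def)
    qed
    ultimately have "v - fscale \<alpha> u \<in> V k y'" using psi(1)[OF k] const by blast
    then have "(v - fscale \<alpha> u) + fscale \<alpha> (u - u') \<in> V k y'"
      using d kc by (intro fv.subspace_add fv.subspace_scale V_subspace) auto
    then have w: "(v - fscale \<alpha> u) + fscale \<alpha> (u - u') \<in> V (k + 1) y'" using kc by (intro V_mono[of k "k + 1"]) auto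
    have "(v - fscale \<alpha> u) + fscale \<alpha> (u - u') + fscale \<alpha> u' \<in> V (k + 1) y'"
      by (rule fv.subspace_add[OF S w fv.subspace_scale[OF S u1(2)]])
    moreover have "(v - fscale \<alpha> u) + fscale \<alpha> (u - u') + fscale \<alpha> u' = v" by (simp add: fun_eq_iff algebra_simps)
    ultimately show ?thesis by simp
  qed
  then show ?case by auto
qed

theorem flag_constant: "j \<le> n \<Longrightarrow> j \<noteq> i \<Longrightarrow> V j x = V j x'"
  using V_high_const[of j x x'] V_low_const[of j x x'] by (cases "j < i") auto

end

section \<open>Cosets of a minimal parabolic subgroup as flags\<close>

lemma SL_carrier: "A \<in> carrier (SL n) \<longleftrightarrow> A \<in> carrier_mat n n \<and> det A = 1"
  by (simp add: SL_def)

lemma SL_mult: "A \<otimes>\<^bsub>SL n\<^esub> B = A * B"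
  by (simp add: SL_def)

lemma mat_mult_entry:
  assumes "A \<in> carrier_mat n m" "B \<in> carrier_mat m l" "r < n" "c < l"
  shows "(A * B) $$ (r, c) = (\<Sum>k<m. A $$ (r, k) * B $$ (k, c))"
  using assms by (simp add: scalar_prod_def atLeast0LessThan)

lemma SL_mult_closed: "A \<in> carrier (SL n) \<Longrightarrow> B \<in> carrier (SL n) \<Longrightarrow> A * B \<in> carrier (SL n)"
  by (auto simp: SL_carrier det_mult)

lemma adj_mult:
  fixes A :: "complex mat"
  assumes "A \<in> carrier_mat n n" "r < n" "c < n"
  shows "(\<Sum>k<n. adj_mat A $$ (r, k) * A $$ (k, c)) = (if r = c then det A else 0)"
    and "(\<Sum>k<n. A $$ (r, k) * adj_mat A $$ (k, c)) = (if r = c then det A else 0)"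
proof -
  note a = adj_mat[OF assms(1)]
  show "(\<Sum>k<n. adj_mat A $$ (r, k) * A $$ (k, c)) = (if r = c then det A else 0)"
    using mat_mult_entry[OF a(1) assms(1,2,3)] a(3) assms by (cases "r = c") simp_all
  show "(\<Sum>k<n. A $$ (r, k) * adj_mat A $$ (k, c)) = (if r = c then det A else 0)"
    using mat_mult_entry[OF assms(1) a(1) assms(2,3)] a(2) assms by (cases "r = c") simp_all
qed

definition block_upper :: "nat \<Rightarrow> nat \<Rightarrow> complex mat \<Rightarrow> bool" where
  "block_upper n i p \<longleftrightarrow> (\<forall>r<n. \<forall>c<r. \<not> (r = i \<and> c = i - 1) \<longrightarrow> p $$ (r, c) = 0)"

lemma block_upper_mult:
  assumes p: "p \<in> carrier_mat n n" "block_upper n i p" and q: "q \<in> carrier_mat n n" "block_upper n i q"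
  shows "block_upper n i (p * q)"
  unfolding block_upper_def
proof (intro allI impI)
  fix r c assume rc: "r < n" "c < r" "\<not> (r = i \<and> c = i - 1)"
  have "(p * q) $$ (r, c) = (\<Sum>k<n. p $$ (r, k) * q $$ (k, c))"
    using rc by (intro mat_mult_entry[OF p(1) q(1)]) auto
  also have "\<dots> = 0"
  proof (rule sum.neutral, rule ballI)
    fix k assume k: "k \<in> {..<n}"
    show "p $$ (r, k) * q $$ (k, c) = 0"
    proof (rule ccontr)
      assume "p $$ (r, k) * q $$ (k, c) \<noteq> 0"
      then have "p $$ (r, k) \<noteq> 0" "q $$ (k, c) \<noteq> 0" by auto
      moreover have "p $$ (r, k) = 0" if "k < r" "\<not> (r = i \<and> k = i - 1)"
        using p(2) rc(1) that unfolding block_upper_def by blast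
      moreover have "q $$ (k, c) = 0" if "c < k" "\<not> (k = i \<and> c = i - 1)"
        using q(2) k that unfolding block_upper_def by blast
      ultimately have "r \<le> k \<or> (r = i \<and> k = i - 1)" "k \<le> c \<or> (k = i \<and> c = i - 1)"
        by (meson not_le)+
      then show False using rc by auto
    qed
  qed
  finally show "(p * q) $$ (r, c) = 0" .
qed

lemma simple_refl_block_upper: "1 \<le> i \<Longrightarrow> i < n \<Longrightarrow> block_upper n i (simple_refl n i)"
  by (auto simp: block_upper_def simple_refl_def)

lemma borel_block_upper: "b \<in> borel_subgroup n \<Longrightarrow> block_upper n i b"
  by (auto simp: borel_subgroup_def block_upper_def SL_carrier)

text \<open>The converse is the Bruhat decomposition of the 2 by 2 block: if its lower left entry is
  zero, the matrix is upper triangular; otherwise a row operation and the reflection make it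
  so.\<close>

lemma min_parabolic_iff:
  assumes i: "1 \<le> i" "i < n"
  shows "p \<in> min_parabolic n i \<longleftrightarrow> p \<in> carrier (SL n) \<and> block_upper n i p"
proof
  assume "p \<in> min_parabolic n i"
  then consider "p \<in> borel_subgroup n"
    | b b' where "b \<in> borel_subgroup n" "b' \<in> borel_subgroup n" "p = b * simple_refl n i * b'"
    unfolding min_parabolic_def r_coset_def set_mult_def SL_mult by blast
  then show "p \<in> carrier (SL n) \<and> block_upper n i p"
  proof cases
    case 1
    then show ?thesis using borel_block_upper by (simp add: borel_subgroup_def)
  next
    case 2
    have c: "b \<in> carrier (SL n)" "b' \<in> carrier (SL n)" "simple_refl n i \<in> carrier (SL n)"
      using 2 simple_refl_in_SL[OF i] by (auto simp: borel_subgroup_def)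
    then have m: "b \<in> carrier_mat n n" "b' \<in> carrier_mat n n" "simple_refl n i \<in> carrier_mat n n"
      by (auto simp: SL_carrier)
    show ?thesis unfolding 2(3)
      by (intro conjI SL_mult_closed c block_upper_mult m borel_block_upper[OF 2(1)] borel_block_upper[OF 2(2)]
          simple_refl_block_upper[OF i] mult_carrier_mat[OF m(1,3)])
  qed
next
  assume "p \<in> carrier (SL n) \<and> block_upper n i p"
  then have p: "p \<in> carrier_mat n n" "det p = 1" and bu: "block_upper n i p" by (auto simp: SL_carrier)
  show "p \<in> min_parabolic n i"
  proof (cases "p $$ (i, i - 1) = 0")
    case True
    have "p $$ (r, c) = 0" if "r < n" "c < r" for r c
      using bu True that unfolding block_upper_def by (cases "r = i \<and> c = i - 1") auto
    then have "p \<in> borel_subgroup n" using p by (simp add: borel_subgroup_def SL_carrier upper_triangular_def)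
    then show ?thesis by (simp add: min_parabolic_def)
  next
    case False
    \<comment> \<open>Chosen so that subtracting \<open>z\<close> times row \<open>i\<close> from
      row \<open>i - 1\<close> clears the entry at \<open>(i - 1, i - 1)\<close>. Then
      \<open>b\<close> is the result with the two rows exchanged and one sign changed.\<close>
    define z where "z = p $$ (i - 1, i - 1) / p $$ (i, i - 1)"
    define u where "u = mat n n (\<lambda>(r, c). if r = c then 1 else if r = i - 1 \<and> c = i then z else 0)"
    define b where "b = mat n n (\<lambda>(r, c). if r = i - 1 then - p $$ (i, c)
        else if r = i then p $$ (i - 1, c) - z * p $$ (i, c) else p $$ (r, c))"
    have u: "u \<in> carrier_mat n n" and b: "b \<in> carrier_mat n n" by (auto simp: u_def b_def)
    have s: "simple_refl n i \<in> carrier_mat n n" "det (simple_refl n i) = 1"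
      using simple_refl_in_SL[OF i] by (auto simp: SL_carrier)
    have ut: "upper_triangular u" using i by (auto simp: u_def upper_triangular_def)
    have "diag_mat u = replicate n 1"
      by (rule nth_equalityI) (auto simp: diag_mat_def u_def)
    then have du: "det u = 1" using det_upper_triangular[OF ut u] by simp
    have sb: "(simple_refl n i * b) $$ (r, c) = (if r = i - 1 then b $$ (i, c) else if r = i then - b $$ (i - 1, c) else b $$ (r, c))"
      if "r < n" "c < n" for r c
    proof -
      have "(simple_refl n i * b) $$ (r, c) = (\<Sum>k<n. simple_refl n i $$ (r, k) * b $$ (k, c))"
        by (rule mat_mult_entry[OF s(1) b that])
      also have "\<dots> = (\<Sum>k<n. if k = (if r = i - 1 then i else if r = i then i - 1 else r)
          then (if r = i then - 1 else 1) * b $$ (k, c) else 0)"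
        by (rule sum.cong) (use i that in \<open>auto simp: simple_refl_def\<close>)
      finally show ?thesis using i that by (simp; fastforce)
    qed
    have be: "b $$ (r, c) = (if r = i - 1 then - p $$ (i, c)
        else if r = i then p $$ (i - 1, c) - z * p $$ (i, c) else p $$ (r, c))" if "r < n" "c < n" for r c
      using that by (simp add: b_def)
    have "(u * (simple_refl n i * b)) $$ (r, c) = p $$ (r, c)" if rc: "r < n" "c < n" for r c
    proof -
      have "(u * (simple_refl n i * b)) $$ (r, c) = (\<Sum>k<n. u $$ (r, k) * (simple_refl n i * b) $$ (k, c))"
        by (rule mat_mult_entry[OF u mult_carrier_mat[OF s(1) b] rc])
      also have "\<dots> = (\<Sum>k<n. (if k = r then (simple_refl n i * b) $$ (k, c) else 0) +
          (if k = i then (if r = i - 1 then z * (simple_refl n i * b) $$ (k, c) else 0) else 0))"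
        by (rule sum.cong) (use i rc in \<open>auto simp: u_def\<close>)
      also have "\<dots> = (simple_refl n i * b) $$ (r, c) + (if r = i - 1 then z * (simple_refl n i * b) $$ (i, c) else 0)"
        using i rc by (simp add: sum.distrib)
      also have "\<dots> = p $$ (r, c)"
        using i rc by (auto simp: sb be)
      finally show ?thesis .
    qed
    then have eq: "u * (simple_refl n i * b) = p"
      using p(1) u s(1) b by (intro eq_matI) auto
    have "det p = det u * (det (simple_refl n i) * det b)"
      unfolding eq[symmetric] using det_mult[OF u mult_carrier_mat[OF s(1) b]] det_mult[OF s(1) b] by simp
    then have db: "det b = 1" using p(2) du s(2) by simp
    have "b $$ (r, c) = 0" if rc: "r < n" "c < r" for r c
    proof -
      have p0: "p $$ (r', c') = 0" if "r' < n" "c' < r'" "\<not> (r' = i \<and> c' = i - 1)" for r' c'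
        using bu that unfolding block_upper_def by blast
      have "p $$ (i - 1, c) - z * p $$ (i, c) = 0" if "r = i"
      proof (cases "c = i - 1")
        case True
        then show ?thesis using False by (simp add: z_def)
      next
        case 2: False
        then show ?thesis using p0[of "i - 1" c] p0[of i c] rc that i by simp
      qed
      then show ?thesis using rc i p0[of r c] p0[of i c] by (auto simp: b_def)
    qed
    then have "b \<in> borel_subgroup n" using b db by (simp add: borel_subgroup_def SL_carrier upper_triangular_def)
    moreover have "u \<in> borel_subgroup n" using u du ut by (simp add: borel_subgroup_def SL_carrier)
    moreover have "p = u * simple_refl n i * b" using eq u s(1) b by (simp add: assoc_mult_mat)
    ultimately show ?thesis unfolding min_parabolic_def r_coset_def set_mult_def SL_mult by blast
  qed
qed

section \<open>Spans of columns and their dependence on the coset\<close>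

definition flag_space :: "nat \<Rightarrow> nat \<Rightarrow> complex mat \<Rightarrow> (nat \<Rightarrow> complex) set" where
  "flag_space n j g = {v. (\<forall>r\<ge>n. v r = 0) \<and> (\<exists>u. \<forall>r<n. v r = (\<Sum>c<j. g $$ (r, c) * u c))}"

lemma flag_space_subspace: "fv.subspace (flag_space n j g)"
proof (rule fv.subspaceI)
  show "0 \<in> flag_space n j g" unfolding flag_space_def by (auto intro!: exI[of _ "\<lambda>_. 0"])
next
  fix v w assume "v \<in> flag_space n j g" "w \<in> flag_space n j g"
  then obtain a b where "\<forall>r\<ge>n. v r = 0" "\<forall>r\<ge>n. w r = 0"
    "\<forall>r<n. v r = (\<Sum>c<j. g $$ (r, c) * a c)" "\<forall>r<n. w r = (\<Sum>c<j. g $$ (r, c) * b c)"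
    by (auto simp: flag_space_def)
  then show "v + w \<in> flag_space n j g"
    unfolding flag_space_def by (auto simp: sum.distrib distrib_left intro!: exI[of _ "\<lambda>c. a c + b c"])
next
  fix x v assume "v \<in> flag_space n j g"
  then obtain a where "\<forall>r\<ge>n. v r = 0" "\<forall>r<n. v r = (\<Sum>c<j. g $$ (r, c) * a c)"
    by (auto simp: flag_space_def)
  then show "fscale x v \<in> flag_space n j g"
    unfolding flag_space_def
    by (auto simp: sum_distrib_left mult.left_commute intro!: exI[of _ "\<lambda>c. x * a c"])
qed

lemma flag_space_mono:
  assumes "j \<le> k" shows "flag_space n j g \<subseteq> flag_space n k g"
proof
  fix v assume "v \<in> flag_space n j g"
  then obtain a where a: "\<forall>r\<ge>n. v r = 0" "\<forall>r<n. v r = (\<Sum>c<j. g $$ (r, c) * a c)"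
    by (auto simp: flag_space_def)
  have "(\<Sum>c<k. g $$ (r, c) * (if c < j then a c else 0)) = (\<Sum>c<j. g $$ (r, c) * a c)" for r
    by (rule sum.mono_neutral_cong_right) (use assms in auto)
  then show "v \<in> flag_space n k g"
    unfolding flag_space_def using a by (intro CollectI conjI exI[of _ "\<lambda>c. if c < j then a c else 0"]) auto
qed

text \<open>The one entry of \<open>p\<close> allowed below the diagonal sits in row
  \<open>i\<close> and column \<open>i - 1\<close>. Only a cut at \<open>j = i\<close> would
  separate these, so the first \<open>j\<close> columns of \<open>g * p\<close> combine the first
  \<open>j\<close> columns of \<open>g\<close>.\<close>

lemma flag_space_mult:
  assumes g: "g \<in> carrier_mat n n" and p: "p \<in> carrier_mat n n" "block_upper n i p" and j: "j \<le> n" "j \<noteq> i"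
  shows "flag_space n j (g * p) \<subseteq> flag_space n j g"
proof
  fix v assume "v \<in> flag_space n j (g * p)"
  then obtain a where a: "\<forall>r\<ge>n. v r = 0" "\<forall>r<n. v r = (\<Sum>c<j. (g * p) $$ (r, c) * a c)"
    by (auto simp: flag_space_def)
  have "v r = (\<Sum>k<j. g $$ (r, k) * (\<Sum>c<j. p $$ (k, c) * a c))" if r: "r < n" for r
  proof -
    have "(g * p) $$ (r, c) = (\<Sum>k<j. g $$ (r, k) * p $$ (k, c))" if c: "c < j" for c
    proof -
      have "(g * p) $$ (r, c) = (\<Sum>k<n. g $$ (r, k) * p $$ (k, c))"
        by (rule mat_mult_entry[OF g p(1) r]) (use c j in simp)
      also have "\<dots> = (\<Sum>k<j. g $$ (r, k) * p $$ (k, c))"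
      proof (rule sum.mono_neutral_right)
        show "\<forall>k\<in>{..<n} - {..<j}. g $$ (r, k) * p $$ (k, c) = 0"
        proof
          fix k assume k: "k \<in> {..<n} - {..<j}"
          then have "\<not> (k = i \<and> c = i - 1)" using c j by auto
          then have "p $$ (k, c) = 0" using p(2) k c unfolding block_upper_def by auto
          then show "g $$ (r, k) * p $$ (k, c) = 0" by simp
        qed
      qed (use j in auto)
      finally show ?thesis .
    qed
    then have "v r = (\<Sum>c<j. \<Sum>k<j. g $$ (r, k) * p $$ (k, c) * a c)"
      using a(2) r by (simp add: sum_distrib_right)
    also have "\<dots> = (\<Sum>k<j. \<Sum>c<j. g $$ (r, k) * p $$ (k, c) * a c)" by (rule sum.swap)
    finally show ?thesis by (simp add: sum_distrib_left mult.assoc)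
  qed
  then have "\<exists>u. \<forall>r<n. v r = (\<Sum>c<j. g $$ (r, c) * u c)"
    by (intro exI[of _ "\<lambda>k. \<Sum>c<j. p $$ (k, c) * a c"]) simp
  then show "v \<in> flag_space n j g" using a(1) by (simp add: flag_space_def)
qed

lemma coset_iff: "x \<in> g <#\<^bsub>SL n\<^esub> P \<longleftrightarrow> (\<exists>p\<in>P. x = g * p)"
  by (auto simp: l_coset_def SL_mult)

lemma one_in_min_parabolic: "1 \<le> i \<Longrightarrow> i < n \<Longrightarrow> 1\<^sub>m n \<in> min_parabolic n i"
  by (auto simp: min_parabolic_iff SL_carrier block_upper_def)

lemma coset_flag_space:
  assumes i: "1 \<le> i" "i < n" and g: "g \<in> carrier (SL n)" "g' \<in> carrier (SL n)"
    and eq: "g <#\<^bsub>SL n\<^esub> min_parabolic n i = g' <#\<^bsub>SL n\<^esub> min_parabolic n i" and j: "j \<le> n" "j \<noteq> i"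
  shows "flag_space n j g = flag_space n j g'"
proof -
  have "flag_space n j a \<subseteq> flag_space n j b"
    if ab: "a \<in> carrier (SL n)" "b \<in> carrier (SL n)"
      "a <#\<^bsub>SL n\<^esub> min_parabolic n i = b <#\<^bsub>SL n\<^esub> min_parabolic n i" for a b
  proof -
    have "a = a * 1\<^sub>m n" using ab(1) right_mult_one_mat[of a n n] by (simp add: SL_carrier)
    then have "a \<in> a <#\<^bsub>SL n\<^esub> min_parabolic n i" unfolding coset_iff using one_in_min_parabolic[OF i] by blast
    then obtain p where "p \<in> min_parabolic n i" "a = b * p" unfolding ab(3) coset_iff by blast
    then show ?thesis using flag_space_mult[OF _ _ _ j, of b p] ab(2) by (simp add: min_parabolic_iff[OF i] SL_carrier)
  qed
  then show ?thesis using g eq by blast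
qed

lemma flag_space_coset:
  assumes i: "1 \<le> i" "i < n" and g: "g \<in> carrier (SL n)" "g' \<in> carrier (SL n)"
    and eq: "\<And>j. j \<le> n \<Longrightarrow> j \<noteq> i \<Longrightarrow> flag_space n j g = flag_space n j g'"
  shows "g <#\<^bsub>SL n\<^esub> min_parabolic n i \<subseteq> g' <#\<^bsub>SL n\<^esub> min_parabolic n i"
proof
  fix x assume "x \<in> g <#\<^bsub>SL n\<^esub> min_parabolic n i"
  then obtain p where p: "p \<in> carrier (SL n)" "block_upper n i p" "x = g * p"
    unfolding coset_iff using min_parabolic_iff[OF i] by blast
  have cm: "g \<in> carrier_mat n n" "g' \<in> carrier_mat n n" "p \<in> carrier_mat n n" "x \<in> carrier_mat n n"
    and d: "det g' = 1" "det x = 1"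
    using g p SL_mult_closed[OF g(1) p(1)] by (auto simp: SL_carrier)
  define q where "q = adj_mat g' * x"
  have adj: "adj_mat g' \<in> carrier_mat n n" "g' * adj_mat g' = 1\<^sub>m n"
    using adj_mat[OF cm(2)] d by auto
  have q: "q \<in> carrier_mat n n" "x = g' * q"
    unfolding q_def using adj cm by (auto simp: assoc_mult_mat[symmetric, of _ n n _ n _ n])
  have dq: "det q = 1" using det_mult[OF cm(2) q(1)] q(2) d by simp
  have "block_upper n i q" unfolding block_upper_def
  proof (intro allI impI)
    fix r c assume rc: "r < n" "c < r" "\<not> (r = i \<and> c = i - 1)"
    \<comment> \<open>The least dimension above \<open>c\<close> that avoids the gap. Column
      \<open>c\<close> of \<open>x\<close> lies in that step of the flag, while row \<open>r\<close>
      is at or beyond \<open>j\<close>, so the entry of \<open>q\<close> vanishes.\<close>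
    define j where "j = (if c + 1 = i then i + 1 else c + 1)"
    have j: "j \<le> n" "j \<noteq> i" "c < j" "j \<le> r" using rc i by (auto simp: j_def)
    define v where "v = (\<lambda>s. if s < n then x $$ (s, c) else 0)"
    have "v \<in> flag_space n j x"
      unfolding flag_space_def
    proof (intro CollectI conjI exI[of _ "\<lambda>d. if d = c then 1 else 0"] allI impI)
      fix s assume "s < n"
      have "(\<Sum>d<j. x $$ (s, d) * (if d = c then 1 else 0)) = x $$ (s, c)"
        using j(3) by (simp add: if_distrib[of "\<lambda>z. _ * z"] cong: if_cong)
      then show "v s = (\<Sum>d<j. x $$ (s, d) * (if d = c then 1 else 0))" using \<open>s < n\<close> by (simp add: v_def)
    qed (simp add: v_def)
    then have "v \<in> flag_space n j g'"
      using flag_space_mult[OF cm(1,3) p(2) j(1,2)] eq[OF j(1,2)] p(3) by auto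
    then obtain u where u: "\<forall>s<n. v s = (\<Sum>d<j. g' $$ (s, d) * u d)" by (auto simp: flag_space_def)
    have "q $$ (r, c) = (\<Sum>s<n. adj_mat g' $$ (r, s) * x $$ (s, c))"
      unfolding q_def by (rule mat_mult_entry[OF adj(1) cm(4)]) (use rc in auto)
    also have "\<dots> = (\<Sum>s<n. \<Sum>d<j. adj_mat g' $$ (r, s) * g' $$ (s, d) * u d)"
    proof (rule sum.cong[OF refl])
      fix s assume s: "s \<in> {..<n}"
      then have "x $$ (s, c) = (\<Sum>d<j. g' $$ (s, d) * u d)" using u by (simp add: v_def)
      then show "adj_mat g' $$ (r, s) * x $$ (s, c) = (\<Sum>d<j. adj_mat g' $$ (r, s) * g' $$ (s, d) * u d)"
        by (simp add: sum_distrib_left mult.assoc)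
    qed
    also have "\<dots> = (\<Sum>d<j. \<Sum>s<n. adj_mat g' $$ (r, s) * g' $$ (s, d) * u d)" by (rule sum.swap)
    also have "\<dots> = (\<Sum>d<j. (if r = d then det g' else 0) * u d)"
      using adj_mult(1)[OF cm(2) rc(1)] j by (intro sum.cong) (auto simp: sum_distrib_right[symmetric])
    also have "\<dots> = 0" using j(4) by (intro sum.neutral) auto
    finally show "q $$ (r, c) = 0" .
  qed
  then have "q \<in> min_parabolic n i" unfolding min_parabolic_iff[OF i] SL_carrier using q dq by blast
  then show "x \<in> g' <#\<^bsub>SL n\<^esub> min_parabolic n i" unfolding coset_iff using q(2) by blast
qed

section \<open>Polynomial matrices\<close>

lemma poly_funs_const: "(\<lambda>_. c) \<in> poly_funs I"
  unfolding poly_funs_def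
  by (rule CollectI, rule exI[of _ "{\<lambda>_. 0}"], rule exI[of _ "\<lambda>_. c"]) auto

lemma poly_funs_coord: assumes "finite I" "k \<in> I" shows "(\<lambda>x. x k) \<in> poly_funs I"
proof -
  have "(\<Prod>i\<in>I. x i ^ (if i = k then 1 else 0)) = x k" for x :: "'a \<Rightarrow> complex"
  proof -
    have "(\<Prod>i\<in>I. x i ^ (if i = k then 1 else 0)) = (\<Prod>i\<in>I. if i = k then x k else 1)"
      by (rule prod.cong) auto
    then show ?thesis using assms by simp
  qed
  then show ?thesis unfolding poly_funs_def
    by (intro CollectI exI[of _ "{\<lambda>i. if i = k then 1 else 0}"] exI[of _ "\<lambda>_. 1"]) auto
qed

lemma poly_funs_eq_span:
  "poly_funs I = fv.span (range (\<lambda>m x. \<Prod>i\<in>I. x i ^ m i))" (is "_ = fv.span (range ?mon)")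
proof (intro subset_antisym subsetI)
  fix p assume "p \<in> poly_funs I"
  then obtain M c where "finite M" "p = (\<lambda>x. \<Sum>m\<in>M. c m * (\<Prod>i\<in>I. x i ^ m i))" by (auto simp: poly_funs_def)
  then have "p = (\<Sum>m\<in>M. fscale (c m) (?mon m))" by (simp add: fun_eq_iff fun_sum_apply)
  also have "\<dots> \<in> fv.span (range ?mon)" by (intro fv.span_sum fv.span_scale fv.span_base) auto
  finally show "p \<in> fv.span (range ?mon)" .
next
  fix p assume "p \<in> fv.span (range ?mon)"
  then show "p \<in> poly_funs I"
  proof (induction rule: fv.span_induct_alt)
    case base
    show ?case using poly_funs_const[of 0 I] by (simp add: zero_fun_def)
  next
    case (step a q r)
    then obtain m where m: "q = ?mon m" by blast
    obtain M c where M: "finite M" "r = (\<lambda>x. \<Sum>m\<in>M. c m * (\<Prod>i\<in>I. x i ^ m i))"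
      using step by (auto simp: poly_funs_def)
    define c' where "c' m' = (if m' \<in> M then c m' else 0) + (if m' = m then a else 0)" for m'
    have "(fscale a q + r) x = (\<Sum>m'\<in>insert m M. c' m' * (\<Prod>i\<in>I. x i ^ m' i))" for x
    proof -
      have "(\<Sum>m'\<in>insert m M. c' m' * (\<Prod>i\<in>I. x i ^ m' i)) =
          (\<Sum>m'\<in>insert m M. (if m' \<in> M then c m' * (\<Prod>i\<in>I. x i ^ m' i) else 0)) +
          (\<Sum>m'\<in>insert m M. (if m' = m then a * (\<Prod>i\<in>I. x i ^ m' i) else 0))"
        unfolding sum.distrib[symmetric] by (rule sum.cong) (auto simp: c'_def algebra_simps)
      also have "(\<Sum>m'\<in>insert m M. (if m' \<in> M then c m' * (\<Prod>i\<in>I. x i ^ m' i) else 0)) = r x"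
        unfolding M(2) by (rule sum.mono_neutral_cong_right) (use M(1) in auto)
      also have "(\<Sum>m'\<in>insert m M. (if m' = m then a * (\<Prod>i\<in>I. x i ^ m' i) else 0)) = a * (\<Prod>i\<in>I. x i ^ m i)"
        using M(1) by simp
      finally show ?thesis by (simp add: m)
    qed
    then show ?case unfolding poly_funs_def using M(1)
      by (intro CollectI exI[of _ "insert m M"] exI[of _ c']) (auto simp: fun_eq_iff)
  qed
qed

lemma poly_funs_add: "p \<in> poly_funs I \<Longrightarrow> q \<in> poly_funs I \<Longrightarrow> (\<lambda>x. p x + q x) \<in> poly_funs I"
  unfolding poly_funs_eq_span using fv.span_add[of p _ q] by (simp add: plus_fun_def)

lemma poly_funs_mult:
  assumes p: "p \<in> poly_funs I" and q: "q \<in> poly_funs I" shows "(\<lambda>x. p x * q x) \<in> poly_funs I"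
proof -
  obtain M c where M: "p = (\<lambda>x. \<Sum>m\<in>M. c m * (\<Prod>i\<in>I. x i ^ m i))" using p by (auto simp: poly_funs_def)
  obtain N d where N: "q = (\<lambda>x. \<Sum>m\<in>N. d m * (\<Prod>i\<in>I. x i ^ m i))" using q by (auto simp: poly_funs_def)
  have "(\<lambda>x. p x * q x) = (\<Sum>m\<in>M. \<Sum>m'\<in>N. fscale (c m * d m') (\<lambda>x. \<Prod>i\<in>I. x i ^ (m i + m' i)))"
    by (simp add: M N fun_eq_iff fun_sum_apply sum_product power_add prod.distrib mult_ac)
  also have "\<dots> \<in> poly_funs I" unfolding poly_funs_eq_span
    by (intro fv.span_sum fv.span_scale fv.span_base) (rule image_eqI[of _ _ "\<lambda>i. _ i + _ i"], auto)
  finally show ?thesis .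
qed

lemma poly_funs_sum: "(\<And>i. i \<in> A \<Longrightarrow> p i \<in> poly_funs I) \<Longrightarrow> (\<lambda>x. \<Sum>i\<in>A. p i x) \<in> poly_funs I"
  by (induction A rule: infinite_finite_induct) (auto simp: poly_funs_const poly_funs_add)

lemma poly_funs_prod: "(\<And>i. i \<in> A \<Longrightarrow> p i \<in> poly_funs I) \<Longrightarrow> (\<lambda>x. \<Prod>i\<in>A. p i x) \<in> poly_funs I"
  by (induction A rule: infinite_finite_induct) (auto simp: poly_funs_const poly_funs_mult)

lemma poly_funs_det:
  assumes "\<And>r c. r < k \<Longrightarrow> c < k \<Longrightarrow> (\<lambda>x. M x $$ (r, c)) \<in> poly_funs I" "\<And>x. M x \<in> carrier_mat k k"
  shows "(\<lambda>x. det (M x)) \<in> poly_funs I"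
proof -
  have "(\<lambda>x. det (M x)) = (\<lambda>x. \<Sum>p\<in>{p. p permutes {0..<k}}. signof p * (\<Prod>i = 0..<k. M x $$ (i, p i)))"
    using det_def'[OF assms(2)] by (simp add: fun_eq_iff)
  also have "\<dots> \<in> poly_funs I"
    using assms(1) by (intro poly_funs_sum poly_funs_mult poly_funs_prod poly_funs_const)
      (auto dest: permutes_in_image)
  finally show ?thesis .
qed

lemma adj_mat_entry:
  assumes "A \<in> carrier_mat k k" "r < k" "c < k"
  shows "adj_mat A $$ (r, c) = (-1) ^ (c + r) * det (mat_delete A c r)"
  using assms by (simp add: adj_mat_def cofactor_def)

lemma mat_delete_entry:
  assumes "A \<in> carrier_mat k k" "a < k - 1" "b < k - 1"
  shows "mat_delete A r c $$ (a, b) = A $$ (if a < r then a else Suc a, if b < c then b else Suc b)"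
  using assms by (simp add: mat_delete_def)

lemma poly_funs_adj:
  assumes M: "\<And>r c. r < k \<Longrightarrow> c < k \<Longrightarrow> (\<lambda>x. M x $$ (r, c)) \<in> poly_funs I" "\<And>x. M x \<in> carrier_mat k k"
    and rc: "r < k" "c < k"
  shows "(\<lambda>x. adj_mat (M x) $$ (r, c)) \<in> poly_funs I"
proof -
  have "(\<lambda>x. det (mat_delete (M x) c r)) \<in> poly_funs I"
  proof (rule poly_funs_det)
    show "mat_delete (M x) c r \<in> carrier_mat (k - 1) (k - 1)" for x by (rule mat_delete_carrier[OF M(2)])
    show "(\<lambda>x. mat_delete (M x) c r $$ (a, b)) \<in> poly_funs I" if "a < k - 1" "b < k - 1" for a b
      unfolding mat_delete_entry[OF M(2) that] using that by (intro M(1)) auto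
  qed
  then show ?thesis unfolding adj_mat_entry[OF M(2) rc] by (intro poly_funs_mult poly_funs_const)
qed

lemma forms_det:
  assumes "\<And>r c. r < k \<Longrightarrow> c < k \<Longrightarrow> (\<lambda>x. M x $$ (r, c)) \<in> forms e" "\<And>x. M x \<in> carrier_mat k k"
  shows "(\<lambda>x. det (M x)) \<in> forms (int k * e)"
proof -
  have "(\<lambda>x. det (M x)) = (\<Sum>p\<in>{p. p permutes {0..<k}}. fscale (signof p) (\<Prod>i = 0..<k. (\<lambda>x. M x $$ (i, p i))))"
    using det_def'[OF assms(2)] by (simp add: fun_eq_iff fun_sum_apply fun_prod_apply)
  also have "\<dots> \<in> forms (\<Sum>i = 0..<k. e)"
    using assms(1) by (intro forms_sum forms_scale forms_prod) (auto dest: permutes_in_image)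
  finally show ?thesis by simp
qed

lemma forms_adj:
  assumes M: "\<And>r c. r < k \<Longrightarrow> c < k \<Longrightarrow> (\<lambda>x. M x $$ (r, c)) \<in> forms e" "\<And>x. M x \<in> carrier_mat k k"
    and rc: "r < k" "c < k"
  shows "(\<lambda>x. adj_mat (M x) $$ (r, c)) \<in> forms (int (k - 1) * e)"
proof -
  have "(\<lambda>x. det (mat_delete (M x) c r)) \<in> forms (int (k - 1) * e)"
  proof (rule forms_det)
    show "mat_delete (M x) c r \<in> carrier_mat (k - 1) (k - 1)" for x by (rule mat_delete_carrier[OF M(2)])
    show "(\<lambda>x. mat_delete (M x) c r $$ (a, b)) \<in> forms e" if "a < k - 1" "b < k - 1" for a b
      unfolding mat_delete_entry[OF M(2) that] using that by (intro M(1)) auto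
  qed
  then show ?thesis unfolding adj_mat_entry[OF M(2) rc] by (rule forms_smult)
qed

section \<open>Regular functions on projective four-space\<close>

lemma homog_poly_funs_eval_cong:
  assumes "p \<in> homog_poly_funs I d" "\<And>i. i \<in> I \<Longrightarrow> x i = y i"
  shows "p x = p y"
proof -
  obtain M c where "p = (\<lambda>x. \<Sum>m\<in>M. c m * (\<Prod>i\<in>I. x i ^ m i))"
    using assms(1) by (auto simp: homog_poly_funs_def)
  then show ?thesis using assms(2) by (auto intro!: sum.cong prod.cong)
qed

lemma homog_poly_funs_eval_scale:
  assumes "p \<in> homog_poly_funs I d"
  shows "p (\<lambda>i. a * x i) = a ^ d * p x"
proof -
  obtain M c where M: "\<forall>m\<in>M. (\<Sum>i\<in>I. m i) = d" "p = (\<lambda>x. \<Sum>m\<in>M. c m * (\<Prod>i\<in>I. x i ^ m i))"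
    using assms by (auto simp: homog_poly_funs_def)
  have "c m * (\<Prod>i\<in>I. (a * x i) ^ m i) = a ^ d * (c m * (\<Prod>i\<in>I. x i ^ m i))" if "m \<in> M" for m
    using M(1) that by (auto simp: power_mult_distrib prod.distrib power_sum[symmetric])
  then show ?thesis unfolding M(2) sum_distrib_left by (rule sum.cong[OF refl])
qed

definition pline :: "pt \<Rightarrow> complex vec set" where
  "pline x = {a \<cdot>\<^sub>v vec 5 (Rep_pt x) | a. True}"

lemma homog_poly_funs_pline:
  assumes "p \<in> homog_poly_funs {..4} d"
  shows "p (vcoord (a \<cdot>\<^sub>v vec 5 (Rep_pt x))) = a ^ d * p (Rep_pt x)"
proof -
  have "p (vcoord (a \<cdot>\<^sub>v vec 5 (Rep_pt x))) = p (\<lambda>i. a * Rep_pt x i)"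
    by (rule homog_poly_funs_eval_cong[OF assms]) auto
  then show ?thesis using homog_poly_funs_eval_scale[OF assms] by simp
qed

lemma vec_pt_nonzero: "vec 5 (Rep_pt x) \<noteq> 0\<^sub>v 5"
proof
  assume z: "vec 5 (Rep_pt x) = 0\<^sub>v 5"
  obtain k where k: "k \<le> 4" "Rep_pt x k \<noteq> 0" using co_nonzero[of x] by (auto simp: co_def)
  have "vec 5 (Rep_pt x) $ k = 0" unfolding z using k(1) by simp
  then show False using k by simp
qed

lemma proj_points_eq_range_pline: "proj_points 4 = range pline"
proof (intro subset_antisym subsetI)
  fix L assume "L \<in> proj_points 4"
  then obtain v where v: "v \<in> carrier_vec 5" "v \<noteq> 0\<^sub>v 5" "L = {a \<cdot>\<^sub>v v | a. True}"
    by (auto simp: proj_points_def)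
  obtain k where k: "k < 5" "v $ k \<noteq> 0"
    using v(1,2) by (metis carrier_vecD eq_vecI index_zero_vec)
  then have "\<exists>k\<le>4. v $ k \<noteq> 0" by (intro exI[of _ k]) auto
  then have "Rep_pt (Abs_pt (vcoord v)) = vcoord v" by (intro Abs_pt_inverse) simp
  then have "vec 5 (Rep_pt (Abs_pt (vcoord v))) = v" using v(1) by auto
  then have "pline (Abs_pt (vcoord v)) = L" by (simp add: pline_def v(3))
  then show "L \<in> range pline" by blast
next
  fix L assume "L \<in> range pline"
  then obtain x where x: "L = pline x" by blast
  show "L \<in> proj_points 4" unfolding proj_points_def x pline_def
    using vec_pt_nonzero[of x] by (intro CollectI exI[of _ "vec 5 (Rep_pt x)"]) simp
qed

lemma homog_poly_funs_pline_nonzero: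
  assumes "p \<in> homog_poly_funs {..4} d"
  shows "(\<exists>v\<in>pline x. p (vcoord v) \<noteq> 0) \<longleftrightarrow> p (Rep_pt x) \<noteq> 0"
proof
  assume "\<exists>v\<in>pline x. p (vcoord v) \<noteq> 0"
  then show "p (Rep_pt x) \<noteq> 0" using homog_poly_funs_pline[OF assms, of _ x] by (auto simp: pline_def)
next
  assume "p (Rep_pt x) \<noteq> 0"
  moreover have "1 \<cdot>\<^sub>v vec 5 (Rep_pt x) \<in> pline x" unfolding pline_def by blast
  ultimately show "\<exists>v\<in>pline x. p (vcoord v) \<noteq> 0"
    using homog_poly_funs_pline[OF assms, of 1 x] by (metis mult_1 power_one)
qed

text \<open>An intersection of nonvanishing loci is the nonvanishing locus of the product, so a
  single form suffices near each point.\<close>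

lemma proj_zariski_neighbourhood:
  assumes "openin (proj_zariski 4) U" "pline x \<in> U"
  shows "\<exists>d s. s \<in> forms d \<and> s x \<noteq> 0 \<and> (\<forall>y. s y \<noteq> 0 \<longrightarrow> pline y \<in> U)"
proof -
  have "generate_topology_on
      {{L \<in> proj_points 4. \<exists>v\<in>L. p (vcoord v) \<noteq> 0} | p d. p \<in> homog_poly_funs {..4} d} U"
    using assms(1) unfolding proj_zariski_def openin_topology_generated_by_iff .
  then show ?thesis using assms(2)
  proof (induction)
    case Empty
    then show ?case by simp
  next
    case (Int a b)
    then obtain d s d' s' where "s \<in> forms d" "s x \<noteq> 0" "\<forall>y. s y \<noteq> 0 \<longrightarrow> pline y \<in> a"
      "s' \<in> forms d'" "s' x \<noteq> 0" "\<forall>y. s' y \<noteq> 0 \<longrightarrow> pline y \<in> b" by blast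
    then show ?case by (intro exI[of _ "d + d'"] exI[of _ "s * s'"] conjI forms_mult) auto
  next
    case (UN K)
    then obtain k where "k \<in> K" "pline x \<in> k" by blast
    with UN.IH show ?case by blast
  next
    case (Basis b)
    then obtain p d where p: "p \<in> homog_poly_funs {..4} d"
      and b: "b = {L \<in> proj_points 4. \<exists>v\<in>L. p (vcoord v) \<noteq> 0}" by blast
    have "pline y \<in> b \<longleftrightarrow> p (Rep_pt y) \<noteq> 0" for y
      unfolding b using homog_poly_funs_pline_nonzero[OF p, of y] proj_points_eq_range_pline by blast
    then show ?case using homog_poly_funs_forms[OF p] Basis(2)
      by (intro exI[of _ "int d"] exI[of _ "\<lambda>y. p (Rep_pt y)"]) simp
  qed
qed

text \<open>Multiplying numerator and denominator by a form confining to the neighbourhood makes one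
  condition, that \<open>s\<close> is nonzero, express both the validity of the fraction and
  membership in \<open>U\<close>.\<close>

lemma regular_proj_space_local:
  assumes f: "f \<in> regular (proj_space 4) U" and x: "pline x \<in> U"
  shows "\<exists>d s p. s \<in> forms d \<and> p \<in> forms d \<and> s x \<noteq> 0 \<and>
    (\<forall>y. s y \<noteq> 0 \<longrightarrow> pline y \<in> U \<and> f (pline y) = p y / s y)"
proof -
  have "\<forall>L\<in>U. \<exists>W d. \<exists>p\<in>homog_poly_funs {..4} d. \<exists>q\<in>homog_poly_funs {..4} d.
      openin (proj_zariski 4) W \<and> L \<in> W \<and> W \<subseteq> U \<and>
      (\<forall>L'\<in>W. \<forall>v\<in>L' - {0\<^sub>v (Suc 4)}. q (vcoord v) \<noteq> 0 \<and> f L' = p (vcoord v) / q (vcoord v))"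
    using f unfolding proj_space_def by (simp only: fspace.simps mem_Collect_eq)
  from bspec[OF this x] obtain W d p q where p: "p \<in> homog_poly_funs {..4} d" and q: "q \<in> homog_poly_funs {..4} d"
    and W: "openin (proj_zariski 4) W" "pline x \<in> W" "W \<subseteq> U"
    and eq: "\<And>L v. L \<in> W \<Longrightarrow> v \<in> L - {0\<^sub>v (Suc 4)} \<Longrightarrow> q (vcoord v) \<noteq> 0 \<and> f L = p (vcoord v) / q (vcoord v)"
    by (elim exE bexE conjE) blast
  have eq': "q (Rep_pt y) \<noteq> 0 \<and> f (pline y) = p (Rep_pt y) / q (Rep_pt y)" if "pline y \<in> W" for y
  proof -
    have "1 \<cdot>\<^sub>v vec 5 (Rep_pt y) \<in> pline y - {0\<^sub>v (Suc 4)}"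
      using vec_pt_nonzero[of y] by (auto simp: pline_def intro!: exI[of _ 1])
    from eq[OF that this] show ?thesis
      using homog_poly_funs_pline[OF p, of 1 y] homog_poly_funs_pline[OF q, of 1 y] by simp
  qed
  obtain e s where s: "s \<in> forms e" "s x \<noteq> 0" "\<And>y. s y \<noteq> 0 \<Longrightarrow> pline y \<in> W"
    using proj_zariski_neighbourhood[OF W(1,2)] by blast
  let ?P = "\<lambda>y. p (Rep_pt y)" and ?Q = "\<lambda>y. q (Rep_pt y)"
  have "s * ?Q \<in> forms (e + int d)" "s * ?P \<in> forms (e + int d)"
    by (rule forms_mult[OF s(1) homog_poly_funs_forms[OF q]], rule forms_mult[OF s(1) homog_poly_funs_forms[OF p]])
  moreover have "(s * ?Q) x \<noteq> 0" using s(2) eq'[OF W(2)] by simp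
  moreover have "pline y \<in> U \<and> f (pline y) = (s * ?P) y / (s * ?Q) y" if "(s * ?Q) y \<noteq> 0" for y
  proof -
    have "s y \<noteq> 0" using that by auto
    then show ?thesis using eq'[OF s(3)] s(3) W(3) by auto
  qed
  ultimately show ?thesis by blast
qed

text \<open>A common denominator for finitely many pulled back functions, which also keeps the image
  inside \<open>V\<close>.\<close>

lemma morphism_local_quotients:
  assumes \<phi>: "morphism (proj_space 4) Y \<phi>" and V: "openin (zariski Y) V" "\<phi> (pline x) \<in> V"
    and I: "finite I" and f: "\<And>j. j \<in> I \<Longrightarrow> f j \<in> regular Y V"
  shows "\<exists>d s p. s \<in> forms d \<and> s x \<noteq> 0 \<and> (\<forall>j\<in>I. p j \<in> forms d) \<and>
    (\<forall>y. s y \<noteq> 0 \<longrightarrow> \<phi> (pline y) \<in> V \<and> (\<forall>j\<in>I. f j (\<phi> (pline y)) = p j y / s y))"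
  using I f
proof (induction I)
  case empty
  have "openin (proj_zariski 4) {L \<in> points (proj_space 4). \<phi> L \<in> V}"
    using \<phi> V(1) unfolding morphism_def by (auto simp: continuous_map_def proj_space_def)
  moreover have "pline x \<in> {L \<in> points (proj_space 4). \<phi> L \<in> V}"
    using V(2) proj_points_eq_range_pline by (simp add: points_proj_space)
  ultimately show ?case using proj_zariski_neighbourhood by fastforce
next
  case (insert j I)
  obtain d s p where A: "s \<in> forms d" "s x \<noteq> 0" "\<And>j. j \<in> I \<Longrightarrow> p j \<in> forms d"
    "\<And>y. s y \<noteq> 0 \<Longrightarrow> \<phi> (pline y) \<in> V" "\<And>y j. s y \<noteq> 0 \<Longrightarrow> j \<in> I \<Longrightarrow> f j (\<phi> (pline y)) = p j y / s y"
    using insert.IH insert.prems by (metis insertCI)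
  have "f j \<circ> \<phi> \<in> regular (proj_space 4) {L \<in> points (proj_space 4). \<phi> L \<in> V}"
    using \<phi> V(1) insert.prems unfolding morphism_def by blast
  moreover have "pline x \<in> {L \<in> points (proj_space 4). \<phi> L \<in> V}"
    using V(2) proj_points_eq_range_pline by (simp add: points_proj_space)
  ultimately obtain d' s' p' where B: "s' \<in> forms d'" "p' \<in> forms d'" "s' x \<noteq> 0"
    "\<And>y. s' y \<noteq> 0 \<Longrightarrow> (f j \<circ> \<phi>) (pline y) = p' y / s' y"
    using regular_proj_space_local by blast
  define P where "P k = (if k = j then s * p' else p k * s')" for k
  have "s * s' \<in> forms (d + d')" by (rule forms_mult[OF A(1) B(1)])
  moreover have "(s * s') x \<noteq> 0" using A(2) B(3) by simp
  moreover have "\<forall>k\<in>insert j I. P k \<in> forms (d + d')"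
  proof
    fix k assume "k \<in> insert j I"
    then show "P k \<in> forms (d + d')"
      using forms_mult[OF A(1) B(2)] forms_mult[OF A(3) B(1), of k] unfolding P_def
      by (cases "k = j") (simp_all only: if_True if_False insert_iff simp_thms)
  qed
  moreover have "\<phi> (pline y) \<in> V \<and> (\<forall>k\<in>insert j I. f k (\<phi> (pline y)) = P k y / (s * s') y)"
    if "(s * s') y \<noteq> 0" for y
  proof -
    have n: "s y \<noteq> 0" "s' y \<noteq> 0" using that by auto
    then show ?thesis using A(4,5)[OF n(1)] B(4)[OF n(2)] insert.hyps by (auto simp: P_def)
  qed
  ultimately show ?case by blast
qed

section \<open>Local frames of the flags of cosets\<close>

text \<open>The upper left \<open>k\<close> by \<open>k\<close> block of the product of
  \<open>A\<close> with a matrix, written on coordinate functions so that its entries are polynomial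
  functions.\<close>

definition lead :: "nat \<Rightarrow> nat \<Rightarrow> complex mat \<Rightarrow> (nat \<times> nat \<Rightarrow> complex) \<Rightarrow> complex mat" where
  "lead n k A x = mat k k (\<lambda>(r, c). \<Sum>s<n. A $$ (r, s) * x (s, c))"

lemma lead_carrier [simp]: "lead n k A x \<in> carrier_mat k k"
  by (simp add: lead_def)

lemma lead_entry: "r < k \<Longrightarrow> c < k \<Longrightarrow> lead n k A x $$ (r, c) = (\<Sum>s<n. A $$ (r, s) * x (s, c))"
  by (simp add: lead_def)

lemma lead_flag_coords:
  assumes "\<forall>s<n. v s = (\<Sum>d<k. g $$ (s, d) * u d)" "r < k"
  shows "(\<Sum>s<n. A $$ (r, s) * v s) = (\<Sum>d<k. lead n k A (mcoord g) $$ (r, d) * u d)"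
proof -
  have "(\<Sum>s<n. A $$ (r, s) * v s) = (\<Sum>s<n. \<Sum>d<k. A $$ (r, s) * g $$ (s, d) * u d)"
    using assms(1) by (simp add: sum_distrib_left mult.assoc)
  also have "\<dots> = (\<Sum>d<k. \<Sum>s<n. A $$ (r, s) * g $$ (s, d) * u d)" by (rule sum.swap)
  also have "\<dots> = (\<Sum>d<k. lead n k A (mcoord g) $$ (r, d) * u d)"
    using assms(2) by (simp add: lead_entry sum_distrib_right)
  finally show ?thesis .
qed

text \<open>The right-hand side, that the first \<open>k\<close> rows of \<open>A\<close> are
  jointly injective on the span, involves the span alone. Hence the nonvanishing of the minor
  depends only on the coset when \<open>k\<close> is not the gap.\<close>

lemma det_lead_nonzero_iff:
  assumes g: "g \<in> carrier (SL n)" and k: "k \<le> n"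
  shows "det (lead n k A (mcoord g)) \<noteq> 0 \<longleftrightarrow>
    (\<forall>v\<in>flag_space n k g. (\<forall>r<k. (\<Sum>s<n. A $$ (r, s) * v s) = 0) \<longrightarrow> v = 0)" (is "?l \<longleftrightarrow> ?r")
proof
  assume l: ?l
  show ?r
  proof (intro ballI impI)
    fix v assume v: "v \<in> flag_space n k g" and z: "\<forall>r<k. (\<Sum>s<n. A $$ (r, s) * v s) = 0"
    obtain u where u: "\<forall>s<n. v s = (\<Sum>d<k. g $$ (s, d) * u d)" and s: "\<forall>s\<ge>n. v s = 0"
      using v by (auto simp: flag_space_def)
    let ?H = "lead n k A (mcoord g)"
    have "u c = 0" if c: "c < k" for c
    proof -
      have "0 = (\<Sum>r<k. adj_mat ?H $$ (c, r) * (\<Sum>d<k. ?H $$ (r, d) * u d))"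
        using lead_flag_coords[OF u, of _ A] z by simp
      also have "\<dots> = (\<Sum>r<k. \<Sum>d<k. adj_mat ?H $$ (c, r) * ?H $$ (r, d) * u d)"
        by (simp add: sum_distrib_left mult.assoc)
      also have "\<dots> = (\<Sum>d<k. \<Sum>r<k. adj_mat ?H $$ (c, r) * ?H $$ (r, d) * u d)" by (rule sum.swap)
      also have "\<dots> = (\<Sum>d<k. (if c = d then det ?H else 0) * u d)"
        using adj_mult(1)[OF lead_carrier c] by (intro sum.cong) (auto simp: sum_distrib_right[symmetric])
      also have "\<dots> = det ?H * u c" using c by (simp add: if_distrib[of "\<lambda>z. z * _"] cong: if_cong)
      finally show ?thesis using l by simp
    qed
    then have "v s = 0" for s using u s by (cases "s < n") auto
    then show "v = 0" by (simp add: fun_eq_iff)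
  qed
next
  assume r: ?r
  show ?l
  proof
    assume "det (lead n k A (mcoord g)) = 0"
    then obtain w where w: "w \<in> carrier_vec k" "w \<noteq> 0\<^sub>v k" "lead n k A (mcoord g) *\<^sub>v w = 0\<^sub>v k"
      using det_0_iff_vec_prod_zero_field[OF lead_carrier] by blast
    define v where "v = (\<lambda>s. if s < n then \<Sum>d<k. g $$ (s, d) * w $ d else 0)"
    have u: "\<forall>s<n. v s = (\<Sum>d<k. g $$ (s, d) * w $ d)" by (simp add: v_def)
    then have "\<exists>u. \<forall>s<n. v s = (\<Sum>d<k. g $$ (s, d) * u d)" by (rule exI[of _ "vcoord w"])
    then have vf: "v \<in> flag_space n k g" by (simp add: flag_space_def v_def)
    have "(\<Sum>s<n. A $$ (r, s) * v s) = 0" if r: "r < k" for r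
    proof -
      have "(\<Sum>d<k. lead n k A (mcoord g) $$ (r, d) * w $ d) = (lead n k A (mcoord g) *\<^sub>v w) $ r"
        using r w(1) carrier_matD[OF lead_carrier[of n k A "mcoord g"]]
        by (simp add: scalar_prod_def atLeast0LessThan)
      then show ?thesis unfolding lead_flag_coords[OF u r] using w(3) r by simp
    qed
    then have "v = 0" using r vf by blast
    have gc: "g \<in> carrier_mat n n" "det g = 1" using g by (auto simp: SL_carrier)
    have "w $ c = 0" if c: "c < k" for c
    proof -
      have cn: "c < n" using c k by simp
      have "0 = (\<Sum>s<n. adj_mat g $$ (c, s) * (\<Sum>d<k. g $$ (s, d) * w $ d))"
        using u \<open>v = 0\<close> by simp
      also have "\<dots> = (\<Sum>s<n. \<Sum>d<k. adj_mat g $$ (c, s) * g $$ (s, d) * w $ d)"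
        by (simp add: sum_distrib_left mult.assoc)
      also have "\<dots> = (\<Sum>d<k. \<Sum>s<n. adj_mat g $$ (c, s) * g $$ (s, d) * w $ d)" by (rule sum.swap)
      also have "\<dots> = (\<Sum>d<k. (if c = d then det g else 0) * w $ d)"
        using adj_mult(1)[OF gc(1) cn] k by (intro sum.cong) (auto simp: sum_distrib_right[symmetric])
      also have "\<dots> = w $ c" using c gc(2) by (simp add: if_distrib[of "\<lambda>z. z * _"] cong: if_cong)
      finally show ?thesis by simp
    qed
    then have "w = 0\<^sub>v k" using w(1) by auto
    then show False using w(2) by blast
  qed
qed

text \<open>When the minor is nonzero and \<open>c < k\<close>, this is the vector of the span of
  the first \<open>k\<close> columns whose first \<open>k\<close> coordinates under \<open>A\<close>
  are those of the unit vector \<open>c\<close>. Such a reduced column depends only on the span, and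
  Cramer's rule makes it a quotient of polynomials.\<close>

definition normal_col :: "nat \<Rightarrow> nat \<Rightarrow> complex mat \<Rightarrow> complex mat \<Rightarrow> nat \<Rightarrow> nat \<Rightarrow> complex" where
  "normal_col n k A g c r = (if r < n then (\<Sum>d<k. g $$ (r, d) * adj_mat (lead n k A (mcoord g)) $$ (d, c)) /
     det (lead n k A (mcoord g)) else 0)"

lemma normal_col_flag_space: "normal_col n k A g c \<in> flag_space n k g"
  unfolding flag_space_def
proof (intro CollectI conjI exI allI impI)
  fix r assume "r < n"
  then show "normal_col n k A g c r = (\<Sum>d<k. g $$ (r, d) *
      (adj_mat (lead n k A (mcoord g)) $$ (d, c) / det (lead n k A (mcoord g))))"
    by (simp add: normal_col_def sum_divide_distrib)
qed (simp add: normal_col_def)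

lemma normal_col_coords:
  assumes "det (lead n k A (mcoord g)) \<noteq> 0" "r < k" "c < k"
  shows "(\<Sum>s<n. A $$ (r, s) * normal_col n k A g c s) = (if r = c then 1 else 0)"
proof -
  let ?H = "lead n k A (mcoord g)"
  have "\<forall>s<n. normal_col n k A g c s = (\<Sum>d<k. g $$ (s, d) * (adj_mat ?H $$ (d, c) / det ?H))"
    by (simp add: normal_col_def sum_divide_distrib)
  from lead_flag_coords[OF this assms(2), of A] show ?thesis
    using adj_mult(2)[OF lead_carrier assms(2,3), of n A "mcoord g"] assms(1)
    by (simp add: sum_divide_distrib[symmetric])
qed

lemma normal_col_unique:
  assumes g: "g \<in> carrier (SL n)" and k: "k \<le> n" and d: "det (lead n k A (mcoord g)) \<noteq> 0" and c: "c < k"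
    and v: "v \<in> flag_space n k g" "\<And>r. r < k \<Longrightarrow> (\<Sum>s<n. A $$ (r, s) * v s) = (if r = c then 1 else 0)"
  shows "v = normal_col n k A g c"
proof -
  have "v - normal_col n k A g c \<in> flag_space n k g"
    by (rule fv.subspace_diff[OF flag_space_subspace v(1) normal_col_flag_space])
  moreover have "\<forall>r<k. (\<Sum>s<n. A $$ (r, s) * (v - normal_col n k A g c) s) = 0"
  proof (intro allI impI)
    fix r assume r: "r < k"
    have "(\<Sum>s<n. A $$ (r, s) * (v - normal_col n k A g c) s) =
        (\<Sum>s<n. A $$ (r, s) * v s) - (\<Sum>s<n. A $$ (r, s) * normal_col n k A g c s)"
      by (simp add: right_diff_distrib sum_subtractf)
    then show "(\<Sum>s<n. A $$ (r, s) * (v - normal_col n k A g c) s) = 0"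
      using v(2)[OF r] normal_col_coords[OF d r c] by simp
  qed
  ultimately have "v - normal_col n k A g c = 0" using d unfolding det_lead_nonzero_iff[OF g k] by blast
  then show ?thesis by simp
qed

text \<open>From a multiple of \<open>v\<close> in \<open>F\<close> subtract the part carried by the
  first \<open>j\<close> columns. The rest still lies in \<open>F\<close> and, being a combination
  of later columns, is killed by the first \<open>j\<close> rows of \<open>A\<close>. So it is zero,
  and the later coordinates of \<open>v\<close> vanish.\<close>

lemma frame_eq_subspace:
  fixes W Y A :: "nat \<Rightarrow> nat \<Rightarrow> complex"
  assumes q: "q \<noteq> 0" and WY: "\<And>r c. r < n \<Longrightarrow> c < n \<Longrightarrow> (\<Sum>k<n. W r k * Y k c) = (if r = c then q else 0)"
    and YW: "\<And>r c. r < n \<Longrightarrow> c < n \<Longrightarrow> (\<Sum>k<n. Y r k * W k c) = (if r = c then q else 0)"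
    and W0: "\<And>r c. n \<le> r \<Longrightarrow> W r c = 0" and F: "fv.subspace F" and F0: "\<And>v r. v \<in> F \<Longrightarrow> n \<le> r \<Longrightarrow> v r = 0"
    and j: "j \<le> n" and WF: "\<And>c. c < j \<Longrightarrow> (\<lambda>r. W r c) \<in> F"
    and inj: "\<And>v. v \<in> F \<Longrightarrow> \<forall>r<j. (\<Sum>s<n. A r s * v s) = 0 \<Longrightarrow> v = 0"
    and AW: "\<And>r c. r < j \<Longrightarrow> j \<le> c \<Longrightarrow> c < n \<Longrightarrow> (\<Sum>s<n. A r s * W s c) = 0"
  shows "F = {v. (\<forall>r\<ge>n. v r = 0) \<and> (\<forall>r. j \<le> r \<longrightarrow> r < n \<longrightarrow> (\<Sum>s<n. Y r s * v s) = 0)}"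
proof -
  define z where "z v r = (\<Sum>s<n. Y r s * v s)" for v :: "nat \<Rightarrow> complex" and r
  define low where "low v = (\<Sum>c<j. fscale (z v c) (\<lambda>r. W r c))" for v
  have low_app: "low v r = (\<Sum>c<j. W r c * z v c)" for v r
    by (simp add: low_def fun_sum_apply mult.commute)
  have lowF: "low v \<in> F" for v
    unfolding low_def by (intro fv.subspace_sum fv.subspace_scale F WF) auto
  have Wz: "(\<Sum>c<n. W r c * z v c) = q * v r" if r: "r < n" for v r
  proof -
    have "(\<Sum>c<n. W r c * z v c) = (\<Sum>c<n. \<Sum>s<n. W r c * Y c s * v s)"
      by (simp add: z_def sum_distrib_left mult.assoc)
    also have "\<dots> = (\<Sum>s<n. \<Sum>c<n. W r c * Y c s * v s)" by (rule sum.swap)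
    also have "\<dots> = (\<Sum>s<n. (if r = s then q else 0) * v s)"
      using WY[OF r] by (intro sum.cong) (auto simp: sum_distrib_right[symmetric])
    finally show ?thesis using r by (simp add: if_distrib[of "\<lambda>z. z * _"] cong: if_cong)
  qed
  have split: "q * v r - low v r = (\<Sum>c\<in>{j..<n}. W r c * z v c)" if r: "r < n" for v r
  proof -
    have "{..<n} = {..<j} \<union> {j..<n}" using j by auto
    then have "(\<Sum>c<n. W r c * z v c) = (\<Sum>c<j. W r c * z v c) + (\<Sum>c\<in>{j..<n}. W r c * z v c)"
      by (simp add: sum.union_disjoint ivl_disj_int)
    then show ?thesis using Wz[OF r, of v] by (simp add: low_app)
  qed
  have "v \<in> F" if v: "\<forall>r\<ge>n. v r = 0" "\<forall>r. j \<le> r \<longrightarrow> r < n \<longrightarrow> z v r = 0" for v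
  proof -
    have "q * v r = low v r" for r
    proof (cases "r < n")
      case True
      then show ?thesis using split[OF True, of v] v(2) by simp
    next
      case False
      then show ?thesis using v(1) W0 by (simp add: low_app)
    qed
    then have "v = fscale (inverse q) (low v)" using q by (simp add: fun_eq_iff field_simps)
    then show ?thesis using fv.subspace_scale[OF F lowF] by metis
  qed
  moreover have "z v a = 0" if v: "v \<in> F" and a: "j \<le> a" "a < n" for v a
  proof -
    define d where "d = fscale q v - low v"
    have dF: "d \<in> F" unfolding d_def by (intro fv.subspace_diff fv.subspace_scale F v lowF)
    have d: "d r = (\<Sum>c\<in>{j..<n}. W r c * z v c)" if "r < n" for r
      using split[OF that, of v] by (simp add: d_def)
    have "(\<Sum>s<n. A r s * d s) = 0" if r: "r < j" for r
    proof -
      have "(\<Sum>s<n. A r s * d s) = (\<Sum>s<n. \<Sum>c\<in>{j..<n}. A r s * W s c * z v c)"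
        using d by (simp add: sum_distrib_left mult.assoc)
      also have "\<dots> = (\<Sum>c\<in>{j..<n}. \<Sum>s<n. A r s * W s c * z v c)" by (rule sum.swap)
      also have "\<dots> = 0" using AW[OF r] by (intro sum.neutral) (auto simp: sum_distrib_right[symmetric])
      finally show ?thesis .
    qed
    then have "d = 0" using inj[OF dF] by blast
    then have "0 = (\<Sum>r<n. Y a r * (\<Sum>c\<in>{j..<n}. W r c * z v c))" using d by simp
    also have "\<dots> = (\<Sum>r<n. \<Sum>c\<in>{j..<n}. Y a r * W r c * z v c)" by (simp add: sum_distrib_left mult.assoc)
    also have "\<dots> = (\<Sum>c\<in>{j..<n}. \<Sum>r<n. Y a r * W r c * z v c)" by (rule sum.swap)
    also have "\<dots> = (\<Sum>c\<in>{j..<n}. (if a = c then q else 0) * z v c)"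
      using YW[OF a(2)] by (intro sum.cong) (auto simp: sum_distrib_right[symmetric])
    also have "\<dots> = q * z v a" using a by (simp add: if_distrib[of "\<lambda>z. z * _"] cong: if_cong)
    finally show ?thesis using q by simp
  qed
  ultimately show ?thesis using F0 unfolding z_def by blast
qed

lemma lead_poly_funs:
  assumes "r < k" "c < k" "k \<le> n"
  shows "(\<lambda>x. lead n k A x $$ (r, c)) \<in> poly_funs ({..<n} \<times> {..<n})"
  unfolding lead_entry[OF assms(1,2)]
  by (intro poly_funs_sum poly_funs_mult poly_funs_const poly_funs_coord) (use assms in auto)

section \<open>The big cell and its regular functions\<close>

lemma openin_SL_quotient:
  "openin (zariski (SL_quotient n P)) U \<longleftrightarrow> U \<subseteq> (\<lambda>g. g <#\<^bsub>SL n\<^esub> P) ` carrier (SL n) \<and>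
    openin (SL_zariski n) {g \<in> carrier (SL n). g <#\<^bsub>SL n\<^esub> P \<in> U}"
  using points_SL_variety[of n]
  by (simp add: SL_quotient_def quotient_fspace_def openin_quotient_topology SL_variety_def)

definition coset_rep :: "nat \<Rightarrow> complex mat set \<Rightarrow> complex mat set \<Rightarrow> complex mat" where
  "coset_rep n P C = (SOME g. g \<in> carrier (SL n) \<and> C = g <#\<^bsub>SL n\<^esub> P)"

lemma coset_rep:
  assumes "C \<in> (\<lambda>g. g <#\<^bsub>SL n\<^esub> P) ` carrier (SL n)"
  shows "coset_rep n P C \<in> carrier (SL n)" "C = coset_rep n P C <#\<^bsub>SL n\<^esub> P"
proof -
  have "\<exists>g. g \<in> carrier (SL n) \<and> C = g <#\<^bsub>SL n\<^esub> P" using assms by blast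
  from someI_ex[OF this] show "coset_rep n P C \<in> carrier (SL n)" "C = coset_rep n P C <#\<^bsub>SL n\<^esub> P"
    unfolding coset_rep_def by blast+
qed

text \<open>The big open cell of \<open>G/P\<close>, translated by \<open>A\<inverse>\<close>.\<close>

definition cell :: "nat \<Rightarrow> nat \<Rightarrow> complex mat \<Rightarrow> complex mat set set" where
  "cell n i A = {g <#\<^bsub>SL n\<^esub> min_parabolic n i | g.
     g \<in> carrier (SL n) \<and> (\<forall>k\<in>{..n} - {i}. det (lead n k A (mcoord g)) \<noteq> 0)}"

context
  fixes n i :: nat
  assumes i: "1 \<le> i" "i < n"
begin

lemma same_coset_lead:
  assumes g: "g \<in> carrier (SL n)" "g' \<in> carrier (SL n)"
    and eq: "g <#\<^bsub>SL n\<^esub> min_parabolic n i = g' <#\<^bsub>SL n\<^esub> min_parabolic n i" and k: "k \<le> n" "k \<noteq> i"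
  shows "det (lead n k A (mcoord g)) \<noteq> 0 \<longleftrightarrow> det (lead n k A (mcoord g')) \<noteq> 0"
  unfolding det_lead_nonzero_iff[OF g(1) k(1)] det_lead_nonzero_iff[OF g(2) k(1)]
    coset_flag_space[OF i g eq k] ..

lemma same_coset_normal_col:
  assumes g: "g \<in> carrier (SL n)" "g' \<in> carrier (SL n)"
    and eq: "g <#\<^bsub>SL n\<^esub> min_parabolic n i = g' <#\<^bsub>SL n\<^esub> min_parabolic n i" and k: "k \<le> n" "k \<noteq> i"
    and d: "det (lead n k A (mcoord g)) \<noteq> 0" and c: "c < k"
  shows "normal_col n k A g c = normal_col n k A g' c"
proof (rule normal_col_unique[OF g(2) k(1) _ c])
  show "det (lead n k A (mcoord g')) \<noteq> 0" using same_coset_lead[OF g eq k] d by blast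
  show "normal_col n k A g c \<in> flag_space n k g'"
    using normal_col_flag_space unfolding coset_flag_space[OF i g eq k, symmetric] .
qed (rule normal_col_coords[OF d _ c])

lemma cell_iff:
  assumes "g \<in> carrier (SL n)"
  shows "g <#\<^bsub>SL n\<^esub> min_parabolic n i \<in> cell n i A \<longleftrightarrow>
    (\<forall>k\<in>{..n} - {i}. det (lead n k A (mcoord g)) \<noteq> 0)"
  using same_coset_lead assms unfolding cell_def by blast

lemma openin_cell: "openin (zariski (SL_quotient n (min_parabolic n i))) (cell n i A)"
proof -
  let ?p = "\<lambda>x. \<Prod>k\<in>{..n} - {i}. det (lead n k A x)"
  have "?p \<in> poly_funs ({..<n} \<times> {..<n})"
    by (intro poly_funs_prod poly_funs_det lead_poly_funs lead_carrier) auto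
  then have "openin (SL_zariski n) {g \<in> carrier (SL n). ?p (mcoord g) \<noteq> 0}"
    unfolding SL_zariski_def by (intro topology_generated_by_Basis CollectI exI[of _ ?p]) simp
  moreover have "{g \<in> carrier (SL n). g <#\<^bsub>SL n\<^esub> min_parabolic n i \<in> cell n i A} =
      {g \<in> carrier (SL n). ?p (mcoord g) \<noteq> 0}"
    using cell_iff by (auto simp: prod_zero_iff)
  ultimately show ?thesis unfolding openin_SL_quotient by (auto simp: cell_def)
qed

text \<open>The choice of a representative does not affect the reduced column, so its pullback to
  the group may be computed from \<open>g\<close> itself, as a quotient of polynomials in the
  entries.\<close>

lemma regular_normal_col:
  assumes k: "k \<le> n" "k \<noteq> i" and c: "c < k" and r: "r < n"
  shows "(\<lambda>C. normal_col n k A (coset_rep n (min_parabolic n i) C) c r)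
    \<in> regular (SL_quotient n (min_parabolic n i)) (cell n i A)" (is "?f \<in> _")
proof -
  let ?P = "min_parabolic n i"
  let ?\<pi> = "\<lambda>g. g <#\<^bsub>SL n\<^esub> ?P"
  let ?U = "{g \<in> carrier (SL n). ?\<pi> g \<in> cell n i A}"
  let ?p = "\<lambda>x. \<Sum>d<k. x (r, d) * adj_mat (lead n k A x) $$ (d, c)"
  let ?q = "\<lambda>x. det (lead n k A x)"
  have U: "openin (SL_zariski n) ?U" using openin_cell[of A] unfolding openin_SL_quotient by blast
  have p: "?p \<in> poly_funs ({..<n} \<times> {..<n})"
    by (intro poly_funs_sum poly_funs_mult poly_funs_coord poly_funs_adj lead_poly_funs lead_carrier)
      (use k c r in auto)
  have q: "?q \<in> poly_funs ({..<n} \<times> {..<n})"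
    by (rule poly_funs_det[where k = k]) (use k in \<open>simp_all add: lead_poly_funs\<close>)
  have val: "?q (mcoord g) \<noteq> 0 \<and> (?f \<circ> ?\<pi>) g = ?p (mcoord g) / ?q (mcoord g)" if g: "g \<in> ?U" for g
  proof -
    have gc: "g \<in> carrier (SL n)" using g by blast
    have d: "?q (mcoord g) \<noteq> 0" using g k cell_iff[of g A] by auto
    let ?g = "coset_rep n ?P (?\<pi> g)"
    have "?\<pi> g \<in> ?\<pi> ` carrier (SL n)" using gc by blast
    note rep = coset_rep[OF this]
    have "normal_col n k A g c = normal_col n k A ?g c"
      by (rule same_coset_normal_col[OF gc rep(1) rep(2) k d c])
    then have "(?f \<circ> ?\<pi>) g = normal_col n k A g c r" by simp
    then show ?thesis using d r by (simp add: normal_col_def)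
  qed
  have "?f \<circ> ?\<pi> \<in> regular (SL_variety n) ?U"
    unfolding SL_variety_def
  proof (simp only: fspace.simps, intro CollectI ballI)
    fix g assume g: "g \<in> ?U"
    show "\<exists>W. \<exists>p\<in>poly_funs ({..<n} \<times> {..<n}). \<exists>q\<in>poly_funs ({..<n} \<times> {..<n}).
       openin (SL_zariski n) W \<and> g \<in> W \<and> W \<subseteq> ?U \<and>
       (\<forall>A'\<in>W. q (mcoord A') \<noteq> 0 \<and> (?f \<circ> ?\<pi>) A' = p (mcoord A') / q (mcoord A'))"
      by (rule exI[of _ ?U], rule bexI[OF _ p], rule bexI[OF _ q]) (use U g val in blast)
  qed
  then show ?thesis by (simp add: SL_quotient_def quotient_fspace_def points_SL_variety)
qed

lemma morphism_pline_coset: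
  assumes \<phi>: "morphism (proj_space 4) (SL_quotient n (min_parabolic n i)) \<phi>"
  shows "\<phi> (pline x) \<in> (\<lambda>g. g <#\<^bsub>SL n\<^esub> min_parabolic n i) ` carrier (SL n)"
proof -
  have "pline x \<in> points (proj_space 4)" using proj_points_eq_range_pline by (simp add: points_proj_space)
  then have "\<phi> (pline x) \<in> points (SL_quotient n (min_parabolic n i))"
    using \<phi> unfolding morphism_def continuous_map_def by blast
  then show ?thesis by (auto simp: points_SL_quotient LCOSETS_def)
qed

text \<open>Near \<open>x0\<close> the reduced columns of the flag, pulled back along the morphism
  and cleared of denominators, give the frame; the adjugate inverts it up to the
  determinant.\<close>

lemma morphism_framed_flag:
  assumes \<phi>: "morphism (proj_space 4) (SL_quotient n (min_parabolic n i)) \<phi>"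
  shows "framed_flag n i (\<lambda>j x. flag_space n j (coset_rep n (min_parabolic n i) (\<phi> (pline x))))"
proof (unfold_locales, rule i(1), rule i(2))
  fix x0
  define P where "P = min_parabolic n i"
  define \<gamma> where "\<gamma> x = coset_rep n P (\<phi> (pline x))" for x
  have \<gamma>: "\<gamma> x \<in> carrier (SL n)" "\<phi> (pline x) = \<gamma> x <#\<^bsub>SL n\<^esub> P" for x
    unfolding \<gamma>_def P_def using coset_rep[OF morphism_pline_coset[OF \<phi>]] by blast+
  \<comment> \<open>The inverse of a representative at \<open>x0\<close>, so that the cell contains
    the image of \<open>x0\<close>.\<close>
  define A where "A = adj_mat (\<gamma> x0)"
  \<comment> \<open>Column \<open>c\<close> is taken from the smallest step of the flag of dimension
    above \<open>c\<close> that avoids the gap; columns \<open>i - 1\<close> and \<open>i\<close>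
    thus both come from step \<open>i + 1\<close>.\<close>
  define \<kappa> where "\<kappa> c = (if c + 1 = i then i + 1 else c + 1)" for c
  have \<kappa>: "\<kappa> c \<le> n" "\<kappa> c \<noteq> i" "c < \<kappa> c" if "c < n" for c using that i by (auto simp: \<kappa>_def)
  have g0: "\<gamma> x0 \<in> carrier_mat n n" "det (\<gamma> x0) = 1" using \<gamma>(1)[of x0] by (auto simp: SL_carrier)
  have A: "(\<Sum>s<n. A $$ (r, s) * \<gamma> x0 $$ (s, c)) = (if r = c then 1 else 0)" if "r < n" "c < n" for r c
    unfolding A_def adj_mult(1)[OF g0(1) that] g0(2) ..
  have "lead n k A (mcoord (\<gamma> x0)) = 1\<^sub>m k" if "k \<le> n" for k
    using that A by (intro eq_matI) (auto simp: lead_def)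
  then have det0: "det (lead n k A (mcoord (\<gamma> x0))) = 1" if "k \<le> n" for k using that by simp
  have cell0: "\<phi> (pline x0) \<in> cell n i A"
    unfolding \<gamma>(2) P_def using cell_iff[OF \<gamma>(1)] det0 by simp
  let ?f = "\<lambda>(r, c) C. normal_col n (\<kappa> c) A (coset_rep n P C) c r"
  have "\<exists>d s p. s \<in> forms d \<and> s x0 \<noteq> 0 \<and> (\<forall>rc\<in>{..<n} \<times> {..<n}. p rc \<in> forms d) \<and>
    (\<forall>y. s y \<noteq> 0 \<longrightarrow> \<phi> (pline y) \<in> cell n i A \<and>
      (\<forall>rc\<in>{..<n} \<times> {..<n}. ?f rc (\<phi> (pline y)) = p rc y / s y))"
  proof (rule morphism_local_quotients[OF \<phi> openin_cell cell0])
    fix rc assume "rc \<in> {..<n} \<times> {..<n}"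
    then show "?f rc \<in> regular (SL_quotient n (min_parabolic n i)) (cell n i A)"
      using regular_normal_col[OF \<kappa>] unfolding P_def by (auto split: prod.split)
  qed simp
  then obtain d s p where s: "s \<in> forms d" "s x0 \<noteq> 0" and p': "\<forall>rc\<in>{..<n} \<times> {..<n}. p rc \<in> forms d"
    and val': "\<forall>y. s y \<noteq> 0 \<longrightarrow> \<phi> (pline y) \<in> cell n i A \<and>
      (\<forall>rc\<in>{..<n} \<times> {..<n}. ?f rc (\<phi> (pline y)) = p rc y / s y)"
    by (elim exE conjE)
  have p: "p (r, c) \<in> forms d" if "r < n" "c < n" for r c using p' that by blast
  have cell: "\<phi> (pline y) \<in> cell n i A" if "s y \<noteq> 0" for y using val' that by blast
  have val: "normal_col n (\<kappa> c) A (\<gamma> y) c r = p (r, c) y / s y" if "s y \<noteq> 0" "r < n" "c < n" for y r c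
  proof -
    have "(r, c) \<in> {..<n} \<times> {..<n}" using that by blast
    then have "?f (r, c) (\<phi> (pline y)) = p (r, c) y / s y" using val' that(1) by blast
    then show ?thesis by (simp add: \<gamma>_def)
  qed
  \<comment> \<open>The extra factor \<open>s\<close> makes the whole matrix vanish where
    \<open>s\<close> does, so a nonzero determinant guarantees that the local formulas
    apply.\<close>
  define M where "M y = mat n n (\<lambda>(r, c). s y * p (r, c) y)" for y
  have M: "M y \<in> carrier_mat n n" for y by (simp add: M_def)
  have Mf: "(\<lambda>y. M y $$ (r, c)) \<in> forms (d + d)" if "r < n" "c < n" for r c
    using forms_mult[OF s(1) p[OF that]] that by (simp add: M_def times_fun_def)
  have Mv: "M y $$ (r, c) = s y ^ 2 * normal_col n (\<kappa> c) A (\<gamma> y) c r" if "s y \<noteq> 0" "r < n" "c < n" for y r c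
    using that val[OF that] by (simp add: M_def power2_eq_square)
  define W where "W r c = (if r < n \<and> c < n then (\<lambda>y. M y $$ (r, c)) else 0)" for r c
  define Y where "Y r c = (if r < n \<and> c < n then (\<lambda>y. adj_mat (M y) $$ (r, c)) else 0)" for r c
  define q where "q y = det (M y)" for y
  have sq: "s y \<noteq> 0" if "q y \<noteq> 0" for y
  proof
    assume "s y = 0"
    then have "M y = 0\<^sub>m n n" by (auto simp: M_def)
    then show False using that i by (simp add: q_def)
  qed
  have WY: "(\<Sum>k<n. W r k y * Y k c y) = (if r = c then q y else 0)"
    and YW: "(\<Sum>k<n. Y r k y * W k c y) = (if r = c then q y else 0)" if "r < n" "c < n" for r c y
    using adj_mult[OF M that, of y] that by (simp_all add: W_def Y_def q_def)
  have "is_frame n i (\<lambda>j x. flag_space n j (\<gamma> x)) (d + d) (int (n - 1) * (d + d)) W Y q"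
    unfolding is_frame_def
  proof (intro conjI allI impI)
    show "W r c \<in> forms (d + d)" for r c using Mf forms_0 by (auto simp: W_def)
    show "Y r c \<in> forms (int (n - 1) * (d + d))" for r c
    proof (cases "r < n \<and> c < n")
      case True
      then show ?thesis using forms_adj[of n M "d + d" r c] Mf M unfolding Y_def by simp
    next
      case False
      then have "Y r c = 0" unfolding Y_def by (rule if_not_P)
      then show ?thesis using forms_0 by (simp only:)
    qed
    have "q \<in> forms (int n * (d + d))" using forms_det[of n M "d + d"] Mf M unfolding q_def by blast
    moreover have "int n * (d + d) = d + d + int (n - 1) * (d + d)" using i by (simp add: algebra_simps of_nat_diff)
    ultimately show "q \<in> forms (d + d + int (n - 1) * (d + d))" by simp
    show "W r c = 0" if "n \<le> r" for r c using that by (simp add: W_def)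
    fix y j assume q: "q y \<noteq> 0" and j: "j \<le> n" "j \<noteq> i"
    note sy = sq[OF q]
    have det: "det (lead n k A (mcoord (\<gamma> y))) \<noteq> 0" if "k \<le> n" "k \<noteq> i" for k
      using cell[OF sy] cell_iff[OF \<gamma>(1)] that unfolding \<gamma>(2)[of y] P_def by auto
    have Wv: "(\<lambda>r. W r c y) = fscale (s y ^ 2) (normal_col n (\<kappa> c) A (\<gamma> y) c)" if "c < n" for c
      using Mv[OF sy _ that] that by (auto simp: W_def fun_eq_iff normal_col_def)
    show "flag_space n j (\<gamma> y) = {v. (\<forall>r\<ge>n. v r = 0) \<and> (\<forall>r. j \<le> r \<longrightarrow> r < n \<longrightarrow> (\<Sum>s<n. Y r s y * v s) = 0)}"
    proof (rule frame_eq_subspace[where W = "\<lambda>r c. W r c y" and A = "\<lambda>r c. A $$ (r, c)" and q = "q y"])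
      show "W r c y = 0" if "n \<le> r" for r c using that by (simp add: W_def)
      show "v r = 0" if "v \<in> flag_space n j (\<gamma> y)" "n \<le> r" for v r using that by (simp add: flag_space_def)
      show "(\<lambda>r. W r c y) \<in> flag_space n j (\<gamma> y)" if c: "c < j" for c
      proof -
        have "\<kappa> c \<le> j" using c j(2) by (auto simp: \<kappa>_def)
        then show ?thesis using Wv[of c] c j(1) flag_space_mono normal_col_flag_space
          by (metis fv.subspace_scale flag_space_subspace order.strict_trans2 subsetD)
      qed
      show "v = 0" if "v \<in> flag_space n j (\<gamma> y)" "\<forall>r<j. (\<Sum>s<n. A $$ (r, s) * v s) = 0" for v
        using that det[OF j] unfolding det_lead_nonzero_iff[OF \<gamma>(1) j(1)] by blast
      show "(\<Sum>t<n. A $$ (r, t) * W t c y) = 0" if "r < j" "j \<le> c" "c < n" for r c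
      proof -
        have "(\<Sum>t<n. A $$ (r, t) * W t c y) = s y ^ 2 * (\<Sum>t<n. A $$ (r, t) * normal_col n (\<kappa> c) A (\<gamma> y) c t)"
          using fun_cong[OF Wv[OF that(3)]] by (simp add: sum_distrib_left mult.left_commute)
        also have "(\<Sum>t<n. A $$ (r, t) * normal_col n (\<kappa> c) A (\<gamma> y) c t) = 0"
          using normal_col_coords[OF det[OF \<kappa>(1,2)[OF that(3)]] _ \<kappa>(3)[OF that(3)], of r] \<kappa>(3)[OF that(3)] that
          by simp
        finally show ?thesis by simp
      qed
    qed (use q j WY YW flag_space_subspace in auto)
  qed (use WY YW in auto)
  moreover have "q x0 \<noteq> 0"
  proof -
    \<comment> \<open>At \<open>x0\<close> the columns of the representative are already reduced,
      since \<open>A\<close> is its inverse.\<close>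
    have "\<gamma> x0 $$ (r, c) = normal_col n (\<kappa> c) A (\<gamma> x0) c r" if rc: "r < n" "c < n" for r c
    proof -
      define v where "v = (\<lambda>r. if r < n then \<gamma> x0 $$ (r, c) else 0)"
      have "v = normal_col n (\<kappa> c) A (\<gamma> x0) c"
      proof (rule normal_col_unique[OF \<gamma>(1) \<kappa>(1)[OF rc(2)] _ \<kappa>(3)[OF rc(2)]])
        show "det (lead n (\<kappa> c) A (mcoord (\<gamma> x0))) \<noteq> 0" using det0[OF \<kappa>(1)[OF rc(2)]] by simp
        show "v \<in> flag_space n (\<kappa> c) (\<gamma> x0)"
          unfolding flag_space_def
        proof (intro CollectI conjI exI[of _ "\<lambda>d. if d = c then 1 else 0"] allI impI)
          fix r assume "r < n"
          then show "v r = (\<Sum>d<\<kappa> c. \<gamma> x0 $$ (r, d) * (if d = c then 1 else 0))"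
            using \<kappa>(3)[OF rc(2)] by (simp add: v_def if_distrib[of "\<lambda>z. _ * z"] cong: if_cong)
        qed (simp add: v_def)
        fix r assume "r < \<kappa> c"
        then show "(\<Sum>s<n. A $$ (r, s) * v s) = (if r = c then 1 else 0)"
          using A[of r c] \<kappa>(1)[OF rc(2)] rc(2) by (simp add: v_def)
      qed
      then show ?thesis using rc(1) by (metis v_def)
    qed
    then have "M x0 = s x0 ^ 2 \<cdot>\<^sub>m \<gamma> x0"
      using Mv[OF s(2)] g0(1) M[of x0] by (intro eq_matI) auto
    then show ?thesis using s(2) g0 by (simp add: q_def det_smult)
  qed
  ultimately show "\<exists>e e' W Y q. is_frame n i
      (\<lambda>j x. flag_space n j (coset_rep n (min_parabolic n i) (\<phi> (pline x)))) e e' W Y q \<and> q x0 \<noteq> 0"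
    unfolding \<gamma>_def P_def by blast
qed

end

theorem theorem5p1:
  fixes n i :: nat
  assumes "n \<ge> 2" and "1 \<le> i" and "i \<le> n - 1"
  shows "\<not> (\<exists>\<phi>. morphism (proj_space 4) (SL_quotient n (min_parabolic n i)) \<phi> \<and>
                \<not> \<phi> constant_on points (proj_space 4))"
proof -
  have i: "1 \<le> i" "i < n" using assms by auto
  have "\<phi> constant_on points (proj_space 4)"
    if \<phi>: "morphism (proj_space 4) (SL_quotient n (min_parabolic n i)) \<phi>" for \<phi>
  proof -
    note V = framed_flag.flag_constant[OF morphism_framed_flag[OF i \<phi>]]
    note rep = coset_rep[OF morphism_pline_coset[OF i \<phi>]]
    have "\<phi> (pline x) \<subseteq> \<phi> (pline y)" for x y
      using flag_space_coset[OF i rep(1) rep(1) V, of x y] rep(2)[of x] rep(2)[of y] by simp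
    then have "\<phi> (pline x) = \<phi> (pline y)" for x y by blast
    then show ?thesis unfolding constant_on_def points_proj_space proj_points_eq_range_pline by blast
  qed
  then show ?thesis by blast
qed

end
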